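(* Let $\Omega$, $F$, $\lambda_1^\pm(F,\Omega)$ be as in the context, let $p>n$, and let $f\in C(\Omega)\cap L^p(\Omega)$ with $f\not\equiv0$. For $\lambda\in\mathbb{R}$ consider the Dirichlet problem $$F(D^2u,Du,u,x)=\lambda u+f\ \text{ in }\Omega,\qquad u=0\ \text{ on }\partial\Omega. \qquad (\ast)$$ (i) If $f\ge0$, then there exists a constant $\eta=\eta(f)>0$ such that if $\lambda_1^+(F,\Omega)\le\lambda_1^-(F,\Omega)<\lambda\le\lambda_1^-(F,\Omega)+\eta$, then every viscosity solution $u\in C(\bar\Omega)$ of $(\ast)$ satisfies $u<0$ in $\Omega$. (ii) If $f\le0$, then there exists a constant $\eta=\eta(f)>0$ such that if $\lambda_1^-(F,\Omega)\le\lambda_1^+(F,\Omega)<\lambda\le\lambda_1^+(F,\Omega)+\eta$, then every viscosity solution $u\in C(\bar\Omega)$ of $(\ast)$ satisfies $u>0$ in $\Omega$.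
   Context: $\Omega\subseteq\mathbb{R}^n$ is a bounded, smooth, connected open set; $\mathbb{S}^n$ denotes the real symmetric $n\times n$ matrices. For $0<\gamma\le\Gamma$ and $M\in\mathbb{S}^n$ the Pucci operators are $\mathcal{P}^+_{\gamma,\Gamma}(M)=\sup_A[-\mathrm{tr}(AM)]$ and $\mathcal{P}^-_{\gamma,\Gamma}(M)=\inf_A[-\mathrm{tr}(AM)]$, with $A$ ranging over symmetric matrices whose eigenvalues lie in $[\gamma,\Gamma]$. The nonlinearity $F:\mathbb{S}^n\times\mathbb{R}^n\times\mathbb{R}\times\Omega\to\mathbb{R}$ satisfies: (F1) for each $K>0$ there are an increasing continuous $\omega_K:[0,\infty)\to[0,\infty)$ with $\omega_K(0)=0$ and $\nu\in(1/2,1]$ such that $|F(M,p,z,x)-F(M,p,z,y)|\le\omega_K(|x-y|^\nu(|M|+1))$ whenever $|p|,|z|\le K$; (F2) there are constants $\delta_1,\delta_0\ge0$, $0<\gamma\le\Gamma$ with $\mathcal{P}^-_{\gamma,\Gamma}(M-N)-\delta_1|p-q|-\delta_0|z-w|\le F(M,p,z,x)-F(N,q,w,x)\le\mathcal{P}^+_{\gamma,\Gamma}(M-N)+\delta_1|p-q|+\delta_0|z-w|$ for all arguments; (F3) $F(tM,tp,tz,x)=tF(M,p,z,x)$ for all $t\ge0$. All differential (in)equalities are meant in the viscosity sense: for $f\in C(\Omega)$, $u\in C(\Omega)$ is a subsolution (supersolution) of $F(D^2u,Du,u,x)=f$ if whenever $\varphi\in C^2(\Omega)$ and $u-\varphi$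 has a local maximum (minimum) at $x_0$, then $F(D^2\varphi(x_0),D\varphi(x_0),u(x_0),x_0)\le f(x_0)$ (resp. $\ge$); a solution is both. Define $\lambda_1^+(F,\Omega)=\sup\{\rho:\exists v\in C(\Omega),\ v>0,\ F(D^2v,Dv,v,x)\ge\rho v\text{ in }\Omega\}$ and $\lambda_1^-(F,\Omega)=\sup\{\rho:\exists v\in C(\Omega),\ v<0,\ F(D^2v,Dv,v,x)\le\rho v\text{ in }\Omega\}$. *)

theory Defs
  imports "HOL-Analysis.Analysis"
begin

fun Ck_on :: "nat \<Rightarrow> ('a::euclidean_space) set \<Rightarrow> ('a \<Rightarrow> real) \<Rightarrow> bool" where
  "Ck_on 0 U g = continuous_on U g"
| "Ck_on (Suc k) U g = (g differentiable_on U \<and>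
      (\<forall>v. Ck_on k U (\<lambda>x. frechet_derivative g (at x) v)))"

definition smooth_on :: "('a::euclidean_space) set \<Rightarrow> ('a \<Rightarrow> real) \<Rightarrow> bool" where
  "smooth_on U g \<longleftrightarrow> (\<forall>k. Ck_on k U g)"

definition smooth_bounded_domain :: "('a::euclidean_space) set \<Rightarrow> bool" where
  "smooth_bounded_domain \<Omega> \<longleftrightarrow> open \<Omega> \<and> bounded \<Omega> \<and> connected \<Omega> \<and> \<Omega> \<noteq> {} \<and>
     (\<forall>x0\<in>frontier \<Omega>. \<exists>r>0. \<exists>\<psi>. smooth_on (ball x0 r) \<psi> \<and>
        frechet_derivative \<psi> (at x0) \<noteq> (\<lambda>v. 0) \<and>
        \<Omega> \<inter> ball x0 r = {x\<in>ball x0 r. \<psi> x < 0})"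

definition symmetric_mat :: "real^'n^'n \<Rightarrow> bool" where
  "symmetric_mat M \<longleftrightarrow> transpose M = M"

definition is_eigenvalue :: "real^'n^'n \<Rightarrow> real \<Rightarrow> bool" where
  "is_eigenvalue A c \<longleftrightarrow> (\<exists>v. v \<noteq> 0 \<and> A *v v = c *\<^sub>R v)"

definition pucci_class :: "real \<Rightarrow> real \<Rightarrow> (real^'n^'n) set" where
  "pucci_class \<gamma> \<Gamma> = {A. symmetric_mat A \<and> (\<forall>c. is_eigenvalue A c \<longrightarrow> \<gamma> \<le> c \<and> c \<le> \<Gamma>)}"

definition pucci_plus :: "real \<Rightarrow> real \<Rightarrow> real^'n^'n \<Rightarrow> real" where
  "pucci_plus \<gamma> \<Gamma> M = (SUP A\<in>pucci_class \<gamma> \<Gamma>. - trace (A ** M))"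

definition pucci_minus :: "real \<Rightarrow> real \<Rightarrow> real^'n^'n \<Rightarrow> real" where
  "pucci_minus \<gamma> \<Gamma> M = (INF A\<in>pucci_class \<gamma> \<Gamma>. - trace (A ** M))"

type_synonym 'n op = "real^'n^'n \<Rightarrow> real^'n \<Rightarrow> real \<Rightarrow> real^'n \<Rightarrow> real"

definition cond_F1 :: "'n op \<Rightarrow> (real^'n) set \<Rightarrow> bool" where
  "cond_F1 F \<Omega> \<longleftrightarrow> (\<forall>K>0. \<exists>\<omega> \<nu>. mono_on {0..} \<omega> \<and> continuous_on {0..} \<omega> \<and> \<omega> 0 = 0 \<and>
      (\<forall>t\<ge>0. \<omega> t \<ge> 0) \<and> 1/2 < \<nu> \<and> \<nu> \<le> 1 \<and>
      (\<forall>M p z x y. symmetric_mat M \<longrightarrow> norm p \<le> K \<longrightarrow> \<bar>z\<bar> \<le> K \<longrightarrow> x \<in> \<Omega> \<longrightarrow> y \<in> \<Omega> \<longrightarrow>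
         \<bar>F M p z x - F M p z y\<bar> \<le> \<omega> (dist x y powr \<nu> * (norm M + 1))))"

definition cond_F2 :: "'n op \<Rightarrow> (real^'n) set \<Rightarrow> bool" where
  "cond_F2 F \<Omega> \<longleftrightarrow> (\<exists>\<delta>1 \<delta>0 \<gamma> \<Gamma>. \<delta>1 \<ge> 0 \<and> \<delta>0 \<ge> 0 \<and> 0 < \<gamma> \<and> \<gamma> \<le> \<Gamma> \<and>
      (\<forall>M N p q z w x. symmetric_mat M \<longrightarrow> symmetric_mat N \<longrightarrow> x \<in> \<Omega> \<longrightarrow>
         pucci_minus \<gamma> \<Gamma> (M - N) - \<delta>1 * norm (p - q) - \<delta>0 * \<bar>z - w\<bar> \<le> F M p z x - F N q w x \<and>
         F M p z x - F N q w x \<le> pucci_plus \<gamma> \<Gamma> (M - N) + \<delta>1 * norm (p - q) + \<delta>0 * \<bar>z - w\<bar>))"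

definition cond_F3 :: "'n op \<Rightarrow> (real^'n) set \<Rightarrow> bool" where
  "cond_F3 F \<Omega> \<longleftrightarrow> (\<forall>t M p z x. t \<ge> 0 \<longrightarrow> symmetric_mat M \<longrightarrow> x \<in> \<Omega> \<longrightarrow>
      F (t *\<^sub>R M) (t *\<^sub>R p) (t * z) x = t * F M p z x)"

definition C2_with :: "(real^'n) set \<Rightarrow> (real^'n \<Rightarrow> real) \<Rightarrow> (real^'n \<Rightarrow> real^'n)
    \<Rightarrow> (real^'n \<Rightarrow> real^'n^'n) \<Rightarrow> bool" where
  "C2_with U \<phi> D\<phi> D2\<phi> \<longleftrightarrow>
     (\<forall>x\<in>U. (\<phi> has_derivative (\<lambda>h. D\<phi> x \<bullet> h)) (at x) \<and>
             (D\<phi> has_derivative (\<lambda>h. D2\<phi> x *v h)) (at x)) \<and> continuous_on U D2\<phi>"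

definition visc_sub :: "'n op \<Rightarrow> (real^'n) set \<Rightarrow> (real^'n \<Rightarrow> real) \<Rightarrow> (real^'n \<Rightarrow> real) \<Rightarrow> bool" where
  "visc_sub F \<Omega> u f \<longleftrightarrow> (\<forall>\<phi> D\<phi> D2\<phi> x0. C2_with \<Omega> \<phi> D\<phi> D2\<phi> \<longrightarrow> x0 \<in> \<Omega> \<longrightarrow>
      (\<exists>r>0. \<forall>x\<in>\<Omega> \<inter> ball x0 r. u x - \<phi> x \<le> u x0 - \<phi> x0) \<longrightarrow>
      F (D2\<phi> x0) (D\<phi> x0) (u x0) x0 \<le> f x0)"

definition visc_super :: "'n op \<Rightarrow> (real^'n) set \<Rightarrow> (real^'n \<Rightarrow> real) \<Rightarrow> (real^'n \<Rightarrow> real) \<Rightarrow> bool" where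
  "visc_super F \<Omega> u f \<longleftrightarrow> (\<forall>\<phi> D\<phi> D2\<phi> x0. C2_with \<Omega> \<phi> D\<phi> D2\<phi> \<longrightarrow> x0 \<in> \<Omega> \<longrightarrow>
      (\<exists>r>0. \<forall>x\<in>\<Omega> \<inter> ball x0 r. u x - \<phi> x \<ge> u x0 - \<phi> x0) \<longrightarrow>
      F (D2\<phi> x0) (D\<phi> x0) (u x0) x0 \<ge> f x0)"

definition visc_sol :: "'n op \<Rightarrow> (real^'n) set \<Rightarrow> (real^'n \<Rightarrow> real) \<Rightarrow> (real^'n \<Rightarrow> real) \<Rightarrow> bool" where
  "visc_sol F \<Omega> u f \<longleftrightarrow> visc_sub F \<Omega> u f \<and> visc_super F \<Omega> u f"

definition lambda1_plus :: "'n op \<Rightarrow> (real^'n) set \<Rightarrow> ereal" where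
  "lambda1_plus F \<Omega> = Sup (ereal ` {\<rho>. \<exists>v. continuous_on \<Omega> v \<and> (\<forall>x\<in>\<Omega>. v x > 0) \<and>
      visc_super F \<Omega> v (\<lambda>x. \<rho> * v x)})"

definition lambda1_minus :: "'n op \<Rightarrow> (real^'n) set \<Rightarrow> ereal" where
  "lambda1_minus F \<Omega> = Sup (ereal ` {\<rho>. \<exists>v. continuous_on \<Omega> v \<and> (\<forall>x\<in>\<Omega>. v x < 0) \<and>
      visc_sub F \<Omega> v (\<lambda>x. \<rho> * v x)})"

definition dirichlet_sol :: "'n op \<Rightarrow> (real^'n) set \<Rightarrow> real \<Rightarrow> (real^'n \<Rightarrow> real)
    \<Rightarrow> (real^'n \<Rightarrow> real) \<Rightarrow> bool" where
  "dirichlet_sol F \<Omega> lam f u \<longleftrightarrow> continuous_on (closure \<Omega>) u \<and> (\<forall>x\<in>frontier \<Omega>. u x = 0) \<and>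
      visc_sol F \<Omega> u (\<lambda>x. lam * u x + f x)"

end

theory Submission
 imports Defs "HOL-Complex_Analysis.Great_Picard"
begin

text \<open>
 Part (ii) is part (i) for the operator \<open>- F (- M) (- p) (- z) x\<close>. For part (i), suppose that solutions
 \<open>u\<^sub>k\<close> for parameters decreasing to \<open>a = \<lambda>\<^sub>1\<^sup>-\<close> are not negative. After division by \<open>max 1 \<parallel>u\<^sub>k\<parallel>\<close> they
 converge uniformly, along a subsequence, to a solution \<open>v\<close> with right-hand side \<open>a v + c f\<close>, \<open>c >= 0\<close>: inside
 they are equi-Lipschitz by the Ishii--Lions method, and at the boundary they grow at most linearly, by an
 Aleksandrov--Bakelman--Pucci estimate that is iterated over shrinking balls at a point with an exterior tangent
 ball; this is where \<open>p > n\<close> enters. If \<open>v = 0\<close>, then \<open>c = 0\<close>, against the normalisation. If \<open>v >= 0\<close> does not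
 vanish, then it is positive by the strong minimum principle, and a maximum principle in a strip at the boundary
 makes some \<open>u\<^sub>k\<close> positive; but a positive \<open>u\<^sub>k\<close> is admissible for \<open>\<lambda>\<^sub>1\<^sup>+ <= a\<close>. If \<open>v\<close> is negative somewhere,
 comparison with the subsolutions in the definition of \<open>\<lambda>\<^sub>1\<^sup>-\<close> gives \<open>v < 0\<close> and \<open>c f = 0\<close>, hence \<open>c = 0\<close>; then \<open>v\<close> decays
 linearly at the boundary (Hopf), \<open>u\<^sub>k / \<parallel>u\<^sub>k\<parallel> - v\<close> is small of the same order, and some \<open>u\<^sub>k\<close> is negative.\<close>

section \<open>Second-order expansions\<close>

text \<open>Two obstacles shape the proof. The supremum in \<open>lambda1_minus\<close> is not known
  to be attained, and its subsolutions \<open>w j\<close> are only continuous inside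
  \<open>\<Omega>\<close>, without boundary values; so boundary behaviour is encoded by compact
  superlevel sets, and the strong minimum principle is stated for sequences with errors instead of
  for a limit. Moreover \<open>f\<close> may be unbounded near the boundary, while a sign survives a
  uniform limit there only under bounds linear in the distance to the boundary; explicit barriers
  alone do not give them, and an integral estimate must enter. Condition (F1) couples
  \<open>|x - y|\<close> with \<open>|M|\<close>: when variables are doubled with parameter
  \<open>ep\<close>, the matrices have to be of order \<open>ep powr (-1/2)\<close>, and then
  \<open>nu > 1/2\<close> makes \<open>|x - y| powr nu * |M|\<close> tend to zero. Theorems on
  differentiability almost everywhere are replaced by an identity: the parallelogram law makes the
  dyadic second differences of a Lipschitz function summable in mean square, and a second-order
  expansion at one small scale, up to a relative error, is all that the theorem on sums
  needs.\<close>

lemmas dist_norms = dist_norm norm_minus_commute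

lemma lborel_integral_translate:
 fixes f :: "'a::euclidean_space => real"
 shows "(LINT x|lborel. f (x + c)) = (LINT x|lborel. f x)"
proof (cases "f \<in> borel_measurable borel")
 case True
 have "(LINT x|lborel. f x) = (LINT x|distr lborel borel ((+) c). f x)"
  by (simp add: lborel_distr_plus)
 also have "... = (LINT x|lborel. f (c + x))"
  by (rule integral_distr) (use True in auto)
 finally show ?thesis by (simp add: add.commute)
next
 case False
 have "(\<lambda>x. f (x + c)) \<notin> borel_measurable borel"
 proof
  assume "(\<lambda>x. f (x + c)) \<in> borel_measurable borel"
  hence "(\<lambda>x. f (x + c)) \<circ> (\<lambda>x. x - c) \<in> borel_measurable borel"
   by (intro measurable_comp[of _ borel borel]) auto
  thus False using False by (simp add: o_def)
 qed
 hence "\<not> integrable lborel f" "\<not> integrable lborel (\<lambda>x. f (x + c))"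
  using False by (auto dest: borel_measurable_integrable)
 thus ?thesis by (simp add: not_integrable_integral_eq)
qed

lemma integrable_continuous_compact_support:
 fixes f :: "'a::euclidean_space => real"
 assumes "continuous_on UNIV f" and "!!x. x \<notin> cball 0 r ==> f x = 0"
 shows "integrable lborel f"
proof -
 have "integrable lborel (\<lambda>x. indicator (cball 0 r) x *\<^sub>R f x)"
  by (rule borel_integrable_compact) (auto intro: continuous_on_subset[OF assms(1)])
 moreover have "(\<lambda>x. indicator (cball 0 r) x *\<^sub>R f x) = f"
  using assms(2) by (auto simp: indicator_def fun_eq_iff)
 ultimately show ?thesis by simp
qed

text \<open>Let \<open>I t\<close> and \<open>J t\<close> be the squared L2 norms of the first and
  second differences. By the parallelogram law \<open>I (2t) + J t = 4 I t\<close>, so up to an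
  index shift and a factor 4 the quantity in question is the increment of
  \<open>E k = 4^k I\<close>, an increasing sequence that the Lipschitz bound keeps bounded.
  Increments of a convergent sequence tend to zero. This takes the place of differentiability almost
  everywhere.\<close>

lemma second_difference_energy:
 fixes g :: "'a::euclidean_space => real"
 assumes lip: "L-lipschitz_on UNIV g" and supp: "!!x. x \<notin> cball 0 r ==> g x = 0"
 shows "(\<lambda>k. 4^k*(LINT x|lborel. (g (x + (1/2)^k *\<^sub>R s) + g (x - (1/2)^k *\<^sub>R s) - 2*g x)^2)) \<longlonglongrightarrow> 0"
proof -
 have cg: "continuous_on UNIV g" using lip lipschitz_on_continuous_on by blast
 have cgc: "continuous_on UNIV (\<lambda>x. g (x + c))" for c
  by (rule continuous_on_compose2[OF cg]) (auto intro!: continuous_intros)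
 have supc: "g (x + c) = 0" if "x \<notin> cball 0 (r + b)" "norm c <= b" for x c b
 proof -
  have "norm x <= norm (x + c) + norm c" by (metis add_diff_cancel norm_triangle_ineq4)
  thus ?thesis using that by (intro supp) auto
 qed
 define I where "I t = (LINT x|lborel. (g (x + t) - g x)^2)" for t
 define J where "J t = (LINT x|lborel. (g (x + t) + g (x-t) - 2*g x)^2)" for t
 have int1: "integrable lborel (\<lambda>x. (g (x + a) - g (x + b))^2)" for a b
 proof (rule integrable_continuous_compact_support)
  show "continuous_on UNIV (\<lambda>x. (g (x + a) - g (x + b))^2)" by (intro continuous_intros cgc)
  fix x :: 'a assume "x \<notin> cball 0 (r + (norm a + norm b))"
  thus "(g (x + a) - g (x + b))^2 = 0" using supc[of x "norm a + norm b"] by simp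
 qed
 have int2: "integrable lborel (\<lambda>x. (g (x + a) + g x - 2*g (x + b))^2)" for a b
 proof (rule integrable_continuous_compact_support)
  show "continuous_on UNIV (\<lambda>x. (g (x + a) + g x - 2*g (x + b))^2)" by (intro continuous_intros cgc cg)
  fix x :: 'a assume "x \<notin> cball 0 (r + (norm a + norm b))"
  thus "(g (x + a) + g x - 2*g (x + b))^2 = 0"
   using supc[of x "norm a + norm b"] supc[of x "norm a + norm b" 0] by simp
 qed
 have J_eq: "J t = (LINT x|lborel. (g (x + 2 *\<^sub>R t) + g x - 2*g (x + t))^2)" for t
  unfolding J_def
  by (subst lborel_integral_translate[symmetric, of _ t]) (simp add: algebra_simps scaleR_2)
 \<comment> \<open>With \<open>a = g (x + 2t) - g (x + t)\<close> and
   \<open>b = g (x + t) - g x\<close> this is \<open>(a + b)^2 + (a - b)^2 = 2a^2 + 2b^2\<close>; by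
   translation invariance the integrals of \<open>a^2\<close> and \<open>b^2\<close> agree.\<close>
 have par: "I (2 *\<^sub>R t) + J t = 4*I t" for t
 proof -
  have "I (2 *\<^sub>R t) + J t = (LINT x|lborel. (g (x + 2 *\<^sub>R t) - g x)^2 + (g (x + 2 *\<^sub>R t) + g x - 2*g (x + t))^2)"
   unfolding I_def J_eq using int1[of "2 *\<^sub>R t" 0] int2[of "2 *\<^sub>R t" t] by simp
  also have "... = (LINT x|lborel. 2*(g (x + 2 *\<^sub>R t) - g (x + t))^2 + 2*(g (x + t) - g x)^2)"
   by (intro Bochner_Integration.integral_cong) (auto simp: power2_eq_square algebra_simps)
  also have "... = 2*(LINT x|lborel. (g (x + 2 *\<^sub>R t) - g (x + t))^2) + 2*I t"
   unfolding I_def using int1[of "2 *\<^sub>R t" t] int1[of t 0] by simp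
  also have "(LINT x|lborel. (g (x + 2 *\<^sub>R t) - g (x + t))^2) = I t"
   unfolding I_def
   by (subst lborel_integral_translate[symmetric, of "\<lambda>x. (g (x + t) - g x)^2" t]) (simp add: algebra_simps scaleR_2)
  finally show ?thesis by simp
 qed
 have I_bound: "I t <= L^2*(norm t)^2*measure lborel (cball (0::'a) (r + norm s))" if "norm t <= norm s" for t
 proof -
  let ?B = "cball (0::'a) (r + norm s)"
  have "I t <= (LINT x|lborel. (L^2*(norm t)^2)*indicator ?B x)"
   unfolding I_def
  proof (rule integral_mono)
   show "integrable lborel (\<lambda>x. (g (x + t) - g x)^2)" using int1[of t 0] by simp
   show "integrable lborel (\<lambda>x. (L^2*(norm t)^2)*indicator ?B x)"
    using emeasure_lborel_cball_finite[of "0::'a" "r + norm s"]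
    by (intro integrable_mult_right integrable_real_indicator) (auto simp: infinity_ennreal_def)
   fix x :: 'a
   have "\<bar>g (x + t) - g x\<bar> <= L*norm t"
    using lipschitz_onD[OF lip, of "x + t" x] by (simp add: dist_norm)
   hence "(g (x + t) - g x)^2 <= (L*norm t)^2"
    by (rule power2_le_iff_abs_le[THEN iffD2, rotated]) (use lipschitz_on_nonneg[OF lip] in auto)
   thus "(g (x + t) - g x)^2 <= (L^2*(norm t)^2)*indicator ?B x"
    using supc[of x "norm s" t] supc[of x "norm s" 0] that
    by (auto simp: indicator_def power_mult_distrib)
  qed
  also have "... = L^2*(norm t)^2*measure lborel ?B" by simp
  finally show ?thesis .
 qed
 define E where "E k = 4^k*I ((1/2)^k *\<^sub>R s)" for k :: nat
 have step: "E (Suc k) - E k = 4^k*J ((1/2)^(Suc k) *\<^sub>R s)" for k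
 proof -
  have "4^k*(I (2 *\<^sub>R (1/2)^(Suc k) *\<^sub>R s) + J ((1/2)^(Suc k) *\<^sub>R s)) = 4^k*(4*I ((1/2)^(Suc k) *\<^sub>R s))"
   by (simp only: par)
  thus ?thesis unfolding E_def by (simp add: distrib_left)
 qed
 have J_nonneg: "J t >= 0" for t unfolding J_def by (rule Bochner_Integration.integral_nonneg) auto
 have mono: "incseq E"
  by (rule incseq_SucI) (use step J_nonneg in \<open>smt (verit) mult_nonneg_nonneg zero_le_power\<close>)
 have bdd: "E k <= L^2*(norm s)^2*measure lborel (cball (0::'a) (r + norm s))" for k
 proof -
  have "norm ((1/2)^k *\<^sub>R s) <= norm s"
   using mult_right_mono[of "(1/2)^k" 1 "norm s"] by (simp add: power_le_one)
  from I_bound[OF this] have "E k <= 4^k*(L^2*(norm ((1/2)^k *\<^sub>R s))^2*measure lborel (cball (0::'a) (r + norm s)))"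
   unfolding E_def by simp
  also have "... = L^2*(norm s)^2*measure lborel (cball (0::'a) (r + norm s))*(4^k*((1/2)^k)^2)"
   by (simp add: power_mult_distrib)
  also have "(4::real)^k*((1/2)^k)^2 = 1"
   by (simp add: power2_eq_square flip: power_mult_distrib)
  finally show ?thesis by simp
 qed
 obtain l where l: "E \<longlonglongrightarrow> l"
  using incseq_convergent[OF mono, of "L^2*(norm s)^2*measure lborel (cball (0::'a) (r + norm s))"] bdd by blast
 have "(\<lambda>k. 4*(E (Suc k) - E k)) \<longlonglongrightarrow> 4*(l-l)"
  by (intro tendsto_intros LIMSEQ_Suc l)
 hence "(\<lambda>k. 4^(Suc k)*J ((1/2)^(Suc k) *\<^sub>R s)) \<longlonglongrightarrow> 0"
  unfolding step by (simp add: mult_ac)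
 hence "(\<lambda>k. 4^k*J ((1/2)^k *\<^sub>R s)) \<longlonglongrightarrow> 0"
  by (rule LIMSEQ_imp_Suc)
 thus ?thesis unfolding J_def .
qed

lemma integrable_second_difference:
 fixes g :: "'a::euclidean_space => real"
 assumes "continuous_on UNIV g" and supp: "!!x. x \<notin> cball 0 r ==> g x = 0"
 shows "integrable lborel (\<lambda>x. (g (x + c + s) + g (x + c - s) - 2*g (x + c))^2)"
proof (rule integrable_continuous_compact_support)
 have "continuous_on UNIV (\<lambda>x. g (x + c))" for c
  by (rule continuous_on_compose2[OF assms(1)]) (auto intro!: continuous_intros)
 from this[of "c + s"] this[of "c - s"] this[of c]
 show "continuous_on UNIV (\<lambda>x. (g (x + c + s) + g (x + c - s) - 2*g (x + c))^2)"
  by (intro continuous_intros) (simp_all add: algebra_simps)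
 fix x :: 'a assume x: "x \<notin> cball 0 (r + (norm c + norm s))"
 have *: "g (x + d) = 0" if "norm d <= norm c + norm s" for d
 proof -
  have "norm x <= norm (x + d) + norm d" by (metis add_diff_cancel norm_triangle_ineq4)
  thus ?thesis using that x by (intro supp) auto
 qed
 have "g (x + (c + s)) = 0" "g (x + (c-s)) = 0" "g (x + c) = 0"
  by (intro * norm_triangle_ineq norm_triangle_ineq4; simp)+
 thus "(g (x + c + s) + g (x + c - s) - 2*g (x + c))^2 = 0" by (simp add: algebra_simps)
qed

text \<open>The McShane extension, as a supremum of cones of slope \<open>L\<close>. A constant
  \<open>c\<close> is allowed because only second differences of \<open>g\<close> are used later.
  Adding the bound \<open>B\<close> makes the values on \<open>K\<close> nonnegative, so that
  cutting off at zero changes nothing on \<open>K\<close> and produces compact support.\<close>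

lemma lipschitz_extension_compact_support:
 fixes h :: "'a::euclidean_space => real"
 assumes "compact K" and lip: "L-lipschitz_on K h"
 obtains g c r where "L-lipschitz_on UNIV g" "!!x. x \<in> K ==> g x = h x + c" "!!x. x \<notin> cball 0 r ==> g x = 0"
proof (cases "K = {}")
 case True
 have "L-lipschitz_on UNIV (\<lambda>x::'a. 0::real)"
  using lipschitz_on_nonneg[OF lip] by (auto simp: lipschitz_on_def)
 thus ?thesis using True that[of "\<lambda>x. 0" 0 0] by auto
next
 case False
 have L: "L >= 0" by (rule lipschitz_on_nonneg[OF lip])
 have "bounded (h ` K)"
  by (intro compact_imp_bounded compact_continuous_image lipschitz_on_continuous_on[OF lip] assms(1))
 then obtain B where B: "!!k. k \<in> K ==> \<bar>h k\<bar> <= B" by (auto simp: bounded_iff)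
 obtain rh where rh: "!!k. k \<in> K ==> norm k <= rh"
  using compact_imp_bounded[OF assms(1)] by (auto simp: bounded_iff)
 define s where "s x = (SUP k\<in>K. h k + B - L*dist x k)" for x
 have bdd: "bdd_above ((\<lambda>k. h k + B - L*dist x k) ` K)" for x
 proof (rule bdd_aboveI[of _ "2*B"])
  fix y assume "y \<in> (\<lambda>k. h k + B - L*dist x k) ` K"
  then obtain k where k: "k \<in> K" "y = h k + B - L*dist x k" by auto
  have "0 <= L*dist x k" using L by simp
  thus "y <= 2*B" using B[OF k(1)] k(2) by linarith
 qed
 have s_le: "s x <= s y + L*dist x y" for x y
  unfolding s_def
 proof (rule cSUP_least[OF False])
  fix k assume k: "k \<in> K"
  have "h k + B - L*dist y k <= (SUP k\<in>K. h k + B - L*dist y k)"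
   by (rule cSUP_upper[OF k bdd])
  moreover have "L*dist y k <= L*(dist x y + dist x k)"
   by (intro mult_left_mono L) (metis add.commute dist_commute dist_triangle)
  ultimately show "h k + B - L*dist x k <= (SUP k\<in>K. h k + B - L*dist y k) + L*dist x y"
   by (simp add: algebra_simps)
 qed
 have s_lip: "\<bar>s x - s y\<bar> <= L*dist x y" for x y
  using s_le[of x y] s_le[of y x] by (simp add: dist_commute abs_le_iff)
 have s_K: "s x = h x + B" if "x \<in> K" for x
 proof (rule antisym)
  show "s x <= h x + B" unfolding s_def
  proof (rule cSUP_least[OF False])
   fix k assume "k \<in> K"
   thus "h k + B - L*dist x k <= h x + B"
    using lipschitz_onD[OF lip \<open>k \<in> K\<close> that] by (simp add: dist_real_def dist_commute abs_le_iff)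
  qed
  show "h x + B <= s x" unfolding s_def
   using cSUP_upper[OF that bdd[of x]] by simp
 qed
 have s_far: "s x <= 2*B + L*rh - L*norm x" for x
  unfolding s_def
 proof (rule cSUP_least[OF False])
  fix k assume k: "k \<in> K"
  have "norm x <= dist x k + norm k" by (metis dist_0_norm dist_commute dist_triangle add.commute)
  hence "L*norm x <= L*(dist x k + rh)" using rh[OF k] by (intro mult_left_mono L) linarith
  thus "h k + B - L*dist x k <= 2*B + L*rh - L*norm x"
   using B[OF k] by (simp add: algebra_simps abs_le_iff)
 qed
 show ?thesis
 proof (cases "L = 0")
  \<comment> \<open>Cones of slope zero do not decrease; here \<open>h\<close> is constant on
    \<open>K\<close>, and \<open>c\<close> absorbs the constant.\<close>
  case True
  obtain k where k: "k \<in> K" using False by blast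
  have hk: "h x = h k" if "x \<in> K" for x
   using lipschitz_onD[OF lip that k] True by simp
  have "0-lipschitz_on UNIV (\<lambda>x::'a. 0::real)" by (auto simp: lipschitz_on_def)
  with True show ?thesis
   by (intro that[of "\<lambda>x. 0" "- h k" 0]) (auto simp: hk)
 next
  case L0: False
  define g where "g x = max 0 (s x)" for x
  show ?thesis
  proof (rule that[of g B "(2*B + L*rh)/L"])
   show "L-lipschitz_on UNIV g"
   proof (rule lipschitz_onI[OF _ L])
    fix x y show "dist (g x) (g y) <= L*dist x y"
     using s_lip[of x y] by (auto simp: g_def dist_real_def)
   qed
   show "g x = h x + B" if "x \<in> K" for x
    using s_K[OF that] B[OF that] by (simp add: g_def abs_le_iff)
   fix x :: 'a assume "x \<notin> cball 0 ((2*B + L*rh)/L)"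
   hence "2*B + L*rh < L*norm x" using L L0 by (simp add: divide_less_eq not_le mult.commute)
   thus "g x = 0" using s_far[of x] by (simp add: g_def)
  qed
 qed
qed

text \<open>A point of \<open>K\<close> that a short translation moves out of \<open>K\<close> lands
  in \<open>T - K\<close>, where \<open>T\<close> is an open neighbourhood of \<open>K\<close> of
  almost the same measure; compactness of \<open>K\<close> gives a uniform admissible
  length.\<close>

lemma measure_translate_inter_compact:
 fixes K :: "'a::euclidean_space set"
 assumes "compact K" "e > 0"
 shows "\<exists>d>0. \<forall>c. norm c < d --> measure lebesgue (K - (\<lambda>x. x + c) -` K) <= e"
proof -
 have mK: "K \<in> lmeasurable" using assms(1) by (simp add: lmeasurable_compact)
 obtain T where T: "open T" "K \<subseteq> T" "T - K \<in> lmeasurable" "emeasure lebesgue (T-K) < ennreal e"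
  using sets_lebesgue_outer_open[OF _ \<open>e > 0\<close>, of K] mK by blast
 obtain d where d: "d > 0" "(\<Union>x\<in>K. ball x d) \<subseteq> T"
  using compact_subset_open_imp_ball_epsilon_subset[OF assms(1) T(1,2)] by blast
 show ?thesis
 proof (intro exI conjI allI impI)
  show "d > 0" by fact
  fix c :: 'a assume c: "norm c < d"
  let ?M = "K - (\<lambda>x. x + c) -` K"
  have M: "?M \<in> sets lebesgue" "?M \<in> lmeasurable"
  proof -
   have "closed ((\<lambda>x. x + c) -` K)"
    using assms(1) by (intro closed_vimage compact_imp_closed continuous_intros)
   hence "?M \<in> sets borel" using assms(1) by (intro sets.Diff borel_compact borel_closed)
   thus "?M \<in> sets lebesgue" by (simp add: sets_completionI_sets)
   thus "?M \<in> lmeasurable" by (intro fmeasurableI2[OF mK]) auto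
  qed
  have "measure lebesgue ?M = measure lebesgue ((+) c ` ?M)" by (simp add: measure_translation)
  also have "... <= measure lebesgue (T-K)"
  proof (rule measure_mono_fmeasurable)
   show "(+) c ` ?M \<subseteq> T - K"
   proof
    fix y assume "y \<in> (+) c ` ?M"
    then obtain x where x: "x \<in> K" "x + c \<notin> K" "y = c + x" by auto
    have "y \<in> ball x d" using c x(3) by (simp add: dist_norm)
    hence "y \<in> T" using d(2) x(1) by blast
    thus "y \<in> T - K" using x by (simp add: add.commute)
   qed
   show "(+) c ` ?M \<in> sets lebesgue" using M by (metis lebesgue_sets_translation)
   show "T - K \<in> lmeasurable" by fact
  qed
  also have "... <= e" using T(4) \<open>e > 0\<close> unfolding measure_def by (metis enn2real_leI less_imp_le)
  finally show "measure lebesgue ?M <= e" .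
 qed
qed

text \<open>An averaging argument. The points of \<open>K\<close> all of whose translates by
  \<open>r\<close> times \<open>S\<close> stay in \<open>K\<close> keep at least half of the
  measure, whereas the integral of the squared second differences at the dyadic scale
  \<open>r\<close> is \<open>o(r^2)\<close>; so at some such point all of them are at most
  \<open>e*r\<close>. The point depends on the scale, which suffices for a blow-up.\<close>

lemma approx_affine_at_point:
 fixes K :: "'a::euclidean_space set" and G :: "'a => 'a"
 assumes K: "compact K" "\<not> negligible K" and lip: "L-lipschitz_on K G" and fin: "finite S" and e: "e > 0"
 obtains x r where "x \<in> K" "0 < r" "r < e" "!!a. a \<in> S ==> x + r *\<^sub>R a \<in> K"
  "!!a s b. a \<in> S ==> a + s \<in> S ==> a - s \<in> S ==> b \<in> Basis ==>
    \<bar>(G (x + r *\<^sub>R (a + s)) + G (x + r *\<^sub>R (a-s)) - 2 *\<^sub>R G (x + r *\<^sub>R a)) \<bullet> b\<bar> <= e*r"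
proof -
 have mK: "K \<in> lmeasurable" using K(1) by (simp add: lmeasurable_compact)
 define m where "m = measure lebesgue K"
 have m: "m > 0"
  using K(2) mK unfolding m_def by (metis fmeasurableD2 less_le measure_nonneg negligible_iff_measure)
 have "\<exists>g. \<forall>b. b \<in> Basis --> L-lipschitz_on UNIV (g b) \<and> (\<exists>c. \<forall>x\<in>K. g b x = G x \<bullet> b + c) \<and> (\<exists>r. \<forall>x. x \<notin> cball 0 r --> g b x = 0)"
 proof (intro choice allI)
  fix b :: 'a
  show "\<exists>g. b \<in> Basis --> L-lipschitz_on UNIV g \<and> (\<exists>c. \<forall>x\<in>K. g x = G x \<bullet> b + c) \<and> (\<exists>r. \<forall>x. x \<notin> cball 0 r --> g x = 0)"
  proof (cases "b \<in> Basis")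
   case True
   have "L-lipschitz_on K (\<lambda>x. G x \<bullet> b)"
   proof (rule lipschitz_onI)
    fix x y assume "x \<in> K" "y \<in> K"
    thus "dist (G x \<bullet> b) (G y \<bullet> b) <= L*dist x y"
     using lipschitz_onD[OF lip, of x y] Basis_le_norm[OF True, of "G x - G y"]
     by (simp add: dist_norm inner_diff_left)
   qed (rule lipschitz_on_nonneg[OF lip])
   from lipschitz_extension_compact_support[OF K(1) this] show ?thesis by metis
  qed auto
 qed
 then obtain g where g: "!!b. b \<in> Basis ==> L-lipschitz_on UNIV (g b)"
  "!!b. b \<in> Basis ==> \<exists>c. \<forall>x\<in>K. g b x = G x \<bullet> b + c" "!!b. b \<in> Basis ==> \<exists>r. \<forall>x. x \<notin> cball 0 r --> g b x = 0"
  by metis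
 define D where "D = (\<lambda>b x c s. (g b (x + c + s) + g b (x + c - s) - 2*g b (x + c))^2)"
 define P where "P = {(a, s). a \<in> S \<and> a + s \<in> S \<and> a - s \<in> S}"
 have finP: "finite P"
 proof (rule finite_subset)
  show "P \<subseteq> (\<lambda>(a, b). (a, b - a)) ` (S \<times> S)"
  proof (clarsimp simp: P_def image_iff)
   fix a s assume "a \<in> S" "a + s \<in> S"
   thus "\<exists>y\<in>S. s = y - a" by (intro bexI[of _ "a + s"]) auto
  qed
  show "finite ((\<lambda>(a, b). (a, b - a)) ` (S \<times> S))" using fin by simp
 qed
 define T where "T k x = (\<Sum>b\<in>Basis. \<Sum>(a, s)\<in>P. D b x ((1/2)^k *\<^sub>R a) ((1/2)^k *\<^sub>R s))" for k :: nat and x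
 have int_D: "integrable lborel (\<lambda>x. D b x c s)" if "b \<in> Basis" for b c s
  using g(3)[OF that] integrable_second_difference[OF lipschitz_on_continuous_on[OF g(1)[OF that]]]
  unfolding D_def by blast
 have int_T: "integrable lborel (T k)" for k
  unfolding T_def split_def by (intro Bochner_Integration.integrable_sum int_D)
 have lim: "(\<lambda>k. 4^k*(LINT x|lborel. T k x)) \<longlonglongrightarrow> 0"
 proof -
  have eq: "4^k*(LINT x|lborel. T k x) = (\<Sum>b\<in>Basis. \<Sum>p\<in>P. 4^k*(LINT x|lborel. D b x 0 ((1/2)^k *\<^sub>R snd p)))" for k
  proof -
   have A: "(LINT x|lborel. T k x) = (\<Sum>b\<in>Basis. \<Sum>p\<in>P. (LINT x|lborel. D b x ((1/2)^k *\<^sub>R fst p) ((1/2)^k *\<^sub>R snd p)))"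
    unfolding T_def split_def
    by (rule trans[OF Bochner_Integration.integral_sum sum.cong[OF refl Bochner_Integration.integral_sum]])
      (intro Bochner_Integration.integrable_sum int_D; assumption)+
   have tr: "(LINT x|lborel. D b x c s) = (LINT x|lborel. D b x 0 s)" for b c s
    unfolding D_def using lborel_integral_translate[of "\<lambda>x. (g b (x + s) + g b (x-s) - 2*g b x)^2" c] by simp
   show ?thesis unfolding A sum_distrib_left by (intro sum.cong refl) (subst tr, simp)
  qed
  have "(\<lambda>k. 4^k*(LINT x|lborel. D b x 0 ((1/2)^k *\<^sub>R s))) \<longlonglongrightarrow> 0" if b: "b \<in> Basis" for b s
  proof -
   obtain r where "!!x. x \<notin> cball 0 r ==> g b x = 0" using g(3)[OF b] by blast
   from second_difference_energy[OF g(1)[OF b] this] show ?thesis unfolding D_def by simp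
  qed
  hence "(\<lambda>k. \<Sum>b\<in>Basis. \<Sum>p\<in>P. 4^k*(LINT x|lborel. D b x 0 ((1/2)^k *\<^sub>R snd p))) \<longlonglongrightarrow> (\<Sum>b::'a\<in>Basis. \<Sum>p\<in>P. 0)"
   by (intro tendsto_sum)
  thus ?thesis unfolding eq by simp
 qed
 \<comment> \<open>Each of the \<open>card S\<close> translations may lose the measure
   \<open>c\<close>; together they lose at most \<open>m/2\<close>.\<close>
 define c where "c = m/(2*(real (card S) + 1))"
 have c: "c > 0" using m by (simp add: c_def)
 from measure_translate_inter_compact[OF K(1) c]
 obtain d where d: "d > 0" "!!v. norm v < d ==> measure lebesgue (K - (\<lambda>x. x + v) -` K) <= c" by blast
 have ev1: "\<forall>\<^sub>F k in sequentially. \<forall>a\<in>S. norm ((1/2)^k *\<^sub>R a) < d"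
 proof (intro eventually_ball_finite fin ballI)
  fix a
  have "(\<lambda>k. norm ((1/2)^k *\<^sub>R a)) \<longlonglongrightarrow> norm (0 *\<^sub>R a)"
   by (intro tendsto_intros LIMSEQ_power_zero) auto
  thus "\<forall>\<^sub>F k in sequentially. norm ((1/2)^k *\<^sub>R a) < d"
   using d(1) by (intro order_tendstoD(2)) auto
 qed
 have ev2: "\<forall>\<^sub>F k in sequentially. 4^k*(LINT x|lborel. T k x) < e^2*(m/2)"
  by (rule order_tendstoD(2)[OF lim]) (use e m in auto)
 have ev3: "\<forall>\<^sub>F k in sequentially. (1/2::real)^k < e"
  by (rule order_tendstoD(2)[OF LIMSEQ_power_zero]) (use e in auto)
 obtain k where k: "!!a. a \<in> S ==> norm ((1/2)^k *\<^sub>R a) < d" "4^k*(LINT x|lborel. T k x) < e^2*(m/2)" "(1/2::real)^k < e"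
  using eventually_happens[OF eventually_conj[OF ev1 eventually_conj[OF ev2 ev3]]] by auto
 define r where "r = (1/2::real)^k"
 define Q where "Q = K - (\<Union>a\<in>S. K - (\<lambda>x. x + r *\<^sub>R a) -` K)"
 have borel: "(\<lambda>x. x + v) -` K \<in> sets borel" "K \<in> sets borel" for v
  by (rule borel_closed closed_vimage compact_imp_closed K(1) | intro continuous_intros)+
 have Qb: "Q \<in> sets borel" unfolding Q_def by (intro sets.Diff sets.finite_UN fin borel)
 have Uc: "measure lebesgue (\<Union>a\<in>S. K - (\<lambda>x. x + r *\<^sub>R a) -` K) <= real (card S)*c"
 proof -
  have "measure lebesgue (\<Union>a\<in>S. K - (\<lambda>x. x + r *\<^sub>R a) -` K) <= (\<Sum>a\<in>S. measure lebesgue (K - (\<lambda>x. x + r *\<^sub>R a) -` K))"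
   using fin borel by (intro measure_UNION_le) (auto intro: sets_completionI_sets)
  also have "... <= (\<Sum>a\<in>S. c)" using k(1) by (intro sum_mono d(2)) (simp add: r_def)
  finally show ?thesis by simp
 qed
 have Qm: "measure lebesgue Q >= m/2"
 proof -
  have "measure lebesgue Q = m - measure lebesgue (\<Union>a\<in>S. K - (\<lambda>x. x + r *\<^sub>R a) -` K)"
   unfolding Q_def m_def
  proof (rule measure_Diff)
   have "(\<Union>a\<in>S. K - (\<lambda>x. x + r *\<^sub>R a) -` K) \<in> sets borel"
    by (intro sets.finite_UN sets.Diff fin borel)
   thus "(\<Union>a\<in>S. K - (\<lambda>x. x + r *\<^sub>R a) -` K) \<in> sets lebesgue" by (simp add: sets_completionI_sets)
  qed (use fmeasurableD2[OF mK] mK in auto)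
  moreover have "real (card S)*c <= m/2" using m by (simp add: c_def field_simps)
  ultimately show ?thesis using Uc by linarith
 qed
 have "\<exists>x\<in>Q. T k x <= e^2*r^2"
 proof (rule ccontr)
  assume "\<not> ?thesis"
  hence *: "T k x > e^2*r^2" if "x \<in> Q" for x using that by force
  have Qfin: "emeasure lborel Q < \<infinity>"
  proof -
   have "emeasure lborel Q <= emeasure lborel K" using borel(2) by (intro emeasure_mono) (auto simp: Q_def)
   also have "... < \<infinity>" by (rule emeasure_compact_finite[OF K(1)])
   finally show ?thesis .
  qed
  have "e^2*r^2*measure lborel Q = (LINT x|lborel. (e^2*r^2)*indicator Q x)" by simp
  also have "... <= (LINT x|lborel. T k x)"
  proof (rule integral_mono)
   show "integrable lborel (\<lambda>x. (e^2*r^2)*indicator Q x)"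
    using Qb Qfin by (intro integrable_mult_right integrable_real_indicator) auto
   show "(e^2*r^2)*indicator Q x <= T k x" for x
    using *[of x] by (auto simp: indicator_def T_def D_def intro!: sum_nonneg)
  qed (rule int_T)
  finally have "4^k*(e^2*r^2*measure lborel Q) <= 4^k*(LINT x|lborel. T k x)" by simp
  also have "... < e^2*(m/2)" by (rule k(2))
  finally have "(4^k*r^2)*(e^2*measure lborel Q) < e^2*(m/2)" by (simp add: mult_ac)
  moreover have "4^k*r^2 = 1" unfolding r_def by (simp add: power2_eq_square flip: power_mult_distrib)
  moreover have "measure lborel Q = measure lebesgue Q" using Qb by simp
  ultimately show False using Qm e by simp
 qed
 then obtain x where x: "x \<in> Q" "T k x <= e^2*r^2" by blast
 show ?thesis
 proof (rule that[of x r])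
  show "x \<in> K" "0 < r" "r < e" using x k(3) by (auto simp: Q_def r_def)
  show inK: "x + r *\<^sub>R a \<in> K" if "a \<in> S" for a using x that by (auto simp: Q_def)
  fix a s b assume as: "a \<in> S" "a + s \<in> S" "a - s \<in> S" and b: "(b::'a) \<in> Basis"
  have "D b x (r *\<^sub>R a) (r *\<^sub>R s) <= (\<Sum>(a, s)\<in>P. D b x (r *\<^sub>R a) (r *\<^sub>R s))"
   using member_le_sum[of "(a, s)" P "\<lambda>(a, s). D b x (r *\<^sub>R a) (r *\<^sub>R s)"] as finP by (auto simp: P_def D_def)
  also have "... <= T k x" unfolding T_def r_def[symmetric]
   by (rule member_le_sum[OF b]) (auto simp: D_def intro!: sum_nonneg)
  also have "... <= (e*r)^2" using x(2) by (simp add: power_mult_distrib)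
  finally have "\<bar>g b (x + r *\<^sub>R a + r *\<^sub>R s) + g b (x + r *\<^sub>R a - r *\<^sub>R s) - 2*g b (x + r *\<^sub>R a)\<bar> <= e*r"
   unfolding D_def using e by (subst (asm) power2_le_iff_abs_le) (auto simp: r_def)
  moreover obtain c where "!!x. x \<in> K ==> g b x = G x \<bullet> b + c" using g(2)[OF b] by blast
  ultimately show "\<bar>(G (x + r *\<^sub>R (a + s)) + G (x + r *\<^sub>R (a-s)) - 2 *\<^sub>R G (x + r *\<^sub>R a)) \<bullet> b\<bar> <= e*r"
   using inK[OF as(1)] inK[OF as(2)] inK[OF as(3)] by (simp add: algebra_simps)
 qed
qed

section \<open>Blow-up limits along vectors with rational coordinates\<close>

definition ratvec :: "'a::euclidean_space set" where
 "ratvec = {x. \<forall>b\<in>Basis. x \<bullet> b \<in> \<rat>}"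

lemma ratvec_scaleR: "x \<in> ratvec ==> q \<in> \<rat> ==> q *\<^sub>R x \<in> ratvec"
 and ratvec_add: "x \<in> ratvec ==> y \<in> ratvec ==> x + y \<in> ratvec"
 and ratvec_Basis: "b \<in> Basis ==> b \<in> ratvec"
 and ratvec_0: "0 \<in> ratvec"
 by (auto simp: ratvec_def inner_add_left inner_Basis)

lemma countable_ratvec: "countable (ratvec :: 'a::euclidean_space set)"
proof -
 let ?F = "PiE (Basis::'a set) (\<lambda>_. \<rat>::real set)"
 have "countable ?F" by (intro countable_PiE finite_Basis countable_rat)
 moreover have "ratvec \<subseteq> (\<lambda>f. \<Sum>b\<in>Basis. f b *\<^sub>R b) ` ?F"
 proof
  fix x :: 'a assume "x \<in> ratvec"
  hence "restrict (\<lambda>b. x \<bullet> b) Basis \<in> ?F" by (auto simp: ratvec_def)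
  moreover have "x = (\<Sum>b\<in>Basis. restrict (\<lambda>b. x \<bullet> b) Basis b *\<^sub>R b)"
   by (simp add: euclidean_representation)
  ultimately show "x \<in> (\<lambda>f. \<Sum>b\<in>Basis. f b *\<^sub>R b) ` ?F" by blast
 qed
 ultimately show ?thesis by (meson countable_image countable_subset)
qed

lemma ratvec_dense:
 fixes x :: "'a::euclidean_space"
 assumes "e > 0"
 shows "\<exists>y\<in>ratvec. norm (x-y) < e"
proof -
 define c where "c = e/(2*real DIM('a))"
 have c: "c > 0" using assms by (simp add: c_def)
 have "\<forall>b. \<exists>q\<in>\<rat>. x \<bullet> b - c < q \<and> q < x \<bullet> b + c" using c by (intro allI Rats_dense_in_real) auto
 then obtain q where q: "!!b. q b \<in> \<rat>" "!!b. x \<bullet> b - c < q b" "!!b. q b < x \<bullet> b + c" by metis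
 let ?y = "\<Sum>b\<in>Basis. q b *\<^sub>R b"
 have "norm (x - ?y) <= (\<Sum>b\<in>Basis. \<bar>(x - ?y) \<bullet> b\<bar>)" by (rule norm_le_l1)
 also have "... <= (\<Sum>b\<in>(Basis::'a set). c)"
 proof (rule sum_mono)
  fix b :: 'a assume "b \<in> Basis"
  thus "\<bar>(x - ?y) \<bullet> b\<bar> <= c"
   using q(2)[of b] q(3)[of b] by (simp add: inner_diff_left abs_le_iff)
 qed
 also have "... < e" using assms by (simp add: c_def)
 finally have "norm (x - ?y) < e" .
 moreover have "?y \<in> ratvec" using q(1) by (simp add: ratvec_def)
 ultimately show ?thesis by blast
qed

text \<open>The midpoint equation makes \<open>l\<close> additive and hence linear over the
  rationals. It is available only on the countable set \<open>ratvec\<close>, where a diagonal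
  argument provides limits; real coefficients enter through the coordinates in the standard
  basis.\<close>

lemma midpoint_affine_ratvec:
 fixes l :: "'a::euclidean_space => 'b::real_vector"
 assumes "l 0 = 0" and mid: "!!a s. a \<in> ratvec ==> s \<in> ratvec ==> l (a + s) + l (a-s) = 2 *\<^sub>R l a"
  and a: "a \<in> ratvec"
 shows "l a = (\<Sum>b\<in>Basis. (a \<bullet> b) *\<^sub>R l b)"
proof -
 have half: "(1/2) *\<^sub>R x \<in> ratvec" if "x \<in> ratvec" for x :: 'a using that by (intro ratvec_scaleR) auto
 have double: "l (2 *\<^sub>R u) = 2 *\<^sub>R l u" if "u \<in> ratvec" for u
  using mid[OF that that] assms(1) by (simp add: scaleR_2)
 have add: "l (u + v) = l u + l v" if "u \<in> ratvec" "v \<in> ratvec" for u v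
 proof -
  have n: "- (1/2) *\<^sub>R v \<in> ratvec" using that by (intro ratvec_scaleR) auto
  have "l (u + v) = 2 *\<^sub>R l ((1/2) *\<^sub>R (u + v))"
   using double[OF half[OF ratvec_add[OF that]]] by simp
  also have "... = l u + l v"
   using mid[OF half[OF ratvec_add[OF that]] ratvec_add[OF half[OF that(1)] n]]
   by (simp add: algebra_simps flip: scaleR_left.add)
  finally show ?thesis .
 qed
 have nat: "l (of_nat n *\<^sub>R u) = of_nat n *\<^sub>R l u" if "u \<in> ratvec" for u and n :: nat
 proof (induction n)
  case (Suc n)
  have "of_nat n *\<^sub>R u \<in> ratvec" using that by (intro ratvec_scaleR) auto
  from add[OF that this] Suc show ?case by (simp add: algebra_simps)
 qed (simp add: assms(1))
 have neg: "l (- u) = - l u" if "u \<in> ratvec" for u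
  using mid[OF ratvec_0 that] assms(1) by (simp add: eq_neg_iff_add_eq_0 add.commute)
 have int: "l (of_int n *\<^sub>R u) = of_int n *\<^sub>R l u" if "u \<in> ratvec" for u n
 proof (cases "n >= 0")
  case True
  thus ?thesis using nat[OF that, of "nat n"] by simp
 next
  case False
  have "of_int (- n) *\<^sub>R u \<in> ratvec" using that by (intro ratvec_scaleR) auto
  from neg[OF this] nat[OF that, of "nat (- n)"] False show ?thesis by simp
 qed
 have rat: "l (q *\<^sub>R u) = q *\<^sub>R l u" if u: "u \<in> ratvec" and q: "q \<in> \<rat>" for u q
 proof -
  obtain m n where mn: "q = of_int m/of_int n" "n > 0"
   using q by (auto elim: Rats_cases')
  have "of_int n *\<^sub>R l (q *\<^sub>R u) = l (of_int n *\<^sub>R (q *\<^sub>R u))" using int[OF ratvec_scaleR[OF u q]] by simp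
  also have "... = of_int m *\<^sub>R l u" using int[OF u, of m] mn by simp
  finally have "(1/of_int n) *\<^sub>R (of_int n *\<^sub>R l (q *\<^sub>R u)) = (1/of_int n) *\<^sub>R (of_int m *\<^sub>R l u)" by simp
  thus ?thesis using mn by simp
 qed
 have "l (\<Sum>b\<in>B. (a \<bullet> b) *\<^sub>R b) = (\<Sum>b\<in>B. (a \<bullet> b) *\<^sub>R l b) \<and> (\<Sum>b\<in>B. (a \<bullet> b) *\<^sub>R b) \<in> ratvec"
  if "finite B" "B \<subseteq> Basis" for B
  using that
 proof (induction B rule: finite_induct)
  case (insert b B)
  have b: "b \<in> ratvec" "a \<bullet> b \<in> \<rat>" using insert.prems a ratvec_Basis by (auto simp: ratvec_def)
  hence "(a \<bullet> b) *\<^sub>R b \<in> ratvec" by (rule ratvec_scaleR)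
  moreover have "(\<Sum>b\<in>B. (a \<bullet> b) *\<^sub>R b) \<in> ratvec" using insert by simp
  ultimately show ?case
   using insert rat[OF b] add[of "(a \<bullet> b) *\<^sub>R b" "\<Sum>b\<in>B. (a \<bullet> b) *\<^sub>R b"]
    ratvec_add[of "(a \<bullet> b) *\<^sub>R b" "\<Sum>b\<in>B. (a \<bullet> b) *\<^sub>R b"] by simp
 qed (simp add: assms(1) ratvec_0)
 from this[OF finite_Basis order.refl] show ?thesis by (simp add: euclidean_representation)
qed

text \<open>A blow-up. The difference quotients of \<open>G\<close> at the points and scales of
  \<open>approx_affine_at_point\<close>, for finite sets \<open>S j\<close> exhausting
  \<open>ratvec\<close>, converge along a subsequence to a midpoint-affine and hence linear map
  \<open>A\<close>. Summing slopes along segments gives the limit of the rescaled \<open>W\<close>,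
  and a finite net makes it uniform on the unit ball. The result concerns one point and one scale,
  not a fixed point and all scales.\<close>

lemma second_order_expansion_at_point:
 fixes W :: "'a::euclidean_space => real" and G :: "'a => 'a"
 assumes K: "compact K" "\<not> negligible K" and lip: "L-lipschitz_on K G" and C: "C >= 0" and rh: "rh > 0"
  and tq: "!!x y. x \<in> K ==> norm (y-x) <= rh ==> \<bar>W y - W x - G x \<bullet> (y-x)\<bar> <= C*(norm (y-x))^2"
  and e: "e > 0"
 obtains x r A where "x \<in> K" "0 < r" "r < e" "linear A"
  "!!h. norm h <= 1 ==> \<bar>W (x + r *\<^sub>R h) - W x - r*(G x \<bullet> h) - r^2/2*(h \<bullet> A h)\<bar> <= e*r^2"
proof -
 define d where "d = from_nat_into (ratvec :: 'a set)"
 have ran_d: "range d = ratvec"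
  unfolding d_def using ratvec_0 by (intro range_from_nat_into countable_ratvec) auto
 define S where "S j = d ` {..j}" for j
 have L0: "L >= 0" by (rule lipschitz_on_nonneg[OF lip])
 have "\<exists>x r. x \<in> K \<and> 0 < r \<and> r < 1/(real j + 1) \<and> (\<forall>a\<in>S j. x + r *\<^sub>R a \<in> K) \<and>
  (\<forall>a s b. a \<in> S j --> a + s \<in> S j --> a - s \<in> S j --> b \<in> Basis -->
    \<bar>(G (x + r *\<^sub>R (a + s)) + G (x + r *\<^sub>R (a-s)) - 2 *\<^sub>R G (x + r *\<^sub>R a)) \<bullet> b\<bar> <= 1/(real j + 1)*r)" for j
  by (rule approx_affine_at_point[OF K lip, of "S j" "1/(real j + 1)"], simp add: S_def, simp, blast)
 then obtain X R where XR: "!!j. X j \<in> K" "!!j. 0 < R j" "!!j. R j < 1/(real j + 1)"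
  "!!j a. a \<in> S j ==> X j + R j *\<^sub>R a \<in> K"
  "!!j a s b. a \<in> S j ==> a + s \<in> S j ==> a - s \<in> S j ==> b \<in> Basis ==>
    \<bar>(G (X j + R j *\<^sub>R (a + s)) + G (X j + R j *\<^sub>R (a-s)) - 2 *\<^sub>R G (X j + R j *\<^sub>R a)) \<bullet> b\<bar> <= 1/(real j + 1) * R j"
  by metis
 define gj where "gj j a = (1/R j) *\<^sub>R (G (X j + R j *\<^sub>R a) - G (X j))" for j a
 have gj_bound: "norm (gj j a) <= L*norm a" if "a \<in> S j" for j a
 proof -
  have "norm (G (X j + R j *\<^sub>R a) - G (X j)) <= L*(R j*norm a)"
   using lipschitz_onD[OF lip XR(4)[OF that] XR(1)[of j]] XR(2)[of j] by (simp add: dist_norm)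
  thus ?thesis using XR(2)[of j] unfolding gj_def norm_scaleR by (simp add: divide_le_eq mult_ac)
 qed
 \<comment> \<open>Division by \<open>1 + norm a\<close> and the cut-off outside \<open>S j\<close>
   make the quotients bounded uniformly in \<open>a\<close>, as the diagonal selection
   requires.\<close>
 define f where "f j a = (if a \<in> S j then (1/(1 + norm a)) *\<^sub>R gj j a else 0)" for j a
 have fb: "norm (f j a) <= L" if "a \<in> ratvec" for j a
 proof (cases "a \<in> S j")
  case True
  have "norm (gj j a) <= L*(1 + norm a)" using gj_bound[OF True] L0 by (simp add: algebra_simps)
  moreover have "0 < 1 + norm a" by (simp add: add_pos_nonneg)
  ultimately show ?thesis using True by (simp add: f_def divide_le_eq)
 qed (simp add: f_def L0)
 obtain k where k: "strict_mono (k::nat=>nat)" "!!a. a \<in> ratvec ==> \<exists>l. (\<lambda>n. f (k n) a) \<longlonglongrightarrow> l"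
  by (rule function_convergent_subsequence[OF countable_ratvec, of f L], erule fb, blast)
 have evS: "\<forall>\<^sub>F n in sequentially. a \<in> S (k n)" if a: "a \<in> ratvec" for a
 proof -
  obtain i where i: "a = d i" using a unfolding ran_d[symmetric] by (rule rangeE)
  show ?thesis using eventually_ge_at_top[of i]
  proof eventually_elim
   case (elim n)
   thus ?case using seq_suble[OF k(1), of n] by (auto simp: S_def i)
  qed
 qed
 define x r g where "x n = X (k n)" and "r n = R (k n)" and "g n = gj (k n)" for n
 have r: "r n > 0" "r n < 1/(real n + 1)" for n
 proof -
  show "r n > 0" using XR(2) by (simp add: r_def)
  have "1/(real (k n) + 1) <= 1/(real n + 1)" using seq_suble[OF k(1), of n] by (intro divide_left_mono) auto
  thus "r n < 1/(real n + 1)" using XR(3)[of "k n"] by (simp add: r_def)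
 qed
 have r0: "r \<longlonglongrightarrow> 0"
 proof (rule Lim_null_comparison[OF always_eventually LIMSEQ_inverse_real_of_nat], rule allI)
  show "norm (r n) <= inverse (real (Suc n))" for n
   using r[of n] by (simp add: inverse_eq_divide add.commute)
 qed
 have "\<exists>l. (\<lambda>n. g n a) \<longlonglongrightarrow> l" if a: "a \<in> ratvec" for a
 proof -
  obtain l where l: "(\<lambda>n. f (k n) a) \<longlonglongrightarrow> l" using k(2)[OF a] by blast
  have "(\<lambda>n. (1 + norm a) *\<^sub>R f (k n) a) \<longlonglongrightarrow> (1 + norm a) *\<^sub>R l" by (intro tendsto_intros l)
  moreover have "\<forall>\<^sub>F n in sequentially. (1 + norm a) *\<^sub>R f (k n) a = g n a"
   using evS[OF a]
  proof eventually_elim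
   case (elim n)
   have "1 + norm a ~= 0" using norm_ge_zero[of a] by linarith
   thus ?case using elim by (simp add: f_def g_def)
  qed
  ultimately show ?thesis by (intro exI) (rule Lim_transform_eventually)
 qed
 then obtain l where l: "!!a. a \<in> ratvec ==> (\<lambda>n. g n a) \<longlonglongrightarrow> l a" by metis
 have l0: "l 0 = 0"
  using l[OF ratvec_0] by (simp add: g_def gj_def LIMSEQ_const_iff)
 have neg: "- s \<in> ratvec" if "s \<in> ratvec" for s :: 'a using ratvec_scaleR[OF that, of "-1"] by simp
 have mid: "l (a + s) + l (a-s) = 2 *\<^sub>R l a" if as: "a \<in> ratvec" "s \<in> ratvec" for a s
 proof (rule euclidean_eqI)
  fix b :: 'a assume b: "b \<in> Basis"
  have rv: "a + s \<in> ratvec" "a - s \<in> ratvec" using ratvec_add[OF as] ratvec_add[OF as(1) neg[OF as(2)]] by auto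
  have "(\<lambda>n. (g n (a + s) + g n (a-s) - 2 *\<^sub>R g n a) \<bullet> b) \<longlonglongrightarrow> (l (a + s) + l (a-s) - 2 *\<^sub>R l a) \<bullet> b"
   by (intro tendsto_intros l as rv)
  moreover have "(\<lambda>n. (g n (a + s) + g n (a-s) - 2 *\<^sub>R g n a) \<bullet> b) \<longlonglongrightarrow> 0"
  proof (rule Lim_null_comparison[OF _ lim_1_over_n])
   show "\<forall>\<^sub>F n in sequentially. norm ((g n (a + s) + g n (a-s) - 2 *\<^sub>R g n a) \<bullet> b) <= 1/real n"
    using evS[OF as(1)] evS[OF rv(1)] evS[OF rv(2)] eventually_gt_at_top[of 0]
   proof eventually_elim
    case (elim n)
    have "g n (a + s) + g n (a-s) - 2 *\<^sub>R g n a = (1/R (k n)) *\<^sub>R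
      (G (X (k n) + R (k n) *\<^sub>R (a + s)) + G (X (k n) + R (k n) *\<^sub>R (a-s)) - 2 *\<^sub>R G (X (k n) + R (k n) *\<^sub>R a))"
     (is "_ = _ *\<^sub>R ?D") unfolding g_def gj_def scaleR_2 by (simp add: algebra_simps)
    hence "norm ((g n (a + s) + g n (a-s) - 2 *\<^sub>R g n a) \<bullet> b) = (1/R (k n))*\<bar>?D \<bullet> b\<bar>"
     using XR(2)[of "k n"] by (simp only: inner_scaleR_left real_norm_def abs_mult) simp
    also have "... <= (1/R (k n))*(1/(real (k n) + 1) * R (k n))"
     using XR(2)[of "k n"] by (intro mult_left_mono XR(5)[OF elim(1-3) b]) simp
    also have "... = 1/(real (k n) + 1)" using XR(2)[of "k n"] by simp
    also have "... <= 1/real n" using seq_suble[OF k(1), of n] elim by (intro divide_left_mono) auto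
    finally show ?case .
   qed
  qed
  ultimately have "(l (a + s) + l (a-s) - 2 *\<^sub>R l a) \<bullet> b = 0" by (rule LIMSEQ_unique)
  thus "(l (a + s) + l (a-s)) \<bullet> b = (2 *\<^sub>R l a) \<bullet> b" by (simp add: inner_diff_left)
 qed
 define A where "A h = (\<Sum>b\<in>Basis. (h \<bullet> b) *\<^sub>R l b)" for h
 have linA: "linear A" unfolding A_def
  by (intro linearI) (simp_all add: inner_add_left scaleR_add_left sum.distrib scaleR_sum_right)
 have lA: "l a = A a" if "a \<in> ratvec" for a
  unfolding A_def by (rule midpoint_affine_ratvec[OF l0 mid that])
 define V where "V n h = (W (x n + r n *\<^sub>R h) - W (x n) - r n*(G (x n) \<bullet> h))/(r n)^2" for n h
 have evrh: "\<forall>\<^sub>F n in sequentially. r n*M <= rh" for M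
 proof -
  have "(\<lambda>n. r n*M) \<longlonglongrightarrow> 0*M" by (intro tendsto_intros r0)
  hence "\<forall>\<^sub>F n in sequentially. r n*M < rh" using rh by (intro order_tendstoD(2)) auto
  thus ?thesis by eventually_elim simp
 qed
 have V_step: "\<bar>V n h - V n a - g n a \<bullet> (h-a)\<bar> <= C*(norm (h-a))^2"
  if "a \<in> S (k n)" "r n*norm (h-a) <= rh" for n a h
 proof -
  have "x n + r n *\<^sub>R a \<in> K" using XR(4)[OF that(1)] by (simp add: x_def r_def)
  from tq[OF this, of "x n + r n *\<^sub>R h"] r(1)[of n] that(2)
  have *: "\<bar>W (x n + r n *\<^sub>R h) - W (x n + r n *\<^sub>R a) - r n*(G (x n + r n *\<^sub>R a) \<bullet> (h-a))\<bar> <= C*(r n*norm (h-a))^2"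
   by (simp add: algebra_simps flip: scaleR_diff_right)
  have "G (x n + r n *\<^sub>R a) = G (x n) + r n *\<^sub>R g n a"
   using r(1)[of n] by (simp add: g_def gj_def x_def r_def)
  hence eq: "V n h - V n a - g n a \<bullet> (h-a) =
    (W (x n + r n *\<^sub>R h) - W (x n + r n *\<^sub>R a) - r n*(G (x n + r n *\<^sub>R a) \<bullet> (h-a)))/(r n)^2"
   unfolding V_def using r(1)[of n]
   by (simp add: field_simps inner_add_left inner_diff_right power2_eq_square)
  show ?thesis unfolding eq using * r(1)[of n]
   by (simp add: divide_le_eq power_mult_distrib abs_divide mult_ac)
 qed
 have V_lim: "(\<lambda>n. V n a) \<longlonglongrightarrow> (1/2)*(a \<bullet> A a)" if a: "a \<in> ratvec" for a
 proof (rule LIMSEQ_I)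
  fix e' :: real assume e': "e' > 0"
  define B where "B = C*(norm a)^2 + \<bar>a \<bullet> A a\<bar>/2"
  obtain m :: nat where m: "real m > (B + 1)/e'" using reals_Archimedean2 by blast
  have B0: "B >= 0" using C by (simp add: B_def)
  have m0: "m > 0"
  proof (rule ccontr)
   assume "\<not> m > 0"
   thus False using m B0 e' by (simp add: field_simps)
  qed
  \<comment> \<open>The segment from 0 to \<open>a\<close> is cut into \<open>m\<close> pieces; on
    each the increment of \<open>V n\<close> is given by the slope \<open>g n\<close> at the left
    end, with an error \<open>C*(norm a/m)^2\<close>. The left-endpoint Riemann sum of a linear
    slope misses its integral by \<open>(a \<bullet> A a)/(2*m)\<close>; \<open>m\<close> is so
    large that both errors are small.\<close>
  define p where "p i = (real i/real m) *\<^sub>R a" for i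
  have pr: "p i \<in> ratvec" for i unfolding p_def by (intro ratvec_scaleR a) auto
  have pd: "p (Suc i) - p i = (1/real m) *\<^sub>R a" for i
   unfolding p_def by (simp add: add_divide_distrib flip: scaleR_diff_left)
  define s where "s n = (\<Sum>i<m. g n (p i) \<bullet> ((1/real m) *\<^sub>R a))" for n
  have "s \<longlonglongrightarrow> (\<Sum>i<m. l (p i) \<bullet> ((1/real m) *\<^sub>R a))"
   unfolding s_def by (intro tendsto_intros l pr)
  also have "(\<Sum>i<m. l (p i) \<bullet> ((1/real m) *\<^sub>R a)) = (\<Sum>i<m. real i)*((a \<bullet> A a)/(real m)^2)"
   unfolding lA[OF pr] unfolding p_def
   by (simp add: linear_cmul[OF linA] sum_distrib_right sum_divide_distrib power2_eq_square inner_commute mult_ac)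
  also have "(\<Sum>i<m. real i) = real m*(real m - 1)/2"
   by (induction m) (auto simp: field_simps)
  also have "real m*(real m - 1)/2*((a \<bullet> A a)/(real m)^2) = (1/2)*(a \<bullet> A a) - (a \<bullet> A a)/(2*real m)"
   using m0 by (simp add: field_simps power2_eq_square)
  finally have s: "s \<longlonglongrightarrow> (1/2)*(a \<bullet> A a) - (a \<bullet> A a)/(2*real m)" .
  have "\<forall>\<^sub>F n in sequentially. \<bar>V n a - s n\<bar> <= C*(norm a)^2/real m"
  proof -
   have "\<forall>\<^sub>F n in sequentially. \<forall>i\<in>{..<m}. p i \<in> S (k n)" by (intro eventually_ball_finite ballI evS pr) auto
   thus ?thesis using evrh[of "norm ((1/real m) *\<^sub>R a)"]
   proof eventually_elim
    case (elim n)
    have V0: "V n (p 0) = 0" by (simp add: V_def p_def)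
    have pm: "p m = a" using m0 by (simp add: p_def)
    have "V n a - s n = (\<Sum>i<m. V n (p (Suc i)) - V n (p i) - g n (p i) \<bullet> ((1/real m) *\<^sub>R a))"
     using sum_lessThan_telescope[of "\<lambda>i. V n (p i)" m] V0 pm by (simp add: sum_subtractf s_def)
    also have "\<bar>...\<bar> <= (\<Sum>i<m. C*(norm ((1/real m) *\<^sub>R a))^2)"
    proof (rule order_trans[OF sum_abs sum_mono])
     fix i assume "i \<in> {..<m}"
     thus "\<bar>V n (p (Suc i)) - V n (p i) - g n (p i) \<bullet> ((1/real m) *\<^sub>R a)\<bar> <= C*(norm ((1/real m) *\<^sub>R a))^2"
      using V_step[of "p i" n "p (Suc i)"] elim unfolding pd by blast
    qed
    also have "... = C*(norm a)^2/real m" using m0 by (simp add: power_mult_distrib power_divide field_simps power2_eq_square)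
    finally show ?case .
   qed
  qed
  moreover have "\<forall>\<^sub>F n in sequentially. dist (s n) ((1/2)*(a \<bullet> A a) - (a \<bullet> A a)/(2*real m)) < 1/real m"
   by (rule tendstoD[OF s]) (use m0 in simp)
  ultimately have "\<forall>\<^sub>F n in sequentially. norm (V n a - (1/2)*(a \<bullet> A a)) < e'"
  proof eventually_elim
   case (elim n)
   have "\<bar>(a \<bullet> A a)/(2*real m)\<bar> = (\<bar>a \<bullet> A a\<bar>/2)/real m" by (simp add: abs_divide)
   moreover have "norm (V n a - (1/2)*(a \<bullet> A a)) <= \<bar>V n a - s n\<bar> +
     dist (s n) ((1/2)*(a \<bullet> A a) - (a \<bullet> A a)/(2*real m)) + \<bar>(a \<bullet> A a)/(2*real m)\<bar>"
    unfolding dist_real_def real_norm_def by linarith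
   ultimately have "norm (V n a - (1/2)*(a \<bullet> A a)) < (B + 1)/real m"
    using elim unfolding B_def add_divide_distrib by linarith
   also have "... < e'" using m m0 e' by (simp add: field_simps)
   finally show ?case .
  qed
  thus "\<exists>no. \<forall>n\<ge>no. norm (V n a - (1/2)*(a \<bullet> A a)) < e'" by (simp add: eventually_sequentially)
 qed
 obtain B where B: "B > 0" "!!h. norm (A h) <= B*norm h"
  using linear_bounded_pos[OF linA] by blast
 define M where "M = 1 + 2*B + 2*L + C"
 have M: "M > 0" using B L0 C by (simp add: M_def)
 define t where "t = min 1 (e/M)"
 have t: "0 < t" "t <= 1" "t*M <= e" using e M by (auto simp: t_def min_def field_simps)
 have "\<exists>N. finite N \<and> N \<subseteq> ratvec \<and> cball (0::'a) 1 \<subseteq> (\<Union>a\<in>N. ball a t)"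
 proof -
  have "cball (0::'a) 1 \<subseteq> (\<Union>a\<in>ratvec. ball a t)"
  proof
   fix h :: 'a
   obtain a where "a \<in> ratvec" "norm (h-a) < t" using ratvec_dense[OF t(1)] by blast
   thus "h \<in> (\<Union>a\<in>ratvec. ball a t)" by (auto simp: dist_norms)
  qed
  thus ?thesis
   using compactE_image[OF compact_cball[of "0::'a" 1], of ratvec "\<lambda>a. ball a t"] by (metis open_ball)
 qed
 then obtain N where N: "finite N" "N \<subseteq> ratvec" "cball (0::'a) 1 \<subseteq> (\<Union>a\<in>N. ball a t)" by blast
 have "\<forall>\<^sub>F n in sequentially. \<forall>a\<in>N. a \<in> S (k n)" using N by (intro eventually_ball_finite ballI evS) auto
 moreover have "\<forall>\<^sub>F n in sequentially. \<forall>a\<in>N. dist (V n a) ((1/2)*(a \<bullet> A a)) < t"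
  using N t(1) by (intro eventually_ball_finite ballI tendstoD[OF V_lim]) auto
 moreover have "\<forall>\<^sub>F n in sequentially. r n < e" by (rule order_tendstoD(2)[OF r0 e])
 ultimately have "\<forall>\<^sub>F n in sequentially. (\<forall>a\<in>N. a \<in> S (k n)) \<and> (\<forall>a\<in>N. dist (V n a) ((1/2)*(a \<bullet> A a)) < t) \<and> r n < e \<and> r n*t <= rh"
  using evrh[of t] by eventually_elim auto
 then obtain n where n: "!!a. a \<in> N ==> a \<in> S (k n)" "!!a. a \<in> N ==> dist (V n a) ((1/2)*(a \<bullet> A a)) < t" "r n < e" "r n*t <= rh"
  using eventually_happens by force
 show ?thesis
 proof (rule that[of "x n" "r n" A])
  show "x n \<in> K" using XR(1) by (simp add: x_def)
  fix h :: 'a assume h: "norm h <= 1"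
  then obtain a where a: "a \<in> N" "norm (h-a) < t" using N(3) by (force simp: dist_norms)
  have na: "norm a <= 2" using norm_triangle_ineq2[of a h] a(2) t(2) h by (simp add: norm_minus_commute)
  have 1: "\<bar>V n h - V n a - g n a \<bullet> (h-a)\<bar> <= C*t"
  proof -
   have "r n*norm (h-a) <= r n*t" using a(2) r(1)[of n] by (intro mult_left_mono) auto
   hence "\<bar>V n h - V n a - g n a \<bullet> (h-a)\<bar> <= C*(norm (h-a))^2"
    using n(4) by (intro V_step n a) linarith
   also have "(norm (h-a))^2 <= t*1"
    using a(2) t unfolding power2_eq_square by (intro mult_mono) auto
   finally show ?thesis using C by (simp add: mult_left_mono)
  qed
  have 2: "\<bar>g n a \<bullet> (h-a)\<bar> <= (2*L)*t"
  proof -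
   have "norm (g n a) <= L*2"
    using gj_bound[OF n(1)[OF a(1)]] mult_left_mono[OF na L0] by (simp add: g_def)
   thus ?thesis using Cauchy_Schwarz_ineq2[of "g n a" "h - a"] a(2)
     mult_mono[of "norm (g n a)" "L*2" "norm (h-a)" t] L0 by simp
  qed
  have 3: "\<bar>h \<bullet> A h - a \<bullet> A a\<bar> <= 3*B*t"
  proof -
   have "h \<bullet> A h - a \<bullet> A a = (h-a) \<bullet> A h + a \<bullet> A (h-a)"
    by (simp add: linear_diff[OF linA] algebra_simps)
   also have "\<bar>...\<bar> <= norm (h-a)*norm (A h) + norm a*norm (A (h-a))"
    by (intro order_trans[OF abs_triangle_ineq] add_mono Cauchy_Schwarz_ineq2)
   also have "... <= t*(B*1) + 2*(B*t)"
    using B a(2) na h t(1) by (intro add_mono mult_mono order_trans[OF B(2)]) auto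
   finally show ?thesis by simp
  qed
  have "\<bar>V n h - (1/2)*(h \<bullet> A h)\<bar> <= C*t + (2*L)*t + t + (3*B*t)/2"
   using 1 2 3 n(2)[OF a(1)] by (simp add: dist_real_def abs_le_iff abs_less_iff)
  also have "... <= t*M" using t(1) B(1) unfolding M_def by (simp add: algebra_simps)
  also have "... <= e" by (rule t(3))
  finally have *: "\<bar>V n h - (1/2)*(h \<bullet> A h)\<bar> <= e" .
  have "W (x n + r n *\<^sub>R h) - W (x n) - r n*(G (x n) \<bullet> h) - (r n)^2/2*(h \<bullet> A h) = (V n h - (1/2)*(h \<bullet> A h))*(r n)^2"
  proof -
   have "V n h*(r n)^2 = W (x n + r n *\<^sub>R h) - W (x n) - r n*(G (x n) \<bullet> h)"
    unfolding V_def using r(1)[of n] by simp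
   thus ?thesis by (simp add: left_diff_distrib)
  qed
  thus "\<bar>W (x n + r n *\<^sub>R h) - W (x n) - r n*(G (x n) \<bullet> h) - (r n)^2/2*(h \<bullet> A h)\<bar> <= e*(r n)^2"
   using mult_right_mono[OF *, of "(r n)^2"] by (simp add: abs_mult)
 qed (use r n linA in auto)
qed

section \<open>Sup-convolutions and the theorem on sums\<close>

text \<open>The second-order superjet, with the remainder \<open>o((norm (y - x))^2)\<close> written
  out. The second derivative is a map rather than a matrix because the theorem on sums needs jets on
  a product space.\<close>

definition upjet :: "('a::euclidean_space => real) => 'a => 'a => ('a => 'a) => bool" where
 "upjet u x p T \<longleftrightarrow> (\<forall>e>0. \<exists>d>0. \<forall>y. norm (y-x) < d -->
   u y <= u x + p \<bullet> (y-x) + 1/2*((y-x) \<bullet> T (y-x)) + e*(norm (y-x))^2)"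

definition selfadj :: "('a::euclidean_space => 'a) => bool" where
 "selfadj T \<longleftrightarrow> linear T \<and> (\<forall>h k. h \<bullet> T k = T h \<bullet> k)"

lemma selfadj_quadratic_add:
 assumes "selfadj T"
 shows "(h + k) \<bullet> T (h + k) = h \<bullet> T h + 2*(T h \<bullet> k) + k \<bullet> T k"
 using assms unfolding selfadj_def
 by (simp add: linear_add inner_add_left inner_add_right) (metis inner_commute)

text \<open>Polarisation, applied to \<open>h\<close> and the vector of the same length in the
  direction of \<open>T h\<close>, recovers the operator norm from the quadratic form.\<close>

lemma selfadj_bound:
 assumes T: "selfadj T" and c: "!!h. \<bar>h \<bullet> T h\<bar> <= c*(norm h)^2"
 shows "norm (T h) <= c*norm h"
proof (cases "T h = 0 \<or> h = 0")
 case True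
 have "0 <= c*norm h"
 proof (cases "h = 0")
  case False
  have "0 <= c*(norm h)^2" using c[of h] by linarith
  hence "c >= 0" using False by (simp add: zero_le_mult_iff)
  thus ?thesis by simp
 qed simp
 moreover have "T h = 0" using True T by (auto simp: selfadj_def linear_0)
 ultimately show ?thesis by simp
next
 case False
 define k where "k = (norm h/norm (T h)) *\<^sub>R T h"
 have nk: "norm k = norm h" using False by (simp add: k_def)
 have lin: "linear T" using T by (simp add: selfadj_def)
 have "(h + k) \<bullet> T (h + k) - (h-k) \<bullet> T (h-k) = 4*(T h \<bullet> k)"
  using selfadj_quadratic_add[OF T, of h k] selfadj_quadratic_add[OF T, of h "- k"]
  by (simp add: linear_neg[OF lin])
 hence "4*(T h \<bullet> k) <= c*(norm (h + k))^2 + c*(norm (h-k))^2"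
  using c[of "h + k"] c[of "h - k"] by linarith
 also have "... = c*(2*(norm h)^2 + 2*(norm k)^2)"
  by (simp add: power2_norm_eq_inner algebra_simps)
 finally have "T h \<bullet> k <= c*(norm h)^2" unfolding nk by simp
 also have "T h \<bullet> k = norm h*norm (T h)"
  using False by (simp add: k_def power2_norm_eq_inner[symmetric] power2_eq_square)
 finally show ?thesis using False by (simp add: power2_eq_square mult.assoc mult.left_commute)
qed

lemma inner_le_quadratic_imp_0:
 fixes g :: "'a::real_inner"
 assumes "s > 0" and le: "!!k. norm k <= s ==> g \<bullet> k <= C*(norm k)^2"
 shows "g = 0"
proof (rule ccontr)
 assume g: "g ~= 0"
 define t where "t = min (s/norm g) (1/(2*(\<bar>C\<bar> + 1)))"
 have t: "t > 0" using assms(1) g by (simp add: t_def)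
 have "norm (t *\<^sub>R g) <= s"
 proof -
  have "t*norm g <= s/norm g*norm g" by (intro mult_right_mono) (auto simp: t_def)
  thus ?thesis using t g by simp
 qed
 from le[OF this] have "t*(norm g)^2 <= C*t^2*(norm g)^2"
  using t by (simp add: power2_norm_eq_inner power_mult_distrib)
 hence "t <= C*t^2" using g by simp
 hence "1 <= C*t" using t by (simp add: power2_eq_square)
 also have "... <= \<bar>C\<bar>*(1/(2*(\<bar>C\<bar> + 1)))" using t by (intro mult_mono) (auto simp: t_def)
 also have "... < 1" by (simp add: field_simps)
 finally show False by simp
qed

text \<open>Both base points predict \<open>W\<close> at the same point \<open>x + k\<close>, where
  \<open>k\<close> has the length \<open>d\<close> of \<open>x - y\<close> and the direction of
  \<open>G y - G x\<close>. The predictions differ by errors \<open>C*d^2\<close>,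
  \<open>4*C*d^2\<close> and \<open>C*d^2\<close>, whence the 6. Points farther apart than
  \<open>s/2\<close> are covered by the bound on \<open>G\<close>.\<close>

lemma two_sided_quadratic_imp_lipschitz:
 fixes G :: "'a::real_inner => 'a"
 assumes s: "s > 0" and C: "C >= 0"
  and tq: "!!x y. x \<in> K ==> norm (y-x) <= s ==> \<bar>W y - W x - G x \<bullet> (y-x)\<bar> <= C*(norm (y-x))^2"
  and bnd: "!!x. x \<in> K ==> norm (G x) <= M"
 shows "(6*C + 4*\<bar>M\<bar>/s)-lipschitz_on K G"
proof (rule lipschitz_onI)
 show "0 <= 6*C + 4*\<bar>M\<bar>/s" using s C by simp
 fix x y assume xy: "x \<in> K" "y \<in> K"
 define d where "d = norm (x-y)"
 show "dist (G x) (G y) <= (6*C + 4*\<bar>M\<bar>/s)*dist x y"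
 proof (cases "d <= s/2")
  case False
  have "dist (G x) (G y) <= 2*\<bar>M\<bar>"
   using norm_triangle_ineq4[of "G x" "G y"] bnd[OF xy(1)] bnd[OF xy(2)] by (simp add: dist_norm)
  also have "... <= 2*\<bar>M\<bar>*(2/s*d)"
   using False s mult_left_mono[of 1 "2/s*d" "2*\<bar>M\<bar>"] by (simp add: field_simps)
  also have "... <= (6*C + 4*\<bar>M\<bar>/s)*d" using C s by (simp add: d_def algebra_simps)
  finally show ?thesis by (simp add: d_def dist_norm)
 next
  case True
  show ?thesis
  proof (cases "G x = G y \<or> d = 0")
   case True
   thus ?thesis using s C by (auto simp: d_def dist_norm)
  next
   case False
   define k where "k = (d/norm (G y - G x)) *\<^sub>R (G y - G x)"
   have d: "d > 0" using False by (simp add: d_def)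
   have nk: "norm k = d" using False d by (simp add: k_def)
   have 1: "\<bar>W (x + k) - W x - G x \<bullet> k\<bar> <= C*d^2"
    using tq[OF xy(1), of "x + k"] nk True s by simp
   have n2: "norm (x + k - y) <= 2*d"
    using norm_triangle_ineq[of "x - y" k] nk by (simp add: d_def algebra_simps)
   have "\<bar>W (x + k) - W y - G y \<bullet> (x + k - y)\<bar> <= C*(norm (x + k - y))^2"
    using n2 True by (intro tq xy) auto
   also have "... <= C*(2*d)^2" by (intro mult_left_mono power_mono n2 C) auto
   finally have 2: "\<bar>W (x + k) - W y - G y \<bullet> (x + k - y)\<bar> <= 4*C*d^2" by (simp add: power_mult_distrib)
   have 3: "\<bar>W x - W y - G y \<bullet> (x-y)\<bar> <= C*d^2"
    using tq[OF xy(2), of x] True s by (simp add: d_def)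
   have "(G y - G x) \<bullet> k = G y \<bullet> (x + k - y) - G y \<bullet> (x-y) - G x \<bullet> k"
    by (simp add: inner_add_right inner_diff_left inner_diff_right)
   hence "(G y - G x) \<bullet> k <= 6*C*d^2" using 1 2 3 by (simp only: abs_le_iff) linarith
   moreover have "(G y - G x) \<bullet> k = d*norm (G y - G x)"
    using False by (simp add: k_def power2_norm_eq_inner[symmetric] power2_eq_square)
   ultimately have "d*norm (G y - G x) <= d*(6*C*d)" by (simp add: power2_eq_square mult_ac)
   hence "norm (G y - G x) <= 6*C*d" using d by simp
   also have "... <= (6*C + 4*\<bar>M\<bar>/s)*d" using d s by (simp add: algebra_simps)
   finally show ?thesis by (simp add: dist_norms d_def)
  qed
 qed
qed

text \<open>The supremum runs over a compact set \<open>B\<close> only, so for continuous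
  \<open>u\<close> it is attained without a growth condition, and \<open>u\<close> matters only near
  the point of interest.\<close>

definition supconv :: "'a set => real => ('a::euclidean_space => real) => 'a => real" where
 "supconv B ka u x = (SUP y\<in>B. u y - (norm (x-y))^2/(2 * ka))"

context
 fixes B :: "'a::euclidean_space set" and u :: "'a => real" and ka :: real
 assumes B: "compact B" "B ~= {}" and u: "continuous_on B u" and ka: "ka > 0"
begin

lemma supconv_attained: "\<exists>y\<in>B. supconv B ka u x = u y - (norm (x-y))^2/(2 * ka)"
 and supconv_ge: "y \<in> B ==> u y - (norm (x-y))^2/(2 * ka) <= supconv B ka u x"
proof -
 have "continuous_on B (\<lambda>y. u y - (norm (x-y))^2/(2 * ka))"
  using ka by (intro continuous_intros u) auto
 then obtain z where z: "z \<in> B" "!!y. y \<in> B ==> u y - (norm (x-y))^2/(2 * ka) <= u z - (norm (x-z))^2/(2 * ka)"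
  using continuous_attains_sup[OF B] by blast
 have "supconv B ka u x = u z - (norm (x-z))^2/(2 * ka)"
  unfolding supconv_def by (intro cSup_eq_maximum) (use z in auto)
 thus "\<exists>y\<in>B. supconv B ka u x = u y - (norm (x-y))^2/(2 * ka)"
  and "y \<in> B ==> u y - (norm (x-y))^2/(2 * ka) <= supconv B ka u x" using z by auto
qed

text \<open>The maximiser for \<open>x\<close> competes at \<open>x + h\<close> as well; this is the
  semiconvexity of the sup-convolution.\<close>

lemma supconv_ge_expand:
 assumes "y \<in> B" "supconv B ka u x = u y - (norm (x-y))^2/(2 * ka)"
 shows "supconv B ka u x - (1/ka)*((x-y) \<bullet> h) - (norm h)^2/(2 * ka) <= supconv B ka u (x + h)"
proof -
 have "(norm (x + h - y))^2 = (norm (x-y))^2 + 2*((x-y) \<bullet> h) + (norm h)^2"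
  by (simp add: power2_norm_eq_inner algebra_simps) (simp add: inner_commute)
 hence "u y - (norm (x + h - y))^2/(2 * ka) = supconv B ka u x - (1/ka)*((x-y) \<bullet> h) - (norm h)^2/(2 * ka)"
  unfolding assms(2) using ka by (simp add: field_simps)
 thus ?thesis using supconv_ge[OF assms(1), of "x + h"] by simp
qed

lemma continuous_supconv: "continuous_on UNIV (supconv B ka u)"
proof -
 obtain M where M: "!!y. y \<in> B ==> norm y <= M" using compact_imp_bounded[OF B(1)] by (auto simp: bounded_iff)
 have le: "supconv B ka u x - supconv B ka u (x + h) <= (1/ka)*((norm x + M)*norm h) + (norm h)^2/(2 * ka)" for x h
 proof -
  obtain y where y: "y \<in> B" "supconv B ka u x = u y - (norm (x-y))^2/(2 * ka)" using supconv_attained by blast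
  have "(x-y) \<bullet> h <= norm (x-y)*norm h" by (rule norm_cauchy_schwarz)
  also have "... <= (norm x + M)*norm h"
   using norm_triangle_ineq4[of x y] M[OF y(1)] by (intro mult_right_mono) auto
  finally have "(1/ka)*((x-y) \<bullet> h) <= (1/ka)*((norm x + M)*norm h)" using ka by (intro mult_left_mono) auto
  thus ?thesis using supconv_ge_expand[OF y, of h] by linarith
 qed
 show ?thesis
 proof (rule continuous_at_imp_continuous_on, rule ballI)
  fix x
  show "isCont (supconv B ka u) x"
   unfolding continuous_at
  proof (rule Lim_null[THEN iffD2, OF Lim_null_comparison])
   let ?b = "\<lambda>y. (1/ka)*((norm y + norm x + 2*M)*norm (y-x)) + (norm (y-x))^2/(2 * ka)"
   have "M >= 0" using M B(2) norm_ge_zero order_trans by blast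
   show "\<forall>\<^sub>F y in at x. norm (supconv B ka u y - supconv B ka u x) <= ?b y"
   proof (intro always_eventually allI)
    fix y
    have "(1/ka)*((norm z + M)*norm (y-x)) <= (1/ka)*((norm y + norm x + 2*M)*norm (y-x))"
     if "z = x \<or> z = y" for z
     using ka \<open>M >= 0\<close> that by (intro mult_left_mono mult_right_mono) auto
    from this[of x] this[of y] le[of x "y - x"] le[of y "x - y"]
    show "norm (supconv B ka u y - supconv B ka u x) <= ?b y"
     by (simp add: abs_le_iff norm_minus_commute)
   qed
   have "(?b \<longlongrightarrow> (1/ka)*((norm x + norm x + 2*M)*norm (x-x)) + (norm (x-x))^2/(2 * ka)) (at x)"
    using ka by (intro tendsto_intros) auto
   thus "(?b \<longlongrightarrow> 0) (at x)" by simp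
  qed
 qed
qed

text \<open>The competitor for \<open>x\<close> is translated along with the point, so a contact
  from above is transported from \<open>x\<close> to the maximiser \<open>y\<close> with the same
  slope. The error \<open>e\<close> of the quadratic bound is moved into the second-order part,
  since a jet tolerates only errors \<open>o((norm h)^2)\<close>.\<close>

lemma upjet_of_supconv:
 assumes x: "y \<in> interior B" "supconv B ka u x = u y - (norm (x-y))^2/(2 * ka)"
  and r: "r > 0" and T: "selfadj T" and e: "e >= 0"
  and up: "!!h. norm h <= r ==> supconv B ka u (x + h) <= supconv B ka u x + p \<bullet> h + 1/2*(h \<bullet> T h) + e*(norm h)^2"
 shows "upjet u y p (\<lambda>h. T h + (2*e) *\<^sub>R h)"
 unfolding upjet_def
proof (intro allI impI)
 fix e' :: real assume e': "e' > 0"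
 obtain d where d: "d > 0" "ball y d \<subseteq> B" using x(1) by (meson mem_interior)
 show "\<exists>d>0. \<forall>z. norm (z-y) < d --> u z <= u y + p \<bullet> (z-y) + 1/2*((z-y) \<bullet> (T (z-y) + (2*e) *\<^sub>R (z-y))) + e'*(norm (z-y))^2"
 proof (intro exI conjI allI impI)
  show "min d r > 0" using d r by simp
  fix z assume z: "norm (z-y) < min d r"
  hence "z \<in> B" using d(2) by (auto simp: dist_norms subset_eq)
  hence "u z - (norm (x-y))^2/(2 * ka) <= supconv B ka u (x + (z-y))"
   using supconv_ge[of z "x + (z-y)"] by simp
  also have "... <= supconv B ka u x + p \<bullet> (z-y) + 1/2*((z-y) \<bullet> T (z-y)) + e*(norm (z-y))^2"
   using z by (intro up) auto
  finally have "u z <= u y + p \<bullet> (z-y) + 1/2*((z-y) \<bullet> (T (z-y) + (2*e) *\<^sub>R (z-y)))"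
   unfolding x(2) by (simp add: inner_add_right power2_norm_eq_inner distrib_left)
  moreover have "0 <= e'*(norm (z-y))^2" using e' by simp
  ultimately show "u z <= u y + p \<bullet> (z-y) + 1/2*((z-y) \<bullet> (T (z-y) + (2*e) *\<^sub>R (z-y))) + e'*(norm (z-y))^2"
   by linarith
 qed
qed

end

section \<open>Jensen's lemma and the theorem on sums\<close>

definition selfadj_part :: "('a::euclidean_space => 'a) => 'a => 'a" where
 "selfadj_part T h = (1/2) *\<^sub>R (T h + adjoint T h)"

lemma selfadj_selfadj_part:
 assumes "linear T"
 shows "selfadj (selfadj_part T)"
 unfolding selfadj_def selfadj_part_def
proof (intro conjI allI)
 show "linear (\<lambda>h. (1/2) *\<^sub>R (T h + adjoint T h))"
  by (intro linear_compose_scale_right linear_compose_add assms adjoint_linear)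
 show "h \<bullet> (1/2) *\<^sub>R (T k + adjoint T k) = (1/2) *\<^sub>R (T h + adjoint T h) \<bullet> k" for h k
  using adjoint_works[OF assms, of h k] adjoint_works[OF assms, of k h]
  by (simp add: inner_add_left inner_add_right inner_commute)
qed

lemma selfadj_part_quadratic: "linear T ==> h \<bullet> selfadj_part T h = h \<bullet> T h"
 using adjoint_works[of T h h] by (simp add: selfadj_part_def inner_add_right inner_commute)

text \<open>The expansion of \<open>f\<close> is known only up to \<open>e*r^2\<close> at the single
  scale \<open>r\<close>. Adding \<open>2*e*(norm h)^2\<close> to the paraboloid pushes the maximum
  of the difference into the open ball, because the value at the centre now exceeds those on the
  sphere by \<open>e*r^2\<close>. At this maximum the contact is exact, with the slope corrected by
  the derivatives of the form and of the added term.\<close>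

lemma approx_quadratic_interior_max:
 fixes f :: "'a::euclidean_space => real"
 assumes f: "continuous_on UNIV f" and r: "r > 0" and e: "e > 0" and T: "selfadj T"
  and approx: "!!h. norm h <= 1 ==> f (x + r *\<^sub>R h) <= f x + r*(p \<bullet> h) + r^2/2*(h \<bullet> T h) + e*r^2"
 obtains k s where "norm k < r" "s > 0"
  "!!h. norm h <= s ==> f (x + k + h) <= f (x + k) + (p + T k + (4*e) *\<^sub>R k) \<bullet> h + 1/2*(h \<bullet> T h) + (2*e)*(norm h)^2"
proof -
 have lin: "linear T" using T by (simp add: selfadj_def)
 define g where "g h = f (x + h) - p \<bullet> h - 1/2*(h \<bullet> T h) - (2*e)*(norm h)^2" for h
 have "continuous_on (cball 0 r) g"
  unfolding g_def
  by (intro continuous_intros continuous_on_compose2[OF f] linear_continuous_on_compose[OF _ lin]) auto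
 moreover have "cball (0::'a) r ~= {}" using r by auto
 ultimately obtain k where k: "k \<in> cball 0 r" "!!h. h \<in> cball 0 r ==> g h <= g k"
  using continuous_attains_sup[OF compact_cball] by blast
 have "norm k ~= r"
 proof
  assume nk: "norm k = r"
  have "norm ((1/r) *\<^sub>R k) <= 1" using r nk by simp
  from approx[OF this] have "f (x + k) <= f x + p \<bullet> k + 1/2*(k \<bullet> T k) + e*r^2"
   using r by (simp add: linear_scale[OF lin] power2_eq_square)
  hence "g k <= f x - e*r^2" unfolding g_def nk by simp
  moreover have "e*r^2 > 0" using e r by simp
  ultimately show False using k(2)[of 0] r by (simp add: g_def)
 qed
 hence nk: "norm k < r" using k(1) by simp
 show ?thesis
 proof (rule that[of k "r - norm k"])
  show "norm k < r" "r - norm k > 0" using nk by auto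
  fix h :: 'a assume "norm h <= r - norm k"
  hence "norm (k + h) <= r" using norm_triangle_ineq[of k h] by linarith
  hence "g (k + h) <= g k" by (intro k) simp
  moreover have "(norm (k + h))^2 = (norm k)^2 + 2*(k \<bullet> h) + (norm h)^2"
   by (simp add: power2_norm_eq_inner algebra_simps) (simp add: inner_commute)
  ultimately show "f (x + k + h) <= f (x + k) + (p + T k + (4*e) *\<^sub>R k) \<bullet> h + 1/2*(h \<bullet> T h) + (2*e)*(norm h)^2"
   unfolding g_def selfadj_quadratic_add[OF T, of k h] add.assoc
   by (simp add: inner_add_left inner_add_right algebra_simps)
 qed
qed

lemma selfadj_bound_square:
 assumes A: "selfadj A"
 obtains b where "b >= 0" "!!h. norm (A h) <= b*norm h" "!!h. h \<bullet> A h <= b*(norm h)^2"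
proof -
 obtain b where b: "b > 0" "!!h. norm (A h) <= b*norm h"
  using linear_bounded_pos A unfolding selfadj_def by blast
 have "h \<bullet> A h <= b*(norm h)^2" for h
 proof -
  have "h \<bullet> A h <= norm h*norm (A h)" by (rule norm_cauchy_schwarz)
  also have "... <= norm h*(b*norm h)" by (intro mult_left_mono b) auto
  finally show ?thesis by (simp add: power2_eq_square mult_ac)
 qed
 thus ?thesis using that[of b] b by auto
qed

text \<open>The maximum point of \<open>W\<close> minus a quadratic is perturbed by small linear functionals; the
 resulting contact points form a set of positive measure (Jensen's lemma).\<close>

lemma perturbed_contact_expansion:
 fixes W :: "'a::euclidean_space => real"
 assumes cW: "continuous_on UNIV W" and s: "s > 0" and A: "selfadj A" and m: "m > 0" and ka: "ka > 0"
  and away: "!!z. s/2 <= norm (z-z0) ==> norm (z-z0) <= s ==>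
    W z - P \<bullet> (z-z0) - 1/2*((z-z0) \<bullet> A (z-z0)) <= W z0 - m"
  and semi: "!!z. \<exists>g. \<forall>h. W z + g \<bullet> h - ka*(norm h)^2 <= W (z + h)"
  and de: "de > 0"
 obtains C where "C >= 0" "!!e. e > 0 ==> \<exists>z p r X. norm (z-z0) <= s/2 \<and> norm (p - P - A (z-z0)) <= de \<and> 0 < r \<and> r < e \<and> r <= s/2 \<and> linear X \<and>
   (\<forall>h. norm h <= 1 --> \<bar>W (z + r *\<^sub>R h) - W z - r*(p \<bullet> h) - r^2/2*(h \<bullet> X h)\<bar> <= e*r^2) \<and>
   (\<forall>h. norm h <= s/2 --> W (z + h) <= W z + p \<bullet> h + 1/2*(h \<bullet> A h)) \<and>
   (\<forall>h. norm h <= s/2 --> \<bar>W (z + h) - W z - p \<bullet> h\<bar> <= C*(norm h)^2)"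
proof -
 obtain b where b: "b >= 0" "!!h. norm (A h) <= b*norm h" "!!h. h \<bullet> A h <= b*(norm h)^2"
  using selfadj_bound_square[OF A] by metis
 have linA: "linear A" using A by (simp add: selfadj_def)
 define Q where "Q z = P \<bullet> (z-z0) + 1/2*((z-z0) \<bullet> A (z-z0))" for z
 have cQ: "continuous_on UNIV Q" unfolding Q_def
  by (intro continuous_intros linear_continuous_on_compose[OF _ linA])
 \<comment> \<open>A functional of norm at most \<open>de'\<close> changes values on the ball by
   less than \<open>m/2\<close> relative to \<open>z0\<close>, so the maximum stays within
   \<open>s/2\<close>.\<close>
 define de' where "de' = min de (m/(4 * s))"
 have de': "0 < de'" "de' <= de" "de' * s < m/2" using de m s by (auto simp: de'_def min_def field_simps)
 \<comment> \<open>The closed relation between a functional \<open>q\<close> and the maximum points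
   \<open>z\<close> it selects; its projection \<open>K\<close>, the set of contact points, is
   therefore compact.\<close>
 define Z where "Z = cball z0 s \<times> cball (0::'a) de' \<inter> (\<Inter>z'\<in>cball z0 s. {zq. W z' - Q z' - snd zq \<bullet> z' <= W (fst zq) - Q (fst zq) - snd zq \<bullet> fst zq})"
 have "compact Z"
  unfolding Z_def
 proof (intro compact_Int_closed compact_Times compact_cball closed_INT ballI closed_Collect_le)
  fix z'
  show "continuous_on UNIV (\<lambda>zq. W z' - Q z' - snd zq \<bullet> z')" by (intro continuous_intros)
  show "continuous_on UNIV (\<lambda>zq. W (fst zq) - Q (fst zq) - snd zq \<bullet> fst zq)"
   by (intro continuous_intros continuous_on_compose2[OF cW] continuous_on_compose2[OF cQ]) auto
 qed
 define K where "K = fst ` Z"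
 have K: "compact K" unfolding K_def
  by (intro compact_continuous_image \<open>compact Z\<close> continuous_intros)
 have Z_iff: "(z, q) \<in> Z \<longleftrightarrow> norm (z-z0) <= s \<and> norm q <= de' \<and> (\<forall>z'. norm (z'-z0) <= s --> W z' - Q z' - q \<bullet> z' <= W z - Q z - q \<bullet> z)" for z q
  by (auto simp: Z_def dist_norms)
 have near: "norm (z-z0) < s/2" if "(z, q) \<in> Z" for z q
 proof (rule ccontr)
  assume "\<not> ?thesis"
  hence "W z - Q z <= W z0 - m" using away[of z] that by (simp add: Z_iff Q_def)
  moreover have "W z0 - Q z0 - q \<bullet> z0 <= W z - Q z - q \<bullet> z"
   using that s unfolding Z_iff by (metis diff_self norm_zero less_imp_le)
  moreover have "\<bar>q \<bullet> (z-z0)\<bar> <= de' * s"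
   using that unfolding Z_iff by (intro order_trans[OF Cauchy_Schwarz_ineq2 mult_mono]) (use de' in auto)
  moreover have "Q z0 = 0" by (simp add: Q_def linear_0[OF linA])
  ultimately show False using de'(3) m by (simp add: inner_diff_right abs_le_iff)
 qed
 have up: "W (z + h) <= W z + (P + A (z-z0) + q) \<bullet> h + 1/2*(h \<bullet> A h)"
  if "(z, q) \<in> Z" "norm h <= s/2" for z q h
 proof -
  have "norm (z + h - z0) <= s"
   using norm_triangle_ineq[of "z - z0" h] near[OF that(1)] that(2) by (simp add: algebra_simps)
  hence "W (z + h) - Q (z + h) - q \<bullet> (z + h) <= W z - Q z - q \<bullet> z" using that(1) by (simp add: Z_iff)
  moreover have "Q (z + h) = Q z + (P + A (z-z0)) \<bullet> h + 1/2*(h \<bullet> A h)"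
  proof -
   have eq: "z + h - z0 = (z-z0) + h" by simp
   show ?thesis unfolding Q_def eq selfadj_quadratic_add[OF A] by (simp add: inner_add_left inner_add_right)
  qed
  ultimately show ?thesis by (simp add: inner_add_left inner_add_right)
 qed
 define C where "C = ka + b"
 have C: "C >= 0" using ka b by (simp add: C_def)
 have two: "\<bar>W (z + h) - W z - (P + A (z-z0) + q) \<bullet> h\<bar> <= C*(norm h)^2"
  if zq: "(z, q) \<in> Z" and h: "norm h <= s/2" for z q h
 proof -
  let ?p = "P + A (z-z0) + q"
  obtain g where g: "!!h. W z + g \<bullet> h - ka*(norm h)^2 <= W (z + h)" using semi by blast
  \<comment> \<open>A function squeezed between two touching paraboloids has only one possible
    slope, so the slope from semiconvexity and the slope of contact agree.\<close>
  have "g - ?p = 0"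
  proof (rule inner_le_quadratic_imp_0[of "s/2"])
   fix k :: 'a assume k: "norm k <= s/2"
   show "(g - ?p) \<bullet> k <= (ka + b)*(norm k)^2"
    using up[OF zq k] g[of k] b(3)[of k] b(1) zero_le_power2[of "norm k"]
     mult_nonneg_nonneg[OF b(1) zero_le_power2[of "norm k"]]
    unfolding inner_diff_left distrib_right by linarith
  qed (use s in auto)
  hence gh: "g \<bullet> h = ?p \<bullet> h" by simp
  show ?thesis
   using gh up[OF zq h] g[of h] b(3)[of h] ka mult_nonneg_nonneg[OF b(1) zero_le_power2[of "norm h"]]
    mult_nonneg_nonneg[OF less_imp_le[OF ka] zero_le_power2[of "norm h"]]
   unfolding C_def abs_le_iff distrib_right by (intro conjI) linarith+
 qed
 define q where "q z = (SOME q. (z, q) \<in> Z)" for z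
 have KI: "z \<in> K" if "(z, q') \<in> Z" for z q' unfolding K_def using imageI[OF that, of fst] by simp
 have q: "(z, q z) \<in> Z" if "z \<in> K" for z
  using that unfolding K_def q_def by (auto intro: someI)
 have q_unique: "q z = q'" if "(z, q') \<in> Z" for z q'
 proof -
  have zq: "(z, q z) \<in> Z" by (rule q[OF KI[OF that]])
  have "q z - q' = 0"
  proof (rule inner_le_quadratic_imp_0[of "s/2"])
   fix k :: 'a assume k: "norm k <= s/2"
   show "(q z - q') \<bullet> k <= (2*C)*(norm k)^2"
    using two[OF zq k] two[OF that k] by (simp add: inner_add_left inner_diff_left abs_le_iff)
  qed (use s in auto)
  thus ?thesis by simp
 qed
 define G where "G z = P + A (z-z0) + q z" for z
 have tq: "\<bar>W y - W z - G z \<bullet> (y-z)\<bar> <= C*(norm (y-z))^2" if "z \<in> K" "norm (y-z) <= s/2" for y z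
  using two[OF q[OF that(1)] that(2)] by (simp add: G_def)
 have Gb: "norm (G z) <= norm P + b * s + de'" if "z \<in> K" for z
 proof -
  have "norm (A (z-z0)) <= b * s"
   using q[OF that] b(1) by (intro order_trans[OF b(2)] mult_left_mono) (auto simp: Z_iff)
  thus ?thesis unfolding G_def
   using q[OF that] by (intro norm_triangle_le add_mono norm_triangle_le) (auto simp: Z_iff)
 qed
 obtain L where L: "L-lipschitz_on K G"
  using two_sided_quadratic_imp_lipschitz[OF half_gt_zero[OF s] C, of K W G, OF tq Gb] by blast
 \<comment> \<open>Every functional of norm at most \<open>de'\<close> is selected at some contact
   point, so \<open>q\<close> maps \<open>K\<close> onto a ball; being Lipschitz, it could not do so
   if \<open>K\<close> were negligible.\<close>
 have "\<not> negligible K"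
 proof
  assume neg: "negligible K"
  have Llip: "norm (q y - q z) <= (L + b)*norm (y-z)" if "y \<in> K" "z \<in> K" for y z
  proof -
   have "q y - q z = (G y - G z) - A (y-z)"
    by (simp add: G_def linear_diff[OF linA])
   hence "norm (q y - q z) <= norm (G y - G z) + norm (A (y-z))" by (metis norm_triangle_ineq4)
   also have "... <= L*norm (y-z) + b*norm (y-z)"
    using lipschitz_onD[OF L that] b(2) by (intro add_mono) (auto simp: dist_norm)
   finally show ?thesis by (simp add: algebra_simps)
  qed
  have "negligible (q ` K)"
   by (rule negligible_locally_Lipschitz_image[OF order.refl neg])
     (use Llip in \<open>auto intro!: exI[of _ UNIV] exI[of _ "L + b"]\<close>)
  moreover have "cball 0 de' \<subseteq> q ` K"
  proof
   fix q' :: 'a assume q': "q' \<in> cball 0 de'"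
   have "continuous_on (cball z0 s) (\<lambda>z. W z - Q z - q' \<bullet> z)"
    by (intro continuous_intros continuous_on_subset[OF cW] continuous_on_subset[OF cQ]) auto
   moreover have "cball z0 s ~= {}" using s by auto
   ultimately obtain z where "z \<in> cball z0 s" "\<forall>z'\<in>cball z0 s. W z' - Q z' - q' \<bullet> z' <= W z - Q z - q' \<bullet> z"
    using continuous_attains_sup[OF compact_cball] by blast
   hence zq: "(z, q') \<in> Z" using q' by (simp add: Z_iff dist_norms)
   have "q z = q'" "z \<in> K" by (rule q_unique[OF zq], rule KI[OF zq])
   thus "q' \<in> q ` K" using imageI[of z K q] by simp
  qed
  ultimately have "negligible (cball (0::'a) de')" by (rule negligible_subset)
  hence "negligible (ball (0::'a) de')" by (rule negligible_subset[OF _ ball_subset_cball])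
  thus False using open_not_negligible[of "ball (0::'a) de'"] de' by auto
 qed
 show ?thesis
 proof (rule that[OF C])
  fix e :: real assume e: "e > 0"
  hence "min e (s/2) > 0" using s by simp
  obtain z r X where zr: "z \<in> K" "0 < r" "r < min e (s/2)" "linear X"
   "!!h. norm h <= 1 ==> \<bar>W (z + r *\<^sub>R h) - W z - r*(G z \<bullet> h) - r^2/2*(h \<bullet> X h)\<bar> <= min e (s/2)*r^2"
   by (rule second_order_expansion_at_point[OF K \<open>\<not> negligible K\<close> L C half_gt_zero[OF s] _ \<open>min e (s / 2) > 0\<close>],
     erule (1) tq, blast)
  have "min e (s/2)*r^2 <= e*r^2" by (intro mult_right_mono) auto
  hence "\<bar>W (z + r *\<^sub>R h) - W z - r*(G z \<bullet> h) - r^2/2*(h \<bullet> X h)\<bar> <= e*r^2" if "norm h <= 1" for h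
   using zr(5)[OF that] by linarith
  moreover have "norm (G z - P - A (z-z0)) <= de" using q[OF zr(1)] de'(2) by (simp add: G_def Z_iff)
  ultimately show "\<exists>z p r X. norm (z-z0) <= s/2 \<and> norm (p - P - A (z-z0)) <= de \<and> 0 < r \<and> r < e \<and> r <= s/2 \<and> linear X \<and>
   (\<forall>h. norm h <= 1 --> \<bar>W (z + r *\<^sub>R h) - W z - r*(p \<bullet> h) - r^2/2*(h \<bullet> X h)\<bar> <= e*r^2) \<and>
   (\<forall>h. norm h <= s/2 --> W (z + h) <= W z + p \<bullet> h + 1/2*(h \<bullet> A h)) \<and>
   (\<forall>h. norm h <= s/2 --> \<bar>W (z + h) - W z - p \<bullet> h\<bar> <= C*(norm h)^2)"
   using zr near[OF q[OF zr(1)]] up[OF q[OF zr(1)]] two[OF q[OF zr(1)]] unfolding G_def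
   by (intro exI[of _ z] exI[of _ "P + A (z-z0) + q z"] exI[of _ r] exI[of _ X]) auto
 qed
qed


lemma supconv_attained_near:
 fixes u :: "'a::euclidean_space => real"
 assumes B: "compact B" "x \<in> B" and u: "continuous_on B u" "!!y. y \<in> B ==> \<bar>u y\<bar> <= M"
  and ka: "ka > 0" and ta: "ta > 0" "4*M * ka <= ta^2"
 obtains y where "y \<in> B" "supconv B ka u x = u y - (norm (x-y))^2/(2 * ka)" "norm (x-y) <= ta"
proof -
 have ne: "B ~= {}" using B by auto
 obtain y where y: "y \<in> B" "supconv B ka u x = u y - (norm (x-y))^2/(2 * ka)"
  using supconv_attained[OF B(1) ne u(1) ka] by blast
 have "u x <= supconv B ka u x" using supconv_ge[OF B(1) ne u(1) ka B(2), of x] by simp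
 hence "(norm (x-y))^2/(2 * ka) <= 2*M" using u(2)[OF y(1)] u(2)[OF B(2)] unfolding y(2) by linarith
 hence "(norm (x-y))^2 <= 4*M * ka" using ka by (simp add: field_simps)
 hence "(norm (x-y))^2 <= ta^2" using ta by linarith
 hence "norm (x-y) <= ta" using ta by (simp add: power2_le_iff_abs_le)
 with y show ?thesis using that by blast
qed

text \<open>The approximate expansion becomes a genuine jet of \<open>u\<close> in three moves: the
  form is symmetrised, the paraboloid is steepened until it touches at an interior point, and the
  contact is carried to the maximiser \<open>y\<close>. The two-sided bound with the constant
  \<open>C\<close> controls the form and hence the change of slope.\<close>

lemma upjet_near_expansion:
 fixes u :: "'a::euclidean_space => real"
 assumes u: "continuous_on (cball x0 rh) u" "!!y. y \<in> cball x0 rh ==> \<bar>u y\<bar> <= M"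
  and ka: "ka > 0" and ta: "ta > 0" "4*M * ka <= ta^2"
  and x: "norm (x-x0) + r + ta < rh" and r: "r > 0" and e: "e > 0" and C: "C >= 0" and T: "linear T"
  and approx: "!!h. norm h <= 1 ==> \<bar>supconv (cball x0 rh) ka u (x + r *\<^sub>R h) - supconv (cball x0 rh) ka u x - r*(p \<bullet> h) - r^2/2*(h \<bullet> T h)\<bar> <= e*r^2"
  and bnd: "!!h. norm h <= r ==> \<bar>supconv (cball x0 rh) ka u (x + h) - supconv (cball x0 rh) ka u x - p \<bullet> h\<bar> <= C*(norm h)^2"
 obtains y q X where "selfadj X" "upjet u y q X" "norm (y-x) <= r + ta" "norm (q-p) <= (2*C + 6*e)*r"
  "!!h. h \<bullet> X h = h \<bullet> T h + 4*e*(norm h)^2"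
proof -
 let ?B = "cball x0 rh"
 let ?S = "supconv ?B ka u"
 have "rh > 0" using x r ta norm_ge_zero[of "x - x0"] by linarith
 hence ne: "?B ~= {}" by auto
 note sc = compact_cball ne u(1) ka
 define S where "S = selfadj_part T"
 have S: "selfadj S" "!!h. h \<bullet> S h = h \<bullet> T h"
  using T by (auto simp: S_def selfadj_selfadj_part selfadj_part_quadratic)
 have linS: "linear S" using S by (simp add: selfadj_def)
 have unit: "\<bar>h \<bullet> S h\<bar> <= 2*C + 2*e" if h: "norm h = 1" for h
 proof -
  have "\<bar>?S (x + r *\<^sub>R h) - ?S x - r*(p \<bullet> h)\<bar> <= C*r^2"
   using bnd[of "r *\<^sub>R h"] r h by simp
  moreover have "\<bar>?S (x + r *\<^sub>R h) - ?S x - r*(p \<bullet> h) - r^2/2*(h \<bullet> S h)\<bar> <= e*r^2"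
   using approx[of h] h S(2) by simp
  ultimately have "\<bar>r^2/2*(h \<bullet> S h)\<bar> <= C*r^2 + e*r^2" by linarith
  hence "r^2*\<bar>h \<bullet> S h\<bar> <= r^2*(2*C + 2*e)" by (simp add: abs_mult algebra_simps)
  thus ?thesis using r by simp
 qed
 have quad: "\<bar>h \<bullet> S h\<bar> <= (2*C + 2*e)*(norm h)^2" for h
 proof (cases "h = 0")
  case False
  have "h \<bullet> S h = (norm h)^2*(((1/norm h) *\<^sub>R h) \<bullet> S ((1/norm h) *\<^sub>R h))"
   using False by (simp add: linear_scale[OF linS] power2_eq_square)
  also have "\<bar>...\<bar> <= (norm h)^2*(2*C + 2*e)"
   using unit[of "(1/norm h) *\<^sub>R h"] False by (simp add: abs_mult mult_left_mono del: inner_scaleR_left)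
  finally show ?thesis by (simp add: mult.commute)
 qed (simp add: linear_0[OF linS])
 obtain k s where k: "norm k < r" "s > 0"
  "!!h. norm h <= s ==> ?S (x + k + h) <= ?S (x + k) + (p + S k + (4*e) *\<^sub>R k) \<bullet> h + 1/2*(h \<bullet> S h) + (2*e)*(norm h)^2"
 proof (rule approx_quadratic_interior_max[OF continuous_supconv[OF sc] r e S(1)])
  fix h :: 'a assume "norm h <= 1"
  from approx[OF this] show "?S (x + r *\<^sub>R h) <= ?S x + r*(p \<bullet> h) + r^2/2*(h \<bullet> S h) + e*r^2"
   unfolding S(2) by (simp add: abs_le_iff)
 qed blast
 have xk: "norm (x + k - x0) < rh - ta"
  using norm_triangle_ineq[of "x - x0" k] k(1) x by (simp add: algebra_simps)
 hence "x + k \<in> ?B" using ta by (simp add: dist_norms)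
 obtain y where y: "y \<in> ?B" "?S (x + k) = u y - (norm (x + k - y))^2/(2 * ka)" "norm (x + k - y) <= ta"
  by (rule supconv_attained_near[OF compact_cball \<open>x + k \<in> ?B\<close> u ka ta])
 have "norm (y-x0) < rh"
  using norm_triangle_ineq4[of "x + k - x0" "x + k - y"] xk y(3) by (simp add: algebra_simps)
 hence "y \<in> interior ?B" by (simp add: dist_norms)
 from upjet_of_supconv[OF sc this y(2) k(2) S(1) _ k(3)] e
 have jet: "upjet u y (p + S k + (4*e) *\<^sub>R k) (\<lambda>h. S h + (2*(2*e)) *\<^sub>R h)" by simp
 show ?thesis
 proof (rule that[OF _ jet])
  show "selfadj (\<lambda>h. S h + (2*(2*e)) *\<^sub>R h)"
   using S(1) unfolding selfadj_def
   by (auto intro!: linear_compose_add linear_compose_scale_right linear_ident simp: inner_add_left inner_add_right)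
  show "norm (y-x) <= r + ta"
   using norm_triangle_ineq4[of k "x + k - y"] k(1) y(3) by (simp add: algebra_simps)
  have "norm (S k) <= (2*C + 2*e)*r"
   using selfadj_bound[OF S(1) quad, of k] mult_left_mono[OF less_imp_le[OF k(1)], of "2*C + 2*e"] C e by linarith
  moreover have "norm ((4*e) *\<^sub>R k) <= 4*e*r" using k(1) e by simp
  ultimately have "norm (S k + (4*e) *\<^sub>R k) <= (2*C + 2*e)*r + 4*e*r"
   by (rule norm_triangle_mono)
  thus "norm (p + S k + (4*e) *\<^sub>R k - p) <= (2*C + 6*e)*r" by (simp add: algebra_simps)
  show "h \<bullet> (S h + (2*(2*e)) *\<^sub>R h) = h \<bullet> T h + 4*e*(norm h)^2" for h
   by (simp add: inner_add_right S(2) power2_norm_eq_inner)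
 qed
qed

text \<open>The maximum principle of Crandall and Ishii in approximate form. The sum
  \<open>W\<close> of the two sup-convolutions is separated, so its expansion at a contact point
  restricts to \<open>T1\<close> and \<open>T2\<close> on the factors, and testing the contact
  inequality with \<open>(h, k)\<close> bounds the sum of the two forms by that of \<open>A\<close>.
  Points, slopes and forms are within \<open>e0\<close> of the ideal ones, and no limit of jets is
  taken.\<close>

theorem theorem_on_sums:
 fixes u v :: "'a::euclidean_space => real"
 assumes U: "open U" "x0 \<in> U" "continuous_on U u" and V: "open V" "y0 \<in> V" "continuous_on V v"
  and jet: "upjet (\<lambda>z. u (fst z) + v (snd z)) (x0, y0) (p0, q0) A" and A: "selfadj A" and e0: "e0 > 0"
 obtains x p X y q Y where "norm (x-x0) < e0" "norm (p-p0) < e0" "norm (y-y0) < e0" "norm (q-q0) < e0"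
  "selfadj X" "selfadj Y" "upjet u x p X" "upjet v y q Y"
  "!!h k. h \<bullet> X h + k \<bullet> Y k <= (h, k) \<bullet> A (h, k) + e0*((norm h)^2 + (norm k)^2)"
proof -
 define e where "e = min 1 e0"
 have e: "e > 0" "e <= 1" "e <= e0" using e0 by (auto simp: e_def)
 define et where "et = e/32"
 have et: "et > 0" "4*et <= 1" using e by (auto simp: et_def)
 define z0 where "z0 = (x0, y0)"
 define P where "P = (p0, q0)"
 have linA: "linear A" using A by (simp add: selfadj_def)
 obtain b where b: "b >= 0" "!!h. norm (A h) <= b*norm h" using selfadj_bound_square[OF A] by metis
 define Q1 where "Q1 h = P \<bullet> h + 1/2*(h \<bullet> A h) + et*(norm h)^2" for h
 obtain d where d: "d > 0" "!!z. norm (z-z0) < d ==> u (fst z) + v (snd z) <= u x0 + v y0 + Q1 (z-z0)"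
  using jet et(1) unfolding upjet_def Q1_def z0_def P_def by (fastforce simp: algebra_simps)
 obtain r1 where r1: "r1 > 0" "cball x0 r1 \<subseteq> U" using U open_contains_cball by metis
 obtain r2 where r2: "r2 > 0" "cball y0 r2 \<subseteq> V" using V open_contains_cball by metis
 define rh where "rh = min (min r1 r2) (d/3)"
 have rh: "rh > 0" "2*rh < d" using r1 r2 d by (auto simp: rh_def)
 let ?B1 = "cball x0 rh" and ?B2 = "cball y0 rh"
 have cu: "continuous_on ?B1 u" using r1 by (intro continuous_on_subset[OF U(3)]) (auto simp: rh_def subset_eq)
 have cv: "continuous_on ?B2 v" using r2 by (intro continuous_on_subset[OF V(3)]) (auto simp: rh_def subset_eq)
 have ne: "?B1 ~= {}" "?B2 ~= {}" using rh by auto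
 obtain M1 where M1: "!!x. x \<in> ?B1 ==> \<bar>u x\<bar> <= M1"
  using compact_imp_bounded[OF compact_continuous_image[OF cu compact_cball]] by (simp add: bounded_iff del: mem_cball) blast
 obtain M2 where M2: "!!x. x \<in> ?B2 ==> \<bar>v x\<bar> <= M2"
  using compact_imp_bounded[OF compact_continuous_image[OF cv compact_cball]] by (simp add: bounded_iff del: mem_cball) blast
 define M where "M = max 1 (max M1 M2)"
 have M: "M > 0" "!!x. x \<in> ?B1 ==> \<bar>u x\<bar> <= M" "!!x. x \<in> ?B2 ==> \<bar>v x\<bar> <= M"
  using M1 M2 unfolding M_def by force+
 define s where "s = min (rh/2) (e/(8*(b + 1)))"
 have s: "s > 0" "s <= rh/2" "s <= e/8" "(b + 1) * s <= e/8"
 proof -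
  show "s > 0" using rh e b by (auto simp: s_def)
  show "s <= rh/2" unfolding s_def by (rule min.cobounded1)
  have "(b + 1) * s <= (b + 1)*(e/(8*(b + 1)))" using b by (intro mult_left_mono) (auto simp: s_def)
  also have "... = e/8" using b by (simp add: field_simps)
  finally show *: "(b + 1) * s <= e/8" .
  have "s <= (b + 1) * s" using b \<open>s > 0\<close> by simp
  thus "s <= e/8" using * by linarith
 qed
 \<comment> \<open>On the shell from \<open>s/2\<close> to \<open>s\<close> the additional term
   \<open>et*(norm h)^2\<close> is worth at least \<open>2*m\<close>: one \<open>m\<close> pays for
   the passage to sup-convolutions, the other is the strict gap.\<close>
 define m where "m = et * s^2/8"
 have m: "m > 0" using et s by (simp add: m_def)
 have "uniformly_continuous_on (?B1 \<times> ?B2) (\<lambda>z. Q1 (z-z0))"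
  unfolding Q1_def
  by (intro compact_uniformly_continuous compact_Times compact_cball continuous_intros
    linear_continuous_on_compose[OF _ linA])
 then obtain w where w: "w > 0" "!!z z'. z \<in> ?B1 \<times> ?B2 ==> z' \<in> ?B1 \<times> ?B2 ==> dist z' z < w ==> dist (Q1 (z'-z0)) (Q1 (z-z0)) < m"
  using m unfolding uniformly_continuous_on_def by metis
 \<comment> \<open>The maximisers in the sup-convolutions may move by \<open>ta\<close>, which
   changes \<open>Q1\<close> by less than \<open>m\<close>; \<open>ka\<close> is the parameter that
   enforces this.\<close>
 define ta where "ta = min (w/3) (min (rh/8) (e/8))"
 have ta: "ta > 0" "2*ta < w" "ta <= rh/8" "ta <= e/8" using w rh e by (auto simp: ta_def)
 define ka where "ka = ta^2/(4*M)"
 have ka: "ka > 0" "4*M * ka <= ta^2" using ta M by (auto simp: ka_def)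
 define Su where "Su = supconv ?B1 ka u"
 define Sv where "Sv = supconv ?B2 ka v"
 define W where "W z = Su (fst z) + Sv (snd z)" for z
 note scu = compact_cball ne(1) cu ka(1) and scv = compact_cball ne(2) cv ka(1)
 have cW: "continuous_on UNIV W" unfolding W_def Su_def Sv_def
  by (intro continuous_intros continuous_on_compose2[OF continuous_supconv[OF scu]] continuous_on_compose2[OF continuous_supconv[OF scv]]) auto
 define A' where "A' h = A h + (4*et) *\<^sub>R h" for h
 have A': "selfadj A'" unfolding A'_def using A unfolding selfadj_def
  by (auto intro!: linear_compose_add linear_compose_scale_right linear_ident simp: inner_add_left inner_add_right)
 have A'q: "h \<bullet> A' h = h \<bullet> A h + 4*et*(norm h)^2" for h
  by (simp add: A'_def inner_add_right power2_norm_eq_inner)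
 have comp: "norm (x-x0) <= norm (z-z0)" "norm (y-y0) <= norm (z-z0)" if "z = (x, y)" for z x y
  using norm_fst_le[of "x - x0" "y - y0"] norm_snd_le[of "y - y0" "x - x0"] unfolding that z0_def by auto
 have away: "W z - P \<bullet> (z-z0) - 1/2*((z-z0) \<bullet> A' (z-z0)) <= W z0 - m"
  if z: "s/2 <= norm (z-z0)" "norm (z-z0) <= s" for z
 proof -
  obtain x y where xy: "z = (x, y)" by (cases z)
  have inB: "x \<in> ?B1" "y \<in> ?B2" using comp[OF xy] z s rh by (auto simp: dist_norms)
  obtain x' where x': "x' \<in> ?B1" "Su x = u x' - (norm (x-x'))^2/(2 * ka)" "norm (x-x') <= ta"
   unfolding Su_def by (rule supconv_attained_near[OF compact_cball inB(1) cu M(2) ka(1) ta(1) ka(2)])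
  obtain y' where y': "y' \<in> ?B2" "Sv y = v y' - (norm (y-y'))^2/(2 * ka)" "norm (y-y') <= ta"
   unfolding Sv_def by (rule supconv_attained_near[OF compact_cball inB(2) cv M(3) ka(1) ta(1) ka(2)])
  have "dist (x', y') z <= norm (x-x') + norm (y-y')"
   unfolding xy dist_norm by (metis diff_Pair norm_Pair_le norm_minus_commute)
  hence "dist (x', y') z < w" using x'(3) y'(3) ta(2) by linarith
  hence Qd: "\<bar>Q1 ((x', y') - z0) - Q1 (z-z0)\<bar> < m"
   using w(2)[of z "(x', y')"] inB x'(1) y'(1) unfolding xy dist_real_def by simp
  have "norm ((x', y') - z0) <= norm (x'-x0) + norm (y'-y0)" unfolding z0_def by (simp add: norm_Pair_le)
  also have "... < d" using x'(1) y'(1) rh(2) by (simp add: dist_norms)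
  finally have "u x' + v y' <= u x0 + v y0 + Q1 ((x', y') - z0)" using d(2)[of "(x', y')"] by simp
  moreover have "W z <= u x' + v y'"
  proof -
   have "(norm a)^2/(2 * ka) >= 0" for a :: 'a using ka by simp
   from this[of "x - x'"] this[of "y - y'"] show ?thesis
    unfolding W_def xy fst_conv snd_conv x'(2) y'(2) by linarith
  qed
  moreover have "u x0 + v y0 <= W z0"
   using supconv_ge[OF scu, of x0 x0] supconv_ge[OF scv, of y0 y0] rh(1) unfolding W_def z0_def Su_def Sv_def by simp
  ultimately have 1: "W z <= W z0 + Q1 (z-z0) + m" using Qd by linarith
  have "2*m <= et*(norm (z-z0))^2"
  proof -
   have "(s/2)^2 <= (norm (z-z0))^2" using z(1) s(1) by (intro power_mono) auto
   hence "et*(s/2)^2 <= et*(norm (z-z0))^2" using et by simp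
   thus ?thesis by (simp add: m_def power_divide)
  qed
  thus ?thesis using 1 unfolding A'q Q1_def by (simp add: distrib_left)
 qed
 have semi: "\<exists>g. \<forall>h. W z + g \<bullet> h - (1/(2 * ka))*(norm h)^2 <= W (z + h)" for z
 proof -
  obtain x y where xy: "z = (x, y)" by (cases z)
  obtain x' where x': "x' \<in> ?B1" "supconv ?B1 ka u x = u x' - (norm (x-x'))^2/(2 * ka)"
   using supconv_attained[OF scu] by blast
  obtain y' where y': "y' \<in> ?B2" "supconv ?B2 ka v y = v y' - (norm (y-y'))^2/(2 * ka)"
   using supconv_attained[OF scv] by blast
  show ?thesis
  proof (intro exI allI)
   fix h :: "'a \<times> 'a"
   obtain h1 h2 where h: "h = (h1, h2)" by (cases h)
   have "(norm h)^2 = (norm h1)^2 + (norm h2)^2" unfolding h by (simp add: norm_Pair)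
   thus "W z + (- (1/ka) *\<^sub>R (x-x'), - (1/ka) *\<^sub>R (y-y')) \<bullet> h - (1/(2 * ka))*(norm h)^2 <= W (z + h)"
    using supconv_ge_expand[OF scu x', of h1] supconv_ge_expand[OF scv y', of h2]
    unfolding W_def xy h Su_def Sv_def by (simp add: add_divide_distrib)
  qed
 qed
 obtain C where C: "C >= 0" "!!e'. e' > 0 ==> \<exists>z p r X. norm (z-z0) <= s/2 \<and> norm (p - P - A' (z-z0)) <= e/8 \<and> 0 < r \<and> r < e' \<and> r <= s/2 \<and> linear X \<and>
   (\<forall>h. norm h <= 1 --> \<bar>W (z + r *\<^sub>R h) - W z - r*(p \<bullet> h) - r^2/2*(h \<bullet> X h)\<bar> <= e'*r^2) \<and>
   (\<forall>h. norm h <= s/2 --> W (z + h) <= W z + p \<bullet> h + 1/2*(h \<bullet> A' h)) \<and>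
   (\<forall>h. norm h <= s/2 --> \<bar>W (z + h) - W z - p \<bullet> h\<bar> <= C*(norm h)^2)"
 proof (rule perturbed_contact_expansion[OF cW s(1) A' m, of "1/(2 * ka)" z0 P "e/8"])
  show "0 < 1/(2 * ka)" "0 < e/8" using ka e by auto
 qed (rule away semi | assumption | blast)+
 define ep where "ep = min (rh/8) (e/(64*(C + 1)))"
 have ep: "ep > 0" "ep <= rh/8" "ep <= e/64" "(2*C + 6*ep)*ep <= e/8"
 proof -
  show "ep > 0" using rh(1) e(1) C(1) by (auto simp: ep_def)
  show "ep <= rh/8" unfolding ep_def by (rule min.cobounded1)
  have "(C + 1)*ep <= (C + 1)*(e/(64*(C + 1)))" using C(1) by (intro mult_left_mono) (auto simp: ep_def)
  also have "... = e/64" using C(1) by (simp add: field_simps)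
  finally have *: "(C + 1)*ep <= e/64" .
  have "ep <= (C + 1)*ep" using C(1) \<open>ep > 0\<close> by simp
  thus "ep <= e/64" using * by linarith
  hence "(2*C + 6*ep)*ep <= (6*(C + 1))*ep" using \<open>ep > 0\<close> C(1) e(2) by (intro mult_right_mono) auto
  thus "(2*C + 6*ep)*ep <= e/8" using * e by linarith
 qed
 from C(2)[OF ep(1)] obtain z p r X where z: "norm (z-z0) <= s/2" "norm (p - P - A' (z-z0)) <= e/8"
  and r: "0 < r" "r < ep" "r <= s/2" and X: "linear X"
  and ex: "!!h. norm h <= 1 ==> \<bar>W (z + r *\<^sub>R h) - W z - r*(p \<bullet> h) - r^2/2*(h \<bullet> X h)\<bar> <= ep*r^2"
  and up: "!!h. norm h <= s/2 ==> W (z + h) <= W z + p \<bullet> h + 1/2*(h \<bullet> A' h)"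
  and two: "!!h. norm h <= s/2 ==> \<bar>W (z + h) - W z - p \<bullet> h\<bar> <= C*(norm h)^2" by blast
 obtain x y where xy: "z = (x, y)" by (cases z)
 obtain p1 p2 where p: "p = (p1, p2)" by (cases p)
 define T1 where "T1 h = fst (X (h, 0))" for h
 define T2 where "T2 h = snd (X (0, h))" for h
 have T1: "linear T1" unfolding T1_def
 proof (rule linearI)
  show "fst (X (a + b, 0)) = fst (X (a, 0)) + fst (X (b, 0))" for a b
   using linear_add[OF X, of "(a, 0)" "(b, 0)"] by simp
  show "fst (X (c *\<^sub>R a, 0)) = c *\<^sub>R fst (X (a, 0))" for c a
   using linear_scale[OF X, of c "(a, 0)"] by simp
 qed
 have T2: "linear T2" unfolding T2_def
 proof (rule linearI)
  show "snd (X (0, a + b)) = snd (X (0, a)) + snd (X (0, b))" for a b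
   using linear_add[OF X, of "(0, a)" "(0, b)"] by simp
  show "snd (X (0, c *\<^sub>R a)) = c *\<^sub>R snd (X (0, a))" for c a
   using linear_scale[OF X, of c "(0, a)"] by simp
 qed
 have ex1: "\<bar>Su (x + r *\<^sub>R h) - Su x - r*(p1 \<bullet> h) - r^2/2*(h \<bullet> T1 h)\<bar> <= ep*r^2" if "norm h <= 1" for h
  using ex[of "(h, 0)"] that by (simp add: W_def xy p T1_def inner_prod_def norm_Pair)
 have ex2: "\<bar>Sv (y + r *\<^sub>R h) - Sv y - r*(p2 \<bullet> h) - r^2/2*(h \<bullet> T2 h)\<bar> <= ep*r^2" if "norm h <= 1" for h
  using ex[of "(0, h)"] that by (simp add: W_def xy p T2_def inner_prod_def norm_Pair)
 have two1: "\<bar>Su (x + h) - Su x - p1 \<bullet> h\<bar> <= C*(norm h)^2" if "norm h <= r" for h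
  using two[of "(h, 0)"] that r(3) by (simp add: W_def xy p inner_prod_def norm_Pair)
 have two2: "\<bar>Sv (y + h) - Sv y - p2 \<bullet> h\<bar> <= C*(norm h)^2" if "norm h <= r" for h
  using two[of "(0, h)"] that r(3) by (simp add: W_def xy p inner_prod_def norm_Pair)
 have n1: "norm (x-x0) <= s/2" "norm (y-y0) <= s/2" using comp[OF xy] z(1) by auto
 obtain x' p' X' where j1: "selfadj X'" "upjet u x' p' X'" "norm (x'-x) <= r + ta" "norm (p'-p1) <= (2*C + 6*ep)*r"
  "!!h. h \<bullet> X' h = h \<bullet> T1 h + 4*ep*(norm h)^2"
  by (rule upjet_near_expansion[OF cu M(2) ka(1) ta(1) ka(2) _ r(1) ep(1) C(1) T1 ex1[unfolded Su_def] two1[unfolded Su_def]])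
    (use n1 r ta s ep rh in \<open>auto\<close>)
 obtain y' q' Y' where j2: "selfadj Y'" "upjet v y' q' Y'" "norm (y'-y) <= r + ta" "norm (q'-p2) <= (2*C + 6*ep)*r"
  "!!h. h \<bullet> Y' h = h \<bullet> T2 h + 4*ep*(norm h)^2"
  by (rule upjet_near_expansion[OF cv M(3) ka(1) ta(1) ka(2) _ r(1) ep(1) C(1) T2 ex2[unfolded Sv_def] two2[unfolded Sv_def]])
    (use n1 r ta s ep rh in \<open>auto\<close>)
 have nP: "norm (p-P) <= e/4"
 proof -
  have "norm (A' (z-z0)) <= (b + 1) * s"
  proof -
   have "norm (A' (z-z0)) <= b*norm (z-z0) + (4*et)*norm (z-z0)"
    unfolding A'_def using b(2)[of "z - z0"] et(1) by (intro norm_triangle_mono) auto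
   also have "... <= (b + 1)*norm (z-z0)" using et(2) mult_right_mono[of "4*et" 1 "norm (z-z0)"] by (simp add: distrib_right)
   also have "... <= (b + 1) * s" using z(1) s(1) b(1) by (intro mult_left_mono) auto
   finally show ?thesis .
  qed
  thus ?thesis using z(2) s(4) norm_triangle_ineq[of "p - P - A' (z-z0)" "A' (z-z0)"] by simp
 qed
 have np: "norm (p1-p0) <= e/4" "norm (p2-q0) <= e/4"
  using nP norm_fst_le[of "p1 - p0" "p2 - q0"] norm_snd_le[of "p2 - q0" "p1 - p0"] unfolding p P_def by auto
 have Cr: "(2*C + 6*ep)*r <= e/8"
  using ep(4) r(2) C(1) ep(1) mult_left_mono[of r ep "2*C + 6*ep"] by linarith
 have unit: "h \<bullet> T1 h + k \<bullet> T2 k <= (h, k) \<bullet> A (h, k) + (e/8 + 4*ep)" if hk: "norm (h, k) = 1" for h k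
 proof -
  have arith: "r^2/2*(a + b) <= r^2/2*(c + (e/8 + 4*ep))"
   if "r^2/2*a + r^2/2*b <= 1/2*(r^2*(c + 4*et)) + 2*(ep*r^2)" for a b c
   using that by (simp add: et_def algebra_simps)
  have nh: "norm h <= 1" "norm k <= 1" using norm_fst_le[of h k] norm_snd_le[of k h] hk by auto
  have "W (z + r *\<^sub>R (h, k)) <= W z + p \<bullet> (r *\<^sub>R (h, k)) + 1/2*((r *\<^sub>R (h, k)) \<bullet> A' (r *\<^sub>R (h, k)))"
  proof (rule up)
   have "norm (r *\<^sub>R (h, k)) = r" unfolding norm_scaleR hk using r(1) by simp
   thus "norm (r *\<^sub>R (h, k)) <= s/2" using r(3) by linarith
  qed
  also have "(r *\<^sub>R (h, k)) \<bullet> A' (r *\<^sub>R (h, k)) = r^2*((h, k) \<bullet> A (h, k) + 4*et)"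
  proof -
   have "linear A'" using A' by (simp add: selfadj_def)
   hence "(r *\<^sub>R (h, k)) \<bullet> A' (r *\<^sub>R (h, k)) = r^2*((h, k) \<bullet> A' (h, k))"
    by (simp only: linear_scale inner_scaleR_left inner_scaleR_right power2_eq_square mult.assoc)
   thus ?thesis unfolding A'q hk by simp
  qed
  finally have "Su (x + r *\<^sub>R h) + Sv (y + r *\<^sub>R k) <= Su x + Sv y + (r*(p1 \<bullet> h) + r*(p2 \<bullet> k)) + 1/2*(r^2*((h, k) \<bullet> A (h, k) + 4*et))"
   by (simp add: W_def xy p)
  moreover have "r^2/2*(h \<bullet> T1 h) + r^2/2*(k \<bullet> T2 k) <= (Su (x + r *\<^sub>R h) - Su x - r*(p1 \<bullet> h)) + (Sv (y + r *\<^sub>R k) - Sv y - r*(p2 \<bullet> k)) + 2*(ep*r^2)"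
   using ex1[OF nh(1)] ex2[OF nh(2)] by linarith
  ultimately have "r^2/2*(h \<bullet> T1 h) + r^2/2*(k \<bullet> T2 k) <= 1/2*(r^2*((h, k) \<bullet> A (h, k) + 4*et)) + 2*(ep*r^2)"
   by linarith
  hence "r^2/2*(h \<bullet> T1 h + k \<bullet> T2 k) <= r^2/2*((h, k) \<bullet> A (h, k) + (e/8 + 4*ep))"
   by (rule arith)
  thus ?thesis using r(1) by (subst (asm) mult_le_cancel_left_pos) auto
 qed
 show ?thesis
 proof (rule that[of x' p' y' q' X' Y'])
  show "norm (x'-x0) < e0" "norm (y'-y0) < e0"
   using norm_triangle_ineq[of "x' - x" "x - x0"] norm_triangle_ineq[of "y' - y" "y - y0"] j1(3) j2(3) n1 s r ta ep e by auto
  show "norm (p'-p0) < e0" "norm (q'-q0) < e0"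
   using norm_triangle_ineq[of "p' - p1" "p1 - p0"] norm_triangle_ineq[of "q' - p2" "p2 - q0"] j1(4) j2(4) np Cr e by auto
  fix h k
  show "h \<bullet> X' h + k \<bullet> Y' k <= (h, k) \<bullet> A (h, k) + e0*((norm h)^2 + (norm k)^2)"
  proof (cases "(h, k) = 0")
   case True
   thus ?thesis using linear_0[OF linA] linear_0 j1(1) j2(1) by (simp add: zero_prod_def)
  next
   case False
   define c where "c = norm (h, k)"
   have c: "c > 0" using False by (simp add: c_def)
   have cc: "c^2 = (norm h)^2 + (norm k)^2" by (simp add: c_def norm_Pair)
   have "norm ((1/c) *\<^sub>R h, (1/c) *\<^sub>R k) = 1"
    using c unfolding scaleR_Pair[symmetric] norm_scaleR c_def[symmetric] by simp
   from unit[OF this] have "(1/c^2)*(h \<bullet> T1 h + k \<bullet> T2 k) <= (1/c^2)*((h, k) \<bullet> A (h, k)) + (e/8 + 4*ep)"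
    unfolding scaleR_Pair[symmetric] linear_scale[OF linA] linear_scale[OF T1] linear_scale[OF T2] inner_scaleR_left inner_scaleR_right
    by (simp add: distrib_left power2_eq_square)
   hence "c^2*((1/c^2)*(h \<bullet> T1 h + k \<bullet> T2 k)) <= c^2*((1/c^2)*((h, k) \<bullet> A (h, k)) + (e/8 + 4*ep))"
    by (intro mult_left_mono) auto
   hence "h \<bullet> T1 h + k \<bullet> T2 k <= (h, k) \<bullet> A (h, k) + (e/8 + 4*ep)*c^2" using c by (simp add: distrib_left mult.commute)
   moreover have "(e/8 + 8*ep)*c^2 <= e0*c^2" using ep(3) e by (intro mult_right_mono) auto
   ultimately show ?thesis unfolding j1(5) j2(5) cc[symmetric] using cc by (simp add: algebra_simps)
  qed
 qed (use j1 j2 in auto)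
qed

section \<open>Symmetric matrices and Pucci operators\<close>

lemma symmetric_mat_entry: "symmetric_mat X ==> X $ i $ j = X $ j $ i"
 unfolding symmetric_mat_def by (metis transpose_def vec_lambda_beta)

lemma symmetric_mat_inner: "symmetric_mat X ==> h \<bullet> (X *v k) = (X *v h) \<bullet> k"
 unfolding symmetric_mat_def by (metis dot_lmul_matrix vector_transpose_matrix)

lemma symmetric_mat_add: "symmetric_mat X ==> symmetric_mat Y ==> symmetric_mat (X + Y)"
 and symmetric_mat_diff: "symmetric_mat X ==> symmetric_mat Y ==> symmetric_mat (X-Y)"
 and symmetric_mat_scaleR: "symmetric_mat X ==> symmetric_mat (c *\<^sub>R X)"
 and symmetric_mat_minus: "symmetric_mat X ==> symmetric_mat (- X)"
 and symmetric_mat_mat: "symmetric_mat (mat c :: real^'n^'n)"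
 and symmetric_mat_0: "symmetric_mat (0 :: real^'n^'n)"
 unfolding symmetric_mat_def by (simp_all add: transpose_def vec_eq_iff mat_def)

lemma selfadj_matrix_vector_mult: "symmetric_mat X ==> selfadj ((*v) X)"
 unfolding selfadj_def by (auto simp: symmetric_mat_inner)

lemma selfadj_matrixE:
 fixes T :: "real^'n => real^'n"
 assumes "selfadj T"
 obtains X where "symmetric_mat X" "T = (*v) X"
proof (rule that)
 have lin: "linear T" using assms by (simp add: selfadj_def)
 show "T = (*v) (matrix T)" using matrix_works[OF lin[unfolded linear_matrix_vector_mul_eq[symmetric]]] lin
  by (simp add: fun_eq_iff matrix_works linear_matrix_vector_mul_eq)
 show "symmetric_mat (matrix T)"
  unfolding symmetric_mat_def vec_eq_iff
 proof (intro allI)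
  fix i j
  have "T (axis i 1) \<bullet> axis j 1 = axis i 1 \<bullet> T (axis j 1)" using assms by (simp add: selfadj_def)
  thus "transpose (matrix T) $ i $ j = matrix T $ i $ j"
   by (simp add: transpose_def matrix_def inner_axis inner_axis' )
 qed
qed

lemma trace_zero: "trace (0 :: real^'n^'n) = 0"
 by (simp add: trace_def)

lemma trace_mult_add_right: "trace (A ** (X + Y)) = trace (A ** X) + trace (A ** (Y :: real^'n^'n))"
 by (simp add: matrix_add_ldistrib trace_add)

lemma trace_mult_scaleR_right: "trace (A ** (c *\<^sub>R X)) = c*trace (A ** (X :: real^'n^'n))"
 by (simp add: trace_def matrix_matrix_mult_def sum_distrib_left mult_ac)

lemma trace_mult_minus_right: "trace (A ** (- X)) = - trace (A ** (X :: real^'n^'n))"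
 using trace_mult_scaleR_right[of A "-1" X] by simp

lemma trace_mult_diff_right: "trace (A ** (X-Y)) = trace (A ** X) - trace (A ** (Y :: real^'n^'n))"
 using trace_mult_add_right[of A X "- Y"] by (simp add: trace_mult_minus_right)

lemma trace_mult_mat: "trace (A ** (mat c :: real^'n^'n)) = c*trace A"
 by (simp add: trace_def matrix_matrix_mult_def mat_def sum_distrib_left if_distrib cong: if_cong)
   (simp add: mult.commute)

definition outer :: "real^'n => real^'n^'n" where
 "outer v = (\<chi> i j. v $ i * v $ j)"

lemma symmetric_mat_outer: "symmetric_mat (outer v)"
 by (simp add: symmetric_mat_def outer_def transpose_def vec_eq_iff mult.commute)

lemma outer_mult_vec: "outer v *v h = (v \<bullet> h) *\<^sub>R v"
 by (simp add: outer_def matrix_vector_mult_def vec_eq_iff inner_vec_def sum_distrib_right mult_ac sum_distrib_left)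

lemma mat_mult_vec: "(mat c :: real^'n^'n) *v h = c *\<^sub>R h"
proof -
 have "(mat c :: real^'n^'n) = c *\<^sub>R mat 1" by (simp add: mat_def vec_eq_iff)
 thus ?thesis by (metis scaleR_matrix_vector_assoc matrix_vector_mul_lid)
qed

lemma trace_mult_outer: "trace (A ** outer v) = v \<bullet> (A *v v)"
 by (simp add: trace_def matrix_matrix_mult_def outer_def inner_vec_def matrix_vector_mult_def sum_distrib_left)
   (simp add: mult_ac)

lemma norm_outer: "norm (outer v) = (norm v)^2"
proof -
 have "norm (outer v $ i) = \<bar>v $ i\<bar>*norm v" for i
 proof -
  have "outer v $ i = (v $ i) *\<^sub>R v" by (simp add: outer_def vec_eq_iff)
  thus ?thesis by simp
 qed
 hence "norm (outer v) = L2_set (\<lambda>i. \<bar>v $ i\<bar>*norm v) UNIV" by (simp add: norm_vec_def)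
 also have "... = L2_set (\<lambda>i. norm (v $ i)) UNIV*norm v" by (subst L2_set_left_distrib) auto
 also have "... = norm v * norm v" by (simp add: norm_vec_def)
 finally show ?thesis by (simp add: power2_eq_square)
qed

section \<open>Positive semidefinite matrices\<close>

definition psd :: "real^'n^'n => bool" where
 "psd N \<longleftrightarrow> symmetric_mat N \<and> (\<forall>h. 0 <= h \<bullet> (N *v h))"

lemma psd_Cauchy_Schwarz:
 assumes "psd N"
 shows "(h \<bullet> (N *v e))^2 <= (h \<bullet> (N *v h))*(e \<bullet> (N *v e))"
proof -
 have sym: "symmetric_mat N" using assms by (simp add: psd_def)
 let ?a = "e \<bullet> (N *v e)" and ?b = "h \<bullet> (N *v e)" and ?c = "h \<bullet> (N *v h)"
 have pos: "0 <= ?c + 2*t * ?b + t^2 * ?a" for t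
 proof -
  have "0 <= (h + t *\<^sub>R e) \<bullet> (N *v (h + t *\<^sub>R e))" using assms by (simp add: psd_def)
  also have "... = ?c + 2*t * ?b + t^2 * ?a"
   using symmetric_mat_inner[OF sym, of e h]
   by (simp add: matrix_vector_right_distrib matrix_vector_mult_scaleR algebra_simps power2_eq_square inner_commute)
  finally show ?thesis .
 qed
 have a: "?a >= 0" using assms by (simp add: psd_def)
 show ?thesis
 proof (cases "?a = 0")
  case True
  have "?b = 0"
  proof (rule ccontr)
   assume b: "?b ~= 0"
   define t where "t = - (?c + 1)/(2 * ?b)"
   have "2*t * ?b = - (?c + 1)" using b by (simp add: t_def)
   thus False using pos[of t] True by simp
  qed
  thus ?thesis using True by simp
 next
  case False
  have "0 <= ?c + 2*(- ?b/?a) * ?b + (- ?b/?a)^2 * ?a" by (rule pos)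
  also have "... = ?c - ?b^2/?a" using False by (simp add: power2_eq_square field_simps)
  finally show ?thesis using a False by (simp add: field_simps)
 qed
qed

text \<open>Elimination one axis at a time, as in the Cholesky factorisation: subtracting
  \<open>outer w\<close> keeps the matrix positive semidefinite by Cauchy-Schwarz and makes it
  vanish on the axis treated. Sums of rank-one matrices are what the trace estimates below work
  with.\<close>

lemma psd_gram:
 fixes N :: "real^'n^'n"
 assumes "psd N"
 obtains V :: "'n => real^'n" where "N = (\<Sum>k\<in>UNIV. outer (V k))"
proof -
 have "\<exists>V N'. N = N' + (\<Sum>k\<in>S. outer (V k)) \<and> psd N' \<and> (\<forall>k\<in>S. N' *v axis k 1 = 0)" if "finite S" for S :: "'n set"
  using that
 proof (induction S rule: finite_induct)
  case empty
  thus ?case using assms by auto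
 next
  case (insert k S)
  then obtain V N' where N': "N = N' + (\<Sum>k\<in>S. outer (V k))" "psd N'" "\<forall>k\<in>S. N' *v axis k 1 = 0" by blast
  let ?e = "axis k 1 :: real^'n"
  define a where "a = ?e \<bullet> (N' *v ?e)"
  have a0: "a >= 0" using N'(2) by (simp add: psd_def a_def)
  have sym: "symmetric_mat N'" using N'(2) by (simp add: psd_def)
  \<comment> \<open>If \<open>a = 0\<close>, division by zero gives \<open>w = 0\<close>, which is
    the right choice because \<open>N'\<close> already vanishes on the axis.\<close>
  define w where "w = (1/sqrt a) *\<^sub>R (N' *v ?e)"
  define N'' where "N'' = N' - outer w"
  have sq: "(v \<bullet> w) *\<^sub>R w = ((v \<bullet> (N' *v ?e))/a) *\<^sub>R (N' *v ?e)" for v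
   using a0 by (simp add: w_def real_sqrt_mult_self flip: real_sqrt_mult)
  have N''_apply: "N'' *v v = N' *v v - ((v \<bullet> (N' *v ?e))/a) *\<^sub>R (N' *v ?e)" for v
   unfolding N''_def using sq[of v] by (simp add: matrix_vector_mult_diff_rdistrib outer_mult_vec inner_commute)
  have Nk: "N' *v ?e = 0" if "a = 0"
  proof -
   have "((N' *v ?e) \<bullet> (N' *v ?e))^2 <= 0"
    using psd_Cauchy_Schwarz[OF N'(2), of "N' *v ?e" ?e] that by (simp add: a_def)
   thus ?thesis by simp
  qed
  have "psd N''" unfolding psd_def
  proof (intro conjI allI)
   show "symmetric_mat N''" unfolding N''_def by (intro symmetric_mat_diff sym symmetric_mat_outer)
   fix h
   have "h \<bullet> (N'' *v h) = h \<bullet> (N' *v h) - (h \<bullet> (N' *v ?e))^2/a"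
    unfolding N''_apply by (simp add: inner_diff_right power2_eq_square)
   moreover have "(h \<bullet> (N' *v ?e))^2/a <= h \<bullet> (N' *v h)"
   proof (cases "a = 0")
    case True
    thus ?thesis using N'(2) by (simp add: psd_def)
   next
    case False
    thus ?thesis using psd_Cauchy_Schwarz[OF N'(2), of h ?e] a0 by (simp add: a_def[symmetric] divide_le_eq)
   qed
   ultimately show "0 <= h \<bullet> (N'' *v h)" by simp
  qed
  moreover have "N'' *v axis j 1 = 0" if "j \<in> insert k S" for j
  proof (cases "j = k")
   case True
   thus ?thesis unfolding N''_apply using Nk by (cases "a = 0") (auto simp: a_def)
  next
   case False
   hence z: "N' *v axis j 1 = 0" using that N'(3) by simp
   hence "axis j 1 \<bullet> (N' *v ?e) = 0" using symmetric_mat_inner[OF sym, of "axis j 1" ?e] by simp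
   thus ?thesis unfolding N''_apply using z by simp
  qed
  moreover have "N = N'' + (\<Sum>j\<in>insert k S. outer ((V(k := w)) j))"
  proof -
   have "(\<Sum>j\<in>S. outer ((V(k := w)) j)) = (\<Sum>j\<in>S. outer (V j))"
    using insert.hyps by (intro sum.cong) auto
   thus ?thesis using N'(1) insert.hyps by (simp add: N''_def)
  qed
  ultimately show ?case by blast
 qed
 from this[of UNIV] obtain V :: "'n => real^'n" and N' where N': "N = N' + (\<Sum>k\<in>UNIV. outer (V k))" "\<forall>k. N' *v axis k 1 = 0" by auto
 have "N' = 0"
  using N'(2) by (simp add: vec_eq_iff matrix_vector_mult_def axis_def if_distrib cong: if_cong)
 thus ?thesis using that N'(1) by simp
qed

lemma norm_psd_le_trace:
 fixes N :: "real^'n^'n"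
 assumes "psd N"
 shows "norm N <= trace N"
proof -
 obtain V :: "'n => real^'n" where V: "N = (\<Sum>k\<in>UNIV. outer (V k))" by (rule psd_gram[OF assms])
 have "trace (outer v) = (norm v)^2" for v :: "real^'n"
  by (simp add: trace_def outer_def power2_norm_eq_inner inner_vec_def)
 hence "trace N = (\<Sum>k\<in>UNIV. (norm (V k))^2)"
 proof -
  assume *: "!!v::real^'n. trace (outer v) = (norm v)^2"
  have "trace (\<Sum>k\<in>S. outer (V k)) = (\<Sum>k\<in>S. (norm (V k))^2)" if "finite S" for S
   using that by (induction S rule: finite_induct) (auto simp: trace_add * trace_zero)
  thus ?thesis unfolding V by simp
 qed
 moreover have "norm N <= (\<Sum>k\<in>UNIV. (norm (V k))^2)" unfolding V
  by (rule order_trans[OF norm_sum]) (simp add: norm_outer)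
 ultimately show ?thesis by simp
qed

lemma psd_quadratic_le_trace:
 fixes N :: "real^'n^'n"
 assumes "psd N"
 shows "h \<bullet> (N *v h) <= trace N*(norm h)^2"
proof -
 obtain V :: "'n => real^'n" where V: "N = (\<Sum>k\<in>UNIV. outer (V k))" by (rule psd_gram[OF assms])
 have *: "h \<bullet> ((\<Sum>k\<in>S. outer (V k)) *v h) <= trace (\<Sum>k\<in>S. outer (V k))*(norm h)^2" if "finite S" for S
  using that
 proof (induction S rule: finite_induct)
  case (insert k S)
  have "(V k \<bullet> h)^2 <= (norm (V k))^2*(norm h)^2"
   using Cauchy_Schwarz_ineq[of "V k" h] by (simp add: power2_norm_eq_inner)
  moreover have "trace (outer (V k)) = (norm (V k))^2"
   by (simp add: trace_def outer_def power2_norm_eq_inner inner_vec_def)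
  ultimately show ?case using insert
   by (simp add: matrix_vector_mult_add_rdistrib inner_add_right outer_mult_vec trace_add distrib_right power2_eq_square inner_commute)
 qed (simp add: trace_zero)
 show ?thesis unfolding V by (rule *) simp
qed

lemma norm_mat_le:
 fixes X :: "real^'n^'n"
 assumes "symmetric_mat X" "!!h. norm h = 1 ==> norm (X *v h) <= c"
 shows "norm X <= real CARD('n)*c"
proof -
 have row: "norm (X $ i) <= c" for i
 proof -
  have "X *v axis i 1 = X $ i"
   using symmetric_mat_entry[OF assms(1)] by (simp add: vec_eq_iff matrix_vector_mult_def axis_def if_distrib cong: if_cong)
  thus ?thesis using assms(2)[of "axis i 1"] by simp
 qed
 have "norm X <= (\<Sum>i\<in>UNIV. norm (X $ i))" unfolding norm_vec_def[of X] by (rule L2_set_le_sum) auto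
 also have "... <= (\<Sum>i\<in>(UNIV::'n set). c)" using row by (intro sum_mono) auto
 finally show ?thesis by simp
qed

text \<open>\<open>c\<close> is the maximum of the form on the unit sphere. The matrix
  \<open>mat c - A\<close> is positive semidefinite with a form that vanishes at the maximiser, so
  by Cauchy-Schwarz for this form it annihilates the maximiser.\<close>

lemma symmetric_mat_max_eigenvalue:
 fixes A :: "real^'n^'n"
 assumes A: "symmetric_mat A"
 obtains c where "is_eigenvalue A c" "!!h. h \<bullet> (A *v h) <= c*(norm h)^2"
proof -
 let ?S = "sphere (0::real^'n) 1"
 have "continuous_on ?S (\<lambda>h. h \<bullet> (A *v h))" by (intro continuous_intros matrix_vector_mult_linear_continuous_on)
 moreover have "?S ~= {}" by simp
 ultimately obtain v where v: "v \<in> ?S" "!!h. h \<in> ?S ==> h \<bullet> (A *v h) <= v \<bullet> (A *v v)"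
  using continuous_attains_sup[OF compact_sphere] by blast
 define c where "c = v \<bullet> (A *v v)"
 have nv: "norm v = 1" using v by simp
 have le: "h \<bullet> (A *v h) <= c*(norm h)^2" for h
 proof (cases "h = 0")
  case False
  have "h \<bullet> (A *v h) = (norm h)^2*(((1/norm h) *\<^sub>R h) \<bullet> (A *v ((1/norm h) *\<^sub>R h)))"
   using False by (simp add: matrix_vector_mult_scaleR power2_eq_square)
  also have "... <= (norm h)^2*c"
   unfolding c_def using False by (intro mult_left_mono v) auto
  finally show ?thesis by (simp add: mult.commute)
 qed simp
 define N where "N = mat c - A"
 have Nv: "N *v h = c *\<^sub>R h - A *v h" for h
  by (simp add: N_def matrix_vector_mult_diff_rdistrib mat_mult_vec)
 have "psd N" unfolding psd_def
 proof (intro conjI allI)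
  show "symmetric_mat N" unfolding N_def by (intro symmetric_mat_diff symmetric_mat_mat A)
  show "0 <= h \<bullet> (N *v h)" for h using le[of h] by (simp add: Nv inner_diff_right power2_norm_eq_inner)
 qed
 moreover have "v \<bullet> (N *v v) = 0" using nv by (simp add: Nv inner_diff_right c_def power2_norm_eq_inner[symmetric])
 ultimately have "((N *v v) \<bullet> (N *v v))^2 <= 0" using psd_Cauchy_Schwarz[of N "N *v v" v] by simp
 hence "A *v v = c *\<^sub>R v" by (simp add: Nv)
 hence "is_eigenvalue A c" unfolding is_eigenvalue_def using nv by (intro exI[of _ v]) auto
 thus ?thesis using that le by blast
qed

section \<open>The Pucci class and its extremal operators\<close>

lemma pucci_class_bounds:
 assumes "A \<in> pucci_class ga Ga"
 shows "ga*(norm h)^2 <= h \<bullet> (A *v h)" "h \<bullet> (A *v h) <= Ga*(norm h)^2"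
proof -
 have A: "symmetric_mat A" "!!c. is_eigenvalue A c ==> ga <= c \<and> c <= Ga" using assms by (auto simp: pucci_class_def)
 obtain c where c: "is_eigenvalue A c" "!!h. h \<bullet> (A *v h) <= c*(norm h)^2"
  using symmetric_mat_max_eigenvalue[OF A(1)] by metis
 show "h \<bullet> (A *v h) <= Ga*(norm h)^2"
  using c(2)[of h] A(2)[OF c(1)] mult_right_mono[of c Ga "(norm h)^2"] by simp
 obtain d where d: "is_eigenvalue (- A) d" "!!h. h \<bullet> ((- A) *v h) <= d*(norm h)^2"
  using symmetric_mat_max_eigenvalue[OF symmetric_mat_minus[OF A(1)]] by metis
 have neg: "(- A) *v h = - (A *v h)" for h by (metis matrix_vector_mult_diff_rdistrib diff_0 matrix_vector_mult_0)
 have "is_eigenvalue A (- d)" using d(1) unfolding is_eigenvalue_def neg by (metis minus_equation_iff scaleR_minus_left)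
 hence "ga <= - d" using A(2) by blast
 thus "ga*(norm h)^2 <= h \<bullet> (A *v h)"
  using d(2)[of h] mult_right_mono[of ga "- d" "(norm h)^2"] unfolding neg by simp
qed

lemma pucci_class_trace:
 fixes A :: "real^'n^'n"
 assumes "A \<in> pucci_class ga Ga"
 shows "real CARD('n)*ga <= trace A" "trace A <= real CARD('n)*Ga"
proof -
 have "A $ i $ i = axis i 1 \<bullet> (A *v axis i 1)" for i
  by (simp add: inner_axis' matrix_vector_mult_basis column_def)
 hence "ga <= A $ i $ i \<and> A $ i $ i <= Ga" for i
  using pucci_class_bounds[OF assms, of "axis i 1"] by simp
 thus "real CARD('n)*ga <= trace A" "trace A <= real CARD('n)*Ga"
  unfolding trace_def using sum_bounded_below[of UNIV ga "\<lambda>i. A $ i $ i"] sum_bounded_above[of UNIV "\<lambda>i. A $ i $ i" Ga] by auto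
qed

text \<open>Through the rank-one decomposition this reduces to the lower bound on the quadratic form
  of \<open>A\<close>.\<close>

lemma trace_pucci_class_psd:
 fixes N :: "real^'n^'n"
 assumes A: "A \<in> pucci_class ga Ga" and N: "psd N"
 shows "ga*trace N <= trace (A ** N)"
proof -
 obtain V :: "'n => real^'n" where V: "N = (\<Sum>k\<in>UNIV. outer (V k))" by (rule psd_gram[OF N])
 have "ga*trace (\<Sum>k\<in>S. outer (V k)) <= trace (A ** (\<Sum>k\<in>S. outer (V k)))" if "finite S" for S
  using that
 proof (induction S rule: finite_induct)
  case (insert k S)
  have "trace (outer (V k)) = (norm (V k))^2"
   by (simp add: trace_def outer_def power2_norm_eq_inner inner_vec_def)
  thus ?case using insert pucci_class_bounds(1)[OF A, of "V k"]
   by (simp add: trace_add trace_mult_add_right trace_mult_outer distrib_left)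
 qed (simp add: trace_zero)
 thus ?thesis unfolding V by simp
qed

lemma mat_in_pucci_class: "ga <= Ga ==> mat ga \<in> pucci_class ga Ga"
 by (auto simp: pucci_class_def symmetric_mat_mat is_eigenvalue_def mat_mult_vec)

lemma pucci_class_entry:
 assumes "A \<in> pucci_class ga Ga" "0 <= ga"
 shows "\<bar>A $ i $ j\<bar> <= Ga"
proof -
 have sym: "symmetric_mat A" using assms by (simp add: pucci_class_def)
 have "\<bar>h \<bullet> (A *v h)\<bar> <= Ga*(norm h)^2" for h
  using pucci_class_bounds[OF assms(1), of h] assms(2) mult_nonneg_nonneg[OF assms(2) zero_le_power2[of "norm h"]] by linarith
 from selfadj_bound[OF selfadj_matrix_vector_mult[OF sym] this, of "axis j 1"]
 have "norm (A *v axis j 1) <= Ga" by simp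
 moreover have "(A *v axis j 1) $ i = A $ i $ j"
  by (simp add: matrix_vector_mult_def axis_def if_distrib cong: if_cong)
 ultimately show ?thesis using component_le_norm_cart[of "A *v axis j 1" i] by simp
qed

context
 fixes ga Ga :: real
 assumes ga: "0 < ga" "ga <= Ga"
begin

text \<open>Suprema and infima over the reals carry information only for bounded families; this
  provides the bound for both Pucci operators.\<close>

lemma bounded_trace_pucci_class:
 fixes M :: "real^'n^'n"
 shows "\<exists>C. \<forall>A\<in>pucci_class ga Ga. \<bar>trace (A ** M)\<bar> <= C"
proof (intro exI ballI)
 fix A :: "real^'n^'n" assume A: "A \<in> pucci_class ga Ga"
 have "\<bar>trace (A ** M)\<bar> <= (\<Sum>i\<in>UNIV. \<bar>\<Sum>k\<in>UNIV. A $ i $ k*M $ k $ i\<bar>)"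
  unfolding trace_def matrix_matrix_mult_def by simp
 also have "... <= (\<Sum>i\<in>UNIV. \<Sum>k\<in>UNIV. \<bar>A $ i $ k*M $ k $ i\<bar>)" by (intro sum_mono sum_abs)
 also have "... <= (\<Sum>i\<in>UNIV. \<Sum>k\<in>UNIV. Ga*\<bar>M $ k $ i\<bar>)"
  unfolding abs_mult using pucci_class_entry[OF A] ga by (intro sum_mono mult_right_mono) auto
 finally show "\<bar>trace (A ** M)\<bar> <= (\<Sum>i\<in>UNIV. \<Sum>k\<in>UNIV. Ga*\<bar>M $ k $ i\<bar>)" .
qed

lemma pucci_minus_le: "A \<in> pucci_class ga Ga ==> pucci_minus ga Ga M <= - trace (A ** M)"
proof -
 assume A: "A \<in> pucci_class ga Ga"
 obtain C where C: "\<forall>A\<in>pucci_class ga Ga. \<bar>trace (A ** M)\<bar> <= C" using bounded_trace_pucci_class by blast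
 show ?thesis unfolding pucci_minus_def
  by (rule cINF_lower[OF _ A]) (use C in \<open>auto intro!: bdd_belowI[of _ "- C"] simp: abs_le_iff\<close>)
qed

lemma pucci_plus_ge: "A \<in> pucci_class ga Ga ==> - trace (A ** M) <= pucci_plus ga Ga M"
proof -
 assume A: "A \<in> pucci_class ga Ga"
 obtain C where C: "\<forall>A\<in>pucci_class ga Ga. \<bar>trace (A ** M)\<bar> <= C" using bounded_trace_pucci_class by blast
 show ?thesis unfolding pucci_plus_def
  by (rule cSUP_upper[OF A]) (use C in \<open>auto intro!: bdd_aboveI[of _ C] simp: abs_le_iff minus_le_iff\<close>)
qed

lemma pucci_minus_geI: "(!!A. A \<in> pucci_class ga Ga ==> c <= - trace (A ** M)) ==> c <= pucci_minus ga Ga M"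
 unfolding pucci_minus_def using mat_in_pucci_class[OF ga(2)] by (intro cINF_greatest) auto

lemma pucci_plus_leI: "(!!A. A \<in> pucci_class ga Ga ==> - trace (A ** M) <= c) ==> pucci_plus ga Ga M <= c"
 unfolding pucci_plus_def using mat_in_pucci_class[OF ga(2)] by (intro cSUP_least) auto

lemma pucci_plus_uminus:
 fixes M :: "real^'n^'n"
 shows "pucci_plus ga Ga (- M) = - pucci_minus ga Ga M"
proof (rule antisym)
 show "pucci_plus ga Ga (- M) <= - pucci_minus ga Ga M"
 proof (rule pucci_plus_leI)
  fix A :: "real^'n^'n" assume "A \<in> pucci_class ga Ga"
  from pucci_minus_le[OF this, of M] show "- trace (A ** - M) <= - pucci_minus ga Ga M"
   by (simp add: trace_mult_minus_right)
 qed
 have "- pucci_plus ga Ga (- M) <= pucci_minus ga Ga M"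
 proof (rule pucci_minus_geI)
  fix A :: "real^'n^'n" assume "A \<in> pucci_class ga Ga"
  from pucci_plus_ge[OF this, of "- M"] show "- pucci_plus ga Ga (- M) <= - trace (A ** M)"
   by (simp add: trace_mult_minus_right)
 qed
 thus "- pucci_minus ga Ga M <= pucci_plus ga Ga (- M)" by simp
qed

lemma pucci_minus_add_le:
 fixes X Y :: "real^'n^'n"
 assumes "!!A. A \<in> pucci_class ga Ga ==> c <= - trace (A ** Y)"
 shows "pucci_minus ga Ga X + c <= pucci_minus ga Ga (X + Y)"
proof (rule pucci_minus_geI)
 fix A :: "real^'n^'n" assume "A \<in> pucci_class ga Ga"
 from pucci_minus_le[OF this, of X] assms[OF this]
 show "pucci_minus ga Ga X + c <= - trace (A ** (X + Y))" by (simp add: trace_mult_add_right)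
qed

lemma pucci_minus_scaleR:
 fixes X :: "real^'n^'n"
 assumes "t > 0"
 shows "pucci_minus ga Ga (t *\<^sub>R X) = t*pucci_minus ga Ga X"
proof -
 have le: "t*pucci_minus ga Ga X <= pucci_minus ga Ga (t *\<^sub>R X)" if "t > 0" for t and X :: "real^'n^'n"
 proof (rule pucci_minus_geI)
  fix A :: "real^'n^'n" assume "A \<in> pucci_class ga Ga"
  from mult_left_mono[OF pucci_minus_le[OF this, of X], of t] that
  show "t*pucci_minus ga Ga X <= - trace (A ** (t *\<^sub>R X))" by (simp add: trace_mult_scaleR_right)
 qed
 have "(1/t)*pucci_minus ga Ga (t *\<^sub>R X) <= pucci_minus ga Ga X"
  using le[of "1/t" "t *\<^sub>R X"] assms by simp
 hence "pucci_minus ga Ga (t *\<^sub>R X) <= t*pucci_minus ga Ga X" using assms by (simp add: field_simps)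
 thus ?thesis using le[OF assms, of X] by simp
qed

end

section \<open>Second-order jets\<close>

lemma upjet_mono:
 assumes "upjet b x p T" "d > 0" "!!y. norm (y-x) < d ==> u y - u x <= b y - b x"
 shows "upjet u x p T"
 unfolding upjet_def
proof (intro allI impI)
 fix e :: real assume "e > 0"
 then obtain d' where d': "d' > 0" "!!y. norm (y-x) < d' ==> b y <= b x + p \<bullet> (y-x) + 1/2*((y-x) \<bullet> T (y-x)) + e*(norm (y-x))^2"
  using assms(1) unfolding upjet_def by blast
 show "\<exists>d>0. \<forall>y. norm (y-x) < d --> u y <= u x + p \<bullet> (y-x) + 1/2*((y-x) \<bullet> T (y-x)) + e*(norm (y-x))^2"
 proof (intro exI[of _ "min d d'"] conjI allI impI)
  fix y assume "norm (y-x) < min d d'"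
  thus "u y <= u x + p \<bullet> (y-x) + 1/2*((y-x) \<bullet> T (y-x)) + e*(norm (y-x))^2"
   using assms(3)[of y] d'(2)[of y] by auto
 qed (use assms(2) d' in auto)
qed

lemma upjet_add:
 assumes "upjet u x p T" "upjet v x q S"
 shows "upjet (\<lambda>y. u y + v y) x (p + q) (\<lambda>h. T h + S h)"
 unfolding upjet_def
proof (intro allI impI)
 fix e :: real assume "e > 0"
 hence e: "e/2 > 0" by simp
 obtain d where d: "d > 0" "!!y. norm (y-x) < d ==> u y <= u x + p \<bullet> (y-x) + 1/2*((y-x) \<bullet> T (y-x)) + e/2*(norm (y-x))^2"
  using assms(1) e unfolding upjet_def by blast
 obtain d' where d': "d' > 0" "!!y. norm (y-x) < d' ==> v y <= v x + q \<bullet> (y-x) + 1/2*((y-x) \<bullet> S (y-x)) + e/2*(norm (y-x))^2"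
  using assms(2) e unfolding upjet_def by blast
 show "\<exists>d>0. \<forall>y. norm (y-x) < d --> u y + v y <= u x + v x + (p + q) \<bullet> (y-x) + 1/2*((y-x) \<bullet> (T (y-x) + S (y-x))) + e*(norm (y-x))^2"
 proof (intro exI[of _ "min d d'"] conjI allI impI)
  fix y assume "norm (y-x) < min d d'"
  hence "u y + v y <= (u x + p \<bullet> (y-x) + 1/2*((y-x) \<bullet> T (y-x)) + e/2*(norm (y-x))^2) +
    (v x + q \<bullet> (y-x) + 1/2*((y-x) \<bullet> S (y-x)) + e/2*(norm (y-x))^2)"
   by (intro add_mono d d') auto
  also have "... = u x + v x + (p + q) \<bullet> (y-x) + 1/2*((y-x) \<bullet> (T (y-x) + S (y-x))) + e*(norm (y-x))^2"
   by (simp add: inner_add_left inner_add_right[of "y - x" "T (y-x)"] add_divide_distrib)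
  finally show "u y + v y <= u x + v x + (p + q) \<bullet> (y-x) + 1/2*((y-x) \<bullet> (T (y-x) + S (y-x))) + e*(norm (y-x))^2" .
 qed (use d d' in auto)
qed

lemma upjet_scale:
 assumes "upjet u x p T" "t > 0"
 shows "upjet (\<lambda>y. t*u y) x (t *\<^sub>R p) (\<lambda>h. t *\<^sub>R T h)"
 unfolding upjet_def
proof (intro allI impI)
 fix e :: real assume "e > 0"
 hence e: "e/t > 0" using assms by simp
 obtain d where d: "d > 0" "!!y. norm (y-x) < d ==> u y <= u x + p \<bullet> (y-x) + 1/2*((y-x) \<bullet> T (y-x)) + e/t*(norm (y-x))^2"
  using assms(1) e unfolding upjet_def by blast
 show "\<exists>d>0. \<forall>y. norm (y-x) < d --> t*u y <= t*u x + (t *\<^sub>R p) \<bullet> (y-x) + 1/2*((y-x) \<bullet> (t *\<^sub>R T (y-x))) + e*(norm (y-x))^2"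
 proof (intro exI[of _ d] conjI allI impI)
  fix y assume "norm (y-x) < d"
  from mult_left_mono[OF d(2)[OF this], of t] assms(2)
  show "t*u y <= t*u x + (t *\<^sub>R p) \<bullet> (y-x) + 1/2*((y-x) \<bullet> (t *\<^sub>R T (y-x))) + e*(norm (y-x))^2"
   by (simp add: distrib_left)
 qed (use d in auto)
qed

definition mjet :: "(real^'n => real) => real^'n => real^'n => real^'n^'n => bool" where
 "mjet u x p X \<longleftrightarrow> symmetric_mat X \<and> upjet u x p ((*v) X)"

text \<open>The way in which test functions enter: \<open>b\<close> plays the role of the function
  that touches \<open>u\<close> from above at \<open>x\<close>.\<close>

lemma mjet_mono:
 assumes "mjet b x p X" "d > 0" "!!y. norm (y-x) < d ==> u y - u x <= b y - b x"
 shows "mjet u x p X"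
 using assms upjet_mono unfolding mjet_def by blast

lemma mjet_add: "mjet u x p X ==> mjet v x q Y ==> mjet (\<lambda>y. u y + v y) x (p + q) (X + Y)"
 using upjet_add[of u x p "(*v) X" v q "(*v) Y"]
 by (simp add: mjet_def symmetric_mat_add flip: matrix_vector_mult_add_rdistrib)

lemma mjet_scale: "mjet u x p X ==> t > 0 ==> mjet (\<lambda>y. t*u y) x (t *\<^sub>R p) (t *\<^sub>R X)"
 using upjet_scale[of u x p "(*v) X" t]
 by (simp add: mjet_def symmetric_mat_scaleR scaleR_matrix_vector_assoc)

lemma mjetI:
 assumes "symmetric_mat X" "d > 0"
  "!!h. norm h < d ==> u (x + h) <= u x + p \<bullet> h + 1/2*(h \<bullet> (X *v h))"
 shows "mjet u x p X"
 unfolding mjet_def upjet_def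
proof (intro conjI allI impI assms(1) exI[of _ d] assms(2))
 fix e :: real and y assume e: "e > 0" and "norm (y-x) < d"
 from assms(3)[OF this(2)] have "u y <= u x + p \<bullet> (y-x) + 1/2*((y-x) \<bullet> (X *v (y-x)))" by simp
 moreover have "0 <= e*(norm (y-x))^2" using e by simp
 ultimately show "u y <= u x + p \<bullet> (y-x) + 1/2*((y-x) \<bullet> (X *v (y-x))) + e*(norm (y-x))^2" by linarith
qed

lemma mjetD:
 assumes "mjet u x p X" "e > 0"
 obtains d where "d > 0" "!!h. norm h < d ==> u (x + h) <= u x + p \<bullet> h + 1/2*(h \<bullet> (X *v h)) + e*(norm h)^2"
proof -
 obtain d where d: "d > 0" "!!y. norm (y-x) < d ==> u y <= u x + p \<bullet> (y-x) + 1/2*((y-x) \<bullet> (X *v (y-x))) + e*(norm (y-x))^2"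
  using assms unfolding mjet_def upjet_def by blast
 show ?thesis
  by (rule that[OF d(1)]) (use d(2)[of "x + _"] in auto)
qed

lemma mjet_const: "mjet (\<lambda>y. c) x 0 0"
 by (rule mjetI[of _ 1]) (auto simp: symmetric_mat_0)

lemma mjet_linear: "mjet (\<lambda>y. a \<bullet> (y-z)) x a 0"
 by (rule mjetI[of _ 1]) (auto simp: symmetric_mat_0 algebra_simps)

lemma mjet_square: "mjet (\<lambda>y. k*(norm (y-z))^2) x ((2 * k) *\<^sub>R (x-z)) (mat (2 * k))"
proof (rule mjetI[of _ 1])
 fix h :: "real^'a"
 have "(norm (x + h - z))^2 = (norm (x-z))^2 + 2*((x-z) \<bullet> h) + (norm h)^2"
  by (simp add: power2_norm_eq_inner algebra_simps) (simp add: inner_commute)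
 thus "k*(norm (x + h - z))^2 <= k*(norm (x-z))^2 + (2 * k) *\<^sub>R (x-z) \<bullet> h + 1/2*(h \<bullet> (mat (2 * k) *v h))"
  by (simp add: mat_mult_vec power2_norm_eq_inner distrib_left)
qed (auto simp: symmetric_mat_mat)

text \<open>The mean value theorem applied to the remainder, whose derivative is \<open>o(h)\<close>
  by the differentiability of \<open>ph'\<close> at the single point \<open>s\<close>.\<close>

lemma peano_second_order:
 fixes ph :: "real => real"
 assumes r: "r > 0" and d1: "!!t. \<bar>t - s\<bar> < r ==> (ph has_real_derivative ph' t) (at t)"
  and d2: "(ph' has_real_derivative b) (at s)" and e: "e > 0"
 obtains d where "d > 0" "!!t. \<bar>t\<bar> < d ==> \<bar>ph (s + t) - ph s - ph' s*t - 1/2*b*t^2\<bar> <= e*t^2"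
proof -
 have "(\<lambda>h. (ph' (s + h) - ph' s)/h) \<midarrow>0\<rightarrow> b" using d2 by (simp add: DERIV_def)
 from LIM_D[OF this e] obtain d where d: "d > 0"
  "!!h. h ~= 0 ==> \<bar>h\<bar> < d ==> \<bar>(ph' (s + h) - ph' s)/h - b\<bar> < e" by auto
 have D: "\<bar>ph' (s + h) - ph' s - b*h\<bar> <= e*\<bar>h\<bar>" if "\<bar>h\<bar> < d" for h
 proof (cases "h = 0")
  case False
  have "ph' (s + h) - ph' s - b*h = ((ph' (s + h) - ph' s)/h - b)*h" using False by (simp add: field_simps)
  thus ?thesis using d(2)[OF False that] by (simp add: abs_mult mult_right_mono)
 qed simp
 show ?thesis
 proof (rule that[of "min d r"])
  fix t :: real assume t: "\<bar>t\<bar> < min d r"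
  define ps where "ps h = ph (s + h) - ph s - ph' s*h - 1/2*b*h^2" for h
  have der: "(ps has_real_derivative (ph' (s + h) - ph' s - b*h)) (at h)" if "\<bar>h\<bar> < min d r" for h
  proof -
   have "(ph has_real_derivative ph' (h + s)) (at (h + s))" using that by (intro d1) auto
   hence "((\<lambda>h. ph (h + s)) has_real_derivative ph' (h + s)) (at h)" by (simp add: DERIV_shift)
   hence 1: "((\<lambda>h. ph (s + h)) has_real_derivative ph' (s + h)) (at h)" by (simp add: add.commute)
   show ?thesis unfolding ps_def by (rule derivative_eq_intros 1 refl)+ simp
  qed
  have "norm (ps t - ps 0) <= (e*\<bar>t\<bar>)*norm (t-0)"
  proof (rule field_differentiable_bound[of "{- \<bar>t\<bar>..\<bar>t\<bar>}"])
   show "(ps has_field_derivative (ph' (s + h) - ph' s - b*h)) (at h within {- \<bar>t\<bar>..\<bar>t\<bar>})" if "h \<in> {- \<bar>t\<bar>..\<bar>t\<bar>}" for h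
    using that t by (intro DERIV_subset[OF der]) auto
   show "norm (ph' (s + h) - ph' s - b*h) <= e*\<bar>t\<bar>" if "h \<in> {- \<bar>t\<bar>..\<bar>t\<bar>}" for h
   proof -
    have "\<bar>h\<bar> <= \<bar>t\<bar>" using that by auto
    hence "e*\<bar>h\<bar> <= e*\<bar>t\<bar>" using e by simp
    thus ?thesis using D[of h] \<open>\<bar>h\<bar> <= \<bar>t\<bar>\<close> t by simp
   qed
  qed auto
  moreover have "ps 0 = 0" by (simp add: ps_def)
  ultimately show "\<bar>ph (s + t) - ph s - ph' s*t - 1/2*b*t^2\<bar> <= e*t^2"
   by (simp add: ps_def power2_eq_square mult.assoc)
 qed (use d r in auto)
qed

text \<open>Writing the function through the square of the norm avoids the singularity at
  \<open>z\<close>: the increment of the argument is the polynomial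
  \<open>t = 2*(w \<bullet> h) + (norm h)^2\<close>, and a one-dimensional Taylor expansion does the
  rest.\<close>

lemma mjet_radial:
 fixes x z :: "real^'n"
 assumes r: "r > 0" and d1: "!!t. \<bar>t - (norm (x-z))^2\<bar> < r ==> (ph has_real_derivative ph' t) (at t)"
  and d2: "(ph' has_real_derivative b) (at ((norm (x-z))^2))"
 shows "mjet (\<lambda>y. ph ((norm (y-z))^2)) x ((2*ph' ((norm (x-z))^2)) *\<^sub>R (x-z))
   (mat (2*ph' ((norm (x-z))^2)) + (4*b) *\<^sub>R outer (x-z))"
 unfolding mjet_def upjet_def
proof (intro conjI allI impI)
 define w where "w = x - z"
 define s where "s = (norm w)^2"
 define a where "a = ph' s"
 let ?X = "mat (2*a) + (4*b) *\<^sub>R outer w"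
 show "symmetric_mat (mat (2*ph' ((norm (x-z))^2)) + (4*b) *\<^sub>R outer (x-z))"
  by (intro symmetric_mat_add symmetric_mat_mat symmetric_mat_scaleR symmetric_mat_outer)
 fix e :: real assume e: "e > 0"
 define R where "R = 2*norm w + 1"
 have R: "R >= 1" by (simp add: R_def)
 define ep where "ep = e/(2 * R^2)"
 have ep: "ep > 0" using e R by (simp add: ep_def)
 obtain d where d: "d > 0" "!!t. \<bar>t\<bar> < d ==> \<bar>ph (s + t) - ph s - a*t - 1/2*b*t^2\<bar> <= ep*t^2"
  using peano_second_order[OF r d1 d2 ep] unfolding a_def s_def w_def by metis
 define d' where "d' = min 1 (min (d/R) (e/(2*((\<bar>b\<bar> + 1) * R))))"
 have d': "d' > 0" "d' <= 1" "R*d' <= d" "(\<bar>b\<bar> * R)*d' <= e/2"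
 proof -
  show "d' > 0" using d e R by (auto simp: d'_def)
  show "d' <= 1" by (simp add: d'_def)
  have "d' <= d/R" by (simp add: d'_def)
  thus "R*d' <= d" using R by (simp add: field_simps)
  have "d' <= e/(2*((\<bar>b\<bar> + 1) * R))" by (simp add: d'_def)
  hence "(\<bar>b\<bar> * R)*d' <= ((\<bar>b\<bar> + 1) * R)*(e/(2*((\<bar>b\<bar> + 1) * R)))"
   using R \<open>d' > 0\<close> by (intro mult_mono) auto
  also have "... = e/2"
  proof -
   have "(\<bar>b\<bar> + 1) * R ~= 0" using R by (simp add: add_nonneg_eq_0_iff)
   thus ?thesis by simp
  qed
  finally show "(\<bar>b\<bar> * R)*d' <= e/2" .
 qed
 have main: "ph ((norm (w + h))^2) <= ph s + ((2*a) *\<^sub>R w) \<bullet> h + 1/2*(h \<bullet> (?X *v h)) + e*(norm h)^2"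
  if h: "norm h < d'" for h
 proof -
  define k where "k = norm h"
  define m where "m = w \<bullet> h"
  define t where "t = 2*m + k^2"
  have k: "0 <= k" "k <= 1" "k < d'" using h d' by (auto simp: k_def)
  have m: "\<bar>m\<bar> <= norm w * k" unfolding m_def k_def by (rule Cauchy_Schwarz_ineq2)
  have st: "(norm (w + h))^2 = s + t"
   by (simp add: s_def t_def m_def k_def power2_norm_eq_inner algebra_simps) (simp add: inner_commute)
  have k2: "k^2 <= k" using k by (simp add: power2_eq_square mult_left_le)
  have tR: "\<bar>t\<bar> <= R * k"
   using m k2 k zero_le_power2[of k] unfolding t_def R_def abs_le_iff distrib_right by linarith
  have "R * k < R*d'" using k R by (intro mult_strict_left_mono) auto
  hence "\<bar>t\<bar> < d" using tR d'(3) by linarith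
  hence "ph (s + t) <= ph s + a*t + 1/2*b*t^2 + ep*t^2" using d(2)[of t] by (simp add: abs_le_iff)
  also have "ep*t^2 <= e/2 * k^2"
  proof -
   have "t^2 <= (R * k)^2" using tR by (rule abs_le_square_iff[THEN iffD1, of t "R * k", OF order_trans[OF _ abs_ge_self]])
   hence "ep*t^2 <= ep*(R * k)^2" using ep by simp
   also have "... = e/2 * k^2" using R by (simp add: ep_def power_mult_distrib)
   finally show ?thesis .
  qed
  also have "1/2*b*t^2 <= 2*b*m^2 + e/2 * k^2"
  proof -
   have "1/2*b*t^2 - 2*b*m^2 = b*(2*m + k^2/2) * k^2"
    by (simp add: t_def power2_eq_square algebra_simps)
   also have "... <= \<bar>b*(2*m + k^2/2)\<bar> * k^2" by (intro mult_right_mono) auto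
   also have "\<bar>b*(2*m + k^2/2)\<bar> <= \<bar>b\<bar>*(R * k)"
   proof -
    have "\<bar>2*m + k^2/2\<bar> <= R * k"
     using m k2 k zero_le_power2[of k] unfolding R_def abs_le_iff distrib_right by linarith
    thus ?thesis by (simp add: abs_mult mult_left_mono)
   qed
   also have "\<bar>b\<bar>*(R * k) <= e/2"
    using d'(4) k mult_left_mono[of k d' "\<bar>b\<bar> * R"] R by (simp add: mult.assoc)
   finally show ?thesis by (simp add: mult_right_mono)
  qed
  finally have "ph (s + t) <= ph s + a*t + 2*b*m^2 + e * k^2" by simp
  moreover have "h \<bullet> (?X *v h) = 2*a * k^2 + 4*b*m^2"
   by (simp add: matrix_vector_mult_add_rdistrib mat_mult_vec scaleR_matrix_vector_assoc[symmetric] outer_mult_vec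
     inner_add_right k_def m_def power2_norm_eq_inner power2_eq_square[of "h \<bullet> w"] inner_commute)
  ultimately show ?thesis unfolding st by (simp add: t_def m_def[symmetric] k_def[symmetric] distrib_left)
 qed
 show "\<exists>d>0. \<forall>y. norm (y-x) < d --> ph ((norm (y-z))^2) <= ph ((norm (x-z))^2) + ((2*ph' ((norm (x-z))^2)) *\<^sub>R (x-z)) \<bullet> (y-x)
   + 1/2*((y-x) \<bullet> ((mat (2*ph' ((norm (x-z))^2)) + (4*b) *\<^sub>R outer (x-z)) *v (y-x))) + e*(norm (y-x))^2"
 proof (intro exI[of _ d'] conjI allI impI d')
  fix y assume "norm (y-x) < d'"
  from main[OF this]
  show "ph ((norm (y-z))^2) <= ph ((norm (x-z))^2) + ((2*ph' ((norm (x-z))^2)) *\<^sub>R (x-z)) \<bullet> (y-x)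
   + 1/2*((y-x) \<bullet> ((mat (2*ph' ((norm (x-z))^2)) + (4*b) *\<^sub>R outer (x-z)) *v (y-x))) + e*(norm (y-x))^2"
   unfolding a_def s_def w_def by simp
 qed
qed

lemma mjet_exp:
 "mjet (\<lambda>y. c*exp (- al*(norm (y-z))^2)) x ((- 2*al*c*exp (- al*(norm (x-z))^2)) *\<^sub>R (x-z))
   (mat (- 2*al*c*exp (- al*(norm (x-z))^2)) + (4*al^2*c*exp (- al*(norm (x-z))^2)) *\<^sub>R outer (x-z))"
proof -
 have 1: "((\<lambda>t. c*exp (- al*t)) has_real_derivative (- al*c*exp (- al*t))) (at t)" for t
  by (auto intro!: derivative_eq_intros)
 have 2: "((\<lambda>t. - al*c*exp (- al*t)) has_real_derivative (al^2*c*exp (- al*t))) (at t)" for t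
  by (auto intro!: derivative_eq_intros simp: power2_eq_square)
 from mjet_radial[OF zero_less_one 1 2, where x = x and z = z] show ?thesis by (simp add: mult.assoc)
qed

text \<open>The inequality of extremal operators to which solutions and differences of solutions are
  reduced. The set \<open>D\<close> is arbitrary because the inequality is often needed only where
  \<open>u\<close> is positive.\<close>

definition esub :: "real => real => real => (real^'n) set => (real^'n => real) => (real^'n => real) => bool" where
 "esub ga Ga de D u g \<longleftrightarrow> (\<forall>x\<in>D. \<forall>p X. mjet u x p X --> pucci_minus ga Ga X <= de*norm p + g x)"

lemma esubD: "esub ga Ga de D u g ==> x \<in> D ==> mjet u x p X ==> pucci_minus ga Ga X <= de*norm p + g x"
 by (auto simp: esub_def)

lemma esub_mono: "esub ga Ga de D u g ==> D' \<subseteq> D ==> (!!x. x \<in> D' ==> g x <= g' x) ==> esub ga Ga de D' u g'"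
 unfolding esub_def by (meson add_left_mono order_trans subsetD)

lemma esub_scale:
 assumes "0 < ga" "ga <= Ga" "esub ga Ga de D u g" "t > 0"
 shows "esub ga Ga de D (\<lambda>x. t*u x) (\<lambda>x. t*g x)"
 unfolding esub_def
proof (intro ballI allI impI)
 fix x p X assume x: "x \<in> D" "mjet (\<lambda>x. t*u x) x p X"
 from mjet_scale[OF this(2), of "1/t"] assms(4) have "mjet u x ((1/t) *\<^sub>R p) ((1/t) *\<^sub>R X)" by simp
 from esubD[OF assms(3) x(1) this] assms(4) have "(1/t)*pucci_minus ga Ga X <= de*norm ((1/t) *\<^sub>R p) + g x"
  by (simp add: pucci_minus_scaleR[OF assms(1,2)])
 from mult_left_mono[OF this, of t] assms(4) show "pucci_minus ga Ga X <= de*norm p + t*g x"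
  by (simp add: distrib_left)
qed

text \<open>For a large exponent the second derivative in the radial direction dominates.\<close>

lemma gaussian_barrier:
 fixes ga Ga de C r :: real
 assumes ga: "0 < ga" "ga <= Ga" and de: "de >= 0" and r: "r > 0"
 obtains al where "al > 0"
  "!!x z :: real^'n. r <= norm (x-z) ==> \<exists>p X. mjet (\<lambda>y. - exp (- al*(norm (y-z))^2)) x p X \<and>
    C*exp (- al*(norm (x-z))^2) <= pucci_minus ga Ga X - de*norm p"
proof -
 define n where "n = real CARD('n)"
 \<comment> \<open>Chosen so that \<open>r*(2*al*ga*r - de)\<close> is at least
   \<open>n*Ga + \<bar>C\<bar>\<close>. The radial second derivative contributes a term quadratic in
   \<open>al\<close>, against terms that are only linear in \<open>al\<close>.\<close>
 define al where "al = 1 + (de*r + n*Ga + \<bar>C\<bar>)/(2*ga*r^2)"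
 have n: "n >= 0" by (simp add: n_def)
 have num: "0 <= de*r + n*Ga + \<bar>C\<bar>" using de r n ga by simp
 have al1: "al >= 1" using num ga r by (simp add: al_def)
 have "2*al*ga*r^2 = 2*ga*r^2 + (de*r + n*Ga + \<bar>C\<bar>)" using ga r by (simp add: al_def field_simps)
 hence al2: "r*(2*al*ga*r - de) >= n*Ga + \<bar>C\<bar>" using ga r by (simp add: power2_eq_square algebra_simps)
 have al3: "2*al*ga*r - de >= 0"
  using al2 n ga r by (smt (verit) mult_nonneg_nonneg mult_pos_neg)
 show ?thesis
 proof (rule that[of al])
  show "al > 0" using al1 by simp
  fix x z :: "real^'n" assume rx: "r <= norm (x-z)"
  define E where "E = exp (- al*(norm (x-z))^2)"
  define k where "k = norm (x-z)"
  have E: "E > 0" by (simp add: E_def)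
  define p where "p = (2*al*E) *\<^sub>R (x-z)"
  define X where "X = mat (2*al*E) + (- 4*al^2*E) *\<^sub>R outer (x-z)"
  have jet: "mjet (\<lambda>y. - exp (- al*(norm (y-z))^2)) x p X"
   using mjet_exp[of "-1" al z x] by (simp add: p_def X_def E_def)
  have "E*(4*al^2*ga * k^2 - 2*al*n*Ga) <= pucci_minus ga Ga X"
  proof (rule pucci_minus_geI[OF ga])
   fix A :: "real^'n^'n" assume A: "A \<in> pucci_class ga Ga"
   have "- trace (A ** X) = E*(4*al^2*((x-z) \<bullet> (A *v (x-z))) - 2*al*trace A)"
    unfolding X_def trace_mult_add_right trace_mult_mat trace_mult_scaleR_right trace_mult_outer
    by (simp only: algebra_simps)
   moreover have "4*al^2*(ga * k^2) <= 4*al^2*((x-z) \<bullet> (A *v (x-z)))"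
    unfolding k_def by (intro mult_left_mono pucci_class_bounds(1)[OF A]) auto
   moreover have "2*al*trace A <= 2*al*(n*Ga)"
    unfolding n_def using al1 by (intro mult_left_mono pucci_class_trace(2)[OF A]) auto
   ultimately show "E*(4*al^2*ga * k^2 - 2*al*n*Ga) <= - trace (A ** X)"
    using E by (simp add: mult.assoc)
  qed
  moreover have "de*norm p = E*(2*al*de * k)" using al1 E by (simp add: p_def k_def)
  moreover have "C <= 4*al^2*ga * k^2 - 2*al*n*Ga - 2*al*de * k"
  proof -
   have "r*(2*al*ga*r - de) <= k*(2*al*ga * k - de)"
    using rx r al1 al3 ga by (intro mult_mono) (auto simp: k_def)
   hence "\<bar>C\<bar> <= k*(2*al*ga * k - de) - n*Ga" using al2 by linarith
   moreover from this have "1*(k*(2*al*ga * k - de) - n*Ga) <= 2*al*(k*(2*al*ga * k - de) - n*Ga)"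
    using al1 by (intro mult_right_mono) auto
   ultimately show ?thesis by (simp add: power2_eq_square algebra_simps)
  qed
  hence "E*C <= E*(4*al^2*ga * k^2 - 2*al*n*Ga - 2*al*de * k)" using E by simp
  moreover have "E*(4*al^2*ga * k^2 - 2*al*n*Ga - 2*al*de * k) = E*(4*al^2*ga * k^2 - 2*al*n*Ga) - E*(2*al*de * k)"
   by (simp only: right_diff_distrib)
  ultimately have "C*E <= pucci_minus ga Ga X - de*norm p" by (simp only: mult.commute[of C E])
  with jet show "\<exists>p X. mjet (\<lambda>y. - exp (- al*(norm (y-z))^2)) x p X \<and>
    C*exp (- al*(norm (x-z))^2) <= pucci_minus ga Ga X - de*norm p" unfolding E_def by blast
 qed
qed

section \<open>Uniformly elliptic operators\<close>

lemma upjet_fst: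
 fixes g :: "'a::euclidean_space => real" and y :: 'a
 assumes "upjet g x p T"
 shows "upjet (\<lambda>z. g (fst z)) (x, y) (p, 0) (\<lambda>h. (T (fst h), 0))"
 unfolding upjet_def
proof (intro allI impI)
 fix e :: real assume e: "e > 0"
 obtain d where d: "d > 0" "!!y. norm (y-x) < d ==> g y <= g x + p \<bullet> (y-x) + 1/2*((y-x) \<bullet> T (y-x)) + e*(norm (y-x))^2"
  using assms e unfolding upjet_def by blast
 show "\<exists>d>0. \<forall>z. norm (z - (x, y)) < d --> g (fst z) <= g (fst (x, y)) + (p, 0) \<bullet> (z - (x, y)) +
   1/2*((z - (x, y)) \<bullet> (T (fst (z - (x, y))), 0)) + e*(norm (z - (x, y)))^2"
 proof (intro exI[of _ d] conjI allI impI d)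
  fix z assume z: "norm (z - (x, y)) < d"
  obtain a b where ab: "z = (a, b)" by (cases z)
  have n: "norm (a-x) <= norm (z - (x, y))" using norm_fst_le[of "a - x" "b - y"] by (simp add: ab)
  hence "e*(norm (a-x))^2 <= e*(norm (z - (x, y)))^2" using e by (intro mult_left_mono power_mono) auto
  thus "g (fst z) <= g (fst (x, y)) + (p, 0) \<bullet> (z - (x, y)) + 1/2*((z - (x, y)) \<bullet> (T (fst (z - (x, y))), 0)) + e*(norm (z - (x, y)))^2"
   using d(2)[of a] n z by (simp add: ab)
 qed
qed

lemma upjet_fst_minus_snd:
 fixes f :: "'a::euclidean_space => real"
 assumes "upjet f (x-y) p T"
 shows "upjet (\<lambda>z. f (fst z - snd z)) (x, y) (p, - p) (\<lambda>h. (T (fst h - snd h), - T (fst h - snd h)))"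
 unfolding upjet_def
proof (intro allI impI)
 fix e :: real assume e: "e > 0"
 hence "e/2 > 0" by simp
 then obtain d where d: "d > 0" "!!w. norm (w - (x-y)) < d ==> f w <= f (x-y) + p \<bullet> (w - (x-y)) + 1/2*((w - (x-y)) \<bullet> T (w - (x-y))) + e/2*(norm (w - (x-y)))^2"
  using assms unfolding upjet_def by blast
 show "\<exists>d>0. \<forall>z. norm (z - (x, y)) < d --> f (fst z - snd z) <= f (fst (x, y) - snd (x, y)) + (p, - p) \<bullet> (z - (x, y)) +
   1/2*((z - (x, y)) \<bullet> (T (fst (z - (x, y)) - snd (z - (x, y))), - T (fst (z - (x, y)) - snd (z - (x, y))))) + e*(norm (z - (x, y)))^2"
 proof (intro exI[of _ "d/2"] conjI allI impI)
  fix z assume z: "norm (z - (x, y)) < d/2"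
  obtain a b where ab: "z = (a, b)" by (cases z)
  define h where "h = a - x"
  define k where "k = b - y"
  have n: "norm h <= norm (h, k)" "norm k <= norm (h, k)" using norm_fst_le norm_snd_le by blast+
  have zhk: "z - (x, y) = (h, k)" by (simp add: ab h_def k_def)
  have w: "(a-b) - (x-y) = h - k" by (simp add: h_def k_def)
  have "norm (h-k) < d" using norm_triangle_ineq4[of h k] n z unfolding zhk by linarith
  hence "f (a-b) <= f (x-y) + p \<bullet> (h-k) + 1/2*((h-k) \<bullet> T (h-k)) + e/2*(norm (h-k))^2"
   using d(2)[of "a - b"] unfolding w by simp
  moreover have "(norm (h-k))^2 <= 2*(norm (h, k))^2"
  proof -
   have "(norm (h-k))^2 + (norm (h + k))^2 = 2*(norm h)^2 + 2*(norm k)^2"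
    by (simp add: power2_norm_eq_inner algebra_simps)
   moreover have "(norm (h, k))^2 = (norm h)^2 + (norm k)^2" by (simp add: norm_Pair)
   ultimately show ?thesis using zero_le_power2[of "norm (h + k)"] by linarith
  qed
  hence "e/2*(norm (h-k))^2 <= e/2*(2*(norm (h, k))^2)" using e by (intro mult_left_mono) auto
  ultimately have "f (a-b) <= f (x-y) + p \<bullet> (h-k) + 1/2*((h-k) \<bullet> T (h-k)) + e*(norm (h, k))^2" by simp
  thus "f (fst z - snd z) <= f (fst (x, y) - snd (x, y)) + (p, - p) \<bullet> (z - (x, y)) +
   1/2*((z - (x, y)) \<bullet> (T (fst (z - (x, y)) - snd (z - (x, y))), - T (fst (z - (x, y)) - snd (z - (x, y))))) + e*(norm (z - (x, y)))^2"
   unfolding zhk by (simp add: ab inner_diff_left inner_diff_right)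
 qed (use d in auto)
qed

text \<open>Here \<open>g\<close> carries the test function and \<open>f\<close> the penalisation of
  \<open>x - y\<close>. The two slopes are close to \<open>pg + pf\<close> and \<open>- pf\<close>,
  so the possibly large slope \<open>pf\<close> cancels in their sum, and in the matrix inequality
  the penalisation acts on \<open>h - k\<close> only.\<close>

lemma doubling:
 fixes u v g f :: "real^'n => real"
 assumes Om: "open Om" "x0 \<in> Om" "y0 \<in> Om" and cont: "continuous_on Om u" "continuous_on Om v"
  and g: "mjet g x0 pg Xg" and f: "mjet f (x0-y0) pf Xf"
  and d: "d > 0" and max: "!!x y. norm (x-x0) < d ==> norm (y-y0) < d ==>
    u x + v y - g x - f (x-y) <= u x0 + v y0 - g x0 - f (x0-y0)"
  and e: "e > 0"
 obtains x p X y q Y where "norm (x-x0) < e" "norm (p - (pg + pf)) < e" "norm (y-y0) < e" "norm (q + pf) < e"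
  "mjet u x p X" "mjet v y q Y"
  "!!h k. h \<bullet> (X *v h) + k \<bullet> (Y *v k) <= h \<bullet> (Xg *v h) + (h-k) \<bullet> (Xf *v (h-k)) + e*((norm h)^2 + (norm k)^2)"
proof -
 define A where "A h = (Xg *v fst h + Xf *v (fst h - snd h), - (Xf *v (fst h - snd h)))" for h :: "(real^'n) \<times> (real^'n)"
 have sym: "symmetric_mat Xg" "symmetric_mat Xf" using g f by (auto simp: mjet_def)
 have "upjet (\<lambda>z. g (fst z) + f (fst z - snd z)) (x0, y0) ((pg, 0) + (pf, - pf))
   (\<lambda>h. (Xg *v fst h, 0) + (Xf *v (fst h - snd h), - (Xf *v (fst h - snd h))))"
  using g f unfolding mjet_def by (intro upjet_add upjet_fst upjet_fst_minus_snd) auto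
 hence "upjet (\<lambda>z. u (fst z) + v (snd z)) (x0, y0) ((pg, 0) + (pf, - pf))
   (\<lambda>h. (Xg *v fst h, 0) + (Xf *v (fst h - snd h), - (Xf *v (fst h - snd h))))"
 proof (rule upjet_mono[OF _ d])
  fix z assume z: "norm (z - (x0, y0)) < d"
  obtain x y where xy: "z = (x, y)" by (cases z)
  have "norm (x-x0) < d" "norm (y-y0) < d"
   using norm_fst_le[of "x - x0" "y - y0"] norm_snd_le[of "y - y0" "x - x0"] z by (auto simp: xy)
  from max[OF this]
  show "u (fst z) + v (snd z) - (u (fst (x0, y0)) + v (snd (x0, y0))) <= g (fst z) + f (fst z - snd z) - (g (fst (x0, y0)) + f (fst (x0, y0) - snd (x0, y0)))"
   by (simp add: xy)
 qed
 hence jet: "upjet (\<lambda>z. u (fst z) + v (snd z)) (x0, y0) (pg + pf, - pf) A"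
  by (simp add: A_def[abs_def])
 have A: "selfadj A" unfolding selfadj_def
 proof (intro conjI allI)
  show "linear A" unfolding A_def
   by (intro linearI) (auto simp: matrix_vector_right_distrib matrix_vector_mult_diff_distrib matrix_vector_mult_scaleR algebra_simps)
  fix h k
  show "h \<bullet> A k = A h \<bullet> k"
   using symmetric_mat_inner[OF sym(1), of "fst h" "fst k"] symmetric_mat_inner[OF sym(2), of "fst h - snd h" "fst k - snd k"]
   by (simp add: A_def inner_prod_def inner_add_left inner_add_right inner_diff_left inner_diff_right)
 qed
 obtain x p X y q Y where r: "norm (x-x0) < e" "norm (p - (pg + pf)) < e" "norm (y-y0) < e" "norm (q - (- pf)) < e"
  "selfadj X" "selfadj Y" "upjet u x p X" "upjet v y q Y"
  "!!h k. h \<bullet> X h + k \<bullet> Y k <= (h, k) \<bullet> A (h, k) + e*((norm h)^2 + (norm k)^2)"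
  using theorem_on_sums[OF Om(1,2) cont(1) Om(1,3) cont(2) jet A e] by metis
 obtain X' where X': "symmetric_mat X'" "X = (*v) X'" using selfadj_matrixE[OF r(5)] by blast
 obtain Y' where Y': "symmetric_mat Y'" "Y = (*v) Y'" using selfadj_matrixE[OF r(6)] by blast
 have "(h, k) \<bullet> A (h, k) = h \<bullet> (Xg *v h) + (h-k) \<bullet> (Xf *v (h-k))" for h k
  by (simp add: A_def inner_add_right inner_diff_left)
 thus ?thesis
  using that[of x p y q X' Y'] r X' Y' by (simp add: mjet_def)
qed

text \<open>The Ishii--Lions matrix inequality: a bound of order \<open>sqrt c\<close> for \<open>Y\<close> instead of the trivial
 one of order \<open>c\<close>, up to the trace of the defect \<open>N\<close>.\<close>

lemma Ishii_Lions_matrix: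
 fixes X Y Z :: "real^'n^'n"
 assumes sym: "symmetric_mat X" "symmetric_mat Y" "symmetric_mat Z" and c: "c > 0" and e: "e >= 0"
  and ineq: "!!h k. h \<bullet> (X *v h) + k \<bullet> (Y *v k) <= h \<bullet> (Z *v h) + c*(norm (h-k))^2 + e*((norm h)^2 + (norm k)^2)"
 defines "N \<equiv> Z + mat (2*e) - (X + Y)"
 shows "psd N" "norm Y <= real CARD('n) * sqrt ((trace N + e)*(2*c + trace N + 2*e))"
proof -
 have Nq: "h \<bullet> (N *v h) = h \<bullet> (Z *v h) + 2*e*(norm h)^2 - h \<bullet> (X *v h) - h \<bullet> (Y *v h)" for h
  by (simp add: N_def matrix_vector_mult_diff_rdistrib matrix_vector_mult_add_rdistrib mat_mult_vec inner_add_right inner_diff_right power2_norm_eq_inner)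
 show N: "psd N" unfolding psd_def
 proof (intro conjI allI)
  show "symmetric_mat N" unfolding N_def by (intro symmetric_mat_diff symmetric_mat_add symmetric_mat_mat sym)
  show "0 <= h \<bullet> (N *v h)" for h using ineq[of h h] unfolding Nq by simp
 qed
 define n where "n = trace N"
 have n: "n >= 0" using norm_psd_le_trace[OF N] norm_ge_zero[of N] unfolding n_def by linarith
 define D where "D = 2*c + n + 2*e"
 have D: "D > 0" using c n e by (simp add: D_def)
 have "norm (Y *v h) <= sqrt ((n + e)*D)" if h: "norm h = 1" for h
 proof -
  \<comment> \<open>The matrix inequality is tested with \<open>(h, h + k)\<close>. It becomes
    \<open>2*((Y *v h) \<bullet> k) <= n + e + D*(norm k)^2\<close>, and this \<open>k\<close> turns
    it into a bound for \<open>norm (Y *v h)\<close>.\<close>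
  define k where "k = (1/D) *\<^sub>R (Y *v h)"
  have hN: "h \<bullet> (N *v h) <= n" using psd_quadratic_le_trace[OF N, of h] h by (simp add: n_def)
  have kN: "k \<bullet> (N *v k) <= n*(norm k)^2" using psd_quadratic_le_trace[OF N, of k] by (simp add: n_def)
  have Yk: "- (n + c)*(norm k)^2 <= k \<bullet> (Y *v k)"
  proof -
   have "k \<bullet> (X *v k) <= k \<bullet> (Z *v k) + c*(norm k)^2 + e*(norm k)^2" using ineq[of k 0] by simp
   moreover have "0 <= e*(norm k)^2" using e by simp
   ultimately show ?thesis using kN Nq[of k] by (simp add: algebra_simps)
  qed
  have "(h + k) \<bullet> (Y *v (h + k)) = h \<bullet> (Y *v h) + 2*((Y *v h) \<bullet> k) + k \<bullet> (Y *v k)"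
   by (rule selfadj_quadratic_add[OF selfadj_matrix_vector_mult[OF sym(2)]])
  moreover have "h \<bullet> (X *v h) + (h + k) \<bullet> (Y *v (h + k)) <= h \<bullet> (Z *v h) + c*(norm k)^2 + e*(1 + (norm (h + k))^2)"
   using ineq[of h "h + k"] h by simp
  moreover have "(norm (h + k))^2 <= 2 + 2*(norm k)^2"
  proof -
   have "(norm (h + k))^2 + (norm (h-k))^2 = 2*(norm h)^2 + 2*(norm k)^2"
    by (simp add: power2_norm_eq_inner algebra_simps)
   thus ?thesis using zero_le_power2[of "norm (h-k)"] unfolding h power_one by linarith
  qed
  hence "e*(1 + (norm (h + k))^2) <= e*(3 + 2*(norm k)^2)" using e by (intro mult_left_mono) auto
  ultimately have "2*((Y *v h) \<bullet> k) <= n + e + D*(norm k)^2"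
   using hN Nq[of h] Yk h unfolding D_def by (simp add: algebra_simps)
  moreover have "(Y *v h) \<bullet> k = (norm (Y *v h))^2/D" by (simp add: k_def power2_norm_eq_inner)
  moreover have "D*(norm k)^2 = (norm (Y *v h))^2/D"
   using D by (simp add: k_def power_mult_distrib power2_eq_square power_divide)
  ultimately have "(norm (Y *v h))^2/D <= n + e" by linarith
  hence "(norm (Y *v h))^2 <= (n + e)*D" using D by (simp add: divide_le_eq)
  thus ?thesis by (rule real_le_rsqrt)
 qed
 from norm_mat_le[OF sym(2) this]
 show "norm Y <= real CARD('n) * sqrt ((trace N + e)*(2*c + trace N + 2*e))"
  unfolding D_def n_def by simp
qed

text \<open>The jet form of \<^const>\<open>visc_sub\<close>. A supersolution is the negative of a subsolution for the reflected operator.\<close>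

definition vsub :: "'n::finite op => (real^'n) set => (real^'n => real) => (real^'n => real) => bool" where
 "vsub F Om u h \<longleftrightarrow> (\<forall>x\<in>Om. \<forall>p X. mjet u x p X --> F X p (u x) x <= h x)"

definition reflected :: "'n::finite op => 'n op" where
 "reflected F M p z x = - F (- M) (- p) (- z) x"

definition vsol :: "'n::finite op => (real^'n) set => (real^'n => real) => (real^'n => real) => bool" where
 "vsol F Om u h \<longleftrightarrow> vsub F Om u h \<and> vsub (reflected F) Om (\<lambda>x. - u x) (\<lambda>x. - h x)"

lemma reflected_reflected: "reflected (reflected F) = F"
 by (simp add: reflected_def fun_eq_iff)

text \<open>The constants of (F2) are parameters instead of being existentially quantified, so that
  the reflected operator is an instance with the same constants.\<close>

locale elliptic =
 fixes F :: "'n::finite op" and Om :: "(real^'n) set" and de1 de0 ga Ga :: real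
 assumes de: "de1 >= 0" "de0 >= 0" and ga: "0 < ga" "ga <= Ga" and open_Om: "open Om"
  and F1: "cond_F1 F Om" and F3: "cond_F3 F Om"
  and F2_lower: "!!M N p q z w x. symmetric_mat M ==> symmetric_mat N ==> x \<in> Om ==>
     pucci_minus ga Ga (M-N) - de1*norm (p-q) - de0*\<bar>z - w\<bar> <= F M p z x - F N q w x"
  and F2_upper: "!!M N p q z w x. symmetric_mat M ==> symmetric_mat N ==> x \<in> Om ==>
     F M p z x - F N q w x <= pucci_plus ga Ga (M-N) + de1*norm (p-q) + de0*\<bar>z - w\<bar>"
begin

lemma F_zero: "x \<in> Om ==> F 0 0 0 x = 0"
 using F3 unfolding cond_F3_def by (metis mult_zero_left order_refl scaleR_zero_left symmetric_mat_0)

lemma F_add_mat_le: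
 assumes "symmetric_mat X" "x \<in> Om" "s >= 0"
 shows "F X p z x <= F (X + mat s) p z x + s*(real CARD('n)*Ga)"
proof -
 have "pucci_plus ga Ga (- mat s :: real^'n^'n) <= s*(real CARD('n)*Ga)"
 proof (rule pucci_plus_leI[OF ga])
  fix A :: "real^'n^'n" assume "A \<in> pucci_class ga Ga"
  from mult_left_mono[OF pucci_class_trace(2)[OF this] assms(3)]
  show "- trace (A ** - mat s) <= s*(real CARD('n)*Ga)" by (simp add: trace_mult_minus_right trace_mult_mat)
 qed
 thus ?thesis
  using F2_upper[OF assms(1) symmetric_mat_add[OF assms(1) symmetric_mat_mat] assms(2), of p z s p z] by simp
qed

text \<open>A jet holds up to \<open>o((norm h)^2)\<close>, so its polynomial need not be a test
  function; with the matrix enlarged by \<open>s\<close> times the identity it is one. By (F2) the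
  price in \<open>F\<close> is at most \<open>s*(real CARD('n)*Ga)\<close>, which is made
  small.\<close>

lemma visc_sub_imp_vsub:
 assumes "visc_sub F Om u f"
 shows "vsub F Om u f"
 unfolding vsub_def
proof (intro ballI allI impI)
 fix x p X assume x: "x \<in> Om" and jet: "mjet u x p X"
 have sym: "symmetric_mat X" using jet by (simp add: mjet_def)
 show "F X p (u x) x <= f x"
 proof (rule field_le_epsilon)
  fix e :: real assume e: "e > 0"
  define s where "s = e/(real CARD('n)*Ga + 1)"
  have pos: "real CARD('n)*Ga >= 0" using ga by simp
  have s: "s > 0" "s*(real CARD('n)*Ga) <= e" using e pos by (auto simp: s_def field_simps)
  let ?X = "X + mat s"
  have symX: "symmetric_mat ?X" by (intro symmetric_mat_add sym symmetric_mat_mat)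
  obtain d where d: "d > 0" "!!h. norm h < d ==> u (x + h) <= u x + p \<bullet> h + 1/2*(h \<bullet> (X *v h)) + s/2*(norm h)^2"
   using mjetD[OF jet, of "s/2"] s by auto
  define ph where "ph y = p \<bullet> (y-x) + 1/2*((y-x) \<bullet> (?X *v (y-x)))" for y
  have "C2_with Om ph (\<lambda>y. p + ?X *v (y-x)) (\<lambda>_. ?X)"
   unfolding C2_with_def
  proof (intro conjI ballI)
   fix y
   have l: "((\<lambda>y. ?X *v (y-x)) has_derivative (\<lambda>h. ?X *v h)) (at y)"
    by (rule bounded_linear.has_derivative[OF matrix_vector_mul_bounded_linear, of "\<lambda>y. y - x" "\<lambda>h. h"]) (auto intro!: derivative_eq_intros)
   thus "((\<lambda>y. p + ?X *v (y-x)) has_derivative (\<lambda>h. ?X *v h)) (at y)"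
    by (auto intro!: derivative_eq_intros)
   have "(ph has_derivative (\<lambda>h. p \<bullet> h + 1/2*((y-x) \<bullet> (?X *v h) + h \<bullet> (?X *v (y-x))))) (at y)"
    unfolding ph_def by (rule derivative_eq_intros l refl | simp)+
   moreover have "(\<lambda>h. p \<bullet> h + 1/2*((y-x) \<bullet> (?X *v h) + h \<bullet> (?X *v (y-x)))) = (\<lambda>h. (p + ?X *v (y-x)) \<bullet> h)"
    using symmetric_mat_inner[OF symX, of "y - x"] by (simp add: fun_eq_iff inner_add_left inner_add_right inner_commute)
   ultimately show "(ph has_derivative (\<lambda>h. (p + ?X *v (y-x)) \<bullet> h)) (at y)" by simp
  qed (intro continuous_intros)
  moreover have "\<exists>r>0. \<forall>y\<in>Om \<inter> ball x r. u y - ph y <= u x - ph x"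
  proof (intro exI[of _ d] conjI ballI d)
   fix y assume "y \<in> Om \<inter> ball x d"
   hence "norm (y-x) < d" by (simp add: dist_norms)
   from d(2)[OF this] show "u y - ph y <= u x - ph x"
    by (simp add: ph_def matrix_vector_mult_add_rdistrib mat_mult_vec inner_add_right power2_norm_eq_inner distrib_left)
  qed
  ultimately have "F ?X (p + ?X *v (x-x)) (u x) x <= f x"
   using assms x unfolding visc_sub_def by blast
  hence "F ?X p (u x) x <= f x" by simp
  thus "F X p (u x) x <= f x + e" using F_add_mat_le[OF sym x, of s p "u x"] s by linarith
 qed
qed

text \<open>Comparison with the zero jet, where \<open>F\<close> vanishes by homogeneity.\<close>

lemma vsub_imp_esub:
 assumes "vsub F Om u h"
 shows "esub ga Ga de1 Om u (\<lambda>x. de0*\<bar>u x\<bar> + h x)"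
 unfolding esub_def
proof (intro ballI allI impI)
 fix x p X assume x: "x \<in> Om" and jet: "mjet u x p X"
 hence "F X p (u x) x <= h x" using assms by (simp add: vsub_def)
 moreover have "symmetric_mat X" using jet by (simp add: mjet_def)
 ultimately show "pucci_minus ga Ga X <= de1*norm p + (de0*\<bar>u x\<bar> + h x)"
  using F2_lower[OF _ symmetric_mat_0 x, of X p 0 "u x" 0] F_zero[OF x] by simp
qed

lemma vsub_scale:
 assumes "vsub F Om u h" "t > 0"
 shows "vsub F Om (\<lambda>x. t*u x) (\<lambda>x. t*h x)"
 unfolding vsub_def
proof (intro ballI allI impI)
 fix x p X assume x: "x \<in> Om" and jet: "mjet (\<lambda>x. t*u x) x p X"
 have "mjet u x ((1/t) *\<^sub>R p) ((1/t) *\<^sub>R X)" using mjet_scale[OF jet, of "1/t"] assms(2) by simp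
 hence "F ((1/t) *\<^sub>R X) ((1/t) *\<^sub>R p) (u x) x <= h x" using assms(1) x by (simp add: vsub_def)
 moreover have "F (t *\<^sub>R ((1/t) *\<^sub>R X)) (t *\<^sub>R ((1/t) *\<^sub>R p)) (t*u x) x = t*F ((1/t) *\<^sub>R X) ((1/t) *\<^sub>R p) (u x) x"
 proof -
  have "symmetric_mat ((1/t) *\<^sub>R X)" using jet by (simp add: mjet_def symmetric_mat_scaleR)
  thus ?thesis using F3 assms(2) x unfolding cond_F3_def by (metis less_imp_le)
 qed
 ultimately show "F X p (t*u x) x <= t*h x" using assms(2) by simp
qed

lemma elliptic_reflected: "elliptic (reflected F) Om de1 de0 ga Ga"
proof
 show "cond_F1 (reflected F) Om"
  unfolding cond_F1_def
 proof (intro allI impI)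
  fix K :: real assume "K > 0"
  then obtain om nu where w: "mono_on {0..} om" "continuous_on {0..} om" "om 0 = 0" "\<forall>t\<ge>0. om t >= 0" "1/2 < nu" "nu <= 1"
   "!!M p z x y. symmetric_mat M ==> norm p <= K ==> \<bar>z\<bar> <= K ==> x \<in> Om ==> y \<in> Om ==>
     \<bar>F M p z x - F M p z y\<bar> <= om (dist x y powr nu*(norm M + 1))"
   using F1 unfolding cond_F1_def by metis
  have "\<bar>reflected F M p z x - reflected F M p z y\<bar> <= om (dist x y powr nu*(norm M + 1))"
   if "symmetric_mat M" "norm p <= K" "\<bar>z\<bar> <= K" "x \<in> Om" "y \<in> Om" for M p z x y
   using w(7)[OF symmetric_mat_minus[OF that(1)], of "- p" "- z" x y] that by (simp add: reflected_def abs_minus_commute)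
  with w show "\<exists>om nu. mono_on {0..} om \<and> continuous_on {0..} om \<and> om 0 = 0 \<and> (\<forall>t\<ge>0. 0 <= om t) \<and> 1/2 < nu \<and> nu <= 1 \<and>
    (\<forall>M p z x y. symmetric_mat M --> norm p <= K --> \<bar>z\<bar> <= K --> x \<in> Om --> y \<in> Om -->
     \<bar>reflected F M p z x - reflected F M p z y\<bar> <= om (dist x y powr nu*(norm M + 1)))"
   by blast
 qed
 show "cond_F3 (reflected F) Om"
  unfolding cond_F3_def reflected_def
 proof (intro allI impI)
  fix t :: real and M :: "real^'n^'n" and p :: "real^'n" and z :: real and x :: "real^'n"
  assume a: "0 <= t" "symmetric_mat M" "x \<in> Om"
  have "F (t *\<^sub>R (- M)) (t *\<^sub>R (- p)) (t*(- z)) x = t*F (- M) (- p) (- z) x"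
   using F3 a symmetric_mat_minus[OF a(2)] unfolding cond_F3_def by blast
  thus "- F (- (t *\<^sub>R M)) (- (t *\<^sub>R p)) (- (t*z)) x = t * - F (- M) (- p) (- z) x" by simp
 qed
 fix M N :: "real^'n^'n" and p q :: "real^'n" and z w :: real and x :: "real^'n"
 assume a: "symmetric_mat M" "symmetric_mat N" "x \<in> Om"
 note b = symmetric_mat_minus[OF a(1)] symmetric_mat_minus[OF a(2)]
 have e: "- M - - N = - (M-N)" "norm (- p - - q) = norm (p-q)" "\<bar>- z - - w\<bar> = \<bar>z - w\<bar>" by (simp_all add: norm_minus_commute)
 show "pucci_minus ga Ga (M-N) - de1*norm (p-q) - de0*\<bar>z - w\<bar> <= reflected F M p z x - reflected F N q w x"
  using F2_upper[OF b a(3), of "- p" "- z" "- q" "- w"] unfolding e pucci_plus_uminus[OF ga] reflected_def by linarith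
 have "pucci_minus ga Ga (- (M-N)) = - pucci_plus ga Ga (M-N)"
  using pucci_plus_uminus[OF ga, of "- (M-N)"] by simp
 thus "reflected F M p z x - reflected F N q w x <= pucci_plus ga Ga (M-N) + de1*norm (p-q) + de0*\<bar>z - w\<bar>"
  using F2_lower[OF b a(3), of "- p" "- q" "- z" "- w"] unfolding e reflected_def by linarith
qed (use de ga open_Om in auto)


text \<open>Homogeneity scales gradient and value below 1, so the modulus for \<open>K = 1\<close>
  serves all sizes. The free factor \<open>t\<close> is decisive later: taken large compared with
  the matrix term, it keeps the argument of \<open>om\<close> bounded, and the whole bound becomes
  linear in \<open>t\<close>.\<close>

lemma F_modulus:
 obtains om nu where "mono_on {0..} om" "continuous_on {0..} om" "om 0 = 0" "!!t. t >= 0 ==> om t >= 0" "1/2 < nu" "nu <= 1"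
  "!!t M p z x y. t > 0 ==> symmetric_mat M ==> norm p <= t ==> \<bar>z\<bar> <= t ==> x \<in> Om ==> y \<in> Om ==>
    \<bar>F M p z x - F M p z y\<bar> <= t * om (dist x y powr nu*(norm M/t + 1))"
proof -
 obtain om nu where w: "mono_on {0..} om" "continuous_on {0..} om" "om 0 = 0" "\<forall>t\<ge>0. om t >= 0" "1/2 < nu" "nu <= 1"
  "!!M p z x y. symmetric_mat M ==> norm p <= 1 ==> \<bar>z\<bar> <= 1 ==> x \<in> Om ==> y \<in> Om ==>
     \<bar>F M p z x - F M p z y\<bar> <= om (dist x y powr nu*(norm M + 1))"
  using F1 zero_less_one unfolding cond_F1_def by metis
 have "\<bar>F M p z x - F M p z y\<bar> <= t * om (dist x y powr nu*(norm M/t + 1))"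
  if t: "t > 0" and M: "symmetric_mat M" and pz: "norm p <= t" "\<bar>z\<bar> <= t" and xy: "x \<in> Om" "y \<in> Om" for t M p z x y
 proof -
  let ?M = "(1/t) *\<^sub>R M" and ?p = "(1/t) *\<^sub>R p" and ?z = "(1/t)*z"
  have sM: "symmetric_mat ?M" by (rule symmetric_mat_scaleR[OF M])
  have "norm ?p <= 1" "\<bar>?z\<bar> <= 1" using pz t by (auto simp: abs_mult divide_le_eq)
  from w(7)[OF sM this xy] have "\<bar>F ?M ?p ?z x - F ?M ?p ?z y\<bar> <= om (dist x y powr nu*(norm M/t + 1))"
   using t by simp
  moreover have "F M p z w = t*F ?M ?p ?z w" if "w \<in> Om" for w
  proof -
   have "F (t *\<^sub>R ?M) (t *\<^sub>R ?p) (t * ?z) w = t*F ?M ?p ?z w"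
    using F3 t sM that less_imp_le[OF t] unfolding cond_F3_def by blast
   thus ?thesis using t by simp
  qed
  ultimately show ?thesis using xy t by (simp add: abs_mult flip: right_diff_distrib)
 qed
 with w show ?thesis by (intro that[of om nu]) auto
qed

text \<open>When the two equations are subtracted, uniform ellipticity turns the defect in the
  matrix inequality into \<open>ga\<close> times its trace on the left. This is what later absorbs
  the oscillation of \<open>F\<close> in \<open>x\<close>, a term that grows with the size of
  \<open>Y\<close>.\<close>

lemma sum_estimate:
 assumes sym: "symmetric_mat X" "symmetric_mat Y" "symmetric_mat Z" and N: "psd (Z + mat (2*e) - (X + Y))"
  and e: "e >= 0" and xy: "x \<in> Om" "y \<in> Om"
  and sub: "F X p a x <= h1" and super: "reflected F Y q (- b) y <= - h2"
 shows "pucci_minus ga Ga Z + ga*trace (Z + mat (2*e) - (X + Y)) - 2*e*(real CARD('n)*Ga)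
  - de1*norm (p + q) - de0*\<bar>a - b\<bar> <= h1 - h2 + \<bar>F (- Y) (- q) b x - F (- Y) (- q) b y\<bar>"
proof -
 let ?N = "Z + mat (2*e) - (X + Y)"
 have "pucci_minus ga Ga Z + (ga*trace ?N - 2*e*(real CARD('n)*Ga)) <= pucci_minus ga Ga (Z + (mat (2*e) - ?N))"
 proof (rule pucci_minus_add_le[OF ga])
  fix A :: "real^'n^'n" assume A: "A \<in> pucci_class ga Ga"
  have "2*e*trace A <= 2*e*(real CARD('n)*Ga)"
   using e by (intro mult_left_mono pucci_class_trace(2)[OF A]) auto
  thus "ga*trace ?N - 2*e*(real CARD('n)*Ga) <= - trace (A ** (mat (2*e) - ?N))"
   using trace_pucci_class_psd[OF A N] by (simp only: trace_mult_diff_right trace_mult_mat)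
 qed
 also have "Z + (mat (2*e) - ?N) = X - (- Y)" by simp
 finally show ?thesis
  using F2_lower[OF sym(1) symmetric_mat_minus[OF sym(2)] xy(1), of p "- q" a b] sub super
  unfolding reflected_def by simp
qed

end

section \<open>Comparison and Lipschitz estimates\<close>

lemma mjet_quadratic:
 assumes "symmetric_mat X"
 shows "mjet (\<lambda>y. p \<bullet> (y-z) + 1/2*((y-z) \<bullet> (X *v (y-z)))) x (p + X *v (x-z)) X"
proof (rule mjetI[OF assms zero_less_one])
 fix h :: "real^'a"
 have eq: "x + h - z = (x-z) + h" by simp
 show "p \<bullet> (x + h - z) + 1/2*((x + h - z) \<bullet> (X *v (x + h - z))) <=
   p \<bullet> (x-z) + 1/2*((x-z) \<bullet> (X *v (x-z))) + (p + X *v (x-z)) \<bullet> h + 1/2*(h \<bullet> (X *v h))"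
  unfolding eq selfadj_quadratic_add[OF selfadj_matrix_vector_mult[OF assms]]
  by (simp add: inner_add_left inner_add_right)
qed

text \<open>Separates, in the Ishii-Lions bound, the part of order \<open>sqrt c\<close> from the
  part controlled by the trace of the defect.\<close>

lemma sqrt_product_bound:
 assumes "n >= 0" "0 <= e" "e <= 1" "c >= 0"
 shows "sqrt ((n + e)*(2*c + n + 2*e)) <= sqrt (2*c) * sqrt (n + 1) + (n + 2)"
proof -
 have "sqrt ((n + e)*(2*c + n + 2*e)) <= sqrt ((n + 1)*(2*c + (n + 2)))"
  using assms by (intro real_sqrt_le_mono mult_mono) auto
 also have "... = sqrt (n + 1) * sqrt (2*c + (n + 2))" by (rule real_sqrt_mult)
 also have "... <= sqrt (n + 1)*(sqrt (2*c) + sqrt (n + 2))"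
  using assms by (intro mult_left_mono sqrt_add_le_add_sqrt) auto
 also have "sqrt (n + 1) * sqrt (n + 2) <= sqrt (n + 2) * sqrt (n + 2)"
  using assms by (intro mult_right_mono) auto
 hence "sqrt (n + 1)*(sqrt (2*c) + sqrt (n + 2)) <= sqrt (2*c) * sqrt (n + 1) + (n + 2)"
  using assms by (simp add: distrib_left mult.commute)
 finally show ?thesis .
qed

text \<open>Variables are doubled with the penalisation \<open>(norm (x - y))^2/(2*ep)\<close>. The
  Lipschitz bound on \<open>u\<close> gives \<open>norm (xh - yh) <= 2*L*ep\<close> and bounded
  slopes, while \<open>w\<close> may be any continuous subsolution, as those in
  \<open>lambda1_minus\<close> are. By the Ishii-Lions bound the oscillation of \<open>F\<close> is
  governed by \<open>ep powr (nu - 1/2)\<close>, up to a factor linear in the trace of the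
  defect.\<close>

lemma (in elliptic) difference_esub:
 assumes w: "vsub F Om w hw" "continuous_on Om w" "continuous_on Om hw"
  and u: "vsub (reflected F) Om (\<lambda>x. - u x) (\<lambda>x. - hu x)" "continuous_on Om u" "continuous_on Om hu"
  and lip: "!!x. x \<in> Om ==> \<exists>r>0. \<exists>L. \<forall>y\<in>ball x r. \<forall>z\<in>ball x r. \<bar>u y - u z\<bar> <= L*norm (y-z)"
 shows "esub ga Ga de1 Om (\<lambda>x. w x - u x) (\<lambda>x. de0*\<bar>w x - u x\<bar> + hw x - hu x)"
 unfolding esub_def
proof (intro ballI allI impI)
 fix x0 p0 X0 assume x0: "x0 \<in> Om" and jet: "mjet (\<lambda>x. w x - u x) x0 p0 X0"
 have symX0: "symmetric_mat X0" using jet by (simp add: mjet_def)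
 define n where "n = real CARD('n)"
 define c1 where "c1 = n*Ga"
 have n: "n > 0" by (simp add: n_def)
 have c1: "c1 >= 0" using ga n by (simp add: c1_def)
 show "pucci_minus ga Ga X0 <= de1*norm p0 + (de0*\<bar>w x0 - u x0\<bar> + hw x0 - hu x0)"
 proof (rule field_le_epsilon)
  fix e0 :: real assume e0: "e0 > 0"
  \<comment> \<open>The error budget: the final inequality collects six errors \<open>th\<close>,
    two with the factor \<open>de0\<close> and one with the factor \<open>de1\<close>.\<close>
  define th where "th = e0/(6 + 2*de0 + de1)"
  have th: "th > 0" "(6 + 2*de0 + de1)*th = e0" using e0 de by (auto simp: th_def)
  define et where "et = th/(4*c1 + 1)"
  have et: "et > 0" "4*et*c1 <= th" using th c1 by (auto simp: et_def field_simps)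
  obtain r1 where r1: "r1 > 0" "ball x0 r1 \<subseteq> Om" using open_Om x0 open_contains_ball by metis
  obtain r2 L0 where r2: "r2 > 0" "!!y z. y \<in> ball x0 r2 ==> z \<in> ball x0 r2 ==> \<bar>u y - u z\<bar> <= L0*norm (y-z)"
   using lip[OF x0] by metis
  obtain r3 where r3: "r3 > 0" "!!h. norm h < r3 ==> w (x0 + h) - u (x0 + h) <= w x0 - u x0 + p0 \<bullet> h + 1/2*(h \<bullet> (X0 *v h)) + et*(norm h)^2"
   using mjetD[OF jet et(1)] by metis
  have contD: "\<exists>d>0. \<forall>y\<in>Om. dist y x0 < d --> \<bar>g y - g x0\<bar> < th" if "continuous_on Om g" for g :: "real^'n => real"
   using that x0 th(1) unfolding continuous_on_iff dist_real_def by blast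
  obtain rh1 where rh1: "rh1 > 0" "!!y. y \<in> Om ==> dist y x0 < rh1 ==> \<bar>w y - w x0\<bar> < th" using contD[OF w(2)] by blast
  obtain rh2 where rh2: "rh2 > 0" "!!y. y \<in> Om ==> dist y x0 < rh2 ==> \<bar>hw y - hw x0\<bar> < th" using contD[OF w(3)] by blast
  obtain rh3 where rh3: "rh3 > 0" "!!y. y \<in> Om ==> dist y x0 < rh3 ==> \<bar>u y - u x0\<bar> < th" using contD[OF u(2)] by blast
  obtain rh4 where rh4: "rh4 > 0" "!!y. y \<in> Om ==> dist y x0 < rh4 ==> \<bar>hu y - hu x0\<bar> < th" using contD[OF u(3)] by blast
  define r where "r = min (min (min r1 r2) r3) (min (min rh1 rh2) (min rh3 rh4))/2"
  have r: "r > 0" using r1 r2 r3 rh1 rh2 rh3 rh4 by (simp add: r_def)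
  have rr: "r < r1" "r < r2" "r < r3" "r < rh1" "r < rh2" "r < rh3" "r < rh4"
   using r unfolding r_def by linarith+
  define L where "L = max 1 L0"
  have L: "L >= 1" by (simp add: L_def)
  have uL: "\<bar>u y - u z\<bar> <= L*norm (y-z)" if "norm (y-x0) <= r" "norm (z-x0) <= r" for y z
  proof -
   have "\<bar>u y - u z\<bar> <= L0*norm (y-z)" using that rr(2) by (intro r2) (auto simp: dist_norms)
   also have "... <= L*norm (y-z)" by (intro mult_right_mono) (auto simp: L_def)
   finally show ?thesis .
  qed
  obtain B where B: "B > 0" "!!h. norm (X0 *v h) <= B*norm h"
   using linear_bounded_pos[OF matrix_vector_mul_linear] by metis
  define s1 where "s1 = min (r/4) (th/(2*(B + 4*et)))"
  have s1: "s1 > 0" "s1 <= r/4" "(B + 4*et) * s1 <= th/2"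
  proof -
   have BB: "B + 4*et > 0" using B et by simp
   thus "s1 > 0" using r th by (simp add: s1_def)
   show "s1 <= r/4" unfolding s1_def by (rule min.cobounded1)
   have "s1 <= th/(2*(B + 4*et))" unfolding s1_def by (rule min.cobounded2)
   thus "(B + 4*et) * s1 <= th/2" using BB by (simp add: pos_le_divide_eq mult_ac)
  qed
  obtain om nu where om: "mono_on {0..} om" "continuous_on {0..} om" "om 0 = 0" "!!t. t >= 0 ==> om t >= 0" "1/2 < nu" "nu <= 1"
   "!!t M p z x y. t > 0 ==> symmetric_mat M ==> norm p <= t ==> \<bar>z\<bar> <= t ==> x \<in> Om ==> y \<in> Om ==>
    \<bar>F M p z x - F M p z y\<bar> <= t * om (dist x y powr nu*(norm M/t + 1))"
   using F_modulus by metis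
  \<comment> \<open>A bound for the slope \<open>q\<close>, which is at most \<open>2*L + 1\<close>,
    and for the values of \<open>u\<close> near \<open>x0\<close>; \<open>t\<close> will be at least
    this.\<close>
  define t0 where "t0 = 2*L + 2 + \<bar>u x0\<bar> + th"
  have t0: "t0 > 0" using L th by (simp add: t0_def add_pos_nonneg)
  obtain m where m: "m > 0" "om (2*m) <= th/t0"
  proof -
   have "th/t0 > 0" using th t0 by simp
   then obtain d where d: "d > 0" "!!t. t \<in> {0..} ==> dist t 0 < d ==> dist (om t) (om 0) < th/t0"
    using om(2) unfolding continuous_on_iff by (metis atLeast_iff order_refl)
   show ?thesis
    by (rule that[of "d/4"]) (use d(1) d(2)[of "d/2"] om(3) in \<open>auto simp: dist_real_def abs_less_iff\<close>)
  qed
  \<comment> \<open>For points at distance at most \<open>(2*L + 2)*ep\<close>, the product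
    \<open>dist x y powr nu * norm Y\<close> is at most \<open>ka ep*(nb + 1)\<close>, where
    \<open>nb\<close> is the trace of the defect.\<close>
  define ka where "ka ep = n*(((2*L + 2)*ep) powr nu*(sqrt (2*(1/ep)) + 2))" for ep
  have p0': "((\<lambda>ep. ep powr a) \<longlongrightarrow> 0) (at_right (0::real))" if "a > 0" for a
   by (rule tendsto_zero_powrI[OF _ tendsto_const]) (use that in \<open>auto intro!: tendsto_eq_intros simp: eventually_at_filter\<close>)
  have k0: "(ka \<longlongrightarrow> 0) (at_right 0)"
  proof -
   have "((\<lambda>ep. n*(2*L + 2) powr nu*(sqrt 2*ep powr (nu - 1/2) + 2*ep powr nu)) \<longlongrightarrow> n*(2*L + 2) powr nu*(sqrt 2*0 + 2*0)) (at_right 0)"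
    using om(5) by (intro tendsto_intros p0') auto
   moreover have "\<forall>\<^sub>F ep in at_right 0. n*(2*L + 2) powr nu*(sqrt 2*ep powr (nu - 1/2) + 2*ep powr nu) = ka ep"
    using eventually_at_right_less[of 0]
   proof eventually_elim
    case (elim ep)
    have p1: "((2*L + 2)*ep) powr nu = (2*L + 2) powr nu*ep powr nu" by (rule powr_mult)
    have "ka ep = n*(2*L + 2) powr nu*(ep powr nu * sqrt (2*(1/ep)) + 2*ep powr nu)"
     unfolding ka_def p1 by (simp only: distrib_left mult_ac)
    moreover have "ep powr nu * sqrt (2*(1/ep)) = sqrt 2*ep powr (nu - 1/2)"
     using elim by (simp add: powr_diff powr_half_sqrt real_sqrt_divide)
    ultimately show ?case by simp
   qed
   ultimately show ?thesis using tendsto_cong by force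
  qed
  have pm: "((\<lambda>ep. ((2*L + 2)*ep) powr nu) \<longlongrightarrow> 0) (at_right 0)"
   by (rule tendsto_zero_powrI[OF _ tendsto_const])
     (use L om(5) in \<open>auto intro!: tendsto_eq_intros simp: eventually_at_filter\<close>)
  have "\<forall>\<^sub>F ep in at_right 0. ka ep < min ga th*(m*t0)/th"
   by (rule order_tendstoD(2)[OF k0]) (use ga th m t0 in auto)
  moreover have "\<forall>\<^sub>F ep in at_right 0. ((2*L + 2)*ep) powr nu < m"
   by (rule order_tendstoD(2)[OF pm]) (use m in auto)
  moreover have "\<forall>\<^sub>F ep in at_right 0. ep < min 1 (min (s1/(2*L)) (et * s1^2/(2*L^2)))"
   by (rule order_tendstoD(2)[OF tendsto_ident_at]) (use s1 L et in auto)
  ultimately have "\<forall>\<^sub>F ep in at_right 0. ep > 0 \<and> ka ep < min ga th*(m*t0)/th \<and> ((2*L + 2)*ep) powr nu < m \<and>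
    ep < min 1 (min (s1/(2*L)) (et * s1^2/(2*L^2)))"
   using eventually_at_right_less[of 0] by eventually_elim auto
  then obtain ep where ep: "ep > 0" "ka ep < min ga th*(m*t0)/th" "((2*L + 2)*ep) powr nu < m"
    "ep < 1" "ep < s1/(2*L)" "ep < et * s1^2/(2*L^2)"
   using eventually_happens[of _ "at_right (0::real)"] by (auto simp: trivial_limit_at_right_real)
  define g where "g y = (p0 \<bullet> (y-x0) + 1/2*((y-x0) \<bullet> (X0 *v (y-x0)))) + (2*et)*(norm (y-x0))^2" for y
  define f where "f y = 1/(2*ep)*(norm (y-0))^2" for y :: "real^'n"
  let ?B = "cball x0 r"
  have BOm: "?B \<subseteq> Om" using rr(1) r1(2) by (auto simp: subset_eq)
  define Ps where "Ps z = w (fst z) - u (snd z) - g (fst z) - f (fst z - snd z)" for z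
  have "continuous_on (?B \<times> ?B) Ps"
   unfolding Ps_def g_def f_def
   by (intro continuous_intros continuous_on_compose2[OF w(2)] continuous_on_compose2[OF u(2)]
     linear_continuous_on_compose[OF _ matrix_vector_mul_linear]) (use BOm in auto)
  moreover have "?B \<times> ?B ~= {}" using r by auto
  ultimately obtain z where z: "z \<in> ?B \<times> ?B" "!!z'. z' \<in> ?B \<times> ?B ==> Ps z' <= Ps z"
   using continuous_attains_sup[OF compact_Times[OF compact_cball compact_cball]] by metis
  obtain xh yh where zxy: "z = (xh, yh)" by (cases z)
  have xyh: "norm (xh-x0) <= r" "norm (yh-x0) <= r" using z(1) by (auto simp: zxy dist_norms)
  define s where "s = norm (xh-yh)"
  \<comment> \<open>Comparison with the diagonal point \<open>(x0, x0)\<close>; it localises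
    \<open>xh\<close> at \<open>x0\<close> and bounds the distance between \<open>xh\<close> and
    \<open>yh\<close> at once.\<close>
  have key: "et*(norm (xh-x0))^2 + s^2/(2*ep) <= L * s"
  proof -
   have "Ps (x0, x0) <= Ps z" using r by (intro z) auto
   moreover have "Ps (x0, x0) = w x0 - u x0" by (simp add: Ps_def g_def f_def)
   moreover have "w (x0 + (xh-x0)) - u (x0 + (xh-x0)) <= w x0 - u x0 + p0 \<bullet> (xh-x0) + 1/2*((xh-x0) \<bullet> (X0 *v (xh-x0))) + et*(norm (xh-x0))^2"
    using xyh rr(3) by (intro r3) auto
   moreover have "\<bar>u xh - u yh\<bar> <= L * s" unfolding s_def by (intro uL xyh)
   ultimately show ?thesis unfolding Ps_def zxy g_def f_def s_def by (simp add: abs_le_iff)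
  qed
  have s: "0 <= s" "s <= 2*L*ep"
  proof -
   show s0: "0 <= s" by (simp add: s_def)
   show "s <= 2*L*ep"
   proof (cases "s = 0")
    case True
    thus ?thesis using L ep by simp
   next
    case False
    have "0 <= et*(norm (xh-x0))^2" using et by simp
    hence "s^2/(2*ep) <= L * s" using key by linarith
    hence "s * s <= s*(2*L*ep)" using ep(1) by (simp add: pos_divide_le_eq power2_eq_square mult_ac)
    thus ?thesis using False s0 by simp
   qed
  qed
  have ss1: "s <= s1" using s(2) ep(5) L by (simp add: field_simps)
  have hs1: "norm (xh-x0) <= s1"
  proof -
   have "0 <= s^2/(2*ep)" using ep by simp
   hence "et*(norm (xh-x0))^2 <= L * s" using key by linarith
   also have "... <= L*(2*L*ep)" using s L by (intro mult_left_mono) auto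
   also have "... <= et * s1^2" using ep(6) L by (simp add: field_simps power2_eq_square)
   finally have "(norm (xh-x0))^2 <= s1^2" using et by simp
   thus ?thesis using s1(1) by (simp add: power2_le_iff_abs_le)
  qed
  define e where "e = min ep (min s1 (min (th/4) (th/(2*c1 + 1))))"
  have e: "e > 0" "e <= ep" "e <= s1" "2*e <= th/2" "2*e*c1 <= th" "e <= 1"
  proof -
   show "e > 0" using ep s1 th c1 by (simp add: e_def)
   show "e <= ep" "e <= s1" by (auto simp: e_def)
   show "e <= 1" using ep(4) by (auto simp: e_def)
   have "e <= th/4" unfolding e_def by (intro min.coboundedI2 min.cobounded1)
   moreover have "e <= th/(2*c1 + 1)" unfolding e_def by (intro min.coboundedI2 order_refl)
   ultimately show "2*e <= th/2" "2*e*c1 <= th" using c1 \<open>e > 0\<close> by (auto simp: field_simps)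
  qed
  have gj: "mjet g xh ((p0 + X0 *v (xh-x0)) + (2*(2*et)) *\<^sub>R (xh-x0)) (X0 + mat (2*(2*et)))"
   unfolding g_def by (intro mjet_add mjet_quadratic mjet_square symX0)
  have fj: "mjet f (xh-yh) ((2*(1/(2*ep))) *\<^sub>R (xh - yh - 0)) (mat (2*(1/(2*ep))))"
   unfolding f_def by (rule mjet_square)
  have xyOm: "xh \<in> Om" "yh \<in> Om" using z(1) BOm by (auto simp: zxy)
  have yhs: "norm (yh-x0) <= 2 * s1"
   using norm_triangle_ineq4[of "xh - x0" "xh - yh"] hs1 ss1 by (simp add: s_def)
  have max: "w x + - u y - g x - f (x-y) <= w xh + - u yh - g xh - f (xh-yh)"
   if "norm (x-xh) < r/4" "norm (y-yh) < r/4" for x y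
  proof -
   have "norm (x-x0) <= r" "norm (y-x0) <= r"
    using norm_triangle_ineq[of "x - xh" "xh - x0"] norm_triangle_ineq[of "y - yh" "yh - x0"] that hs1 yhs s1(2) r by auto
   hence "Ps (x, y) <= Ps z" by (intro z) (auto simp: dist_norms)
   thus ?thesis by (simp add: Ps_def zxy)
  qed
  have cu': "continuous_on Om (\<lambda>y. - u y)" by (intro continuous_intros u(2))
  have r4: "r/4 > 0" using r by simp
  obtain x p X y q Y where d: "norm (x-xh) < e" "norm (p - (((p0 + X0 *v (xh-x0)) + (2*(2*et)) *\<^sub>R (xh-x0)) + (2*(1/(2*ep))) *\<^sub>R (xh - yh - 0))) < e"
   "norm (y-yh) < e" "norm (q + (2*(1/(2*ep))) *\<^sub>R (xh - yh - 0)) < e"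
   "mjet w x p X" "mjet (\<lambda>y. - u y) y q Y"
   "!!h k. h \<bullet> (X *v h) + k \<bullet> (Y *v k) <= h \<bullet> ((X0 + mat (2*(2*et))) *v h) + (h-k) \<bullet> (mat (2*(1/(2*ep))) *v (h-k)) + e*((norm h)^2 + (norm k)^2)"
   using doubling[OF open_Om xyOm w(2) cu' gj fj r4 max e(1)] by metis
  define Z where "Z = X0 + mat (4*et)"
  have sym: "symmetric_mat X" "symmetric_mat Y" "symmetric_mat Z"
   using d(5,6) symX0 by (auto simp: mjet_def Z_def intro: symmetric_mat_add symmetric_mat_mat)
  have ineq: "h \<bullet> (X *v h) + k \<bullet> (Y *v k) <= h \<bullet> (Z *v h) + (1/ep)*(norm (h-k))^2 + e*((norm h)^2 + (norm k)^2)" for h k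
   using d(7)[of h k] by (simp add: Z_def mat_mult_vec power2_norm_eq_inner)
  define N where "N = Z + mat (2*e) - (X + Y)"
  define nb where "nb = trace N"
  have epi: "1/ep > 0" using ep by simp
  note IL = Ishii_Lions_matrix[OF sym epi less_imp_le[OF e(1)] ineq]
  have N: "psd N" unfolding N_def by (rule IL(1))
  have nb: "nb >= 0" using norm_psd_le_trace[OF N] norm_ge_zero[of N] unfolding nb_def by linarith
  have Yb: "norm Y <= n*((sqrt (2*(1/ep)) + 2)*(nb + 1))"
  proof -
   have "norm Y <= n * sqrt ((nb + e)*(2*(1/ep) + nb + 2*e))" using IL(2) unfolding nb_def N_def n_def by simp
   also have "... <= n*(sqrt (2*(1/ep)) * sqrt (nb + 1) + (nb + 2))"
    using nb e ep n by (intro mult_left_mono sqrt_product_bound) auto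
   also have "... <= n*(sqrt (2*(1/ep))*(nb + 1) + 2*(nb + 1))"
   proof -
    have "sqrt (nb + 1) <= nb + 1"
     using nb by (intro real_le_lsqrt) (auto simp: power2_eq_square algebra_simps)
    thus ?thesis using nb n ep(1) by (intro mult_left_mono add_mono) auto
   qed
   finally show ?thesis by (simp add: algebra_simps)
  qed
  have nx: "norm (x-x0) <= 2 * s1" using norm_triangle_ineq[of "x - xh" "xh - x0"] d(1) hs1 e(3) by simp
  have ny: "norm (y-x0) <= 3 * s1" using norm_triangle_ineq[of "y - yh" "yh - x0"] d(3) yhs e(3) by simp
  have dx: "dist x x0 < r" "dist y x0 < r" using nx ny s1 r by (auto simp: dist_norm)
  hence xy: "x \<in> Om" "y \<in> Om" using BOm by (auto simp: subset_eq dist_commute)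
  have dxy: "dist x y <= (2*L + 2)*ep"
  proof -
   have "dist x y <= dist x xh + dist xh yh + dist yh y" using dist_triangle[of x y xh] dist_triangle[of xh y yh] by linarith
   also have "... <= e + s + e" using d(1,3) by (simp add: dist_norm s_def norm_minus_commute)
   also have "... <= (2*L + 2)*ep" using e(2) s(2) by (simp add: algebra_simps)
   finally show ?thesis .
  qed
  have dpow: "dist x y powr nu <= ((2*L + 2)*ep) powr nu" using dxy om(5) by (intro powr_mono2) auto
  have qb: "norm q <= t0"
  proof -
   have "norm ((2*(1/(2*ep))) *\<^sub>R (xh - yh - 0)) = s/ep" using ep(1) by (simp add: s_def)
   also have "... <= 2*L" using s(2) ep(1) by (simp add: divide_le_eq)
   finally have "norm q <= e + 2*L"
    using norm_triangle_ineq4[of "q + (2*(1/(2*ep))) *\<^sub>R (xh - yh - 0)" "(2*(1/(2*ep))) *\<^sub>R (xh - yh - 0)"] d(4) by simp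
   thus ?thesis using e(6) th unfolding t0_def by linarith
  qed
  have uyx: "\<bar>u y - u x0\<bar> < th" using dx rr by (intro rh3 xy) auto
  hence ub: "\<bar>u y\<bar> <= t0" unfolding t0_def using L by linarith
  \<comment> \<open>With this \<open>t\<close> the argument of \<open>om\<close> is at most
    \<open>2*m\<close>, so the oscillation is at most \<open>t*(th/t0)\<close>, which is linear in
    \<open>nb\<close>. The smallness of \<open>ka ep\<close> keeps its part in \<open>nb\<close>
    below \<open>ga*nb\<close> and the constants of order \<open>th\<close>.\<close>
  define t where "t = t0 + ka ep*(nb + 1)/m"
  have kpos: "ka ep >= 0" using n ep(1) by (simp add: ka_def)
  have t: "t >= t0" "t > 0" using kpos nb m t0 by (auto simp: t_def add_pos_nonneg)
  have "\<bar>F (- Y) (- q) (u y) x - F (- Y) (- q) (u y) y\<bar> <= t * om (dist x y powr nu*(norm (- Y)/t + 1))"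
   using t qb ub by (intro om(7) symmetric_mat_minus sym xy) auto
  also have "... <= t*(th/t0)"
  proof (intro mult_left_mono)
   have "dist x y powr nu*norm Y <= ((2*L + 2)*ep) powr nu*(n*((sqrt (2*(1/ep)) + 2)*(nb + 1)))"
    using dpow Yb by (intro mult_mono) auto
   also have "... = ka ep*(nb + 1)" by (simp add: ka_def mult_ac)
   also have "... <= m*t" unfolding t_def using m t0 by (simp add: field_simps)
   finally have "dist x y powr nu*(norm (- Y)/t) <= m" using t(2) by (simp add: divide_le_eq)
   hence "dist x y powr nu*(norm (- Y)/t + 1) <= 2*m" using dpow ep(3) by (simp add: distrib_left)
   hence "om (dist x y powr nu*(norm (- Y)/t + 1)) <= om (2*m)"
    using m t(2) by (intro mono_onD[OF om(1)]) auto
   thus "om (dist x y powr nu*(norm (- Y)/t + 1)) <= th/t0" using m(2) by simp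
  qed (use t in simp)
  also have "... = th + (nb + 1)*(ka ep*th/(m*t0))"
   using t0 m by (simp add: t_def field_simps)
  also have "... <= th + (nb + 1)*min ga th"
  proof -
   have "ka ep*th < min ga th*(m*t0)" using ep(2) th(1) by (simp only: pos_less_divide_eq)
   hence "ka ep*th/(m*t0) <= min ga th"
    by (subst pos_divide_le_eq) (use m(1) t0 in \<open>simp_all only: mult_pos_pos less_imp_le\<close>)
   thus ?thesis using nb by (intro add_left_mono mult_left_mono) auto
  qed
  also have "... <= th + (ga*nb + th)"
  proof -
   have "nb*min ga th <= nb*ga" using nb by (intro mult_left_mono) auto
   thus ?thesis by (simp add: distrib_right mult.commute)
  qed
  finally have E: "\<bar>F (- Y) (- q) (u y) x - F (- Y) (- q) (u y) y\<bar> <= th + (ga*nb + th)" .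
  have sub: "F X p (w x) x <= hw x" using w(1) xy(1) d(5) by (simp add: vsub_def)
  have sup: "reflected F Y q (- u y) y <= - hu y" using u(1) xy(2) d(6) by (simp add: vsub_def)
  from sum_estimate[OF sym N[unfolded N_def] less_imp_le[OF e(1)] xy sub sup]
  have S: "pucci_minus ga Ga Z + ga*nb - 2*e*c1 - de1*norm (p + q) - de0*\<bar>w x - u y\<bar>
   <= hw x - hu y + \<bar>F (- Y) (- q) (u y) x - F (- Y) (- q) (u y) y\<bar>"
   unfolding nb_def N_def c1_def n_def .
  have PZ: "pucci_minus ga Ga X0 - th <= pucci_minus ga Ga Z"
  proof -
   have "pucci_minus ga Ga X0 + - (4*et*c1) <= pucci_minus ga Ga Z"
    unfolding Z_def
   proof (rule pucci_minus_add_le[OF ga])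
    fix A :: "real^'n^'n" assume A: "A \<in> pucci_class ga Ga"
    have "4*et*trace A <= 4*et*c1" unfolding c1_def n_def
     using et by (intro mult_left_mono pucci_class_trace(2)[OF A]) auto
    thus "- (4*et*c1) <= - trace (A ** mat (4*et))" by (simp add: trace_mult_mat)
   qed
   thus ?thesis using et(2) by linarith
  qed
  have pq: "norm (p + q) <= norm p0 + th"
  proof -
   have "p + q = p0 + ((X0 *v (xh-x0) + (2*(2*et)) *\<^sub>R (xh-x0)) + ((p - (((p0 + X0 *v (xh-x0)) + (2*(2*et)) *\<^sub>R (xh-x0)) + (2*(1/(2*ep))) *\<^sub>R (xh - yh - 0))) + (q + (2*(1/(2*ep))) *\<^sub>R (xh - yh - 0))))"
    by simp
   also have "norm ... <= norm p0 + ((B*norm (xh-x0) + 4*et*norm (xh-x0)) + (e + e))"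
    by (intro norm_triangle_mono order_refl B(2) less_imp_le[OF d(2)] less_imp_le[OF d(4)]) (use et in simp)
   also have "... <= norm p0 + ((B + 4*et) * s1 + (e + e))"
    using mult_left_mono[OF hs1, of "B + 4*et"] B et by (simp add: distrib_right)
   finally show ?thesis using s1(3) e(4) by linarith
  qed
  have g1: "hw x - hu y <= hw x0 - hu x0 + 2*th"
   using rh2(2)[OF xy(1)] rh4(2)[OF xy(2)] dx rr by fastforce
  have g2: "\<bar>w x - u y\<bar> <= \<bar>w x0 - u x0\<bar> + 2*th"
   using rh1(2)[OF xy(1)] uyx dx rr by fastforce
  have "de1*norm (p + q) <= de1*(norm p0 + th)" using pq de by (intro mult_left_mono) auto
  moreover have "de0*\<bar>w x - u y\<bar> <= de0*(\<bar>w x0 - u x0\<bar> + 2*th)" using g2 de by (intro mult_left_mono) auto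
  ultimately have "pucci_minus ga Ga X0 <= hw x0 - hu x0 + de1*(norm p0 + th) + de0*(\<bar>w x0 - u x0\<bar> + 2*th) + 6*th"
   using S E PZ g1 e(5) by linarith
  also have "... = de1*norm p0 + (de0*\<bar>w x0 - u x0\<bar> + hw x0 - hu x0) + (6 + 2*de0 + de1)*th"
   by (simp add: algebra_simps)
  finally show "pucci_minus ga Ga X0 <= de1*norm p0 + (de0*\<bar>w x0 - u x0\<bar> + hw x0 - hu x0) + e0"
   unfolding th(2) .
 qed
qed

text \<open>The penalisation \<open>L (s - k s powr (3/2))\<close> of \<open>s = norm (x - y)\<close>, written as a function of \<open>s^2\<close>.\<close>

definition lip_profile :: "real => real => real" where
 "lip_profile k si = si powr (1/2) - k * si powr (3/4)"

text \<open>With the distance written as \<open>q^2\<close> all fractional powers become polynomials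
  in \<open>q\<close>: the profile is \<open>q^2 - k*q^3\<close>.\<close>

lemma lip_profile_square:
 assumes "q >= 0"
 shows "lip_profile k ((q^2)^2) = q^2*(1 - k*q)"
proof (cases "q = 0")
 case False
 hence q: "q > 0" using assms by simp
 have p: "(q^2)^2 = q powr 4" using q by (simp add: powr_numeral flip: power_mult)
 have "(q powr 4) powr (1/2) = q^2" "(q powr 4) powr (3/4) = q ^ 3"
  unfolding powr_powr using q by (simp_all add: powr_numeral)
 thus ?thesis unfolding lip_profile_def p by (simp add: algebra_simps power2_eq_square power3_eq_cube)
qed (simp add: lip_profile_def)

lemma mjet_lip_profile:
 fixes x :: "real^'n"
 assumes q: "q > 0" and x: "norm x = q^2"
 shows "mjet (\<lambda>y. lip_profile k ((norm (y-0))^2)) x ((1/q^2 - 3/2 * k/q) *\<^sub>R x)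
  (mat (1/q^2 - 3/2 * k/q) + (- 1/q ^ 6 + 3/4 * k/q ^ 5) *\<^sub>R outer x)"
proof -
 define si where "si = (norm (x-0))^2"
 have sip: "si = q powr 4" using q by (simp add: si_def x powr_numeral flip: power_mult)
 have si: "si > 0" using q by (simp add: sip)
 define ph' where "ph' t = (1/2)*t powr (1/2 - 1) - k*((3/4)*t powr (3/4 - 1))" for t :: real
 define b where "b = (1/2)*((1/2 - 1) * si powr (1/2 - 1 - 1)) - k*((3/4)*((3/4 - 1) * si powr (3/4 - 1 - 1)))"
 have 1: "(lip_profile k has_real_derivative ph' t) (at t)" if "\<bar>t - (norm (x-0))^2\<bar> < si" for t
 proof -
  have "t > 0" using that unfolding si_def by linarith
  thus ?thesis unfolding lip_profile_def ph'_def
   by (intro DERIV_diff DERIV_cmult has_real_derivative_powr)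
 qed
 have 2: "(ph' has_real_derivative b) (at ((norm (x-0))^2))"
  unfolding ph'_def b_def si_def[symmetric]
  by (intro DERIV_diff DERIV_cmult has_real_derivative_powr si)
 have "2*ph' ((norm (x-0))^2) = 1/q^2 - 3/2 * k/q"
 proof -
  have "si powr (1/2 - 1) = 1/q^2" "si powr (3/4 - 1) = 1/q"
   unfolding sip powr_powr using q by (simp_all add: powr_minus powr_numeral inverse_eq_divide)
  thus ?thesis unfolding ph'_def si_def[symmetric] by simp
 qed
 moreover have "4*b = - 1/q ^ 6 + 3/4 * k/q ^ 5"
 proof -
  have "si powr (1/2 - 1 - 1) = 1/q ^ 6" "si powr (3/4 - 1 - 1) = 1/q ^ 5"
   unfolding sip powr_powr using q by (simp_all add: powr_minus powr_numeral inverse_eq_divide)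
  thus ?thesis unfolding b_def by simp
 qed
 ultimately show ?thesis using mjet_radial[OF si 1 2] by simp
qed

text \<open>Suppose that the doubled difference is positive somewhere. Concavity of the profile
  makes the trace of the defect at least \<open>3*L*k/q\<close>, where \<open>q^2\<close> is the
  distance of the two points, while the equations bound half of \<open>ga\<close> times this trace
  by a constant multiple of \<open>L\<close>. The factors \<open>L\<close> cancel, and
  \<open>L\<close> is so large that \<open>q\<close> is too small for this. The localising term is
  centred at \<open>z\<close>, one of the two points compared, hence the one-sided form;
  \<open>L\<close> depends on \<open>r\<close> and \<open>M\<close> but not on \<open>u\<close>,
  \<open>h\<close> or \<open>z\<close>.\<close>

lemma (in elliptic) one_sided_lipschitz:
 assumes r: "r > 0" and M: "M > 0"
 obtains L where "L > 0" "!!u h z y. continuous_on Om u ==> vsub F Om u h ==> vsub (reflected F) Om (\<lambda>x. - u x) (\<lambda>x. - h x) ==>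
   cball z r \<subseteq> Om ==> (!!x. x \<in> cball z r ==> \<bar>u x\<bar> <= M \<and> \<bar>h x\<bar> <= M) ==> y \<in> cball z r ==> u z - u y <= L*norm (z-y)"
proof -
 define n where "n = real CARD('n)"
 define c1 where "c1 = n*Ga"
 have n: "n > 0" by (simp add: n_def)
 have c1: "c1 >= 0" using ga n by (simp add: c1_def)
 obtain om nu where om: "mono_on {0..} om" "!!t. t >= 0 ==> om t >= 0" "1/2 < nu"
   "!!t M p z x y. t > 0 ==> symmetric_mat M ==> norm p <= t ==> \<bar>z\<bar> <= t ==> x \<in> Om ==> y \<in> Om ==>
    \<bar>F M p z x - F M p z y\<bar> <= t * om (dist x y powr nu*(norm M/t + 1))"
  using F_modulus by metis
 define W where "W = om 2"
 have W: "W >= 0" using om(2) by (simp add: W_def)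
 \<comment> \<open>Keeps \<open>k*q\<close> at most 1/3 for all distances \<open>q^2 <= 2*r\<close>
   in the ball, so the profile lies between two thirds of the distance and the distance.\<close>
 define k where "k = 1/(3 * sqrt (2*r))"
 have k: "k > 0" using r by (simp add: k_def)
 \<comment> \<open>A maximum point with positive value satisfies \<open>g xh <= 2*M\<close>; this
   weight then confines \<open>xh\<close> to the ball of radius \<open>r/2\<close>.\<close>
 define Q where "Q = 8*M/r^2"
 have Q: "Q > 0" using M r by (simp add: Q_def)
 define C1 where "C1 = 2*M + 2*Q*c1 + 2*c1 + de1*(Q*r + 2) + de0*(2*M)"
 have C1: "C1 >= 0" using M Q c1 de r by (simp add: C1_def)
 \<comment> \<open>The weight in the inequality between geometric and arithmetic mean for
   \<open>sqrt L * sqrt (nb + 1)\<close>; its share of the trace has a factor at most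
   \<open>ga/4\<close>.\<close>
 define th where "th = ga/(4*(n*W + 1))"
 have th: "th > 0" "n*W*th <= ga/4"
 proof -
  have "n*W + 1 > 0" using n W by (simp add: add_nonneg_pos)
  thus "th > 0" "n*W*th <= ga/4" using ga by (auto simp: th_def field_simps)
 qed
 define C2 where "C2 = C1 + W*(1 + M) + ga"
 define C3 where "C3 = W + W*n/th"
 have C23: "C2 > 0" "C3 >= 0" using C1 W M ga n th by (auto simp: C2_def C3_def add_nonneg_pos)
 define q2 where "q2 = min (3*ga * k/(2*(C2 + C3))) (ga/(8*n*W + 1))"
 have q2: "q2 > 0" "q2*(2*(C2 + C3)) <= 3*ga * k" "2*n*W*q2 <= ga/4"
 proof -
  have a: "C2 + C3 > 0" "8*n*W + 1 > 0" using C23 n W by (auto simp: add_nonneg_pos)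
  show "q2 > 0" using a ga k by (simp add: q2_def)
  have "q2 <= 3*ga * k/(2*(C2 + C3))" unfolding q2_def by (rule min.cobounded1)
  thus "q2*(2*(C2 + C3)) <= 3*ga * k" using a by (subst (asm) pos_le_divide_eq) auto
  have "q2 <= ga/(8*n*W + 1)" unfolding q2_def by (rule min.cobounded2)
  hence "q2*(8*n*W + 1) <= ga" using a by (subst (asm) pos_le_divide_eq) auto
  thus "2*n*W*q2 <= ga/4" using \<open>q2 > 0\<close> by (simp add: algebra_simps)
 qed
 \<comment> \<open>A positive maximum forces \<open>L * s < 3*M\<close>; the summands turn this into
   \<open>s < 1/2\<close>, \<open>s < r/4\<close> and \<open>q < q2\<close>.\<close>
 define L where "L = 1 + 6*M + 12*M/r + 3*M/q2^2"
 have L1: "L >= 1" using M r q2 by (simp add: L_def)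
 have L: "3*M <= L*(1/2)" "3*M <= L*(r/4)" "3*M <= L*q2^2"
 proof -
  have nn: "6*M >= 0" "12*M/r >= 0" "3*M/q2^2 >= 0" using M r by auto
  have "6*M <= L" using nn unfolding L_def by linarith
  thus "3*M <= L*(1/2)" by simp
  have "12*M/r*(r/4) <= L*(r/4)" using nn r unfolding L_def by (intro mult_right_mono) linarith+
  thus "3*M <= L*(r/4)" using r by simp
  have "3*M/q2^2*q2^2 <= L*q2^2" using nn unfolding L_def by (intro mult_right_mono) auto
  thus "3*M <= L*q2^2" using q2 by simp
 qed
 show ?thesis
 proof (rule that[of L])
  show "L > 0" using L1 by simp
  fix u h :: "real^'n => real" and z y0 :: "real^'n"
  assume cu: "continuous_on Om u" and sub: "vsub F Om u h" and sup: "vsub (reflected F) Om (\<lambda>x. - u x) (\<lambda>x. - h x)"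
   and BOm: "cball z r \<subseteq> Om" and bnd: "!!x. x \<in> cball z r ==> \<bar>u x\<bar> <= M \<and> \<bar>h x\<bar> <= M" and y0: "y0 \<in> cball z r"
  let ?B = "cball z r"
  define g where "g x = Q*(norm (x-z))^2" for x :: "real^'n"
  define f where "f x = L*lip_profile k ((norm (x-0))^2)" for x :: "real^'n"
  define Ps where "Ps w = u (fst w) - u (snd w) - g (fst w) - f (fst w - snd w)" for w
  have kq: "k*q <= 1/3" if "0 <= q" "q^2 <= 2*r" for q
  proof -
   have "q <= sqrt (2*r)" using that(2) by (rule real_le_rsqrt)
   hence "k*q <= k * sqrt (2*r)" using k by simp
   also have "... = 1/3" using r by (simp add: k_def)
   finally show ?thesis .
  qed
  have fval: "f x = L*(norm x*(1 - k * sqrt (norm x)))" for x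
   using lip_profile_square[of "sqrt (norm x)" k] by (simp add: f_def)
  have "continuous_on (?B \<times> ?B) Ps"
   unfolding Ps_def g_def fval
   by (intro continuous_intros continuous_on_compose2[OF cu]) (use BOm in auto)
  moreover have "?B \<times> ?B ~= {}" using r by auto
  ultimately obtain w where w: "w \<in> ?B \<times> ?B" "!!w'. w' \<in> ?B \<times> ?B ==> Ps w' <= Ps w"
   using continuous_attains_sup[OF compact_Times[OF compact_cball compact_cball]] by metis
  obtain xh yh where wxy: "w = (xh, yh)" by (cases w)
  have xyB: "xh \<in> ?B" "yh \<in> ?B" using w(1) by (auto simp: wxy)
  have "Ps w <= 0"
  proof (rule ccontr)
   assume pos: "\<not> Ps w <= 0"
   define s where "s = norm (xh-yh)"
   define q where "q = sqrt s"
   have s0: "s >= 0" by (simp add: s_def)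
   have s2r: "s <= 2*r"
    using norm_triangle_ineq4[of "xh - z" "yh - z"] xyB by (simp add: s_def dist_norms)
   have qs: "q >= 0" "q^2 = s" using s0 by (auto simp: q_def)
   have kq3: "k*q <= 1/3" using kq[of q] qs s2r by simp
   have fs: "f (xh-yh) = L*(s*(1 - k*q))" unfolding fval s_def q_def ..
   have "s*(2/3) <= s*(1 - k*q)" using kq3 s0 by (intro mult_left_mono) auto
   hence "L*(s*(2/3)) <= f (xh-yh)" unfolding fs by (rule mult_left_mono) (use L1 in simp)
   moreover have "u xh - u yh <= 2*M" using bnd[OF xyB(1)] bnd[OF xyB(2)] by (simp add: abs_le_iff)
   moreover have "g xh >= 0" using Q by (simp add: g_def)
   moreover have "L*(s*(2/3)) >= 0" using L1 s0 by simp
   ultimately have gs: "g xh <= 2*M" and Ls: "L * s < 3*M"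
    using pos unfolding Ps_def wxy by auto
   have sn: "s ~= 0"
   proof
    assume "s = 0"
    thus False using pos \<open>g xh >= 0\<close> fs unfolding Ps_def wxy by (simp add: s_def)
   qed
   hence s: "s > 0" and q: "q > 0" using s0 by (auto simp: q_def)
   have ss: "s < 1/2" "s < r/4" "q < q2"
   proof -
    have "L * s < L*(1/2)" "L * s < L*(r/4)" "L * s < L*q2^2" using Ls L by auto
    hence "s < 1/2" "s < r/4" "s < q2^2" using L1 by auto
    thus "s < 1/2" "s < r/4" by auto
    show "q < q2" using \<open>s < q2^2\<close> q2(1) unfolding q_def by (intro real_less_lsqrt) auto
   qed
   have xz: "norm (xh-z) <= r/2"
   proof -
    have "(norm (xh-z))^2 <= (r/2)^2"
     using gs M r unfolding g_def Q_def by (simp add: field_simps)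
    thus ?thesis using r by (simp add: power2_le_iff_abs_le)
   qed
   have yz: "norm (yh-z) <= 3/4*r"
    using norm_triangle_ineq4[of "xh - z" "xh - yh"] xz ss(2) by (simp add: s_def)
   have xyOm: "xh \<in> Om" "yh \<in> Om" using xyB BOm by auto
   define a where "a = 1/q^2 - 3/2 * k/q"
   define b where "b = - 1/q ^ 6 + 3/4 * k/q ^ 5"
   have as: "a * s = 1 - 3/2*(k*q)"
    using q unfolding a_def qs(2)[symmetric] by (simp add: field_simps power2_eq_square)
   have a: "0 <= a" "a <= 1/s"
   proof -
    have "0 <= a * s" unfolding as using kq3 by simp
    thus "0 <= a" using s by (simp add: zero_le_mult_iff)
    have "a * s <= 1" unfolding as using k q by simp
    thus "a <= 1/s" using s by (simp add: pos_le_divide_eq)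
   qed
   have b: "b <= 0"
   proof -
    have "q ^ 6 = q ^ 5*q" by (simp add: eval_nat_numeral)
    hence "b = (3/4*(k*q) - 1)/q ^ 6" using q by (simp add: b_def field_simps)
    moreover have "3/4*(k*q) - 1 <= 0" using kq3 by simp
    ultimately show ?thesis using q by (simp add: divide_nonpos_pos)
   qed
   have abs: "a + b * s^2 = - (3/4) * k/q"
   proof -
    have "q ^ 6 = q^2*q ^ 4" "q ^ 5 = q*q ^ 4" by (simp_all add: eval_nat_numeral)
    moreover have "s^2 = q ^ 4" using qs(2) by (simp add: power2_eq_square eval_nat_numeral flip: qs(2))
    ultimately show ?thesis using q by (simp add: a_def b_def distrib_right) (simp add: field_simps)
   qed
   let ?d = "xh - yh"
   define pf where "pf = L *\<^sub>R (a *\<^sub>R ?d)"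
   define Xf where "Xf = L *\<^sub>R (mat a + b *\<^sub>R outer ?d)"
   have fj: "mjet f ?d pf Xf"
   proof -
    have "norm ?d = q^2" using qs(2) by (simp add: s_def)
    from mjet_scale[OF mjet_lip_profile[OF q this, of k], of L] L1
    show ?thesis unfolding f_def pf_def Xf_def a_def b_def by simp
   qed
   have gj: "mjet g xh ((2*Q) *\<^sub>R (xh-z)) (mat (2*Q))" unfolding g_def by (rule mjet_square)
   have Xfq: "v \<bullet> (Xf *v v) = L*(a*(norm v)^2 + b*(?d \<bullet> v)^2)" for v
    unfolding Xf_def by (simp add: scaleR_matrix_vector_assoc[symmetric] matrix_vector_mult_add_rdistrib mat_mult_vec outer_mult_vec
      inner_add_right power2_norm_eq_inner power2_eq_square[of "?d \<bullet> v"] inner_commute[of v ?d])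
   have max: "u x + - u y - g x - f (x-y) <= u xh + - u yh - g xh - f ?d"
    if "norm (x-xh) < r/4" "norm (y-yh) < r/4" for x y
   proof -
    have "norm (x-z) <= r" "norm (y-z) <= r"
     using norm_triangle_ineq[of "x - xh" "xh - z"] norm_triangle_ineq[of "y - yh" "yh - z"] that xz yz r by auto
    hence "Ps (x, y) <= Ps w" by (intro w) (auto simp: dist_norms)
    thus ?thesis by (simp add: Ps_def wxy)
   qed
   define e where "e = min (s/2) (r/8)"
   have e: "e > 0" "e <= s/2" "e <= r/8" "e <= 1" using s r ss unfolding e_def by (auto simp: min_def)
   have cu': "continuous_on Om (\<lambda>y. - u y)" by (intro continuous_intros cu)
   have r4: "r/4 > 0" using r by simp
   obtain x p X y p' Y where d: "norm (x-xh) < e" "norm (p - ((2*Q) *\<^sub>R (xh-z) + pf)) < e"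
    "norm (y-yh) < e" "norm (p' + pf) < e" "mjet u x p X" "mjet (\<lambda>y. - u y) y p' Y"
    "!!v v'. v \<bullet> (X *v v) + v' \<bullet> (Y *v v') <= v \<bullet> (mat (2*Q) *v v) + (v-v') \<bullet> (Xf *v (v-v')) + e*((norm v)^2 + (norm v')^2)"
    using doubling[OF open_Om xyOm cu cu' gj fj r4 max e(1)] by metis
   define Z where "Z = (mat (2*Q) :: real^'n^'n)"
   have sym: "symmetric_mat X" "symmetric_mat Y" "symmetric_mat Z"
    using d(5,6) by (auto simp: mjet_def Z_def symmetric_mat_mat)
   have ineq: "v \<bullet> (X *v v) + v' \<bullet> (Y *v v') <= v \<bullet> (Z *v v) + (L/s)*(norm (v-v'))^2 + e*((norm v)^2 + (norm v')^2)" for v v'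
   proof -
    have "a*(norm (v-v'))^2 + b*(?d \<bullet> (v-v'))^2 <= 1/s*(norm (v-v'))^2 + 0"
     using a b by (intro add_mono mult_right_mono mult_nonpos_nonneg) auto
    hence "L*(a*(norm (v-v'))^2 + b*(?d \<bullet> (v-v'))^2) <= L*(1/s*(norm (v-v'))^2 + 0)"
     using L1 by (intro mult_left_mono) auto
    thus ?thesis using d(7)[of v v'] unfolding Xfq Z_def by simp
   qed
   define N where "N = Z + mat (2*e) - (X + Y)"
   define nb where "nb = trace N"
   have Ls0: "L/s > 0" using L1 s by simp
   note IL = Ishii_Lions_matrix[OF sym Ls0 less_imp_le[OF e(1)] ineq]
   have N: "psd N" unfolding N_def by (rule IL(1))
   have nb0: "nb >= 0" using norm_psd_le_trace[OF N] norm_ge_zero[of N] unfolding nb_def by linarith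
   \<comment> \<open>The pair \<open>(v, - v)\<close> along the line through the two points has
     difference \<open>2 *\<^sub>R v\<close> and so sees the concave direction of the profile, where
     \<open>a + b * s^2\<close> is negative.\<close>
   have nb: "3*L * k/q <= nb"
   proof -
    define v where "v = (1/s) *\<^sub>R ?d"
    have nv: "norm v = 1" using s by (simp add: v_def s_def)
    have dv: "?d \<bullet> v = s" using s by (simp add: v_def s_def power2_norm_eq_inner[symmetric] power2_eq_square)
    have dd: "?d \<bullet> (v - (- v)) = 2 * s" "norm (v - (- v)) = 2"
    proof -
     have eq: "v - (- v) = 2 *\<^sub>R v" by (simp only: scaleR_2 diff_minus_eq_add)
     show "?d \<bullet> (v - (- v)) = 2 * s" "norm (v - (- v)) = 2"
      unfolding eq inner_scaleR_right norm_scaleR dv nv by simp_all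
    qed
    have "v \<bullet> (X *v v) + (- v) \<bullet> (Y *v (- v)) <= v \<bullet> (mat (2*Q) *v v) + L*(a*2^2 + b*(2 * s)^2) + e*((norm v)^2 + (norm (- v))^2)"
     using d(7)[of v "- v"] unfolding Xfq dd .
    moreover have "(- v) \<bullet> (Y *v (- v)) = v \<bullet> (Y *v v)" using linear_neg[OF matrix_vector_mul_linear, of Y v] by simp
    moreover have "L*(a*2^2 + b*(2 * s)^2) = 4*L*(a + b * s^2)" by (simp add: algebra_simps power2_eq_square)
    ultimately have "v \<bullet> (X *v v) + v \<bullet> (Y *v v) <= 2*Q - 3*L * k/q + 2*e"
     unfolding abs using nv by (simp add: mat_mult_vec power2_norm_eq_inner[symmetric])
    moreover have "v \<bullet> (N *v v) = 2*Q + 2*e - (v \<bullet> (X *v v) + v \<bullet> (Y *v v))"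
     using nv by (simp add: N_def Z_def matrix_vector_mult_diff_rdistrib matrix_vector_mult_add_rdistrib mat_mult_vec inner_add_right inner_diff_right power2_norm_eq_inner[symmetric])
    moreover have "v \<bullet> (N *v v) <= nb" using psd_quadratic_le_trace[OF N, of v] nv by (simp add: nb_def)
    ultimately show ?thesis by linarith
   qed
   have Yb: "norm Y <= n*(sqrt (2*L)/q * sqrt (nb + 1) + (nb + 2))"
   proof -
    have "norm Y <= n * sqrt ((nb + e)*(2*(L/s) + nb + 2*e))" using IL(2) unfolding nb_def N_def n_def by simp
    also have "... <= n*(sqrt (2*(L/s)) * sqrt (nb + 1) + (nb + 2))"
     using nb0 e Ls0 n by (intro mult_left_mono sqrt_product_bound) auto
    also have "sqrt (2*(L/s)) = sqrt (2*L)/q" by (simp add: q_def real_sqrt_divide real_sqrt_mult)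
    finally show ?thesis .
   qed
   have nx: "norm (x-z) <= r" "norm (y-z) <= r"
    using norm_triangle_ineq[of "x - xh" "xh - z"] norm_triangle_ineq[of "y - yh" "yh - z"] d(1,3) xz yz e(3) r by auto
   hence xyB': "x \<in> ?B" "y \<in> ?B" by (auto simp: dist_norms)
   hence xy: "x \<in> Om" "y \<in> Om" using BOm by auto
   have dxy: "dist x y <= 2 * s"
   proof -
    have "dist x y <= dist x xh + dist xh yh + dist yh y" using dist_triangle[of x y xh] dist_triangle[of xh y yh] by linarith
    also have "... <= e + s + e" using d(1,3) by (simp add: dist_norm s_def norm_minus_commute)
    also have "... <= 2 * s" using e(2) by simp
    finally show ?thesis .
   qed
   have dpow: "dist x y powr nu <= sqrt 2*q"
   proof -
    have "dist x y powr nu <= (2 * s) powr nu" using dxy om(3) by (intro powr_mono2) auto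
    also have "... <= (2 * s) powr (1/2)" using ss(1) s om(3) by (intro powr_mono') auto
    also have "... = sqrt 2*q" using s by (simp add: powr_half_sqrt real_sqrt_mult q_def)
    finally show ?thesis .
   qed
   have q1: "sqrt 2*q <= 1"
   proof -
    have "sqrt 2*q = sqrt (2 * s)" by (simp add: q_def real_sqrt_mult)
    also have "... <= 1" using ss(1) by simp
    finally show ?thesis .
   qed
   define T where "T = dist x y powr nu*norm Y"
   have T: "0 <= T" "T <= n*(L/th + th*(nb + 1)) + 2*n*q*(nb + 2)"
   proof -
    show "0 <= T" by (simp add: T_def)
    have "T <= (sqrt 2*q)*(n*(sqrt (2*L)/q * sqrt (nb + 1) + (nb + 2)))"
     unfolding T_def using dpow Yb q by (intro mult_mono) auto
    also have "... = n*(2*(sqrt L * sqrt (nb + 1))) + n * sqrt 2*q*(nb + 2)"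
     using q by (simp add: real_sqrt_mult algebra_simps)
    also have "... <= n*(L/th + th*(nb + 1)) + n*2*q*(nb + 2)"
    proof (intro add_mono mult_left_mono mult_right_mono)
     have "0 <= (sqrt L/sqrt th - sqrt th * sqrt (nb + 1))^2" by simp
     also have "... = L/th + th*(nb + 1) - 2*(sqrt L * sqrt (nb + 1))"
      using L1 th(1) nb0 by (simp add: power2_diff power_divide power_mult_distrib)
     finally show "2*(sqrt L * sqrt (nb + 1)) <= L/th + th*(nb + 1)" by simp
     show "sqrt 2 <= 2" using sqrt2_less_2 by simp
    qed (use n q nb0 in auto)
    finally show "T <= n*(L/th + th*(nb + 1)) + 2*n*q*(nb + 2)" by (simp add: mult_ac)
   qed
   have p'b: "norm p' <= L + 1"
   proof -
    have "norm pf = L*(a * s)" using L1 a by (simp add: pf_def s_def)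
    also have "... <= L" using a(2) s L1 by (simp add: pos_le_divide_eq)
    finally show ?thesis using norm_triangle_ineq4[of "p' + pf" pf] d(4) e(4) by simp
   qed
   \<comment> \<open>The summand \<open>T\<close> makes \<open>T/t <= 1\<close>, so that the
     argument of \<open>om\<close> is at most 2; the others bound slope and value.\<close>
   define t where "t = L + 1 + M + T"
   have t: "t > 0" using L1 M T by (simp add: t_def)
   have "\<bar>F (- Y) (- p') (u y) x - F (- Y) (- p') (u y) y\<bar> <= t * om (dist x y powr nu*(norm (- Y)/t + 1))"
    using t p'b bnd[OF xyB'(2)] T M L1 unfolding t_def by (intro om(4) symmetric_mat_minus sym xy) auto
   also have "... <= t*W"
   proof (intro mult_left_mono)
    have "T/t <= 1" using t L1 M by (simp add: divide_le_eq t_def)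
    hence "dist x y powr nu*(norm (- Y)/t + 1) <= 2" using dpow q1 by (simp add: distrib_left T_def)
    thus "om (dist x y powr nu*(norm (- Y)/t + 1)) <= W"
     unfolding W_def using t by (intro mono_onD[OF om(1)]) auto
   qed (use t in simp)
   finally have E: "\<bar>F (- Y) (- p') (u y) x - F (- Y) (- p') (u y) y\<bar> <= t*W" .
   have s1: "F X p (u x) x <= h x" using sub xy(1) d(5) by (simp add: vsub_def)
   have s2: "reflected F Y p' (- u y) y <= - h y" using sup xy(2) d(6) by (simp add: vsub_def)
   from sum_estimate[OF sym N[unfolded N_def] less_imp_le[OF e(1)] xy s1 s2]
   have S: "pucci_minus ga Ga Z + ga*nb - 2*e*c1 - de1*norm (p + p') - de0*\<bar>u x - u y\<bar>
    <= h x - h y + \<bar>F (- Y) (- p') (u y) x - F (- Y) (- p') (u y) y\<bar>"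
    unfolding nb_def N_def c1_def n_def .
   have PZ: "- (2*Q*c1) <= pucci_minus ga Ga Z"
   proof (rule pucci_minus_geI[OF ga])
    fix A :: "real^'n^'n" assume A: "A \<in> pucci_class ga Ga"
    have "2*Q*trace A <= 2*Q*c1" unfolding c1_def n_def
     using Q by (intro mult_left_mono pucci_class_trace(2)[OF A]) auto
    thus "- (2*Q*c1) <= - trace (A ** Z)" by (simp add: Z_def trace_mult_mat)
   qed
   have pp: "norm (p + p') <= Q*r + 2"
   proof -
    have "p + p' = (2*Q) *\<^sub>R (xh-z) + ((p - ((2*Q) *\<^sub>R (xh-z) + pf)) + (p' + pf))" by simp
    also have "norm ... <= Q*r + (e + e)"
     using xz Q by (intro norm_triangle_mono less_imp_le[OF d(2)] less_imp_le[OF d(4)]) auto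
    finally show ?thesis using e(4) by simp
   qed
   have "de1*norm (p + p') <= de1*(Q*r + 2)" using pp de by (intro mult_left_mono) auto
   moreover have "de0*\<bar>u x - u y\<bar> <= de0*(2*M)"
    using bnd[OF xyB'(1)] bnd[OF xyB'(2)] de by (intro mult_left_mono) auto
   moreover have "h x - h y <= 2*M" using bnd[OF xyB'(1)] bnd[OF xyB'(2)] by (simp add: abs_le_iff)
   moreover have "2*e*c1 <= 2*c1" using e(4) c1 mult_right_mono[of "2*e" 2 c1] by simp
   ultimately have 1: "ga*nb <= C1 + t*W" using S PZ E unfolding C1_def by linarith
   have "t*W <= (L + 1 + M + (n*(L/th + th*(nb + 1)) + 2*n*q*(nb + 2)))*W"
    unfolding t_def using T W by (intro mult_right_mono) auto
   also have "... = W*(L + 1 + M) + W*n/th*L + (n*W*th)*(nb + 1) + (2*n*W*q)*(nb + 2)"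
    by (simp add: algebra_simps)
   also have "... <= W*(L + 1 + M) + W*n/th*L + ga/4*(nb + 1) + ga/4*(nb + 2)"
   proof (intro add_mono mult_right_mono th(2) order.refl)
    have "2*n*W*q <= 2*n*W*q2" using ss(3) n W by (intro mult_left_mono) auto
    thus "2*n*W*q <= ga/4" using q2(3) by linarith
   qed (use nb0 L1 M in auto)
   also have "... = W*(1 + M) + (W + W*n/th)*L + ga*nb/2 + 3/4*ga"
    by (simp add: field_simps)
   finally have 2: "ga*nb/2 <= C2 + C3*L"
    using 1 ga(1) unfolding C2_def C3_def by linarith
   also have "... <= (C2 + C3)*L" using C23 L1 by (simp add: distrib_right)
   finally have 3: "ga*nb/2 <= (C2 + C3)*L" .
   have "ga*(3*L * k/q)/2 <= ga*nb/2"
    by (intro divide_right_mono mult_left_mono nb) (use ga in auto)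
   hence "ga*(3*L * k/q)/2 <= (C2 + C3)*L" using 3 by (rule order_trans)
   hence "L*(3*ga * k) <= L*(q*(2*(C2 + C3)))" using q by (simp add: field_simps)
   hence "3*ga * k <= q*(2*(C2 + C3))" using L1 by simp
   also have "... < q2*(2*(C2 + C3))" using ss(3) C23 by (intro mult_strict_right_mono) auto
   finally show False using q2(2) by simp
  qed
  moreover have "Ps (z, y0) <= Ps w" using y0 r by (intro w) auto
  ultimately have "u z - u y0 <= f (z-y0)" by (simp add: Ps_def g_def)
  also have "... <= L*norm (z-y0)" unfolding fval using k L1 by (intro mult_left_mono mult_left_le) auto
  finally show "u z - u y0 <= L*norm (z-y0)" .
 qed
qed

lemma (in elliptic) interior_lipschitz:
 assumes r: "r > 0" "cball x0 (2*r) \<subseteq> Om" and M: "M > 0"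
 obtains L where "!!u h x y. continuous_on Om u ==> vsol F Om u h ==> (!!x. x \<in> cball x0 (2*r) ==> \<bar>u x\<bar> <= M \<and> \<bar>h x\<bar> <= M) ==>
  x \<in> ball x0 (r/2) ==> y \<in> ball x0 (r/2) ==> \<bar>u x - u y\<bar> <= L*norm (x-y)"
proof -
 obtain L where L: "L > 0" "!!u h z y. continuous_on Om u ==> vsub F Om u h ==> vsub (reflected F) Om (\<lambda>x. - u x) (\<lambda>x. - h x) ==>
   cball z r \<subseteq> Om ==> (!!x. x \<in> cball z r ==> \<bar>u x\<bar> <= M \<and> \<bar>h x\<bar> <= M) ==> y \<in> cball z r ==> u z - u y <= L*norm (z-y)"
  using one_sided_lipschitz[OF r(1) M] by metis
 show ?thesis
 proof (rule that[of L])
  fix u h x y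
  assume u: "continuous_on Om u" "vsol F Om u h" and b: "!!x. x \<in> cball x0 (2*r) ==> \<bar>u x\<bar> <= M \<and> \<bar>h x\<bar> <= M"
   and xy: "x \<in> ball x0 (r/2)" "y \<in> ball x0 (r/2)"
  have main: "u z - u w <= L*norm (z-w)" if "z \<in> ball x0 (r/2)" "w \<in> ball x0 (r/2)" for z w
  proof (rule L(2)[OF u(1), of h])
   have sub: "cball z r \<subseteq> cball x0 (2*r)"
    using that(1) r(1) by (auto simp: subset_eq dist_norm) (smt (verit) dist_norm dist_triangle dist_commute)
   thus "cball z r \<subseteq> Om" using r(2) by blast
   show "\<bar>u x\<bar> <= M \<and> \<bar>h x\<bar> <= M" if "x \<in> cball z r" for x using b that sub by blast
   show "w \<in> cball z r" using that dist_triangle[of z w x0] by (simp add: dist_commute)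
  qed (use u(2) in \<open>auto simp: vsol_def\<close>)
  show "\<bar>u x - u y\<bar> <= L*norm (x-y)"
   using main[OF xy] main[OF xy(2,1)] by (simp add: abs_le_iff norm_minus_commute)
 qed
qed

section \<open>Stability and maximum principles\<close>

text \<open>The contact of the limit is made strict by \<open>2*et*(norm (y - x0))^2\<close>; the
  approximating functions then have contacts near \<open>x0\<close> with the fixed matrix
  \<open>X'\<close>. Because this matrix does not vary, (F1) acts as continuity of \<open>F\<close>
  in \<open>x\<close>, and (F2) removes the perturbation.\<close>

lemma (in elliptic) vsub_limit:
 assumes u: "!!k::nat. continuous_on Om (u k)" "!!k. vsub F Om (u k) (h k)"
  and U: "continuous_on Om U" "continuous_on Om H"
  and lim: "!!K e. compact K ==> K \<subseteq> Om ==> e > 0 ==> \<forall>\<^sub>F k in sequentially. \<forall>x\<in>K. \<bar>u k x - U x\<bar> < e \<and> \<bar>h k x - H x\<bar> < e"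
 shows "vsub F Om U H"
 unfolding vsub_def
proof (intro ballI allI impI)
 fix x0 p X assume x0: "x0 \<in> Om" and jet: "mjet U x0 p X"
 have symX: "symmetric_mat X" using jet by (simp add: mjet_def)
 define c1 where "c1 = real CARD('n)*Ga"
 have c1: "c1 >= 0" using ga by (simp add: c1_def)
 show "F X p (U x0) x0 <= H x0"
 proof (rule field_le_epsilon)
  fix e0 :: real assume e0: "e0 > 0"
  define th where "th = e0/(4 + de1 + 2*de0)"
  have th: "th > 0" "(4 + de1 + 2*de0)*th = e0" using e0 de by (auto simp: th_def)
  define et where "et = th/(4*c1 + 1)"
  have et: "et > 0" "4*et*c1 <= th" using th c1 by (auto simp: et_def field_simps)
  define X' where "X' = X + mat (2*(2*et))"
  have symX': "symmetric_mat X'" unfolding X'_def by (intro symmetric_mat_add symX symmetric_mat_mat)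
  obtain r1 where r1: "r1 > 0" "cball x0 r1 \<subseteq> Om" using open_Om x0 open_contains_cball by metis
  obtain r3 where r3: "r3 > 0" "!!h. norm h < r3 ==> U (x0 + h) <= U x0 + p \<bullet> h + 1/2*(h \<bullet> (X *v h)) + et*(norm h)^2"
   using mjetD[OF jet et(1)] by metis
  obtain om nu where om: "mono_on {0..} om" "continuous_on {0..} om" "om 0 = 0" "1/2 < nu"
   "!!t M p z x y. t > 0 ==> symmetric_mat M ==> norm p <= t ==> \<bar>z\<bar> <= t ==> x \<in> Om ==> y \<in> Om ==>
    \<bar>F M p z x - F M p z y\<bar> <= t * om (dist x y powr nu*(norm M/t + 1))"
   using F_modulus by metis
  define t where "t = norm p + \<bar>U x0\<bar> + 2*th"
  have t: "t > 0" using th by (simp add: t_def add_nonneg_pos)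
  define ph where "ph x = om (dist x x0 powr nu*(norm X'/t + 1))" for x
  have "continuous_on UNIV ph" unfolding ph_def
   by (rule continuous_on_compose2[OF om(2)])
     (use om(4) t in \<open>auto intro!: continuous_intros continuous_on_powr' add_nonneg_nonneg\<close>)
  hence "isCont ph x0" by (simp add: continuous_on_eq_continuous_at)
  moreover have "ph x0 = 0" using om(3) by (simp add: ph_def)
  moreover have "th/t > 0" using th t by simp
  ultimately obtain r4 where r4: "r4 > 0" "!!x. dist x x0 < r4 ==> ph x < th/t"
   unfolding continuous_at_eps_delta by (fastforce simp: dist_real_def)
  have contD: "\<exists>d>0. \<forall>y\<in>Om. dist y x0 < d --> \<bar>g y - g x0\<bar> < th" if "continuous_on Om g" for g :: "real^'n => real"
   using that x0 th(1) unfolding continuous_on_iff dist_real_def by blast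
  obtain rh1 where rh1: "rh1 > 0" "!!y. y \<in> Om ==> dist y x0 < rh1 ==> \<bar>U y - U x0\<bar> < th" using contD[OF U(1)] by blast
  obtain rh2 where rh2: "rh2 > 0" "!!y. y \<in> Om ==> dist y x0 < rh2 ==> \<bar>H y - H x0\<bar> < th" using contD[OF U(2)] by blast
  obtain B where B: "B > 0" "!!h. norm (X *v h) <= B*norm h"
   using linear_bounded_pos[OF matrix_vector_mul_linear] by metis
  define r where "r = min r1 (r3/2)"
  have r: "r > 0" "r <= r1" "r < r3" using r1 r3 by (auto simp: r_def)
  define s where "s = min (min (r/2) (r4/2)) (min (min (rh1/2) (rh2/2)) (th/(B + 4*et)))"
  have BB: "B + 4*et > 0" using B et by simp
  have s: "s > 0" "s < r" "s < r4" "s < rh1" "s < rh2" "(B + 4*et) * s <= th"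
  proof -
   show s0: "s > 0" using r r4 rh1 rh2 th BB by (simp add: s_def)
   have "s <= r/2" "s <= r4/2" "s <= rh1/2" "s <= rh2/2" "s <= th/(B + 4*et)"
    unfolding s_def by (simp_all only: min_le_iff_disj order_refl simp_thms)
   thus "s < r" "s < r4" "s < rh1" "s < rh2" "(B + 4*et) * s <= th"
    using s0 BB by (auto simp: pos_le_divide_eq mult.commute)
  qed
  \<comment> \<open>An error \<open>si\<close> in the uniform convergence moves the contact point by
    less than \<open>s\<close>.\<close>
  define si where "si = min th (et * s^2/4)"
  have si: "si > 0" "si <= th" "4 * si <= et * s^2" using th et s(1) by (auto simp: si_def)
  let ?B = "cball x0 r"
  have BOm: "?B \<subseteq> Om" using r1 r by auto
  obtain k where k: "!!x. x \<in> ?B ==> \<bar>u k x - U x\<bar> < si \<and> \<bar>h k x - H x\<bar> < si"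
   using eventually_happens[OF lim[OF compact_cball BOm si(1)]] by (auto simp del: mem_cball)
  define g where "g y = (p \<bullet> (y-x0) + 1/2*((y-x0) \<bullet> (X *v (y-x0)))) + (2*et)*(norm (y-x0))^2" for y
  have cont: "continuous_on ?B (\<lambda>x. u k x - g x)"
   unfolding g_def
   by (intro continuous_intros continuous_on_subset[OF u(1) BOm] linear_continuous_on_compose[OF _ matrix_vector_mul_linear])
  have ne: "?B ~= {}" using r by auto
  obtain x where x: "x \<in> ?B" "!!y. y \<in> ?B ==> u k y - g y <= u k x - g x"
   using continuous_attains_sup[OF compact_cball ne cont] by blast
  have x0B: "x0 \<in> ?B" using r by simp
  have xOm: "x \<in> Om" using x BOm by auto
  have nxr: "norm (x-x0) <= r" using x(1) by (simp add: dist_norms)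
  have nx: "norm (x-x0) < s"
  proof -
   have "g x0 = 0" by (simp add: g_def)
   hence "u k x0 <= u k x - g x" using x(2)[OF x0B] by simp
   moreover have "U (x0 + (x-x0)) <= U x0 + p \<bullet> (x-x0) + 1/2*((x-x0) \<bullet> (X *v (x-x0))) + et*(norm (x-x0))^2"
    using nxr r by (intro r3) auto
   ultimately have "et*(norm (x-x0))^2 < 2 * si"
    using k[OF x(1)] k[OF x0B] unfolding g_def by (simp add: abs_less_iff)
   also have "... < et * s^2" using si by linarith
   finally have "(norm (x-x0))^2 < s^2" using et by simp
   thus ?thesis using s(1) by (simp add: power2_less_imp_less)
  qed
  define p' where "p' = (p + X *v (x-x0)) + (2*(2*et)) *\<^sub>R (x-x0)"
  have "mjet g x p' X'" unfolding g_def p'_def X'_def by (intro mjet_add mjet_quadratic mjet_square symX)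
  hence "mjet (u k) x p' X'"
  proof (rule mjet_mono)
   show "r - s > 0" using s by simp
   fix y assume "norm (y-x) < r - s"
   hence "y \<in> ?B" using norm_triangle_ineq[of "y - x" "x - x0"] nx by (simp add: dist_norms)
   thus "u k y - u k x <= g y - g x" using x(2) by fastforce
  qed
  hence 1: "F X' p' (u k x) x <= h k x" using u(2) xOm by (simp add: vsub_def)
  have pp: "norm (p-p') <= th"
  proof -
   have "norm (p-p') = norm (X *v (x-x0) + (4*et) *\<^sub>R (x-x0))"
    unfolding p'_def by (simp add: norm_minus_commute algebra_simps)
   also have "... <= B*norm (x-x0) + 4*et*norm (x-x0)"
    using et by (intro norm_triangle_mono B) auto
   also have "... <= (B + 4*et) * s"
    using nx BB mult_left_mono[of "norm (x-x0)" s "B + 4*et"] by (simp add: distrib_right)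
   finally show ?thesis using s(6) by simp
  qed
  have Ux: "\<bar>U x0 - u k x\<bar> <= 2*th"
   using rh1(2)[OF xOm] nx s(4) k[OF x(1)] si(2) by (simp add: dist_norm abs_le_iff abs_less_iff)
  have Hx: "h k x <= H x0 + 2*th"
   using rh2(2)[OF xOm] nx s(5) k[OF x(1)] si(2) by (simp add: dist_norm abs_le_iff abs_less_iff)
  have "\<bar>F X' p' (u k x) x - F X' p' (u k x) x0\<bar> <= t*ph x"
   unfolding ph_def
  proof (rule om(5)[OF t symX' _ _ xOm x0])
   show "norm p' <= t" using pp norm_triangle_ineq2[of p' p] th(1) by (simp add: t_def norm_minus_commute)
   show "\<bar>u k x\<bar> <= t" unfolding t_def using Ux norm_ge_zero[of p] by linarith
  qed
  also have "... <= th" using r4(2)[of x] nx s(3) t by (simp add: dist_norm field_simps)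
  finally have 2: "F X' p' (u k x) x0 <= h k x + th" using 1 by linarith
  have 3: "F X p (U x0) x0 - F X' p' (u k x) x0 <= th + de1*th + de0*(2*th)"
  proof -
   have "pucci_plus ga Ga (X-X') <= th"
   proof (rule pucci_plus_leI[OF ga])
    fix A :: "real^'n^'n" assume A: "A \<in> pucci_class ga Ga"
    have "4*et*trace A <= 4*et*c1"
     unfolding c1_def using et by (intro mult_left_mono pucci_class_trace(2)[OF A]) auto
    thus "- trace (A ** (X-X')) <= th"
     using et(2) by (simp add: X'_def trace_mult_minus_right trace_mult_mat)
   qed
   moreover have "de1*norm (p-p') <= de1*th" using pp de by (intro mult_left_mono) auto
   moreover have "de0*\<bar>U x0 - u k x\<bar> <= de0*(2*th)" using Ux de by (intro mult_left_mono) auto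
   ultimately show ?thesis using F2_upper[OF symX symX' x0, of p "U x0" p' "u k x"] by linarith
  qed
  have "F X p (U x0) x0 <= H x0 + (4 + de1 + 2*de0)*th"
   using 2 3 Hx by (simp add: algebra_simps)
  thus "F X p (U x0) x0 <= H x0 + e0" unfolding th(2) .
 qed
qed

text \<open>At a maximum of \<open>E/g\<close> the multiple \<open>k*g\<close> of the barrier
  touches \<open>E\<close> from above, and the two inequalities force \<open>k <= e\<close>.
  Boundary values appear only as compactness of the sets \<open>E >= ep\<close>, which makes sense
  for functions without boundary values, such as the differences of multiples of \<open>w j\<close>
  and \<open>u\<close> later.\<close>

lemma barrier_max_principle:
 fixes E g :: "real^'n => real"
 assumes ga: "0 < ga" "ga <= Ga" and Om: "open Om" and E: "continuous_on Om E" "!!ep. ep > 0 ==> compact {x\<in>Om. ep <= E x}"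
  and g: "continuous_on Om g" "!!x. x \<in> Om ==> 1 <= g x"
  and C: "C >= 0" and e: "e >= 0"
  and bar: "!!x. x \<in> Om ==> E x > 0 ==> g x <= 2 \<and> (\<exists>p X. mjet g x p X \<and> 2*C + 1 <= pucci_minus ga Ga X - de*norm p)"
  and sub: "esub ga Ga de {x\<in>Om. E x > 0} E (\<lambda>x. C*E x + e)"
  and x: "x \<in> Om"
 shows "E x <= 2*e"
proof (rule ccontr)
 assume "\<not> E x <= 2*e"
 hence Ex: "E x > 2*e" by simp
 define ep where "ep = E x/2"
 have ep: "ep > 0" "ep > e" using Ex e by (auto simp: ep_def)
 define S where "S = {x\<in>Om. ep <= E x}"
 have xS: "x \<in> S" using x ep by (simp add: S_def ep_def)
 have SOm: "S \<subseteq> Om" by (auto simp: S_def)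
 have "continuous_on S (\<lambda>x. E x/g x)"
  by (intro continuous_intros continuous_on_subset[OF E(1) SOm] continuous_on_subset[OF g(1) SOm])
    (use g(2) SOm in fastforce)
 moreover have "compact S" unfolding S_def by (rule E(2)[OF ep(1)])
 ultimately obtain y where y: "y \<in> S" "!!z. z \<in> S ==> E z/g z <= E y/g y"
  using continuous_attains_sup[of S] xS by blast
 define k where "k = E y/g y"
 have yOm: "y \<in> Om" and Ey: "E y > 0" using y(1) ep by (auto simp: S_def)
 have kx: "ep <= k"
 proof -
  have "ep <= E x/g x" using bar[OF x] g(2)[OF x] ep by (simp add: ep_def field_simps)
  thus ?thesis using y(2)[OF xS] by (simp add: k_def)
 qed
 have le: "E z <= k*g z" if z: "z \<in> Om" for z
 proof (cases "z \<in> S")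
  case True
  thus ?thesis using y(2)[OF True] g(2)[OF z] unfolding k_def[symmetric] by (simp add: pos_divide_le_eq)
 next
  case False
  hence "E z < ep" using z by (simp add: S_def)
  also have "ep <= k*1" using kx by simp
  also have "... <= k*g z" using g(2)[OF z] kx ep by (intro mult_left_mono) auto
  finally show ?thesis by simp
 qed
 have eq: "E y = k*g y" using g(2)[OF yOm] by (simp add: k_def)
 obtain p X where pX: "mjet g y p X" "2*C + 1 <= pucci_minus ga Ga X - de*norm p" using bar[OF yOm Ey] by blast
 have k: "k > 0" using kx ep by linarith
 obtain d where d: "d > 0" "ball y d \<subseteq> Om" using Om yOm open_contains_ball by metis
 have "mjet E y (k *\<^sub>R p) (k *\<^sub>R X)"
 proof (rule mjet_mono[OF mjet_scale[OF pX(1) k] d(1)])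
  fix z assume "norm (z-y) < d"
  hence "z \<in> Om" using d(2) by (auto simp: dist_norms subset_eq)
  thus "E z - E y <= k*g z - k*g y" using le eq by fastforce
 qed
 from esubD[OF sub _ this] yOm Ey k
 have "k*pucci_minus ga Ga X <= de*(k*norm p) + (C*E y + e)" by (simp add: pucci_minus_scaleR[OF ga k])
 moreover have "k*(2*C + 1) <= k*(pucci_minus ga Ga X - de*norm p)" using pX(2) k by (intro mult_left_mono) auto
 moreover have "C*E y <= C*(k*2)" unfolding eq using bar[OF yOm Ey] C k by (intro mult_left_mono) auto
 ultimately have "k <= e" by (simp add: algebra_simps)
 thus False using kx ep by linarith
qed

text \<open>The distance to \<open>Y\<close> lies below the distance to the nearest point of
  \<open>Y\<close>, with equality at \<open>x\<close>; so an increasing function of it is touched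
  from above by a radial barrier. \<open>M\<close> scales the barrier so that the strict inequality
  holds up to the distance \<open>2*R\<close>, and \<open>s\<close> keeps the values between 1 and
  2.\<close>

lemma strip_barrier:
 fixes ga Ga de C R :: real
 assumes ga: "0 < ga" "ga <= Ga" and de: "de >= 0" and C: "C >= 0" and R: "R > 0"
 obtains s G where "s > 0" "continuous_on UNIV G" "!!t. R <= t ==> 1 <= G t" "!!t. 0 <= t ==> t <= R + s ==> G t <= 2"
  "!!(x::real^'n) Y. closed Y ==> Y ~= {} ==> R <= infdist x Y ==> infdist x Y <= R + s ==>
   \<exists>p X. mjet (\<lambda>y. G (infdist y Y)) x p X \<and> 2*C + 1 <= pucci_minus ga Ga X - de*norm p"
proof -
 obtain al where al: "al > 0"
  "!!x z :: real^'n. R <= norm (x-z) ==> \<exists>p X. mjet (\<lambda>y. - exp (- al*(norm (y-z))^2)) x p X \<and>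
    1*exp (- al*(norm (x-z))^2) <= pucci_minus ga Ga X - de*norm p"
  using gaussian_barrier[OF ga de R, of 1, where 'n = 'n] by metis
 define M where "M = (2*C + 1)*exp (al*(2 * R)^2)"
 have M: "M > 0" using C by (simp add: M_def)
 define G where "G t = 1 + M*(exp (- al * R^2) - exp (- al*t^2))" for t
 have cG: "continuous_on UNIV G" unfolding G_def by (intro continuous_intros)
 have mono: "G a <= G b" if "0 <= a" "a <= b" for a b
 proof -
  have "a^2 <= b^2" using that by (intro power_mono)
  thus ?thesis using M al(1) by (simp add: G_def)
 qed
 have "isCont G R" using cG by (simp add: continuous_on_eq_continuous_at)
 then obtain d where d: "d > 0" "!!t. \<bar>t - R\<bar> < d ==> \<bar>G t - G R\<bar> < 1"
  unfolding continuous_at_eps_delta by (metis dist_real_def zero_less_one)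
 have GR: "G R = 1" by (simp add: G_def)
 define s where "s = min (d/2) R"
 have s: "s > 0" "s < d" "s <= R" using d R by (auto simp: s_def)
 show ?thesis
 proof (rule that[OF s(1) cG])
  show "1 <= G t" if "R <= t" for t using mono[of R t] that R GR by simp
  show "G t <= 2" if "0 <= t" "t <= R + s" for t
   using mono[OF that] d(2)[of "R + s"] s GR by (simp add: abs_less_iff)
  fix x :: "real^'n" and Y assume Y: "closed Y" "Y ~= {}" "R <= infdist x Y" "infdist x Y <= R + s"
  obtain y where y: "y \<in> Y" "infdist x Y = dist x y" using infdist_attains_inf[OF Y(1,2)] by metis
  have ry: "R <= norm (x-y)" "norm (x-y) <= 2 * R" using Y(3,4) y(2) s by (auto simp: dist_norm)
  obtain p X where pX: "mjet (\<lambda>w. - exp (- al*(norm (w-y))^2)) x p X"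
   "exp (- al*(norm (x-y))^2) <= pucci_minus ga Ga X - de*norm p" using al(2)[OF ry(1)] by auto
  have "mjet (\<lambda>w. G (infdist w Y)) x (M *\<^sub>R p) (M *\<^sub>R X)"
  proof (rule mjet_mono[OF mjet_scale[OF pX(1) M] zero_less_one])
   fix w
   have "G (infdist w Y) <= G (norm (w-y))"
    using infdist_le[OF y(1), of w] by (intro mono infdist_nonneg) (simp add: dist_norm)
   moreover have i: "infdist x Y = norm (x-y)" using y(2) by (simp add: dist_norm)
   ultimately show "G (infdist w Y) - G (infdist x Y) <= M * - exp (- al*(norm (w-y))^2) - M * - exp (- al*(norm (x-y))^2)"
    unfolding i by (simp add: G_def algebra_simps)
  qed
  moreover have "2*C + 1 <= pucci_minus ga Ga (M *\<^sub>R X) - de*norm (M *\<^sub>R p)"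
  proof -
   have "(norm (x-y))^2 <= (2 * R)^2" using ry by (intro power_mono) auto
   hence "exp (- al*(2 * R)^2) <= exp (- al*(norm (x-y))^2)" using al(1) by simp
   hence "exp (- al*(2 * R)^2) <= pucci_minus ga Ga X - de*norm p" using pX(2) by linarith
   hence "M*exp (- al*(2 * R)^2) <= M*(pucci_minus ga Ga X - de*norm p)" using M by simp
   moreover have "M*exp (- al*(2 * R)^2) = 2*C + 1"
    unfolding M_def by (simp add: mult.assoc flip: exp_add)
   ultimately show ?thesis using M by (simp add: pucci_minus_scaleR[OF ga M] right_diff_distrib mult_ac)
  qed
  ultimately show "\<exists>p X. mjet (\<lambda>y. G (infdist y Y)) x p X \<and> 2*C + 1 <= pucci_minus ga Ga X - de*norm p" by blast
 qed
qed

text \<open>A Gaussian bump centred at \<open>y\<close>, shifted to equal \<open>- e\<close> on the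
  outer sphere, stays below \<open>D\<close> on the annulus. The constant depends on neither
  \<open>D\<close>, \<open>y\<close>, \<open>e\<close> nor \<open>th\<close>, so the bound can be
  propagated uniformly along a sequence.\<close>

lemma lower_bound_spreads:
 fixes ga Ga de C r R0 R1 :: real
 assumes ga: "0 < ga" "ga <= Ga" and de: "de >= 0" and C: "C >= 0" and r: "0 < r" "r < R0" "R0 < R1"
 obtains c where "c > 0" "!!(D::real^'n => real) y e th. continuous_on (cball y R1) D ==>
   esub ga Ga de (ball y R1) (\<lambda>x. - D x) (\<lambda>x. C*\<bar>D x\<bar> + e) ==> 0 <= e ==> 0 < th ==> e < c*th ==>
   (!!x. x \<in> cball y R1 ==> - e <= D x) ==> (!!x. x \<in> cball y r ==> th <= D x) ==> \<forall>x\<in>cball y R0. c*th <= D x"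
proof -
 obtain al where al: "al > 0"
  "!!x z :: real^'n. r <= norm (x-z) ==> \<exists>p X. mjet (\<lambda>y. - exp (- al*(norm (y-z))^2)) x p X \<and>
    (C + 1)*exp (- al*(norm (x-z))^2) <= pucci_minus ga Ga X - de*norm p"
  using gaussian_barrier[OF ga de r(1), of "C + 1", where 'n = 'n] by metis
 define ep1 where "ep1 = exp (- al * R1^2)"
 define ka where "ka = exp (- al * R0^2) - ep1"
 have "R0^2 < R1^2" using r by (intro power_strict_mono) auto
 hence ka: "ka > 0" using al(1) by (simp add: ka_def ep1_def)
 have ep1: "ep1 > 0" by (simp add: ep1_def)
 \<comment> \<open>The first entry lets the bump beat the error \<open>e\<close> in the differential
   inequality; the second leaves \<open>c*th\<close> on the ball of radius \<open>R0\<close> after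
   \<open>e\<close> has been subtracted.\<close>
 define c where "c = min (ep1/(C + 1)) (ka/2)"
 have c: "c > 0" "c*(C + 1) <= ep1" "2*c <= ka"
 proof -
  show "c > 0" using ep1 ka C by (simp add: c_def)
  have "c <= ep1/(C + 1)" "c <= ka/2" unfolding c_def by (rule min.cobounded1, rule min.cobounded2)
  thus "c*(C + 1) <= ep1" "2*c <= ka" using C by (auto simp: pos_le_divide_eq)
 qed
 show ?thesis
 proof (rule that[OF c(1)])
  fix D :: "real^'n => real" and y e th
  assume D: "continuous_on (cball y R1) D" "esub ga Ga de (ball y R1) (\<lambda>x. - D x) (\<lambda>x. C*\<bar>D x\<bar> + e)"
   and e: "0 <= e" and th: "0 < th" "e < c*th"
   and lo: "!!x. x \<in> cball y R1 ==> - e <= D x" and core: "!!x. x \<in> cball y r ==> th <= D x"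
  define E where "E x = exp (- al*(norm (x-y))^2)" for x
  have E: "0 < E x" "E x <= 1" for x using al(1) by (auto simp: E_def)
  define b where "b x = th*(E x - ep1) - e" for x
  have cb: "continuous_on S b" for S unfolding b_def E_def by (intro continuous_intros)
  define S where "S = cball y R1 - ball y r"
  have "compact S" unfolding S_def by (intro compact_diff compact_cball open_ball)
  moreover have "continuous_on S (\<lambda>x. D x - b x)"
   by (intro continuous_intros cb continuous_on_subset[OF D(1)]) (auto simp: S_def)
  moreover have "S ~= {}"
  proof -
   have "y + R0 *\<^sub>R axis undefined 1 \<in> S" using r by (simp add: S_def dist_norm)
   thus ?thesis by blast
  qed
  ultimately obtain x where x: "x \<in> S" "!!z. z \<in> S ==> D x - b x <= D z - b z"
   using continuous_attains_inf[of S "\<lambda>x. D x - b x"] by auto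
  have nx: "r <= norm (x-y)" "norm (x-y) <= R1" using x(1) by (auto simp: S_def dist_norms)
  have "0 <= D x - b x"
  proof (rule ccontr)
   assume "\<not> 0 <= D x - b x"
   hence neg: "D x < b x" by simp
   have "norm (x-y) ~= R1"
   proof
    assume "norm (x-y) = R1"
    hence "b x = - e" by (simp add: b_def E_def ep1_def)
    thus False using neg lo[of x] nx by (simp add: dist_norms)
   qed
   moreover have "norm (x-y) ~= r"
   proof
    assume "norm (x-y) = r"
    hence "th <= D x" by (intro core) (simp add: dist_norms)
    moreover have "th*(E x - ep1) <= th*1" using E(2)[of x] ep1 th by (intro mult_left_mono) auto
    ultimately show False using neg e unfolding b_def by linarith
   qed
   ultimately have nx': "r < norm (x-y)" "norm (x-y) < R1" using nx by auto
   obtain p X where pX: "mjet (\<lambda>w. - exp (- al*(norm (w-y))^2)) x p X"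
    "(C + 1)*E x <= pucci_minus ga Ga X - de*norm p" using al(2)[OF nx(1)] unfolding E_def by auto
   have "mjet (\<lambda>x. - D x) x (th *\<^sub>R p) (th *\<^sub>R X)"
   proof (rule mjet_mono[OF mjet_scale[OF pX(1) th(1)]])
    show "min (norm (x-y) - r) (R1 - norm (x-y)) > 0" using nx' by simp
    fix w assume w: "norm (w-x) < min (norm (x-y) - r) (R1 - norm (x-y))"
    have "w \<in> S" using w norm_triangle_ineq[of "w - x" "x - y"] norm_triangle_ineq[of "x - w" "w - y"]
     by (simp add: S_def dist_norms)
    thus "- D w - - D x <= th * - exp (- al*(norm (w-y))^2) - th * - exp (- al*(norm (x-y))^2)"
     using x(2) unfolding b_def E_def by (fastforce simp: algebra_simps)
   qed
   from esubD[OF D(2) _ this] nx'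
   have "th*pucci_minus ga Ga X <= de*(th*norm p) + (C*\<bar>D x\<bar> + e)"
    using th(1) by (simp add: pucci_minus_scaleR[OF ga th(1)] dist_norms)
   moreover have "th*((C + 1)*E x) <= th*(pucci_minus ga Ga X - de*norm p)"
    using pX(2) th by (intro mult_left_mono) auto
   moreover have "C*\<bar>D x\<bar> <= C*(th*E x + e)"
   proof (intro mult_left_mono C)
    have "b x <= th*E x" unfolding b_def using th ep1 e by (simp add: algebra_simps)
    moreover have "- e <= D x" using nx by (intro lo) (simp add: dist_norms)
    moreover have "0 <= th*E x" using th E(1)[of x] by simp
    ultimately show "\<bar>D x\<bar> <= th*E x + e" using neg e by (simp add: abs_le_iff)
   qed
   moreover have "(C + 1)*e < th*E x"
   proof -
    have "(norm (x-y))^2 <= R1^2" using nx by (intro power_mono) auto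
    hence "ep1 <= E x" using al(1) by (simp add: E_def ep1_def)
    have "(C + 1)*e < (C + 1)*(c*th)" using th C by (intro mult_strict_left_mono) auto
    also have "... <= th*ep1" using mult_left_mono[OF c(2), of th] th by (simp add: mult_ac)
    also have "... <= th*E x" using \<open>ep1 <= E x\<close> th by simp
    finally show ?thesis .
   qed
   ultimately show False by (simp add: algebra_simps)
  qed
  hence ge: "b z <= D z" if "z \<in> S" for z using x(2)[OF that] by linarith
  show "\<forall>x\<in>cball y R0. c*th <= D x"
  proof
   fix z assume z: "z \<in> cball y R0"
   show "c*th <= D z"
   proof (cases "z \<in> cball y r")
    case True
    have "exp (- al * R0^2) <= 1" using al(1) by simp
    hence "c <= 1" using c(3) ep1 c(1) unfolding ka_def by linarith
    thus ?thesis using core[OF True] mult_right_mono[OF _ less_imp_le[OF th(1)], of c 1] by simp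
   next
    case False
    hence "b z <= D z" using z r by (intro ge) (auto simp: S_def)
    moreover have "(norm (z-y))^2 <= R0^2" using z by (intro power_mono) (auto simp: dist_norms)
    hence "ka <= E z - ep1" using al(1) by (simp add: ka_def E_def)
    hence "th*(2*c) <= th*(E z - ep1)" using c(3) th by (intro mult_left_mono) auto
    ultimately show ?thesis using th unfolding b_def by (simp add: algebra_simps)
   qed
  qed
 qed
qed

text \<open>The sequence need not converge, so the usual argument is applied to the set of points
  near which it is eventually bounded below by a positive constant. This set and its complement in
  \<open>Om\<close> are open, because such a bound spreads from a point to a ball whose radius is
  governed by the distance to the complement of \<open>Om\<close>.\<close>

lemma strong_minimum_sequence:
 fixes D :: "nat => real^'n => real"
 assumes ga: "0 < ga" "ga <= Ga" and de: "de >= 0" and C: "C >= 0" and Om: "open Om" "connected Om"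
  and D: "!!j. continuous_on Om (D j)" "!!j. esub ga Ga de Om (\<lambda>x. - D j x) (\<lambda>x. C*\<bar>D j x\<bar> + e j)"
   "!!j x. x \<in> Om ==> - e j <= D j x"
  and e: "!!j. 0 <= e j" "e \<longlonglongrightarrow> 0"
  and x0: "x0 \<in> Om" "r0 > 0" "th0 > 0" "\<forall>\<^sub>F j in sequentially. \<forall>x\<in>ball x0 r0. th0 <= D j x"
  and x1: "x1 \<in> Om"
 shows "\<exists>r>0. \<exists>th>0. \<forall>\<^sub>F j in sequentially. \<forall>x\<in>ball x1 r. th <= D j x"
proof -
 define S where "S = {x\<in>Om. \<exists>r>0. \<exists>th>0. \<forall>\<^sub>F j in sequentially. \<forall>z\<in>ball x r. th <= D j z}"
 \<comment> \<open>Starting at \<open>y\<close> within \<open>rh\<close> of \<open>x\<close>, the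
   bound reaches the ball of radius \<open>2*rh\<close> about \<open>y\<close>, which covers the
   ball of radius \<open>rh\<close> about \<open>x\<close>.\<close>
 have step: "ball x rh \<subseteq> S" if st: "cball x (4*rh) \<subseteq> Om" "rh > 0" "y \<in> S" "y \<in> ball x rh" for x rh y
 proof -
  obtain r th where r: "r > 0" "th > 0" "\<forall>\<^sub>F j in sequentially. \<forall>z\<in>ball y r. th <= D j z"
   using st(3) by (auto simp: S_def)
  define r' where "r' = min (r/2) rh"
  have r': "0 < r'" "r' < 2*rh" "2*rh < 3*rh" "r' < r" using r st(2) by (auto simp: r'_def)
  obtain c where c: "c > 0" "!!(D::real^'n => real) y e th. continuous_on (cball y (3*rh)) D ==>
   esub ga Ga de (ball y (3*rh)) (\<lambda>x. - D x) (\<lambda>x. C*\<bar>D x\<bar> + e) ==> 0 <= e ==> 0 < th ==> e < c*th ==>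
   (!!x. x \<in> cball y (3*rh) ==> - e <= D x) ==> (!!x. x \<in> cball y r' ==> th <= D x) ==> \<forall>x\<in>cball y (2*rh). c*th <= D x"
   using lower_bound_spreads[OF ga de C r'(1-3)] by metis
  have sub: "cball y (3*rh) \<subseteq> Om"
  proof
   fix z assume "z \<in> cball y (3*rh)"
   hence "z \<in> cball x (4*rh)" using st(4) dist_triangle[of x z y] by simp
   thus "z \<in> Om" using st(1) by blast
  qed
  have "\<forall>\<^sub>F j in sequentially. e j < c*th" by (rule order_tendstoD(2)[OF e(2)]) (use c r in auto)
  with r(3) have ev: "\<forall>\<^sub>F j in sequentially. \<forall>z\<in>cball y (2*rh). c*th <= D j z"
  proof eventually_elim
   case (elim j)
   show ?case
   proof (rule c(2))
    show "continuous_on (cball y (3*rh)) (D j)" by (rule continuous_on_subset[OF D(1) sub])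
    show "esub ga Ga de (ball y (3*rh)) (\<lambda>x. - D j x) (\<lambda>x. C*\<bar>D j x\<bar> + e j)"
     using sub by (intro esub_mono[OF D(2)]) auto
    show "- e j <= D j z" if "z \<in> cball y (3*rh)" for z using that sub D(3) by blast
    show "th <= D j z" if "z \<in> cball y r'" for z using that elim r'(4) by auto
   qed (use e(1) r elim in auto)
  qed
  show ?thesis
  proof
   fix z assume z: "z \<in> ball x rh"
   have "dist y z < 2*rh" using z st(4) dist_triangle[of y z x] by (simp add: dist_commute)
   hence "ball z (2*rh - dist y z) \<subseteq> cball y (2*rh)"
   proof (intro subsetI)
    fix v assume "v \<in> ball z (2*rh - dist y z)"
    thus "v \<in> cball y (2*rh)" using dist_triangle[of y v z] by simp
   qed
   with ev have "\<forall>\<^sub>F j in sequentially. \<forall>v\<in>ball z (2*rh - dist y z). c*th <= D j v"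
    by (auto elim!: eventually_mono)
   moreover have "z \<in> Om" using z st(1,2) by (auto simp: subset_eq)
   moreover have "2*rh - dist y z > 0" "c*th > 0" using \<open>dist y z < 2 * rh\<close> c(1) r(2) by auto
   ultimately show "z \<in> S" unfolding S_def by blast
  qed
 qed
 have ex: "\<exists>rh>0. cball x (4*rh) \<subseteq> Om" if x: "x \<in> Om" for x
 proof -
  obtain d where "d > 0" "cball x d \<subseteq> Om" using Om(1) x open_contains_cball by metis
  thus ?thesis by (intro exI[of _ "d/4"]) auto
 qed
 have SOm: "S \<subseteq> Om" by (auto simp: S_def)
 have oS: "open S"
  unfolding open_contains_ball
 proof
  fix x assume x: "x \<in> S"
  then obtain rh where "rh > 0" "cball x (4*rh) \<subseteq> Om" using ex SOm by blast
  hence "ball x rh \<subseteq> S" using x by (intro step[of x rh x]) auto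
  thus "\<exists>e>0. ball x e \<subseteq> S" using \<open>rh > 0\<close> by blast
 qed
 have oC: "open (Om-S)"
  unfolding open_contains_ball
 proof
  fix x assume x: "x \<in> Om - S"
  then obtain rh where rh: "rh > 0" "cball x (4*rh) \<subseteq> Om" using ex by blast
  have "ball x rh \<subseteq> Om - S"
  proof
   fix y assume y: "y \<in> ball x rh"
   have "y \<notin> S"
   proof
    assume "y \<in> S"
    hence "ball x rh \<subseteq> S" using y rh by (intro step[of x rh y]) auto
    thus False using x rh(1) centre_in_ball by blast
   qed
   moreover have "y \<in> Om" using y rh by (auto simp: subset_eq)
   ultimately show "y \<in> Om - S" by blast
  qed
  thus "\<exists>e>0. ball x e \<subseteq> Om - S" using rh(1) by blast
 qed
 have "x0 \<in> S" using x0 unfolding S_def by blast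
 hence "Om - S = {}"
  using connectedD[OF Om(2) oS oC] SOm by blast
 hence "x1 \<in> S" using x1 by blast
 thus ?thesis by (auto simp: S_def)
qed

section \<open>The Aleksandrov--Bakelman--Pucci estimate\<close>

text \<open>If \<open>u\<close> lies below two planes that touch it at \<open>x1\<close> and \<open>x2\<close>, then it lies below the ridge of the
 two planes; a paraboloid that is very concave across the ridge bounds the difference of the slopes.\<close>

lemma contact_slopes_close:
 fixes u g :: "real^'n => real"
 assumes ga: "0 < ga" "ga <= Ga" and de: "de >= 0" and rh: "rh > 0"
  and K: "K = 2*real CARD('n)*Ga/ga" and R: "R = 10*K*rh"
  and u: "continuous_on (cball x1 R) u" "esub ga Ga de (ball x1 R) u g" and g: "!!x. x \<in> ball x1 R ==> g x <= m"
  and x12: "norm (x2-x1) <= rh" and pB: "norm p1 <= B" "norm p2 <= B"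
  and c1: "!!y. y \<in> cball x1 R ==> u y <= u x1 + p1 \<bullet> (y-x1)"
  and c2: "!!y. y \<in> cball x1 R ==> u y <= u x2 + p2 \<bullet> (y-x2)"
 shows "norm (p2-p1) <= 16*K/(real CARD('n)*Ga)*rh*(m + 5*de*B)"
proof -
 define n where "n = real CARD('n)"
 have n: "n >= 1" using zero_less_card_finite[where 'a='n] by (simp add: n_def Suc_leI)
 have K2: "K >= 2"
 proof -
  have "2*ga <= 2*n*Ga" using n ga mult_mono[of 1 n ga Ga] by simp
  thus ?thesis using ga unfolding K n_def[symmetric] by (simp add: pos_le_divide_eq)
 qed
 have nG: "n*Ga > 0" using n ga by simp
 have Kga: "K*ga = 2*n*Ga" using ga by (simp add: K n_def)
 have B0: "B >= 0" using pB(1) norm_ge_zero order_trans by blast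
 define P where "P = norm (p2-p1)"
 have R0: "R > 0" and rhR: "rh <= R" using K2 rh mult_right_mono[of 1 "10*K" rh] by (auto simp: R)
 have x2B: "x2 \<in> cball x1 R" using x12 rhR by (simp add: dist_norms)
 have x1B: "x1 \<in> cball x1 R" using R0 by simp
 show ?thesis
 proof (cases "P = 0")
  case True
  have "x1 \<in> ball x1 R" using R0 by simp
  have "0 <= m + 5*de*B"
  proof -
   have "mjet u x1 p1 0"
   proof (rule mjetI[OF symmetric_mat_0 R0])
    fix h :: "real^'n" assume "norm h < R"
    thus "u (x1 + h) <= u x1 + p1 \<bullet> h + 1/2*(h \<bullet> (0 *v h))" using c1[of "x1 + h"] by (simp add: dist_norm)
   qed
   from esubD[OF u(2) \<open>x1 \<in> ball x1 R\<close> this]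
   have "pucci_minus ga Ga (0 :: real^'n^'n) <= de*norm p1 + g x1" .
   moreover have "0 <= pucci_minus ga Ga (0 :: real^'n^'n)"
    by (rule pucci_minus_geI[OF ga]) (simp add: trace_def matrix_matrix_mult_def)
   moreover have "de*norm p1 <= de*(5*B)" using pB de B0 by (intro mult_left_mono) auto
   ultimately show ?thesis using g[OF \<open>x1 \<in> ball x1 R\<close>] by simp
  qed
  thus ?thesis using True rh K2 nG unfolding P_def[symmetric] n_def[symmetric] by simp
 next
  case False
  hence P: "P > 0" by (simp add: P_def)
  define e where "e = (1/P) *\<^sub>R (p2-p1)"
  have ne: "norm e = 1" and pe: "p2 - p1 = P *\<^sub>R e" using P by (auto simp: e_def P_def)
  \<comment> \<open>Makes \<open>a*K = P/(32*rh)\<close>: in the slab the concave term costs at most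
    \<open>P*rh/2\<close>, whereas on the sphere of radius \<open>R = 10*K*rh\<close> the convex
    term is worth more than \<open>6*P*rh\<close>.\<close>
  define a where "a = P/(32*K*rh)"
  have a: "a > 0" "a*(32*K*rh) = P" using P K2 rh by (auto simp: a_def)
  define v where "v h = u (x1 + h) - u x1 - p1 \<bullet> h" for h
  have v1: "v h <= 0" if "norm h <= R" for h using c1[of "x1 + h"] that by (simp add: v_def dist_norm)
  have v2: "v h <= P*(e \<bullet> h) + P*rh" if "norm h <= R" for h
  proof -
   have "u (x1 + h) <= u x2 + p2 \<bullet> (x1 + h - x2)" using that by (intro c2) (simp add: dist_norm)
   moreover have "u x2 <= u x1 + p1 \<bullet> (x2-x1)" by (rule c1[OF x2B])
   ultimately have "v h <= (p2-p1) \<bullet> h + (p2-p1) \<bullet> (x1-x2)"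
    by (simp add: v_def inner_diff_left inner_diff_right inner_add_right)
   also have "(p2-p1) \<bullet> (x1-x2) <= norm (p2-p1)*norm (x1-x2)" by (rule norm_cauchy_schwarz)
   also have "... <= P*rh" using x12 by (simp add: P_def norm_minus_commute mult_left_mono)
   finally show ?thesis unfolding pe by simp
  qed
  \<comment> \<open>After subtraction of the first plane, \<open>v\<close> lies below functions of
    slope 0 and \<open>P\<close> in the direction \<open>e\<close>. The paraboloid has the mean
    slope \<open>P/2\<close>, agrees with \<open>v\<close> at 0 and exceeds \<open>v\<close> on the
    boundary of \<open>D\<close>, so that lowering it produces a contact inside.\<close>
  define ph where "ph h = P/2*(e \<bullet> h) + a*(norm h)^2 - a*K*(e \<bullet> h)^2" for h
  define D where "D = cball (0::real^'n) R \<inter> {h. \<bar>e \<bullet> h\<bar> <= 4*rh}"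
  have aK: "a*K = P/(32*rh)" using K2 by (simp add: a_def)
  have "closed {h::real^'n. \<bar>e \<bullet> h\<bar> <= 4*rh}" by (intro closed_Collect_le continuous_intros)
  hence "compact D" unfolding D_def by (intro compact_Int_closed compact_cball)
  moreover have "continuous_on D (\<lambda>h. ph h - v h)"
   unfolding ph_def v_def
   by (intro continuous_intros continuous_on_compose2[OF u(1)]) (auto simp: D_def dist_norm)
  moreover have "0 \<in> D" using R0 rh by (simp add: D_def)
  hence "D ~= {}" by blast
  ultimately obtain h where h: "h \<in> D" "!!k. k \<in> D ==> ph h - v h <= ph k - v k"
   using continuous_attains_inf[of D "\<lambda>h. ph h - v h"] by auto
  have le0: "ph h <= v h" using h(2)[OF \<open>0 \<in> D\<close>] by (simp add: ph_def v_def)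
  define s where "s = e \<bullet> h"
  have hR: "norm h <= R" and s4: "\<bar>s\<bar> <= 4*rh" using h(1) by (auto simp: D_def s_def)
  have s2: "s^2 <= 16*rh^2" using power_mono[OF s4, of 2] by (simp add: power_mult_distrib)
  have aKs: "a*K * s^2 <= P*rh/2"
  proof -
   have "a*K * s^2 <= a*K*(16*rh^2)" using s2 a K2 by (intro mult_left_mono) auto
   also have "... = P*rh/2" unfolding aK using rh by (simp add: power2_eq_square)
   finally show ?thesis .
  qed
  have ah: "0 <= a*(norm h)^2" using a by simp
  have nR: "norm h < R"
  proof (rule ccontr)
   assume "\<not> norm h < R"
   hence "norm h = R" using hR by simp
   hence "a*(norm h)^2 = P/32*(100*K*rh)"
    using K2 rh by (simp add: R a_def power2_eq_square)
   moreover have "P/32*(100*K*rh) >= P/32*(200*rh)" using P K2 rh by (intro mult_left_mono) auto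
   moreover have "P/2 * s >= - (P/2*(4*rh))" using s4 P mult_left_mono[of "- s" "4*rh" "P/2"] by (simp add: abs_le_iff)
   moreover have "P*rh > 0" using P rh by simp
   ultimately have "ph h > 0" using aKs unfolding ph_def s_def[symmetric] by simp
   thus False using le0 v1[OF hR] by simp
  qed
  have s_up: "s < 4*rh"
  proof (rule ccontr)
   assume "\<not> s < 4*rh"
   hence s: "s = 4*rh" using s4 by simp
   have "P*rh > 0" using P rh by simp
   moreover have "P/2 * s = 2*(P*rh)" using s by simp
   ultimately have "ph h > 0" using aKs ah unfolding ph_def s_def[symmetric] by linarith
   thus False using le0 v1[OF hR] by simp
  qed
  have s_lo: "- (4*rh) < s"
  proof (rule ccontr)
   assume "\<not> - (4*rh) < s"
   hence s: "s = - (4*rh)" using s4 by simp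
   have "P*rh > 0" using P rh by simp
   moreover have "P/2 * s = - 2*(P*rh)" "P * s = - 4*(P*rh)" using s by simp_all
   moreover have "v h <= P * s + P*rh" using v2[OF hR] by (simp add: s_def)
   ultimately have "ph h > v h" using aKs ah unfolding ph_def s_def[symmetric] by simp
   thus False using le0 by simp
  qed
  define q where "q = (P/2) *\<^sub>R e + (2*a) *\<^sub>R h - (2*a*K * s) *\<^sub>R e"
  define X where "X = mat (2*a) - (2*a*K) *\<^sub>R outer e"
  have symX: "symmetric_mat X" unfolding X_def by (intro symmetric_mat_diff symmetric_mat_mat symmetric_mat_scaleR symmetric_mat_outer)
  have phexp: "ph (h + k) = ph h + q \<bullet> k + 1/2*(k \<bullet> (X *v k))" for k
  proof -
   have "(norm (h + k))^2 = (norm h)^2 + 2*(h \<bullet> k) + (norm k)^2"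
    by (simp add: power2_norm_eq_inner algebra_simps) (simp add: inner_commute)
   moreover have "k \<bullet> (X *v k) = 2*a*(norm k)^2 - 2*a*K*(e \<bullet> k)^2"
    by (simp add: X_def matrix_vector_mult_diff_rdistrib mat_mult_vec scaleR_matrix_vector_assoc[symmetric] outer_mult_vec
      inner_diff_right power2_norm_eq_inner power2_eq_square[of "e \<bullet> k"] inner_commute[of k e])
   ultimately show ?thesis
    unfolding ph_def q_def s_def by (simp add: inner_add_left inner_diff_left inner_add_right power2_eq_square algebra_simps)
  qed
  define d where "d = min (R - norm h) (4*rh - \<bar>s\<bar>)"
  have d: "d > 0" using nR s_up s_lo by (simp add: d_def abs_less_iff)
  have jet: "mjet u (x1 + h) (p1 + q) X"
  proof (rule mjetI[OF symX d])
   fix k :: "real^'n" assume k: "norm k < d"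
   have "norm (h + k) <= R" using norm_triangle_ineq[of h k] k by (simp add: d_def)
   moreover have "\<bar>e \<bullet> (h + k)\<bar> <= 4*rh"
   proof -
    have "\<bar>e \<bullet> k\<bar> <= norm k" using Cauchy_Schwarz_ineq2[of e k] ne by simp
    thus ?thesis using k unfolding inner_add_right s_def[symmetric] d_def by linarith
   qed
   ultimately have "h + k \<in> D" by (simp add: D_def)
   from h(2)[OF this] have "v (h + k) <= v h + (ph (h + k) - ph h)" by linarith
   thus "u (x1 + h + k) <= u (x1 + h) + (p1 + q) \<bullet> k + 1/2*(k \<bullet> (X *v k))"
    unfolding phexp v_def by (simp add: inner_add_left inner_add_right algebra_simps)
  qed
  have inb: "x1 + h \<in> ball x1 R" using nR by (simp add: dist_norm)
  \<comment> \<open>\<open>K*ga\<close> is twice \<open>n*Ga\<close>, so the concave direction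
    outweighs all the others.\<close>
  have "2*a*(n*Ga) <= pucci_minus ga Ga X"
  proof (rule pucci_minus_geI[OF ga])
   fix A :: "real^'n^'n" assume A: "A \<in> pucci_class ga Ga"
   have "2*a*trace A <= 2*a*(n*Ga)"
    unfolding n_def using a by (intro mult_left_mono pucci_class_trace(2)[OF A]) auto
   moreover have "2*a*K*ga <= 2*a*K*(e \<bullet> (A *v e))"
    using pucci_class_bounds(1)[OF A, of e] ne a K2 by (intro mult_left_mono) auto
   moreover have "2*a*K*ga = 4*a*(n*Ga)" using Kga by simp
   moreover have "- trace (A ** X) = 2*a*K*(e \<bullet> (A *v e)) - 2*a*trace A"
    by (simp add: X_def trace_mult_diff_right trace_mult_mat trace_mult_scaleR_right trace_mult_outer)
   ultimately show "2*a*(n*Ga) <= - trace (A ** X)" by linarith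
  qed
  also have "... <= de*norm (p1 + q) + g (x1 + h)" by (rule esubD[OF u(2) inb jet])
  also have "... <= de*(5*B) + m"
  proof (intro add_mono mult_left_mono de g inb)
   have PB: "P <= 2*B" using norm_triangle_ineq4[of p2 p1] pB unfolding P_def by simp
   have "norm q <= P/2 + 2*a * R + 2*a*K*(4*rh)"
    unfolding q_def
   proof (intro order_trans[OF norm_triangle_ineq4] add_mono norm_triangle_mono)
    show "norm ((P/2) *\<^sub>R e) <= P/2" using P ne by simp
    show "norm ((2*a) *\<^sub>R h) <= 2*a * R" using a hR by simp
    show "norm ((2*a*K * s) *\<^sub>R e) <= 2*a*K*(4*rh)"
     using a K2 s4 ne by (simp add: abs_mult mult_left_mono)
   qed
   also have "... = P/2 + 5/8*P + P/4"
    using K2 rh by (simp add: R a_def)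
   also have "... <= 2*P" using P by simp
   finally show "norm (p1 + q) <= 5*B" using norm_triangle_ineq[of p1 q] pB(1) PB B0 by linarith
  qed
  finally have "2*a*(n*Ga) <= m + 5*de*B" by simp
  hence "16*K/(n*Ga)*rh*(2*a*(n*Ga)) <= 16*K/(n*Ga)*rh*(m + 5*de*B)"
   using K2 nG rh by (intro mult_left_mono) auto
  moreover have "16*K/(n*Ga)*rh*(2*a*(n*Ga)) = P"
   using a(2) nG n ga by (simp add: mult_ac)
  ultimately show ?thesis unfolding P_def n_def by simp
 qed
qed


text \<open>Additivity on the disjoint interiors of the cubes against subadditivity on the sets
  \<open>X K\<close> that cover \<open>T\<close>. This does the work of an area formula for the
  relation between contact points and slopes, which need not be a function.\<close>

lemma emeasure_le_of_disjoint_cover: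
 fixes nu :: "'a::euclidean_space measure"
 assumes D: "countable \<D>" "pairwise (\<lambda>A B. interior A \<inter> interior B = {}) \<D>"
  and X: "!!K. K \<in> \<D> ==> X K \<in> sets lborel" and nu: "sets nu = sets lborel"
  and le: "!!K. K \<in> \<D> ==> emeasure lborel (X K) <= emeasure nu (interior K)"
  and T: "T \<subseteq> (\<Union>K\<in>\<D>. X K)"
 shows "emeasure lborel T <= emeasure nu UNIV"
proof -
 obtain f :: "nat => 'a set" and C where f: "bij_betw f C \<D>" by (rule countableE_bij[OF D(1)])
 hence fD: "f i \<in> \<D>" if "i \<in> C" for i using that by (auto simp: bij_betw_def)
 define Y where "Y i = (if i \<in> C then X (f i) else {})" for i
 define Z where "Z i = (if i \<in> C then interior (f i) else {})" for i
 have "emeasure lborel T <= emeasure lborel (\<Union>i. Y i)"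
 proof (rule emeasure_mono)
  show "T \<subseteq> (\<Union>i. Y i)"
  proof
   fix x assume "x \<in> T"
   then obtain K where "K \<in> \<D>" "x \<in> X K" using T by auto
   moreover then obtain i where "i \<in> C" "K = f i" using f by (auto simp: bij_betw_def)
   ultimately have "x \<in> Y i" by (simp add: Y_def)
   thus "x \<in> (\<Union>i. Y i)" by blast
  qed
  have "Y i \<in> sets lborel" for i using X fD by (simp add: Y_def)
  thus "(\<Union>i. Y i) \<in> sets lborel" by blast
 qed
 also have "... <= (\<Sum>i. emeasure lborel (Y i))"
  using X fD by (intro emeasure_subadditive_countably) (auto simp: Y_def)
 also have "... <= (\<Sum>i. emeasure nu (Z i))"
  using le fD by (intro suminf_le) (auto simp: Y_def Z_def)
 also have "... = emeasure nu (\<Union>i. Z i)"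
 proof (rule suminf_emeasure)
  show "range Z \<subseteq> sets nu" by (auto simp: Z_def nu)
  show "disjoint_family Z"
   unfolding disjoint_family_on_def
  proof (intro ballI impI)
   fix i j :: nat assume "i ~= j"
   thus "Z i \<inter> Z j = {}"
   proof (cases "i \<in> C \<and> j \<in> C")
    case True
    hence "f i ~= f j" using f \<open>i ~= j\<close> by (auto simp: bij_betw_def inj_on_def)
    thus ?thesis using D(2) fD True by (auto simp: Z_def pairwise_def)
   qed (auto simp: Z_def)
  qed
 qed
 also have "... <= emeasure nu UNIV" by (rule emeasure_mono) (auto simp: nu intro: sets_eq_imp_space_eq)
 finally show ?thesis .
qed

lemma power_add3_le:
 fixes x y z :: real
 assumes "0 <= x" "0 <= y" "0 <= z"
 shows "(x + y + z) ^ N <= 3 ^ N*(x ^ N + y ^ N + z ^ N)"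
proof -
 define m where "m = max x (max y z)"
 have "x + y + z <= 3*m" by (simp add: m_def max_def)
 hence "(x + y + z) ^ N <= (3*m) ^ N" using assms by (intro power_mono) auto
 also have "... = 3 ^ N*m ^ N" by (rule power_mult_distrib)
 also have "m ^ N <= x ^ N + y ^ N + z ^ N" using assms by (auto simp: m_def max_def add_increasing add_increasing2)
 finally show ?thesis by simp
qed

text \<open>Every slope of norm at most \<open>B\<close> occurs at a contact point of
  \<open>V\<close> with a positive value. The contact set is covered by small cubes; by
  \<open>contact_slopes_close\<close> the slopes that occur in one cube lie in a ball whose radius
  is the side length times a multiple of \<open>g + b0\<close>. So the volume of the ball of all
  slopes is bounded by the integral of the \<open>N\<close>-th power of this density.\<close>

lemma ABP_estimate:
 fixes T :: "'n::finite itself"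
 assumes ga: "0 < ga" "ga <= Ga" and p: "p > real CARD('n)" and be: "be = 1 - real CARD('n)/p"
 obtains C c where "C > 0" "c > 0"
  "!!V (z::real^'n) r de g u x. 0 < r ==> 0 <= de ==> de*r <= c ==> open V ==> V \<subseteq> ball z r ==>
   continuous_on (closure V) u ==> (!!y. y \<in> frontier V ==> u y <= 0) ==> continuous_on V g ==>
   (!!y. y \<in> V ==> 0 <= g y) ==> (\<integral>\<^sup>+y\<in>V. ennreal (g y powr p) \<partial>lborel) <= 1 ==>
   esub ga Ga de {y\<in>V. 0 < u y} u g ==> x \<in> V ==> u x <= C*r powr (1 + be)"
proof -
 define n where "n = real CARD('n)"
 define N where "N = CARD('n)"
 define K where "K = 2*real CARD('n)*Ga/ga"
 define C' where "C' = 16*K/(real CARD('n)*Ga)"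
 define ka where "ka = measure lborel (ball (0::real^'n) 1)"
 \<comment> \<open>The 3 comes from the power of a sum of three terms, \<open>C'\<close> from the
   slope estimate, and \<open>n\<close> from the bound \<open>n*l\<close> for the diameter of a cube
   of side \<open>l\<close>.\<close>
 define c0 where "c0 = 3*C'*n"
 define C2 where "C2 = max 1 (2*c0 ^ N*((1 + 2 ^ N) * ka + 1))"
 \<comment> \<open>So small that the gradient term contributes at most half of
   \<open>B ^ N\<close>.\<close>
 define c where "c = 1/(5*c0*(2 * ka + 1))"
 have N: "N >= 1" and n: "n >= 1" "n = real N" using zero_less_card_finite[where 'a='n] by (simp_all add: n_def N_def Suc_leI)
 have Ga: "Ga > 0" using ga by simp
 have K: "K > 0" and C': "C' > 0" using ga Ga by (auto simp: K_def C'_def)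
 hence c0: "c0 > 0" using n by (simp add: c0_def)
 have ka: "ka > 0" unfolding ka_def by (rule content_ball_pos) simp
 have vol: "emeasure lborel (ball q t) = ennreal (ka*t ^ N)" "emeasure lborel (cball q t) = ennreal (ka*t ^ N)"
  if "t >= 0" for q :: "real^'n" and t
 proof -
  have "measure lborel (ball q t) = ka*t ^ N" using content_ball_conv_unit_ball[OF that, of q] by (simp add: ka_def N_def mult.commute)
  thus "emeasure lborel (ball q t) = ennreal (ka*t ^ N)" "emeasure lborel (cball q t) = ennreal (ka*t ^ N)"
   using emeasure_lborel_ball_finite[of q t] emeasure_lborel_cball_finite[of q t] content_cball_conv_ball[of q t]
   by (simp_all add: emeasure_eq_ennreal_measure)
 qed
 have c: "c > 0" using c0 ka by (simp add: c_def)
 show thesis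
 proof (rule that[of "8*C2" c])
  show "8*C2 > 0" by (simp add: C2_def)
  show "c > 0" by (rule c)
  fix V :: "(real^'n) set" and z r de g u and x0 :: "real^'n"
  assume r: "0 < r" and de: "0 <= de" "de*r <= c" and V: "open V" "V \<subseteq> ball z r"
   and u: "continuous_on (closure V) u" and ub: "!!y. y \<in> frontier V ==> u y <= 0"
   and g: "continuous_on V g" and g0: "!!y. y \<in> V ==> 0 <= g y"
   and gp: "(\<integral>\<^sup>+y\<in>V. ennreal (g y powr p) \<partial>lborel) <= 1"
   and es: "esub ga Ga de {y\<in>V. 0 < u y} u g" and x0: "x0 \<in> V"
  have "bounded V" using V(2) bounded_ball bounded_subset by blast
  hence cV: "compact (closure V)" by (simp add: compact_closure)
  have Vc: "V \<subseteq> closure V" by (rule closure_subset)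
  have clz: "closure V \<subseteq> cball z r" by (rule closure_minimal) (use V(2) ball_subset_cball in auto)
  obtain x1 where x1: "x1 \<in> closure V" "!!y. y \<in> closure V ==> u y <= u x1"
   using continuous_attains_sup[OF cV _ u] x0 Vc by auto
  define M where "M = u x1"
  have "u x0 <= M" unfolding M_def using x1(2) x0 Vc by blast
  have "M <= 8*C2*r powr (1 + be)"
  proof (cases "M <= 0")
   case True
   thus ?thesis by (rule order_trans) (simp add: C2_def)
  next
   case False
   hence M: "M > 0" by simp
   \<comment> \<open>A plane of slope at most \<open>B\<close> varies by at most \<open>M/4\<close>
     over a ball of diameter \<open>2*r\<close>; lowered from above, it meets the graph of
     \<open>u\<close> at a point where \<open>u\<close> is still positive.\<close>
   define B where "B = M/(8*r)"
   have B: "B > 0" "8*r*B = M" using M r by (auto simp: B_def)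
   \<comment> \<open>Both the slack for the variation of \<open>g\<close> in a cube and the
     threshold between small and large values of \<open>g\<close>. With this power of
     \<open>r\<close> the two resulting terms \<open>(mu*r) ^ N\<close> and
     \<open>mu powr (n-p)\<close> both equal \<open>r powr (be*n)\<close>.\<close>
   define mu where "mu = r powr (be-1)"
   have mu: "mu > 0" using r by (simp add: mu_def)
   define W where "W = {y\<in>V. 0 < u y}"
   have oW: "open W"
    unfolding W_def using continuous_openin_preimage_gen[of V u "{0<..}"] V(1) continuous_on_subset[OF u Vc]
    by (auto simp: openin_open_eq vimage_def Int_def)
   define tch where "tch q y \<longleftrightarrow> y \<in> W \<and> (\<forall>k\<in>closure V. u k <= u y + q \<bullet> (k-y))" for q y
   have touch: "\<exists>y. tch q y" if q: "norm q <= B" for q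
   proof -
    have "continuous_on (closure V) (\<lambda>y. u y - q \<bullet> y)" by (intro continuous_intros u)
    then obtain y where y: "y \<in> closure V" "!!k. k \<in> closure V ==> u k - q \<bullet> k <= u y - q \<bullet> y"
     using continuous_attains_sup[OF cV, of "\<lambda>y. u y - q \<bullet> y"] x0 Vc by auto
    have "norm (x1-y) <= 2*r"
    proof -
     have "x1 \<in> cball z r" "y \<in> cball z r" using x1(1) y(1) clz by auto
     thus ?thesis using dist_triangle[of x1 y z] by (simp add: dist_norms)
    qed
    hence "norm q*norm (x1-y) <= B*(2*r)" using q B by (intro mult_mono) auto
    moreover have "B*(2*r) = M/4" unfolding B(2)[symmetric] by simp
    ultimately have "\<bar>q \<bullet> (x1-y)\<bar> <= M/4" using Cauchy_Schwarz_ineq2[of q "x1 - y"] by linarith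
    moreover have "q \<bullet> (x1-y) = q \<bullet> x1 - q \<bullet> y" by (rule inner_diff_right)
    ultimately have "u y > 0" using y(2)[OF x1(1)] M unfolding M_def by linarith
    moreover have "y \<in> V"
    proof (rule ccontr)
     assume "y \<notin> V"
     hence "y \<in> frontier V" using y(1) V(1) by (simp add: frontier_def interior_open)
     thus False using ub \<open>u y > 0\<close> by force
    qed
    ultimately show ?thesis using y(2) by (intro exI[of _ y]) (auto simp: tch_def W_def inner_diff_right algebra_simps)
   qed
   have "\<exists>t>0. y \<in> W --> ball y t \<subseteq> W \<and> (\<forall>k\<in>ball y t. \<bar>g k - g y\<bar> <= mu)" for y
   proof (cases "y \<in> W")
    case True
    obtain t1 where t1: "t1 > 0" "ball y t1 \<subseteq> W" using oW True by (meson open_contains_ball)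
    have "y \<in> V" using True by (simp add: W_def)
    then obtain t2 where t2: "t2 > 0" "!!k. k \<in> V ==> dist k y < t2 ==> dist (g k) (g y) < mu"
     using g[unfolded continuous_on_iff] mu by blast
    show ?thesis
    proof (intro exI[of _ "min t1 t2"] conjI impI ballI)
     show "min t1 t2 > 0" using t1(1) t2(1) by simp
     show "ball y (min t1 t2) \<subseteq> W" using t1(2) by auto
     fix k assume k: "k \<in> ball y (min t1 t2)"
     hence "k \<in> V" using t1(2) by (auto simp: W_def)
     thus "\<bar>g k - g y\<bar> <= mu" using t2(2)[of k] k by (simp add: dist_real_def dist_commute)
    qed
   qed (auto intro: exI[of _ 1])
   then obtain rad where rad: "!!y. rad y > 0" "!!y. y \<in> W ==> ball y (rad y) \<subseteq> W"
    "!!y k. y \<in> W ==> k \<in> ball y (rad y) ==> \<bar>g k - g y\<bar> <= mu" by metis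
   \<comment> \<open>A cube inside \<open>ball y (ep y)\<close> has side below
     \<open>2*ep y\<close>, and the slope estimate needs a ball of radius \<open>10*K*n\<close>
     times the side: hence the factor 20.\<close>
   define ep where "ep y = rad y/(20*K*n + 1)" for y
   have den: "20*K*n + 1 > 0" using K n by (simp add: add_pos_pos)
   have ep: "ep y > 0" "ep y <= rad y" "20*K*n*ep y < rad y" for y
   proof -
    show e: "ep y > 0" using rad(1) den by (simp add: ep_def)
    have "(20*K*n + 1)*ep y = rad y" using den by (simp add: ep_def)
    hence eq: "20*K*n*ep y + ep y = rad y" by (simp add: distrib_right)
    thus "20*K*n*ep y < rad y" using e by linarith
    have "20*K*n*ep y >= 0" using e K n by simp
    thus "ep y <= rad y" using eq by linarith
   qed
   define S where "S = {y. \<exists>q. norm q <= B \<and> tch q y}"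
   define a b where "a = z - r *\<^sub>R One" and "b = z + r *\<^sub>R (One::real^'n)"
   have ab: "b \<bullet> i - a \<bullet> i = 2*r" if "i \<in> Basis" for i using that by (simp add: a_def b_def inner_simps)
   have Sab: "S \<subseteq> cbox a b"
   proof
    fix y assume "y \<in> S"
    hence "y \<in> ball z r" using V(2) by (auto simp: S_def tch_def W_def)
    hence "\<bar>(y-z) \<bullet> i\<bar> <= r" if "i \<in> Basis" for i
     using Basis_le_norm[OF that, of "y - z"] by (simp add: dist_norms)
    thus "y \<in> cbox a b" by (auto simp: mem_box a_def b_def inner_simps abs_le_iff) (smt (verit))+
   qed
   have bne: "box a b ~= {}" using r by (auto simp: box_ne_empty a_def b_def inner_simps)
   have gauge: "gauge (\<lambda>y. ball y (ep y))" using ep(1) by (simp add: gauge_def)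
   obtain \<D> where D: "countable \<D>" "!!Q. Q \<in> \<D> ==> interior Q ~= {} \<and> (\<exists>c d. Q = cbox c d)"
    "pairwise (\<lambda>A B. interior A \<inter> interior B = {}) \<D>"
    "!!Q. Q \<in> \<D> ==> \<exists>y \<in> S \<inter> Q. Q \<subseteq> ball y (ep y)"
    "!!u v. cbox u v \<in> \<D> ==> \<exists>k. \<forall>i \<in> Basis. v \<bullet> i - u \<bullet> i = (b \<bullet> i - a \<bullet> i)/2^k"
    "S \<subseteq> \<Union>\<D>"
    using covering_lemma[OF Sab bne gauge] by metis
   define b0 where "b0 = 2*mu + 5*de*B"
   have b0: "b0 > 0" using mu de B by (simp add: b0_def add_pos_nonneg)
   define g' where "g' y = indicator V y *\<^sub>R g y" for y
   have g'm[measurable]: "g' \<in> borel_measurable borel"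
    unfolding g'_def using g V(1) by (intro borel_measurable_continuous_on_indicator) auto
   have g'0: "g' y >= 0" and g'V: "y \<in> V ==> g' y = g y" for y using g0 by (auto simp: g'_def indicator_def)
   have Vm[measurable]: "V \<in> sets borel" using V(1) by simp
   \<comment> \<open>The measure whose value on a cube dominates the volume of the ball of slopes
     belonging to that cube.\<close>
   define nu where "nu = density lborel (\<lambda>y. ennreal (ka*(C'*n*(g' y + b0)) ^ N)*indicator V y)"
   have nu: "emeasure nu X = (\<integral>\<^sup>+y. ennreal (ka*(C'*n*(g' y + b0)) ^ N)*indicator V y*indicator X y \<partial>lborel)"
    if "X \<in> sets borel" for X using that unfolding nu_def by (subst emeasure_density) auto
   have "\<exists>q t. 0 <= t \<and> (\<forall>q2 y. norm q2 <= B --> y \<in> Q --> tch q2 y --> q2 \<in> cball q t) \<and>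
     ennreal (ka*t ^ N) <= emeasure nu (interior Q)" if Q: "Q \<in> \<D>" for Q
   proof -
    obtain xc d where Qb: "Q = cbox xc d" and Qi: "interior Q ~= {}" using D(2)[OF Q] by blast
    obtain xQ where xQ: "xQ \<in> S" "xQ \<in> Q" "Q \<subseteq> ball xQ (ep xQ)" using D(4)[OF Q] by blast
    obtain q where q: "norm q <= B" "tch q xQ" using xQ(1) by (auto simp: S_def)
    hence xW: "xQ \<in> W" by (simp add: tch_def)
    obtain k where "\<forall>i \<in> Basis. d \<bullet> i - xc \<bullet> i = (b \<bullet> i - a \<bullet> i)/2^k" using D(5) Q Qb by blast
    then obtain l where l: "!!i. i \<in> Basis ==> d \<bullet> i - xc \<bullet> i = l" using ab by auto
    have bne2: "box xc d ~= {}" using Qi Qb by (simp add: interior_cbox)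
    obtain i0 :: "real^'n" where i0: "i0 \<in> Basis" using nonempty_Basis by blast
    have "xc \<bullet> i0 < d \<bullet> i0" using bne2 i0 by (simp add: box_ne_empty)
    hence l0: "l > 0" using l[OF i0] by linarith
    define rh where "rh = n*l"
    have rh: "rh > 0" using n l0 by (simp add: rh_def)
    have Qd: "norm (y-xQ) <= rh" if y: "y \<in> Q" for y
    proof -
     have "norm (y-xQ) <= (\<Sum>i\<in>Basis. \<bar>(y-xQ) \<bullet> i\<bar>)" by (rule norm_le_l1)
     also have "... <= (\<Sum>i\<in>(Basis::(real^'n) set). l)"
     proof (rule sum_mono)
      fix i :: "real^'n" assume i: "i \<in> Basis"
      have "xc \<bullet> i <= y \<bullet> i" "y \<bullet> i <= d \<bullet> i" "xc \<bullet> i <= xQ \<bullet> i" "xQ \<bullet> i <= d \<bullet> i"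
       using y xQ(2) i unfolding Qb by (auto simp: mem_box)
      thus "\<bar>(y-xQ) \<bullet> i\<bar> <= l" using l[OF i] by (simp add: inner_diff_left abs_le_iff)
     qed
     also have "... = rh" by (simp add: rh_def n_def)
     finally show ?thesis .
    qed
    have "l < 2*ep xQ"
    proof -
     have "xc \<in> Q" "d \<in> Q" using bne2 unfolding Qb by (auto simp: box_ne_empty mem_box less_imp_le)
     hence "dist xc xQ < ep xQ" "dist d xQ < ep xQ" using xQ(3) by (auto simp: dist_commute)
     hence "norm (d-xc) < 2*ep xQ" using dist_triangle2[of d xc xQ] by (simp add: dist_norm)
     moreover have "l <= norm (d-xc)" using Basis_le_norm[OF i0, of "d - xc"] l[OF i0] by (simp add: inner_diff_left)
     ultimately show ?thesis by simp
    qed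
    hence "10*K*n*l <= 10*K*n*(2*ep xQ)" using K n by (intro mult_left_mono) auto
    moreover have "10*K*n*l = 10*K*rh" "10*K*n*(2*ep xQ) = 20*K*n*ep xQ" by (simp_all add: rh_def)
    ultimately have R: "10*K*rh < rad xQ" using ep(3)[of xQ] by linarith
    hence RW: "cball xQ (10*K*rh) \<subseteq> ball xQ (rad xQ)" by auto
    also have "... \<subseteq> W" by (rule rad(2)[OF xW])
    finally have RW': "cball xQ (10*K*rh) \<subseteq> W" .
    have WV: "W \<subseteq> closure V" using Vc by (auto simp: W_def)
    define m where "m = g xQ + mu"
    have gx: "g xQ >= 0" using g0 xW by (simp add: W_def)
    define t where "t = C'*rh*(m + 5*de*B)"
    have m0: "m + 5*de*B >= 0" using gx mu de B by (simp add: m_def)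
    hence t: "t >= 0" using C' rh by (simp add: t_def)
    show ?thesis
    proof (intro exI[of _ q] exI[of _ t] conjI t allI impI)
     fix q2 y assume q2: "norm q2 <= B" "y \<in> Q" "tch q2 y"
     have "norm (q2-q) <= 16*K/(real CARD('n)*Ga)*rh*(m + 5*de*B)"
     proof (rule contact_slopes_close[OF ga de(1) rh K_def refl, of xQ u g m y q B q2])
      show "continuous_on (cball xQ (10*K*rh)) u" by (rule continuous_on_subset[OF u]) (use RW' WV in blast)
      show "esub ga Ga de (ball xQ (10*K*rh)) u g"
       using es RW' ball_subset_cball unfolding esub_def W_def[symmetric] by blast
      show "g k <= m" if "k \<in> ball xQ (10*K*rh)" for k
       using rad(3)[OF xW, of k] that R by (simp add: m_def)
      show "norm (y-xQ) <= rh" by (rule Qd[OF q2(2)])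
      show "norm q <= B" "norm q2 <= B" by (fact q(1), fact q2(1))
      show "u k <= u xQ + q \<bullet> (k-xQ)" if "k \<in> cball xQ (10*K*rh)" for k
       using q(2) that RW' WV unfolding tch_def by blast
      show "u k <= u y + q2 \<bullet> (k-y)" if "k \<in> cball xQ (10*K*rh)" for k
       using q2(3) that RW' WV unfolding tch_def by blast
     qed
     thus "q2 \<in> cball q t" by (simp add: t_def C'_def dist_norms)
    next
     have iQ: "interior Q = box xc d" by (simp add: Qb interior_cbox)
     have vQ: "emeasure lborel (box xc d) = ennreal (l ^ N)"
     proof -
      have "emeasure lborel (box xc d) = (\<Prod>i\<in>Basis. (d-xc) \<bullet> i)"
       using bne2 by (intro emeasure_lborel_box) (auto simp: box_ne_empty less_imp_le)
      also have "(\<Prod>i\<in>Basis. (d-xc) \<bullet> i) = (\<Prod>i\<in>(Basis::(real^'n) set). l)"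
       by (intro prod.cong) (auto simp: l inner_diff_left)
      also have "... = l ^ N" by (simp add: N_def)
      finally show ?thesis .
     qed
     have "ennreal (ka*t ^ N) = ennreal (ka*(C'*n*(m + 5*de*B)) ^ N)*ennreal (l ^ N)"
      using ka C' n m0 l0 by (subst ennreal_mult[symmetric]) (auto simp: t_def rh_def power_mult_distrib mult_ac)
     also have "... = (\<integral>\<^sup>+y. ennreal (ka*(C'*n*(m + 5*de*B)) ^ N)*indicator (box xc d) y \<partial>lborel)"
      by (simp add: nn_integral_cmult_indicator vQ)
     also have "... <= emeasure nu (box xc d)"
      unfolding nu[OF borel_open[OF open_box]]
     proof (rule nn_integral_mono)
      fix y :: "real^'n"
      show "ennreal (ka*(C'*n*(m + 5*de*B)) ^ N)*indicator (box xc d) y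
       <= ennreal (ka*(C'*n*(g' y + b0)) ^ N)*indicator V y*indicator (box xc d) y"
      proof (cases "y \<in> box xc d")
       case True
       hence "y \<in> Q" using Qb box_subset_cbox by blast
       hence yb: "y \<in> ball xQ (rad xQ)" using xQ(3) ep(2)[of xQ] by (force simp: subset_iff)
       hence yV: "y \<in> V" using rad(2)[OF xW] by (auto simp: W_def)
       have "m + 5*de*B <= g' y + b0" using rad(3)[OF xW yb] by (simp add: g'V[OF yV] m_def b0_def)
       hence "ka*(C'*n*(m + 5*de*B)) ^ N <= ka*(C'*n*(g' y + b0)) ^ N"
        using ka C' n m0 by (intro mult_left_mono power_mono) auto
       thus ?thesis using True yV by (simp add: ennreal_leI)
      qed simp
     qed
     finally show "ennreal (ka*t ^ N) <= emeasure nu (interior Q)" unfolding iQ .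
    qed
   qed
   then obtain q t where qt: "!!Q. Q \<in> \<D> ==> 0 <= t Q"
    "!!Q q2 y. Q \<in> \<D> ==> norm q2 <= B ==> y \<in> Q ==> tch q2 y ==> q2 \<in> cball (q Q) (t Q)"
    "!!Q. Q \<in> \<D> ==> ennreal (ka*t Q ^ N) <= emeasure nu (interior Q)" by metis
   have "ennreal (ka*B ^ N) = emeasure lborel (cball (0::real^'n) B)" using B by (simp add: vol)
   also have "... <= emeasure nu UNIV"
   proof (rule emeasure_le_of_disjoint_cover[OF D(1) D(3), where X = "\<lambda>Q. cball (q Q) (t Q)"])
    show "cball 0 B \<subseteq> (\<Union>Q\<in>\<D>. cball (q Q) (t Q))"
    proof
     fix q2 :: "real^'n" assume "q2 \<in> cball 0 B"
     hence q2: "norm q2 <= B" by simp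
     obtain y where y: "tch q2 y" using touch[OF q2] by blast
     hence "y \<in> S" using q2 by (auto simp: S_def)
     then obtain Q where "Q \<in> \<D>" "y \<in> Q" using D(6) by blast
     thus "q2 \<in> (\<Union>Q\<in>\<D>. cball (q Q) (t Q))" using qt(2)[OF _ q2 _ y] by blast
    qed
    show "emeasure lborel (cball (q Q) (t Q)) <= emeasure nu (interior Q)" if "Q \<in> \<D>" for Q
     unfolding vol(2)[OF qt(1)[OF that]] by (rule qt(3)[OF that])
   qed (auto simp: nu_def)
   also have "... <= (\<integral>\<^sup>+y. (ennreal (ka*c0 ^ N*((1 + 2 ^ N)*mu ^ N + (5*de*B) ^ N))*indicator V y
      + ennreal (ka*c0 ^ N*mu powr (n-p))*(ennreal (g y powr p)*indicator V y)) \<partial>lborel)"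
    unfolding nu[OF borel_open[OF open_UNIV]]
   proof (rule nn_integral_mono)
    fix y :: "real^'n"
    show "ennreal (ka*(C'*n*(g' y + b0)) ^ N)*indicator V y*indicator UNIV y
     <= ennreal (ka*c0 ^ N*((1 + 2 ^ N)*mu ^ N + (5*de*B) ^ N))*indicator V y
      + ennreal (ka*c0 ^ N*mu powr (n-p))*(ennreal (g y powr p)*indicator V y)"
    proof (cases "y \<in> V")
     case True
     have gy: "g y >= 0" by (rule g0[OF True])
     \<comment> \<open>Where \<open>g\<close> exceeds \<open>mu\<close>, the power \<open>N\<close>
       is traded for the power \<open>p\<close> at the price of \<open>mu powr (n-p)\<close>; this
       is where \<open>n < p\<close> enters.\<close>
     have gN: "g y ^ N <= mu ^ N + mu powr (n-p)*g y powr p"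
     proof (cases "g y <= mu")
      case True
      hence "g y ^ N <= mu ^ N" using gy by (intro power_mono) auto
      thus ?thesis by (rule order_trans) simp
     next
      case False
      hence gl: "g y > mu" by simp
      hence "g y ^ N = g y powr (n-p)*g y powr p" using mu n(2) by (simp add: powr_add[symmetric] powr_realpow)
      also have "... <= mu powr (n-p)*g y powr p" using gl mu p by (intro mult_right_mono powr_mono2') (auto simp: n_def)
      finally show ?thesis using zero_le_power[of mu N] mu by linarith
     qed
     have "(g y + b0) ^ N = (g y + 2*mu + 5*de*B) ^ N" by (simp add: b0_def add.assoc)
     also have "... <= 3 ^ N*(g y ^ N + (2*mu) ^ N + (5*de*B) ^ N)"
      using gy mu de B by (intro power_add3_le) auto
     also have "... <= 3 ^ N*((1 + 2 ^ N)*mu ^ N + (5*de*B) ^ N + mu powr (n-p)*g y powr p)"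
      using gN by (intro mult_left_mono) (auto simp: power_mult_distrib algebra_simps)
     finally have "ka*(C'*n) ^ N*(g y + b0) ^ N
      <= ka*(C'*n) ^ N*(3 ^ N*((1 + 2 ^ N)*mu ^ N + (5*de*B) ^ N + mu powr (n-p)*g y powr p))"
      using ka C' n by (intro mult_left_mono) auto
     moreover have "ka*(C'*n) ^ N*(g y + b0) ^ N = ka*(C'*n*(g y + b0)) ^ N" by (simp add: power_mult_distrib)
     moreover have "ka*(C'*n) ^ N*(3 ^ N*((1 + 2 ^ N)*mu ^ N + (5*de*B) ^ N + mu powr (n-p)*g y powr p))
       = ka*c0 ^ N*((1 + 2 ^ N)*mu ^ N + (5*de*B) ^ N) + ka*c0 ^ N*mu powr (n-p)*g y powr p"
      unfolding c0_def power_mult_distrib by (simp add: algebra_simps)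
     ultimately have "ka*(C'*n*(g y + b0)) ^ N
      <= ka*c0 ^ N*((1 + 2 ^ N)*mu ^ N + (5*de*B) ^ N) + ka*c0 ^ N*mu powr (n-p)*g y powr p" by simp
     thus ?thesis using True g'V[OF True] ka c0 mu de B
      by (simp add: ennreal_leI ennreal_plus[symmetric] ennreal_mult[symmetric] del: ennreal_plus)
    qed simp
   qed
   also have "... = ennreal (ka*c0 ^ N*((1 + 2 ^ N)*mu ^ N + (5*de*B) ^ N))*emeasure lborel V
     + ennreal (ka*c0 ^ N*mu powr (n-p))*(\<integral>\<^sup>+y\<in>V. ennreal (g y powr p) \<partial>lborel)"
   proof -
    have "(\<lambda>y. ennreal (g y powr p)*indicator V y) = (\<lambda>y. ennreal (g' y powr p)*indicator V y)"
     using g'V by (auto simp: fun_eq_iff indicator_def)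
    moreover have "(\<lambda>y. ennreal (g' y powr p)*indicator V y) \<in> borel_measurable lborel" by measurable
    ultimately have "(\<lambda>y. ennreal (g y powr p)*indicator V y) \<in> borel_measurable lborel" by simp
    thus ?thesis by (simp add: nn_integral_add nn_integral_cmult nn_integral_cmult_indicator)
   qed
   also have "... <= ennreal (ka*c0 ^ N*((1 + 2 ^ N)*mu ^ N + (5*de*B) ^ N))*ennreal (ka*r ^ N)
     + ennreal (ka*c0 ^ N*mu powr (n-p))*1"
   proof (intro add_mono mult_left_mono gp)
    show "emeasure lborel V <= ennreal (ka*r ^ N)" using emeasure_mono[OF V(2), of lborel] r by (simp add: vol)
   qed auto
   also have "... = ennreal (ka*c0 ^ N*((1 + 2 ^ N)*mu ^ N + (5*de*B) ^ N)*(ka*r ^ N) + ka*c0 ^ N*mu powr (n-p))"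
    using ka c0 mu de B r by (simp add: ennreal_plus[symmetric] ennreal_mult[symmetric] del: ennreal_plus)
   finally have "ka*B ^ N <= ka*c0 ^ N*((1 + 2 ^ N)*mu ^ N + (5*de*B) ^ N)*(ka*r ^ N) + ka*c0 ^ N*mu powr (n-p)"
    using ka c0 mu de B r by (subst (asm) ennreal_le_iff) auto
   also have "... = ka*(c0 ^ N*((1 + 2 ^ N)*mu ^ N + (5*de*B) ^ N)*(ka*r ^ N) + c0 ^ N*mu powr (n-p))"
    by (simp add: algebra_simps)
   finally have "B ^ N <= c0 ^ N*((1 + 2 ^ N)*mu ^ N + (5*de*B) ^ N)*(ka*r ^ N) + c0 ^ N*mu powr (n-p)"
    using ka by simp
   also have "... = c0 ^ N*((1 + 2 ^ N) * ka*(mu*r) ^ N + mu powr (n-p)) + (5*c0*(de*r)) ^ N * ka*B ^ N"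
    by (simp add: power_mult_distrib algebra_simps)
   finally have main: "B ^ N <= c0 ^ N*((1 + 2 ^ N) * ka*(mu*r) ^ N + mu powr (n-p)) + (5*c0*(de*r)) ^ N * ka*B ^ N" .
   define s where "s = r powr be"
   have s: "s > 0" using r by (simp add: s_def)
   have p0: "p > 0" using p n unfolding n_def by linarith
   have lr: "mu*r = s" using r by (simp add: mu_def s_def powr_diff)
   have "(be-1)*(n-p) = be*n" using p0 by (simp add: be n_def[symmetric] field_simps)
   hence lnp: "mu powr (n-p) = s ^ N" using r n(2) by (simp add: mu_def s_def powr_powr powr_realpow[symmetric])
   have "(5*c0*(de*r)) ^ N * ka <= 1/2"
   proof -
    have "5*c0*(de*r) <= 5*c0*c" using de(2) c0 by (intro mult_left_mono) auto
    also have "... = 1/(2 * ka + 1)" using c0 by (simp add: c_def)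
    finally have "5*c0*(de*r) <= 1/(2 * ka + 1)" .
    hence "(5*c0*(de*r)) ^ N <= (1/(2 * ka + 1)) ^ N" using c0 de(1) r by (intro power_mono) auto
    also have "... <= (1/(2 * ka + 1)) ^ 1" using ka N by (intro power_decreasing) auto
    finally have "(5*c0*(de*r)) ^ N * ka <= 1/(2 * ka + 1) * ka" using ka by (intro mult_right_mono) auto
    also have "... <= 1/2" using ka by (simp add: field_simps)
    finally show ?thesis .
   qed
   hence "(5*c0*(de*r)) ^ N * ka*B ^ N <= 1/2*B ^ N" using B by (intro mult_right_mono) auto
   hence "B ^ N <= 2*(c0 ^ N*((1 + 2 ^ N) * ka * s ^ N + s ^ N))" using main lr lnp by simp
   also have "... = 2*c0 ^ N*((1 + 2 ^ N) * ka + 1) * s ^ N" by (simp add: algebra_simps)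
   also have "... <= C2 * s ^ N" using s by (intro mult_right_mono) (auto simp: C2_def)
   also have "... <= C2 ^ N * s ^ N" using s N power_increasing[of 1 N C2] by (intro mult_right_mono) (auto simp: C2_def)
   finally have "B ^ N <= (C2 * s) ^ N" by (simp add: power_mult_distrib)
   hence "B <= C2 * s" using N s by (intro power_le_imp_le_base[of B "N - 1"]) (auto simp: C2_def)
   hence "8*r*B <= 8*r*(C2 * s)" using r by (intro mult_left_mono) auto
   also have "... = 8*C2*r powr (1 + be)" using r by (simp add: s_def powr_add)
   finally show ?thesis using B(2) by simp
  qed
  thus "u x0 <= 8*C2*r powr (1 + be)" using \<open>u x0 <= M\<close> by linarith
 qed
qed

section \<open>Growth at a boundary point\<close>

lemma pucci_minus_superadditive:
 assumes "0 < ga" "ga <= Ga"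
 shows "pucci_minus ga Ga X + pucci_minus ga Ga Y <= pucci_minus ga Ga (X + Y)"
 by (rule pucci_minus_add_le[OF assms]) (rule pucci_minus_le[OF assms])

lemma mjet_dilate:
 assumes j: "mjet u ((1/r) *\<^sub>R (x-z)) p X" and r: "r > 0"
 shows "mjet (\<lambda>y. u ((1/r) *\<^sub>R (y-z))) x ((1/r) *\<^sub>R p) ((1/r^2) *\<^sub>R X)"
 unfolding mjet_def upjet_def
proof (intro conjI allI impI)
 show "symmetric_mat ((1/r^2) *\<^sub>R X)" using j by (simp add: mjet_def symmetric_mat_scaleR)
 fix e :: real assume e: "e > 0"
 obtain d where d: "d > 0" "!!h. norm h < d ==> u ((1/r) *\<^sub>R (x-z) + h) <= u ((1/r) *\<^sub>R (x-z)) + p \<bullet> h + 1/2*(h \<bullet> (X *v h)) + e*r^2*(norm h)^2"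
  using mjetD[OF j, of "e*r^2"] e r by auto
 show "\<exists>d>0. \<forall>y. norm (y-x) < d --> u ((1/r) *\<^sub>R (y-z)) <= u ((1/r) *\<^sub>R (x-z)) + ((1/r) *\<^sub>R p) \<bullet> (y-x)
   + 1/2*((y-x) \<bullet> ((1/r^2) *\<^sub>R X *v (y-x))) + e*(norm (y-x))^2"
 proof (intro exI[of _ "d*r"] conjI allI impI)
  show "d*r > 0" using d(1) r by simp
  fix y assume "norm (y-x) < d*r"
  hence "norm ((1/r) *\<^sub>R (y-x)) < d" using r by (simp add: pos_divide_less_eq)
  from d(2)[OF this] have "u ((1/r) *\<^sub>R (y-z)) <= u ((1/r) *\<^sub>R (x-z)) + p \<bullet> ((1/r) *\<^sub>R (y-x))
    + 1/2*(((1/r) *\<^sub>R (y-x)) \<bullet> (X *v ((1/r) *\<^sub>R (y-x)))) + e*r^2*(norm ((1/r) *\<^sub>R (y-x)))^2"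
   by (simp add: scaleR_diff_right)
  moreover have "e*r^2*(norm ((1/r) *\<^sub>R (y-x)))^2 = e*(norm (y-x))^2" using r by (simp add: power_divide)
  moreover have "((1/r) *\<^sub>R (y-x)) \<bullet> (X *v ((1/r) *\<^sub>R (y-x))) = (y-x) \<bullet> ((1/r^2) *\<^sub>R X *v (y-x))"
   by (simp add: matrix_vector_mult_scaleR scaleR_matrix_vector_assoc[symmetric] power2_eq_square)
  moreover have "p \<bullet> ((1/r) *\<^sub>R (y-x)) = ((1/r) *\<^sub>R p) \<bullet> (y-x)" by simp
  ultimately show "u ((1/r) *\<^sub>R (y-z)) <= u ((1/r) *\<^sub>R (x-z)) + ((1/r) *\<^sub>R p) \<bullet> (y-x)
   + 1/2*((y-x) \<bullet> ((1/r^2) *\<^sub>R X *v (y-x))) + e*(norm (y-x))^2" by (simp only:)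
 qed
qed

text \<open>The Gaussian barrier at unit scale, dilated by \<open>r\<close> and centred at
  \<open>z - r *\<^sub>R nu\<close>. The quadratic term makes the function at least 1 on the sphere
  of radius \<open>r\<close> about \<open>z\<close>, outside the ball of radius \<open>r\<close>
  about that centre; the factor \<open>c\<close> pays for its Hessian and gradient, with
  \<open>exp (4*al)\<close> because the points lie within two radii of the centre.\<close>

lemma boundary_barrier:
 fixes T :: "'n::finite itself"
 assumes ga: "0 < ga" "ga <= Ga"
 obtains al c where "al > 0" "c > 0"
  "!!(x::real^'n) z nu r de. r > 0 ==> 0 <= de ==> de*r <= 1 ==> norm nu = 1 ==> r <= norm (x - (z - r *\<^sub>R nu)) ==>
   norm (x-z) <= r ==>
   \<exists>q Y. mjet (\<lambda>y. 1/r^2*(norm (y-z))^2 + c*(exp (- al) - exp (- al*(norm ((1/r) *\<^sub>R (y - (z - r *\<^sub>R nu))))^2))) x q Y \<and>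
    1/r^2 <= pucci_minus ga Ga Y - de*norm q"
proof -
 define n where "n = real CARD('n)"
 obtain al where al: "al > 0"
  "!!x z :: real^'n. 1 <= norm (x-z) ==> \<exists>p X. mjet (\<lambda>y. - exp (- al*(norm (y-z))^2)) x p X \<and>
    1*exp (- al*(norm (x-z))^2) <= pucci_minus ga Ga X - 1*norm p"
  using gaussian_barrier[OF ga, of 1 1 1] by (metis zero_le_one zero_less_one)
 define c where "c = (2*n*Ga + 3)*exp (4*al)"
 have n0: "n >= 0" by (simp add: n_def)
 have c: "c > 0" using n0 ga by (simp add: c_def add_nonneg_pos)
 show thesis
 proof (rule that[OF al(1) c])
  fix x z nu :: "real^'n" and r de :: real
  assume r: "r > 0" and de: "0 <= de" "de*r <= 1" and nu: "norm nu = 1" and x: "r <= norm (x - (z - r *\<^sub>R nu))" "norm (x-z) <= r"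
  define y0 where "y0 = z - r *\<^sub>R nu"
  define xi where "xi = (1/r) *\<^sub>R (x-y0)"
  have xi1: "1 <= norm (xi-0)" using x(1) r by (simp add: xi_def y0_def pos_le_divide_eq)
  have "norm (x-y0) <= norm (x-z) + norm (r *\<^sub>R nu)" using norm_triangle_ineq[of "x - z" "r *\<^sub>R nu"] by (simp add: y0_def algebra_simps)
  hence "norm (x-y0) <= 2*r" using x(2) nu r by simp
  hence xi2: "norm xi <= 2" using r by (simp add: xi_def pos_divide_le_eq)
  obtain q Y where qY: "mjet (\<lambda>y. - exp (- al*(norm (y-0))^2)) xi q Y" "1*exp (- al*(norm (xi-0))^2) <= pucci_minus ga Ga Y - 1*norm q"
   using al(2)[OF xi1] by blast
  have "mjet (\<lambda>y. - exp (- al*(norm ((1/r) *\<^sub>R (y-y0) - 0))^2)) x ((1/r) *\<^sub>R q) ((1/r^2) *\<^sub>R Y)"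
   by (rule mjet_dilate[OF _ r]) (use qY(1) in \<open>simp add: xi_def\<close>)
  from mjet_add[OF mjet_square[of "1/r^2" z] mjet_add[OF mjet_const[of "c*exp (- al)"] mjet_scale[OF this c]]]
  have jet: "mjet (\<lambda>y. 1/r^2*(norm (y-z))^2 + c*(exp (- al) - exp (- al*(norm ((1/r) *\<^sub>R (y-y0)))^2))) x
    ((2/r^2) *\<^sub>R (x-z) + (c/r) *\<^sub>R q) (mat (2/r^2) + (c/r^2) *\<^sub>R Y)" (is "mjet _ _ ?q ?Y")
   by (simp add: right_diff_distrib)
  have "exp (- (4*al)) <= exp (- al*(norm xi)^2)"
   using mult_left_mono[OF power_mono[OF xi2, of 2], of al] al(1) by simp
  hence "exp (- (4*al)) <= pucci_minus ga Ga Y - norm q" using qY(2) unfolding diff_zero mult_1 by (rule order_trans)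
  hence "c*exp (- (4*al)) <= c*(pucci_minus ga Ga Y - norm q)" using c by (intro mult_left_mono) auto
  moreover have "c*exp (- (4*al)) = 2*n*Ga + 3" by (simp add: c_def mult.assoc flip: exp_add)
  ultimately have Y: "2*n*Ga + 3 <= c*pucci_minus ga Ga Y - c*norm q" by (simp only: right_diff_distrib)
  have "- (2*n*Ga/r^2) <= pucci_minus ga Ga (mat (2/r^2) :: real^'n^'n)"
  proof (rule pucci_minus_geI[OF ga])
   fix A :: "real^'n^'n" assume A: "A \<in> pucci_class ga Ga"
   have "2/r^2*trace A <= 2/r^2*(n*Ga)" using pucci_class_trace(2)[OF A] unfolding n_def by (intro mult_left_mono) auto
   thus "- (2*n*Ga/r^2) <= - trace (A ** mat (2/r^2))" by (simp add: trace_mult_mat)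
  qed
  moreover have "pucci_minus ga Ga ((c/r^2) *\<^sub>R Y) = c/r^2*pucci_minus ga Ga Y" using c r by (simp add: pucci_minus_scaleR[OF ga])
  ultimately have P: "c/r^2*pucci_minus ga Ga Y - 2*n*Ga/r^2 <= pucci_minus ga Ga ?Y"
   using pucci_minus_superadditive[OF ga, of "mat (2/r^2)" "(c/r^2) *\<^sub>R Y"] by linarith
  have "de*norm ?q <= de*(2/r + c/r*norm q)"
  proof (intro mult_left_mono de order_trans[OF norm_triangle_ineq] add_mono)
   have "2/r^2*norm (x-z) <= 2/r^2*r" using x(2) by (intro mult_left_mono) auto
   thus "norm ((2/r^2) *\<^sub>R (x-z)) <= 2/r" using r by (simp add: power2_eq_square)
   show "norm ((c/r) *\<^sub>R q) <= c/r*norm q" using c r by simp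
  qed
  also have "... = de*r*((2 + c*norm q)/r^2)" using r by (simp add: field_simps power2_eq_square)
  also have "... <= 1*((2 + c*norm q)/r^2)" using de(2) c by (intro mult_right_mono) auto
  finally have "de*norm ?q <= (2 + c*norm q)/r^2" by simp
  moreover have "1/r^2 <= (c*pucci_minus ga Ga Y - c*norm q - 2*n*Ga - 2)/r^2"
   using Y r by (intro divide_right_mono) auto
  moreover have "(c*pucci_minus ga Ga Y - c*norm q - 2*n*Ga - 2)/r^2
    = c/r^2*pucci_minus ga Ga Y - 2*n*Ga/r^2 - (2 + c*norm q)/r^2" by (simp add: diff_divide_distrib add_divide_distrib)
  ultimately have "1/r^2 <= pucci_minus ga Ga ?Y - de*norm ?q" using P by linarith
  thus "\<exists>q Y. mjet (\<lambda>y. 1/r^2*(norm (y-z))^2 + c*(exp (- al) - exp (- al*(norm ((1/r) *\<^sub>R (y - (z - r *\<^sub>R nu))))^2))) x q Y \<and>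
    1/r^2 <= pucci_minus ga Ga Y - de*norm q" using jet unfolding y0_def by blast
 qed
qed

text \<open>The solution is compared with \<open>K\<^sub>j\<close> times the distance to the tangent plane, up to an error
 \<open>A r\<^sub>j\<^bsup>1+be\<^esup>\<close> at scale \<open>r\<^sub>j = r\<^sub>0 th\<^sup>j\<close>; each step changes the slope by a multiple of \<open>A r\<^sub>j\<^bsup>be\<^esup>\<close>, which is summable.\<close>

lemma boundary_growth:
 fixes T :: "'n::finite itself"
 assumes ga: "0 < ga" "ga <= Ga" and p: "p > real CARD('n)" and de: "de >= 0" and R: "R > 0" and r1: "r1 > 0"
 obtains r0 C where "0 < r0" "r0 <= r1" "C > 0"
  "!!Om (z::real^'n) nu w g x. open Om ==> norm nu = 1 ==> ball (z - R *\<^sub>R nu) R \<inter> Om = {} ==>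
   continuous_on (closure Om \<inter> cball z r0) w ==> (!!y. y \<in> frontier Om ==> norm (y-z) <= r0 ==> w y <= 0) ==>
   (!!y. y \<in> closure Om ==> norm (y-z) <= r0 ==> w y <= 1) ==>
   continuous_on Om g ==> (!!y. y \<in> Om ==> 0 <= g y) ==> (\<integral>\<^sup>+y\<in>Om. ennreal (g y powr p) \<partial>lborel) <= 1 ==>
   esub ga Ga de {y\<in>Om \<inter> ball z r0. 0 < w y} w g ==> x \<in> closure Om ==> norm (x-z) <= r0 ==> w x <= C*norm (x-z)"
proof -
 define be where "be = 1 - real CARD('n)/p"
 have p0: "p > 0" using p by (meson of_nat_0_le_iff order_le_less_trans)
 have be: "0 < be" "be < 1" using p p0 zero_less_card_finite[where 'a='n] by (auto simp: be_def)
 show thesis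
 proof (rule ABP_estimate[OF ga p be_def], goal_cases)
 case Ca: (1 Ca ca)
 show thesis
 proof (rule boundary_barrier[OF ga, where 'n = 'n], goal_cases)
 case bar: (1 al c)
 \<comment> \<open>The ratio of consecutive scales. It makes \<open>(1 + c)*th^2\<close> half of
   \<open>th powr (1 + be)\<close>, which is possible because quadratic decay beats the exponent
   \<open>1 + be < 2\<close>.\<close>
 define th where "th = (1/(2*(1 + c))) powr (1/(1-be))"
 have thbe: "th powr (1-be) = 1/(2*(1 + c))" using be bar(2) by (simp add: th_def powr_powr)
 have th0: "th > 0" using bar(2) by (simp add: th_def)
 have th1: "th < 1"
 proof (rule ccontr)
  assume "\<not> th < 1"
  hence "1 <= th powr (1-be)" using be by (intro ge_one_powr_ge_zero) auto
  thus False unfolding thbe using bar(2) by (simp add: pos_le_divide_eq)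
 qed
 define q where "q = th powr be"
 have q: "0 < q" "q < 1" using th0 th1 be powr_less_mono2[of be th 1] by (auto simp: q_def)
 define ta where "ta = th powr (1 + be)"
 have ta: "ta > 0" using th0 by (simp add: ta_def)
 have th2: "(1 + c)*th^2 = ta/2"
 proof -
  have "th^2 = th powr (1 + be)*th powr (1-be)" using th0 by (simp add: powr_add[symmetric] powr_numeral)
  thus ?thesis unfolding thbe ta_def using bar(2) by (simp add: field_simps)
 qed
 \<comment> \<open>The increments of the slope form a geometric series with ratio \<open>q\<close>;
   their sum is at most \<open>S*A*r0 powr be\<close>.\<close>
 define S where "S = 2*c/(1-q)"
 have S: "S > 0" using q bar(2) by (simp add: S_def)
 \<comment> \<open>After the prescribed bounds the entries ensure that the drift is small for the
   barrier and for the ABP estimate, that the accumulated slope is harmless in the equation, and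
   that the curvature of the exterior ball and the ABP error each cost at most a quarter of the next
   error.\<close>
 define r0 where "r0 = Min {1, r1, R, 1/(de + 1), ca/(de + 1), (1/(de*S + 1)) powr (1/be), ta * R/(2*S), ta/(4*Ca)}"
 have "1/(de + 1) > 0" "ca/(de + 1) > 0" "ta * R/(2*S) > 0" "ta/(4*Ca) > 0"
  using R de Ca(1,2) ta S by (simp_all add: add_nonneg_pos)
 moreover have "1/(de*S + 1) > 0" using de S by (simp add: add_nonneg_pos)
 ultimately have r0: "r0 > 0" unfolding r0_def using r1 R by (subst Min_gr_iff) auto
 have le: "r0 <= 1" "r0 <= r1" "r0 <= R" "r0 <= 1/(de + 1)" "r0 <= ca/(de + 1)" "r0 <= (1/(de*S + 1)) powr (1/be)"
  "r0 <= ta * R/(2*S)" "r0 <= ta/(4*Ca)"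
  unfolding r0_def by (rule Min_le, intro finite.intros, blast)+
 have del_r: "de*r0 <= 1" "de*r0 <= ca"
 proof -
  have "(de + 1)*r0 <= 1" "(de + 1)*r0 <= ca" using le(4,5) de by (simp_all add: pos_le_divide_eq mult.commute)
  thus "de*r0 <= 1" "de*r0 <= ca" using r0 unfolding distrib_right by linarith+
 qed
 have deS: "de*S*r0 powr be <= 1"
 proof -
  have pos: "de*S + 1 > 0" using de S by (simp add: add_nonneg_pos)
  have "r0 powr be <= ((1/(de*S + 1)) powr (1/be)) powr be" using le(6) r0 be by (intro powr_mono2) auto
  also have "... = 1/(de*S + 1)" using pos be by (simp add: powr_powr)
  finally have "de*S*r0 powr be <= de*S*(1/(de*S + 1))" using de S by (intro mult_left_mono) auto
  also have "... <= 1" using pos by simp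
  finally show ?thesis .
 qed
 \<comment> \<open>Normalised so that the error at the initial scale is 1, the bound assumed for
   \<open>w\<close>.\<close>
 define A where "A = r0 powr (- (1 + be))"
 have A: "A > 0" "A*r0 powr (1 + be) = 1" using r0 by (auto simp: A_def powr_add[symmetric])
 have CaA: "Ca <= A*(ta/4)"
 proof -
  have "r0 powr (1 + be) <= r0 powr 1" using r0 le(1) be by (intro powr_mono') auto
  hence "r0 powr (1 + be) <= ta/(4*Ca)" using le(8) r0 by simp
  hence "Ca*r0 powr (1 + be) <= ta/4" using Ca(1) by (simp add: field_simps)
  hence "A*(Ca*r0 powr (1 + be)) <= A*(ta/4)" using A(1) by (intro mult_left_mono) auto
  moreover have "A*(Ca*r0 powr (1 + be)) = Ca" using A(2) by (simp add: mult_ac)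
  ultimately show ?thesis by simp
 qed
 define Km where "Km = S*A*r0 powr be"
 have Km0: "Km >= 0" using S A by (simp add: Km_def)
 show thesis
 proof (rule that[of r0 "Km + A/th"])
  show "0 < r0" "r0 <= r1" by (fact r0, fact le(2))
  show "Km + A/th > 0" using Km0 A th0 by (simp add: add_nonneg_pos)
  fix Om :: "(real^'n) set" and z nu w g and x0 :: "real^'n"
  assume Om: "open Om" and nu: "norm nu = 1" and ext: "ball (z - R *\<^sub>R nu) R \<inter> Om = {}"
   and w: "continuous_on (closure Om \<inter> cball z r0) w" and w0: "!!y. y \<in> frontier Om ==> norm (y-z) <= r0 ==> w y <= 0"
   and w1: "!!y. y \<in> closure Om ==> norm (y-z) <= r0 ==> w y <= 1"
   and g: "continuous_on Om g" "!!y. y \<in> Om ==> 0 <= g y" "(\<integral>\<^sup>+y\<in>Om. ennreal (g y powr p) \<partial>lborel) <= 1"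
   and es: "esub ga Ga de {y\<in>Om \<inter> ball z r0. 0 < w y} w g" and x0: "x0 \<in> closure Om" "norm (x0-z) <= r0"
  define l where "l y = nu \<bullet> (y-z)" for y
  have nsq: "(norm (y - (z - s *\<^sub>R nu)))^2 = (norm (y-z))^2 + 2 * s*l y + s^2" for y s
  proof -
   have "y - (z - s *\<^sub>R nu) = (y-z) + s *\<^sub>R nu" by simp
   moreover have "nu \<bullet> nu = 1" using nu by (simp add: power2_norm_eq_inner[symmetric])
   ultimately show ?thesis unfolding power2_norm_eq_inner l_def
    by (simp only: inner_add_left inner_add_right inner_scaleR_left inner_scaleR_right)
     (simp add: inner_commute power2_eq_square algebra_simps)
  qed
  \<comment> \<open>\<open>Om\<close> may cross the tangent plane, so \<open>l\<close> can be
    negative, but the exterior ball bounds it from below by a quadratic term.\<close>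
  have lR: "- ((norm (y-z))^2)/(2 * R) <= l y" if "y \<in> closure Om" for y
  proof -
   have "ball (z - R *\<^sub>R nu) R \<inter> closure Om = {}" using ext open_Int_closure_eq_empty[of "ball (z - R *\<^sub>R nu) R" Om] by auto
   hence "R <= norm (y - (z - R *\<^sub>R nu))" using that by (auto simp: dist_norms not_less disjoint_iff)
   hence "R^2 <= (norm (y - (z - R *\<^sub>R nu)))^2" using R by (intro power_mono) auto
   thus ?thesis unfolding nsq using R by (simp add: field_simps)
  qed
  have lr: "- ((norm (y-z))^2)/(2*r) <= l y" if "y \<in> closure Om" "0 < r" "r <= r0" for y r
  proof -
   have "(norm (y-z))^2/(2 * R) <= (norm (y-z))^2/(2*r)" using that le(3) by (intro divide_left_mono) auto
   thus ?thesis using lR[OF that(1)] by simp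
  qed
  have step: "w y <= (K + 2*c*A*r powr be)*l y + A*(th*r) powr (1 + be)"
   if r: "0 < r" "r <= r0" and K: "0 <= K" "K <= Km" and y: "y \<in> closure Om" "norm (y-z) <= th*r"
    and IH: "!!y. y \<in> closure Om ==> norm (y-z) <= r ==> w y <= K*l y + A*r powr (1 + be)" for r K y
  proof -
   define b where "b y = 1/r^2*(norm (y-z))^2 + c*(exp (- al) - exp (- al*(norm ((1/r) *\<^sub>R (y - (z - r *\<^sub>R nu))))^2))" for y
   define A' where "A' = A*r powr (1 + be)"
   have A': "A' > 0" using A r by (simp add: A'_def)
   have out: "r <= norm (y - (z - r *\<^sub>R nu))" if "y \<in> closure Om" for y
   proof -
    have "r^2 <= (norm (y - (z - r *\<^sub>R nu)))^2" unfolding nsq using mult_left_mono[OF lr[OF that r], of "2*r"] r(1) by simp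
    thus ?thesis by (rule power2_le_imp_le) simp
   qed
   define ps where "ps y = exp (- al) - exp (- al*(norm ((1/r) *\<^sub>R (y - (z - r *\<^sub>R nu))))^2)" for y
   have b: "b y = (norm (y-z))^2/r^2 + c*ps y" for y by (simp add: b_def ps_def)
   have sq: "(norm ((1/r) *\<^sub>R (y - (z - r *\<^sub>R nu))))^2 = 1 + ((norm (y-z))^2/r^2 + 2*l y/r)" for y
    using r(1) by (simp add: power_divide nsq add_divide_distrib) (simp add: power2_eq_square)
   have ps0: "0 <= ps y" if "y \<in> closure Om" for y
   proof -
    have "1 <= (norm ((1/r) *\<^sub>R (y - (z - r *\<^sub>R nu))))^2" using out[OF that] r(1) by (simp add: pos_le_divide_eq)
    hence "al*1 <= al*(norm ((1/r) *\<^sub>R (y - (z - r *\<^sub>R nu))))^2" using bar(1) by (intro mult_left_mono) auto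
    thus ?thesis by (simp add: ps_def)
   qed
   have ps1: "ps y <= (norm (y-z))^2/r^2 + 2*l y/r" if "y \<in> closure Om" for y
   proof -
    define s where "s = (norm (y-z))^2/r^2 + 2*l y/r"
    have s: "s >= 0"
    proof -
     have "1 <= (norm ((1/r) *\<^sub>R (y - (z - r *\<^sub>R nu))))^2" using out[OF that] r(1) by (simp add: pos_le_divide_eq)
     thus ?thesis unfolding sq s_def by simp
    qed
    have "ps y = exp (- al)*(1 - exp (- (al * s)))"
     unfolding ps_def sq s_def[symmetric] by (simp add: right_diff_distrib distrib_left flip: exp_add)
    also have "... <= exp (- al)*(al * s)" using exp_ge_add_one_self[of "- (al * s)"] by (intro mult_left_mono) auto
    also have "... = exp (- al)*al * s" by simp
    also have "... <= 1 * s"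
    proof (rule mult_right_mono[OF _ s])
     have "al <= exp al" using exp_ge_add_one_self[of al] by linarith
     thus "exp (- al)*al <= 1" by (simp add: exp_minus field_simps)
    qed
    finally show ?thesis by (simp add: s_def)
   qed
   have b0: "0 <= b y" if "y \<in> closure Om" for y using ps0[OF that] bar(2) by (simp add: b)
   \<comment> \<open>Compensates the possibly negative values of \<open>K*l\<close>, so that
     \<open>v\<close> is not positive on the boundary of \<open>Om\<close>.\<close>
   define E where "E = K*r^2/(2 * R)"
   have E: "E >= 0" using K R by (simp add: E_def)
   have KE: "- E <= K*l y" if "y \<in> closure Om" "norm (y-z) <= r" for y
   proof -
    have "(norm (y-z))^2/(2 * R) <= r^2/(2 * R)" using that(2) R by (intro divide_right_mono power_mono) auto
    hence "- (r^2)/(2 * R) <= l y" using lR[OF that(1)] by simp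
    from mult_left_mono[OF this K(1)] show ?thesis by (simp add: E_def)
   qed
   define V where "V = Om \<inter> ball z r"
   define v where "v y = w y - K*l y - A'*b y - E" for y
   have oV: "open V" unfolding V_def using Om by (intro open_Int open_ball)
   have clV: "closure V \<subseteq> closure Om \<inter> cball z r"
    unfolding V_def by (intro closure_minimal) (use closure_subset[of Om] ball_subset_cball in auto)
   have subV: "V \<subseteq> Om" by (simp add: V_def)
   have vb: "v y <= Ca*r powr (1 + be)" if yV: "y \<in> V" for y
   proof (rule Ca(3)[OF r(1) de _ oV, where g = g])
    show "de*r <= ca" using del_r(2) mult_left_mono[OF r(2) de] by linarith
    show "V \<subseteq> ball z r" by (simp add: V_def)
    show "continuous_on (closure V) v"
     unfolding v_def b_def l_def
     by (intro continuous_intros continuous_on_subset[OF w]) (use clV r(2) in auto)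
    show "continuous_on V g" using g(1) subV by (rule continuous_on_subset)
    show "0 <= g y" if "y \<in> V" for y using g(2) that subV by blast
    have "(\<integral>\<^sup>+y\<in>V. ennreal (g y powr p) \<partial>lborel) <= (\<integral>\<^sup>+y\<in>Om. ennreal (g y powr p) \<partial>lborel)"
     using subV by (intro nn_integral_mono) (auto simp: indicator_def)
    thus "(\<integral>\<^sup>+y\<in>V. ennreal (g y powr p) \<partial>lborel) <= 1" using g(3) by (rule order_trans)
    show "y \<in> V" by (rule yV)
   next
    fix y assume "y \<in> frontier V"
    hence y: "y \<in> closure Om" "norm (y-z) <= r" "y \<notin> V"
     using clV oV by (auto simp: frontier_def interior_open dist_norms)
    show "v y <= 0"
    proof (cases "y \<in> Om")
     case False
     hence "y \<in> frontier Om" using y(1) Om by (simp add: frontier_def interior_open)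
     hence "w y <= 0" using w0 y(2) r(2) by simp
     moreover have "0 <= A'*b y" using A' b0[OF y(1)] by simp
     ultimately show ?thesis using KE[OF y(1,2)] by (simp add: v_def)
    next
     case True
     hence "norm (y-z) = r" using y by (simp add: V_def dist_norms)
     hence "1 <= b y" using ps0[OF y(1)] bar(2) r(1) by (simp add: b)
     hence "A'*1 <= A'*b y" using A' by (intro mult_left_mono) auto
     thus ?thesis using IH[OF y(1,2)] E by (simp add: v_def A'_def)
    qed
   next
    show "esub ga Ga de {y \<in> V. 0 < v y} v g"
     unfolding esub_def
    proof (intro ballI allI impI)
     fix y p' X assume "y \<in> {y \<in> V. 0 < v y}" and j: "mjet v y p' X"
     hence y: "y \<in> Om" "norm (y-z) < r" "v y > 0" by (auto simp: V_def dist_norms)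
     have yc: "y \<in> closure Om" using y(1) closure_subset by blast
     have "norm (y-z) <= r" "de*r <= 1" using y(2) del_r(1) mult_left_mono[OF r(2) de] by linarith+
     from bar(3)[OF r(1) de this(2) nu out[OF yc] this(1)]
     obtain q' Y where qY: "mjet b y q' Y" "1/r^2 <= pucci_minus ga Ga Y - de*norm q'"
      unfolding b_def[symmetric] by blast
     have "mjet (\<lambda>y. v y + ((K *\<^sub>R nu) \<bullet> (y-z) + (A'*b y + E))) y (p' + (K *\<^sub>R nu + (A' *\<^sub>R q' + 0))) (X + (0 + (A' *\<^sub>R Y + 0)))"
      by (intro mjet_add mjet_linear mjet_scale mjet_const j qY(1) A')
     moreover have "(\<lambda>y. v y + ((K *\<^sub>R nu) \<bullet> (y-z) + (A'*b y + E))) = w" by (simp add: v_def l_def fun_eq_iff)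
     ultimately have jw: "mjet w y (p' + (K *\<^sub>R nu + A' *\<^sub>R q')) (X + A' *\<^sub>R Y)" by simp
     have "0 <= A'*b y" using A' b0[OF yc] by simp
     hence "w y > 0" using y(3) KE[OF yc \<open>norm (y - z) <= r\<close>] by (simp add: v_def)
     hence "y \<in> {y\<in>Om \<inter> ball z r0. 0 < w y}" using y r(2) by (simp add: dist_norms)
     from esubD[OF es this jw]
     have "pucci_minus ga Ga (X + A' *\<^sub>R Y) <= de*norm (p' + (K *\<^sub>R nu + A' *\<^sub>R q')) + g y" .
     moreover have "pucci_minus ga Ga X + pucci_minus ga Ga (A' *\<^sub>R Y) <= pucci_minus ga Ga (X + A' *\<^sub>R Y)"
      by (rule pucci_minus_superadditive[OF ga])
     moreover have "pucci_minus ga Ga (A' *\<^sub>R Y) = A'*pucci_minus ga Ga Y" using A' by (simp add: pucci_minus_scaleR[OF ga])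
     moreover have "de*norm (p' + (K *\<^sub>R nu + A' *\<^sub>R q')) <= de*(norm p' + (K + A'*norm q'))"
      using norm_triangle_ineq[of p' "K *\<^sub>R nu + A' *\<^sub>R q'"] norm_triangle_ineq[of "K *\<^sub>R nu" "A' *\<^sub>R q'"] nu K A'
      by (intro mult_left_mono de) auto
     moreover have "A'*(1/r^2) <= A'*(pucci_minus ga Ga Y - de*norm q')" using A' qY(2) by (intro mult_left_mono) auto
     moreover have "de*K <= A'*(1/r^2)"
     proof -
      have "de*K <= de*Km" using K(2) de by (intro mult_left_mono)
      also have "... = A*(de*S*r0 powr be)" by (simp add: Km_def)
      also have "... <= A*1" using deS A by (intro mult_left_mono) auto
      also have "... <= A*r powr (be-1)"
      proof (intro mult_left_mono)
       have "1 powr (be-1) <= r powr (be-1)" using r le(1) be by (intro powr_mono2') auto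
       thus "1 <= r powr (be-1)" by simp
      qed (use A in auto)
      also have "... = A'*(1/r^2)"
      proof -
       have "r powr (1 + be) = r powr (be-1)*r powr 2" by (simp flip: powr_add)
       thus ?thesis using r(1) by (simp add: A'_def powr_numeral)
      qed
      finally show ?thesis .
     qed
     moreover have "de*(A'*norm q') = A'*(de*norm q')" by simp
     ultimately show "pucci_minus ga Ga X <= de*norm p' + g y" unfolding right_diff_distrib distrib_left by linarith
    qed
   qed
   have thr: "th*r < r" using th1 r by simp
   have vy: "v y <= Ca*r powr (1 + be)"
   proof (cases "y \<in> Om")
    case True
    thus ?thesis using y(2) thr by (intro vb) (simp add: V_def dist_norms)
   next
    case False
    hence "y \<in> frontier Om" using y(1) Om by (simp add: frontier_def interior_open)
    hence "w y <= 0" using w0 y(2) r(2) thr by simp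
    moreover have "0 <= A'*b y" using A' b0[OF y(1)] by simp
    moreover have "- E <= K*l y" using y(2) thr by (intro KE y(1)) simp
    moreover have "0 <= Ca*r powr (1 + be)" using Ca(1) by simp
    ultimately show ?thesis by (simp add: v_def)
   qed
   have "(norm (y-z))^2/r^2 <= (th*r)^2/r^2" using y(2) by (intro divide_right_mono power_mono) auto
   hence yr: "(norm (y-z))^2/r^2 <= th^2" using r(1) by (simp add: power_mult_distrib)
   hence "ps y <= th^2 + 2*l y/r" using ps1[OF y(1)] by linarith
   hence "c*ps y <= c*(th^2 + 2*l y/r)" using bar(2) by (intro mult_left_mono) auto
   hence "b y <= ta/2 + 2*c*l y/r" using yr th2 unfolding b by (simp add: distrib_left distrib_right)
   hence "A'*b y <= A'*(ta/2 + 2*c*l y/r)" using A' by (intro mult_left_mono) auto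
   also have "... = A'*ta/2 + 2*c*A*r powr be*l y"
    using r(1) by (simp add: A'_def powr_add distrib_left)
   finally have Ab: "A'*b y <= A'*ta/2 + 2*c*A*r powr be*l y" .
   have Ca': "Ca*r powr (1 + be) <= A'*ta/4" using mult_right_mono[OF CaA, of "r powr (1 + be)"] by (simp add: A'_def mult_ac)
   have "E <= A'*ta/4"
   proof -
    have "r0 powr be*r^2 <= r0*r powr (1 + be)"
    proof -
     have "r^2 = r powr (1 + be)*r powr (1-be)" using r(1) by (simp add: powr_add[symmetric] powr_numeral)
     moreover have "r powr (1-be) <= r0 powr (1-be)" using r be by (intro powr_mono2) auto
     hence "r0 powr be*r powr (1-be) <= r0 powr be*r0 powr (1-be)" by (intro mult_left_mono) auto
     hence "r0 powr be*r powr (1-be) <= r0" using r0 by (simp add: powr_add[symmetric])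
     hence "r powr (1 + be)*(r0 powr be*r powr (1-be)) <= r powr (1 + be)*r0" by (intro mult_left_mono) auto
     ultimately show ?thesis by (simp add: mult_ac)
    qed
    have "E <= Km*r^2/(2 * R)" unfolding E_def using K R by (intro divide_right_mono mult_right_mono) auto
    also have "... = S*A/(2 * R)*(r0 powr be*r^2)" by (simp add: Km_def)
    also have "... <= S*A/(2 * R)*(r0*r powr (1 + be))"
     using S A R by (intro mult_left_mono \<open>r0 powr be * r^2 <= r0 * r powr (1 + be)\<close>) auto
    also have "... = S*r0/(2 * R)*A'" by (simp add: A'_def)
    also have "... <= ta/4*A'"
    proof (intro mult_right_mono)
     have "S*r0 <= S*(ta * R/(2*S))" using le(7) S by (intro mult_left_mono) auto
     thus "S*r0/(2 * R) <= ta/4" using S R by (simp add: field_simps)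
    qed (use A' in auto)
    finally show ?thesis by (simp add: mult_ac)
   qed
   moreover have "A'*ta = A*(th*r) powr (1 + be)" using r(1) th0 by (simp add: A'_def ta_def powr_mult)
   ultimately show ?thesis using vy Ab Ca' unfolding v_def distrib_right by linarith
  qed
  define rj where "rj j = r0*th ^ j" for j
  define Kj where "Kj j = (\<Sum>i<j. 2*c*A*rj i powr be)" for j
  have rj: "0 < rj j" "rj j <= r0" for j
   using r0 th0 th1 power_le_one[of th j] by (auto simp: rj_def mult_le_cancel_left1)
  have Kj: "0 <= Kj j" "Kj j <= Km" for j
  proof -
   show "0 <= Kj j" using bar(2) A by (auto simp: Kj_def intro!: sum_nonneg)
   have "rj i powr be = r0 powr be*q ^ i" for i
    using r0 th0 by (simp add: rj_def q_def powr_mult powr_realpow[symmetric] powr_powr mult.commute)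
   hence "Kj j = 2*c*A*r0 powr be*(\<Sum>i<j. q ^ i)" by (simp add: Kj_def sum_distrib_left mult.assoc)
   also have "... <= 2*c*A*r0 powr be*(1/(1-q))"
   proof (intro mult_left_mono)
    have "(\<Sum>i<j. q ^ i) = (1 - q ^ j)/(1-q)" using q by (intro sum_gp_strict[THEN trans]) auto
    also have "... <= 1/(1-q)" using q by (intro divide_right_mono) auto
    finally show "(\<Sum>i<j. q ^ i) <= 1/(1-q)" .
   qed (use bar(2) A in auto)
   also have "... = Km" by (simp add: Km_def S_def)
   finally show "Kj j <= Km" .
  qed
  have claim: "w y <= Kj j*l y + A*rj j powr (1 + be)" if "y \<in> closure Om" "norm (y-z) <= rj j" for y j
   using that
  proof (induction j arbitrary: y)
   case 0
   thus ?case using w1[of y] A(2) by (simp add: Kj_def rj_def)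
  next
   case (Suc j)
   have e: "rj (Suc j) = th*rj j" by (simp add: rj_def)
   have "w y <= (Kj j + 2*c*A*rj j powr be)*l y + A*(th*rj j) powr (1 + be)"
    by (rule step[OF rj Kj Suc.prems(1)]) (use Suc e in auto)
   thus ?case unfolding e by (simp add: Kj_def)
  qed
  show "w x0 <= (Km + A/th)*norm (x0-z)"
  proof (cases "x0 = z")
   case True
   have "z \<notin> Om"
   proof
    assume "z \<in> Om"
    then obtain e where e: "e > 0" "ball z e \<subseteq> Om" using Om open_contains_ball by blast
    define t where "t = min (e/2) R"
    have t: "t > 0" "t < e" "t <= R" using e(1) R by (auto simp: t_def)
    have "z - t *\<^sub>R nu \<in> ball z e" using t nu by (simp add: dist_norm)
    moreover have "dist (z - R *\<^sub>R nu) (z - t *\<^sub>R nu) = R - t"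
    proof -
     have "(z - R *\<^sub>R nu) - (z - t *\<^sub>R nu) = (t-R) *\<^sub>R nu" by (simp add: algebra_simps)
     thus ?thesis using nu t by (simp add: dist_norm)
    qed
    hence "z - t *\<^sub>R nu \<in> ball (z - R *\<^sub>R nu) R" using t by simp
    ultimately show False using e(2) ext by blast
   qed
   hence "z \<in> frontier Om" using x0(1) True Om by (simp add: frontier_def interior_open)
   thus ?thesis using w0[of z] r0 True by simp
  next
   case False
   define t where "t = norm (x0-z)"
   have t: "0 < t" "t <= r0" using False x0 by (auto simp: t_def)
   have "(\<lambda>j. th ^ j) \<longlonglongrightarrow> 0" using th0 th1 by (intro LIMSEQ_power_zero) auto
   hence "eventually (\<lambda>j. th ^ j < t/r0) sequentially" using t r0 by (intro order_tendstoD(2)) auto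
   then obtain m where m: "th ^ m < t/r0" by (auto simp: eventually_sequentially)
   \<comment> \<open>The first scale below \<open>norm (x0-z)\<close>; its predecessor is larger by
     the factor \<open>1/th\<close> only, and there the estimate is read off.\<close>
   define k where "k = (LEAST k. th ^ k < t/r0)"
   have k: "th ^ k < t/r0" "!!i. i < k ==> \<not> th ^ i < t/r0"
    unfolding k_def by (rule LeastI[of _ m], rule m) (rule not_less_Least)
   have "k ~= 0"
   proof
    assume "k = 0"
    thus False using k(1) t r0 by (simp add: field_simps)
   qed
   then obtain j where j: "k = Suc j" using not0_implies_Suc by blast
   have "rj (Suc j) < t" using k(1) r0 unfolding j rj_def by (simp add: field_simps)
   hence up: "rj j < t/th" using th0 by (simp add: rj_def field_simps)
   have "t <= rj j" using k(2)[of j] r0 unfolding j rj_def by (simp add: field_simps not_less)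
   hence "w x0 <= Kj j*l x0 + A*rj j powr (1 + be)" by (intro claim x0(1)) (simp add: t_def)
   moreover have "Kj j*l x0 <= Km*t"
   proof -
    have "l x0 <= t" using norm_cauchy_schwarz[of nu "x0 - z"] nu by (simp add: l_def t_def)
    hence "Kj j*l x0 <= Kj j*t" using Kj(1) by (rule mult_left_mono)
    also have "... <= Km*t" using Kj(2) t by (intro mult_right_mono) auto
    finally show ?thesis .
   qed
   moreover have "A*rj j powr (1 + be) <= A*(t/th)"
   proof (intro mult_left_mono)
    have "rj j <= 1" using rj(2)[of j] le(1) by linarith
    hence "rj j powr (1 + be) <= rj j powr 1" using rj(1)[of j] be by (intro powr_mono') auto
    thus "rj j powr (1 + be) <= t/th" using up rj(1)[of j] by simp
   qed (use A in auto)
   ultimately show ?thesis unfolding t_def[symmetric] distrib_right by simp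
  qed
 qed
 qed
 qed
qed

section \<open>Domains with tangent balls\<close>

text \<open>Here \<open>nu\<close> is the inner normal at \<open>z\<close>. A radius
  \<open>R\<close> common to all boundary points is all that the proof takes from the smoothness of
  the boundary.\<close>

definition tangent_balls :: "'a::euclidean_space set => real => 'a => 'a => bool" where
 "tangent_balls Om R z nu \<longleftrightarrow> norm nu = 1 \<and> ball (z + R *\<^sub>R nu) R \<subseteq> Om \<and> ball (z - R *\<^sub>R nu) R \<inter> Om = {}"

lemma tangent_balls_mono:
 assumes "tangent_balls Om R z nu" "0 < R'" "R' <= R"
 shows "tangent_balls Om R' z nu"
proof -
 have nu: "norm nu = 1" using assms(1) by (simp add: tangent_balls_def)
 have sub: "ball (z + R' *\<^sub>R v) R' \<subseteq> ball (z + R *\<^sub>R v) R" if "norm v = 1" for v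
 proof
  fix y assume y: "y \<in> ball (z + R' *\<^sub>R v) R'"
  have "dist (z + R *\<^sub>R v) (z + R' *\<^sub>R v) = R - R'" using that assms(2,3) by (simp add: dist_norm flip: scaleR_diff_left)
  thus "y \<in> ball (z + R *\<^sub>R v) R" using y dist_triangle[of "z + R *\<^sub>R v" y "z + R' *\<^sub>R v"] by simp
 qed
 show ?thesis using assms(1) sub[OF nu] sub[of "- nu"] nu unfolding tangent_balls_def by auto
qed

text \<open>Near \<open>z\<close> the defining function equals its linear part up to
  \<open>K*(norm h)^2\<close>, and in a tangent ball \<open>(norm h)^2 < 2*R*t\<close>, with
  \<open>t\<close> the normal component of \<open>h\<close>; for small \<open>R\<close> the linear
  part fixes the sign. Continuity of the second derivatives makes \<open>K\<close> and the lower
  bound \<open>m\<close> of the gradient uniform for all \<open>z\<close> near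
  \<open>x0\<close>.\<close>

lemma tangent_balls_at_regular_point:
 fixes ps :: "'a::euclidean_space => real"
 assumes Om: "open Om" and r: "r > 0" and ps: "smooth_on (ball x0 r) ps" "frechet_derivative ps (at x0) ~= (\<lambda>v. 0)"
  and lev: "Om \<inter> ball x0 r = {x\<in>ball x0 r. ps x < 0}"
 obtains e R where "e > 0" "R > 0" "!!z. z \<in> frontier Om ==> z \<in> ball x0 e ==> \<exists>nu. tangent_balls Om R z nu"
proof -
 define g where "g v x = frechet_derivative ps (at x) v" for v x
 define H where "H v w x = frechet_derivative (g v) (at x) w" for v w x
 have "Ck_on (Suc (Suc 0)) (ball x0 r) ps" using ps(1) unfolding smooth_on_def by blast
 hence C: "ps differentiable_on ball x0 r" "!!v. g v differentiable_on ball x0 r" "!!v w. continuous_on (ball x0 r) (H v w)"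
  unfolding g_def H_def by auto
 have dps: "(ps has_derivative (\<lambda>v. g v x)) (at x)" if "x \<in> ball x0 r" for x
  using C(1) that unfolding g_def by (simp add: differentiable_on_eq_differentiable_at frechet_derivative_works)
 have dg: "(g v has_derivative (\<lambda>w. H v w x)) (at x)" if "x \<in> ball x0 r" for v x
  using C(2)[of v] that unfolding H_def by (simp add: differentiable_on_eq_differentiable_at frechet_derivative_works)
 have lin: "linear (\<lambda>v. g v x)" if "x \<in> ball x0 r" for x using dps[OF that] by (rule has_derivative_linear)
 have levD: "y \<in> Om \<longleftrightarrow> ps y < 0" if "y \<in> ball x0 r" for y using lev that by blast
 have x0: "x0 \<in> ball x0 r" using r by simp
 obtain b0 where b0: "b0 \<in> Basis" "g b0 x0 ~= 0"
 proof (rule ccontr)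
  assume "\<not> thesis"
  hence "!!b. b \<in> Basis ==> g b x0 = 0" using that by blast
  hence "(\<lambda>v. g v x0) = (\<lambda>v. 0)" using lin[OF x0] by (intro linear_eq_stdbasis) (auto simp: linear_zero)
  thus False using ps(2) by (simp add: g_def)
 qed
 define m where "m = \<bar>g b0 x0\<bar>/2"
 have m: "m > 0" using b0(2) by (simp add: m_def)
 have "\<forall>\<^sub>F x in nhds x0. \<bar>H v w x\<bar> < \<bar>H v w x0\<bar> + 1" for v w
 proof -
  have "isCont (H v w) x0" using C(3)[of v w] x0 by (simp add: continuous_on_eq_continuous_at)
  hence "((\<lambda>x. \<bar>H v w x\<bar>) \<longlongrightarrow> \<bar>H v w x0\<bar>) (nhds x0)" by (intro tendsto_rabs) (simp add: isCont_def tendsto_at_iff_tendsto_nhds)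
  thus ?thesis by (rule order_tendstoD) simp
 qed
 hence "\<forall>\<^sub>F x in nhds x0. \<forall>v\<in>Basis. \<forall>w\<in>Basis. \<bar>H v w x\<bar> < \<bar>H v w x0\<bar> + 1" by (intro eventually_ball_finite ballI finite_Basis)
 moreover have "\<forall>\<^sub>F x in nhds x0. m < \<bar>g b0 x\<bar>"
 proof -
  have "isCont (g b0) x0" by (rule has_derivative_continuous[OF dg[OF x0]])
  hence "((\<lambda>x. \<bar>g b0 x\<bar>) \<longlongrightarrow> \<bar>g b0 x0\<bar>) (nhds x0)" by (intro tendsto_rabs) (simp add: isCont_def tendsto_at_iff_tendsto_nhds)
  thus ?thesis by (rule order_tendstoD) (use b0 in \<open>simp add: m_def\<close>)
 qed
 moreover have "\<forall>\<^sub>F x in nhds x0. x \<in> ball x0 r" using x0 by (intro eventually_nhds_in_open) auto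
 ultimately have "\<forall>\<^sub>F x in nhds x0. (\<forall>v\<in>Basis. \<forall>w\<in>Basis. \<bar>H v w x\<bar> < \<bar>H v w x0\<bar> + 1) \<and> m < \<bar>g b0 x\<bar> \<and> x \<in> ball x0 r"
  by eventually_elim blast
 then obtain s where s: "s > 0" "!!x. x \<in> ball x0 s ==> (\<forall>v\<in>Basis. \<forall>w\<in>Basis. \<bar>H v w x\<bar> < \<bar>H v w x0\<bar> + 1) \<and> m < \<bar>g b0 x\<bar> \<and> x \<in> ball x0 r"
  unfolding eventually_nhds_metric by (metis dist_commute mem_ball)
 define B where "B = (\<Sum>v\<in>Basis. \<Sum>w\<in>Basis. \<bar>H v w x0\<bar> + 1)"
 define N where "N = real DIM('a)"
 have B: "B >= 0" "N >= 0" by (auto simp: B_def N_def intro!: sum_nonneg)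
 have Lg: "\<bar>g v x - g v y\<bar> <= B*norm (x-y)" if v: "v \<in> Basis" and xy: "x \<in> ball x0 s" "y \<in> ball x0 s" for v x y
 proof -
  have "norm (g v x - g v y) <= B*norm (x-y)"
  proof (rule differentiable_bound[OF convex_ball _ _ xy])
   fix k assume k: "k \<in> ball x0 s"
   show dk: "(g v has_derivative (\<lambda>w. H v w k)) (at k within ball x0 s)" using dg s(2)[OF k] by (blast intro: has_derivative_at_withinI)
   have "onorm (\<lambda>w. H v w k) <= (\<Sum>w\<in>Basis. norm (H v w k))" by (intro onorm_componentwise has_derivative_bounded_linear[OF dk])
   also have "... <= (\<Sum>w\<in>Basis. \<bar>H v w x0\<bar> + 1)" using s(2)[OF k] v by (intro sum_mono) (auto intro: less_imp_le)
   also have "... <= B" unfolding B_def using v by (intro member_le_sum) (auto intro!: sum_nonneg)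
   finally show "onorm (\<lambda>w. H v w k) <= B" .
  qed
  thus ?thesis by simp
 qed
 have taylor: "\<bar>ps y - ps x - g (y-x) x\<bar> <= N*B*(norm (y-x))^2" if xy: "x \<in> ball x0 s" "y \<in> ball x0 s" for x y
 proof -
  have xr: "x \<in> ball x0 r" using s(2)[OF xy(1)] by blast
  let ?S = "ball x0 s \<inter> cball x (norm (y-x))"
  have "norm ((ps y - g y x) - (ps x - g x x)) <= (N*B*norm (y-x))*norm (y-x)"
  proof (rule differentiable_bound[where S = ?S])
   show "convex ?S" by (intro convex_Int convex_ball convex_cball)
   show "x \<in> ?S" "y \<in> ?S" using xy by (auto simp: dist_norms)
   fix k assume k: "k \<in> ?S"
   have "(ps has_derivative (\<lambda>v. g v k)) (at k within ?S)" using dps s(2) k by (blast intro: has_derivative_at_withinI)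
   moreover have "((\<lambda>v. g v x) has_derivative (\<lambda>v. g v x)) (at k within ?S)"
    by (intro bounded_linear_imp_has_derivative linear_conv_bounded_linear[THEN iffD1] lin xr)
   ultimately show d: "((\<lambda>y. ps y - g y x) has_derivative (\<lambda>v. g v k - g v x)) (at k within ?S)" by (rule has_derivative_diff)
   have "onorm (\<lambda>v. g v k - g v x) <= (\<Sum>v\<in>Basis. norm (g v k - g v x))" by (intro onorm_componentwise has_derivative_bounded_linear[OF d])
   also have "... <= (\<Sum>v\<in>(Basis::'a set). B*norm (y-x))"
   proof (rule sum_mono)
    fix v :: 'a assume "v \<in> Basis"
    hence "norm (g v k - g v x) <= B*norm (k-x)" using Lg[of v k x] k xy by simp
    also have "... <= B*norm (y-x)" using k B by (intro mult_left_mono) (auto simp: dist_norms)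
    finally show "norm (g v k - g v x) <= B*norm (y-x)" .
   qed
   finally show "onorm (\<lambda>v. g v k - g v x) <= N*B*norm (y-x)" by (simp add: N_def)
  qed
  moreover have "g (y-x) x = g y x - g x x" using linear_diff[OF lin[OF xr]] by simp
  ultimately show ?thesis by (simp add: power2_eq_square mult.assoc algebra_simps)
 qed
 define K where "K = N*B"
 \<comment> \<open>Small against the gradient bound \<open>m\<close>, so that the linear part wins,
   and against \<open>s\<close>, so that the tangent balls stay where the expansion holds.\<close>
 define R where "R = min (s/4) (m/(2*(K + 1)))"
 have K: "K >= 0" using B by (simp add: K_def)
 have R: "R > 0" using s(1) m K by (simp add: R_def)
 have R2: "2 * R*(K + 1) <= m"
 proof -
  have "R <= m/(2*(K + 1))" by (simp add: R_def)
  thus ?thesis using K by (simp add: field_simps)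
 qed
 have R4: "4 * R <= s" by (simp add: R_def)
 show thesis
 proof (rule that[of "s/2" R])
  fix z assume z: "z \<in> frontier Om" "z \<in> ball x0 (s/2)"
  have zs: "z \<in> ball x0 s" using z(2) s(1) by simp
  have zr: "z \<in> ball x0 r" using s(2)[OF zs] by blast
  have "z \<notin> Om" using z(1) Om by (simp add: frontier_def interior_open)
  hence "ps z >= 0" using levD[OF zr] by force
  moreover have "ps z <= 0"
  proof (rule ccontr)
   assume "\<not> ps z <= 0"
   moreover have "continuous_on (ball x0 r) ps" by (rule differentiable_imp_continuous_on[OF C(1)])
   hence "isCont ps z" using zr by (simp add: continuous_on_eq_continuous_at)
   ultimately have "\<forall>\<^sub>F y in nhds z. 0 < ps y" using order_tendstoD(1)[of ps "ps z" "nhds z" 0] by (simp add: isCont_def tendsto_at_iff_tendsto_nhds)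
   moreover have "\<forall>\<^sub>F y in nhds z. y \<in> ball x0 r" using zr by (intro eventually_nhds_in_open) auto
   ultimately have "\<forall>\<^sub>F y in nhds z. y \<notin> Om" by eventually_elim (use levD in force)
   then obtain U where "open U" "z \<in> U" "U \<inter> Om = {}" by (auto simp: eventually_nhds)
   thus False using z(1) open_Int_closure_eq_empty[of U Om] by (auto simp: frontier_def)
  qed
  ultimately have psz: "ps z = 0" by simp
  define G where "G = (\<Sum>v\<in>Basis. g v z *\<^sub>R v)"
  have G: "g h z = G \<bullet> h" for h
  proof -
   have "g h z = g (\<Sum>v\<in>Basis. (h \<bullet> v) *\<^sub>R v) z" by (simp add: euclidean_representation)
   also have "... = (\<Sum>v\<in>Basis. (h \<bullet> v)*g v z)" by (simp add: linear_sum[OF lin[OF zr]] linear_scale[OF lin[OF zr]])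
   also have "... = h \<bullet> G" by (simp add: G_def inner_sum_right mult.commute)
   also have "... = G \<bullet> h" by (rule inner_commute)
   finally show ?thesis .
  qed
  have Gm: "m < norm G"
  proof -
   have "m < \<bar>g b0 z\<bar>" using s(2)[OF zs] by blast
   also have "... <= norm G" unfolding G using Cauchy_Schwarz_ineq2[of G b0] b0(1) by simp
   finally show ?thesis .
  qed
  define nu where "nu = (- 1/norm G) *\<^sub>R G"
  have nu: "norm nu = 1" "G \<bullet> h = - norm G*(nu \<bullet> h)" for h using Gm m by (auto simp: nu_def)
  have key: "si*ps y < 0 \<and> y \<in> ball x0 r" if y: "y \<in> ball (z + R *\<^sub>R (si *\<^sub>R nu)) R" and si: "\<bar>si\<bar> = 1" for y si
  proof -
   define h where "h = y - z"
   define t where "t = si*(nu \<bullet> h)"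
   have n1: "norm (si *\<^sub>R nu) = 1" using nu si by simp
   have hR: "norm (h - R *\<^sub>R (si *\<^sub>R nu)) < R" using y by (simp add: h_def dist_norms algebra_simps)
   hence "(norm (h - R *\<^sub>R (si *\<^sub>R nu)))^2 < R^2" by (intro power_strict_mono) auto
   moreover have "(norm (h - R *\<^sub>R (si *\<^sub>R nu)))^2 = (norm h)^2 - 2 * R*t + R^2"
    using n1[THEN arg_cong[where f = "\<lambda>x. x^2"]]
    by (simp add: power2_norm_eq_inner inner_diff_left inner_diff_right inner_commute t_def algebra_simps power2_eq_square[of R] power2_eq_square[of si])
   ultimately have ht: "(norm h)^2 < 2 * R*t" by simp
   hence t: "t > 0" using R zero_le_power2[of "norm h"] by (smt (verit) mult_nonneg_nonpos)
   have "norm (R *\<^sub>R (si *\<^sub>R nu)) = R" unfolding norm_scaleR[of R] n1 using R by simp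
   hence "norm h < 2 * R" using norm_triangle_ineq2[of h "R *\<^sub>R (si *\<^sub>R nu)"] hR by linarith
   hence ys: "y \<in> ball x0 s" using z(2) R4 dist_triangle[of x0 y z] by (simp add: h_def dist_norms)
   have "\<bar>ps y - g h z\<bar> <= K*(norm h)^2" using taylor[OF zs ys] by (simp add: psz h_def K_def)
   hence "\<bar>si\<bar>*\<bar>ps y - g h z\<bar> <= K*(norm h)^2" using si by simp
   hence "si*(ps y - g h z) <= K*(norm h)^2" unfolding abs_mult[symmetric] by linarith
   moreover have "si*g h z = - norm G*t" by (simp add: G nu(2) t_def)
   moreover have "K*(norm h)^2 <= K*(2 * R*t)" using ht K by (intro mult_left_mono) auto
   moreover have "2 * R*(K + 1)*t <= norm G*t" using R2 Gm t by (intro mult_right_mono) auto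
   moreover have "R*t > 0" using R t by simp
   ultimately have "si*ps y < 0" by (simp add: algebra_simps)
   thus ?thesis using s(2)[OF ys] by blast
  qed
  have "y \<in> Om" if "y \<in> ball (z + R *\<^sub>R nu) R" for y using key[of y 1] that levD by simp
  moreover have "y \<notin> Om" if "y \<in> ball (z - R *\<^sub>R nu) R" for y using key[of y "- 1"] that levD[of y] by simp
  ultimately show "\<exists>nu. tangent_balls Om R z nu" using nu(1) unfolding tangent_balls_def by (intro exI[of _ nu]) blast
 qed (use s(1) R in auto)
qed

lemma smooth_bounded_domain_tangent_balls:
 fixes Om :: "'a::euclidean_space set"
 assumes "smooth_bounded_domain Om"
 obtains R where "R > 0" "!!z. z \<in> frontier Om ==> \<exists>nu. tangent_balls Om R z nu"
proof -
 have Om: "open Om" "bounded Om" using assms by (auto simp: smooth_bounded_domain_def)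
 have "\<forall>x\<in>frontier Om. \<exists>e>0. \<exists>R>0. \<forall>z\<in>frontier Om \<inter> ball x e. \<exists>nu. tangent_balls Om R z nu"
 proof
  fix x assume "x \<in> frontier Om"
  then obtain r ps where "r > 0" "smooth_on (ball x r) ps" "frechet_derivative ps (at x) ~= (\<lambda>v. 0)"
    "Om \<inter> ball x r = {y\<in>ball x r. ps y < 0}" using assms unfolding smooth_bounded_domain_def by blast
  from tangent_balls_at_regular_point[OF Om(1) this]
  show "\<exists>e>0. \<exists>R>0. \<forall>z\<in>frontier Om \<inter> ball x e. \<exists>nu. tangent_balls Om R z nu" by (metis IntD1 IntD2)
 qed
 then obtain e R where eR: "!!x. x \<in> frontier Om ==> e x > 0" "!!x. x \<in> frontier Om ==> R x > 0"
  "!!x z. x \<in> frontier Om ==> z \<in> frontier Om \<inter> ball x (e x) ==> \<exists>nu. tangent_balls Om (R x) z nu" by metis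
 have "compact (frontier Om)" using Om(2) by (rule compact_frontier_bounded)
 moreover have "open (ball x (e x))" for x by simp
 moreover have "frontier Om \<subseteq> (\<Union>x\<in>frontier Om. ball x (e x))" using eR(1) by force
 ultimately obtain C where C: "C \<subseteq> frontier Om" "finite C" "frontier Om \<subseteq> (\<Union>x\<in>C. ball x (e x))"
  by (rule compactE_image)
 define R' where "R' = Min (insert 1 (R ` C))"
 have R': "R' > 0" using C eR(2) by (auto simp: R'_def)
 show thesis
 proof (rule that[OF R'])
  fix z assume z: "z \<in> frontier Om"
  then obtain x where x: "x \<in> C" "z \<in> ball x (e x)" using C(3) by blast
  then obtain nu where "tangent_balls Om (R x) z nu" using eR(3)[of x z] C(1) z by blast
  moreover have "R' <= R x" unfolding R'_def using C(2) x(1) by (intro Min_le) auto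
  ultimately show "\<exists>nu. tangent_balls Om R' z nu" using tangent_balls_mono R' by blast
 qed
qed

text \<open>The ball about \<open>x\<close> of radius \<open>dist x z\<close> lies in
  \<open>Om\<close> and so misses the exterior ball at \<open>z\<close>. Hence the centres are at
  least the sum of the radii apart, while the path through \<open>z\<close> has exactly this length:
  equality in the triangle inequality makes the two directions agree.\<close>

lemma nearest_boundary_point_normal:
 assumes Om: "open Om" and x: "x \<in> Om" and z: "z \<in> frontier Om" "!!y. y \<in> frontier Om ==> dist x z <= dist x y"
  and R: "R > 0" and t: "tangent_balls Om R z nu"
 shows "x = z + dist x z *\<^sub>R nu"
proof -
 have nu: "norm nu = 1" using t by (simp add: tangent_balls_def)
 have xz: "dist x z > 0" using x z(1) Om by (auto simp: frontier_def interior_open)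
 have "ball x (dist x z) \<inter> frontier Om = {}" using z(2) by (fastforce simp: dist_commute)
 hence "ball x (dist x z) \<subseteq> Om"
  using connected_Int_frontier[OF connected_ball[of x "dist x z"], of Om] x xz centre_in_ball[of x "dist x z"] by blast
 hence dj: "ball x (dist x z) \<inter> ball (z - R *\<^sub>R nu) R = {}" using t by (auto simp: tangent_balls_def)
 have far: "dist x z + R <= dist x (z - R *\<^sub>R nu)"
 proof (rule ccontr)
  define w where "w = z - R *\<^sub>R nu"
  define D where "D = dist x w"
  \<comment> \<open>If the centres were closer, the point dividing their segment in the ratio of the
    radii would lie in both balls.\<close>
  define a where "a = dist x z/(dist x z + R)"
  assume "\<not> ?thesis"
  hence D: "D < dist x z + R" by (simp add: D_def w_def)
  have pos: "dist x z + R > 0" by (rule add_pos_pos[OF xz R])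
  hence a3: "a*(dist x z + R) = dist x z" by (simp add: a_def)
  have a: "0 < a" "a < 1" using xz R pos by (simp_all add: a_def)
  have a4: "(1-a)*(dist x z + R) = R" unfolding left_diff_distrib a3 by simp
  define k where "k = x + a *\<^sub>R (w-x)"
  have "dist x k = a*D" using a by (simp add: k_def D_def dist_norms)
  moreover have "w - k = (1-a) *\<^sub>R (w-x)" by (simp add: k_def algebra_simps)
  hence "dist w k = (1-a)*D" using a by (simp add: D_def dist_norms)
  moreover have "a*D < dist x z" "(1-a)*D < R" using a a3 a4 mult_strict_left_mono[OF D, of a] mult_strict_left_mono[OF D, of "1 - a"] by simp_all
  ultimately have "k \<in> ball x (dist x z) \<inter> ball w R" by simp
  thus False using dj unfolding w_def by blast
 qed
 have "norm ((x-z) + R *\<^sub>R nu) = norm (x-z) + norm (R *\<^sub>R nu)"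
  using far norm_triangle_ineq[of "x - z" "R *\<^sub>R nu"] nu R by (simp add: dist_norm algebra_simps)
 hence "norm (x-z) *\<^sub>R (R *\<^sub>R nu) = norm (R *\<^sub>R nu) *\<^sub>R (x-z)" by (simp only: norm_triangle_eq)
 hence "R *\<^sub>R (dist x z *\<^sub>R nu) = R *\<^sub>R (x-z)" using nu R by (simp add: dist_norm mult.commute)
 hence "dist x z *\<^sub>R nu = x - z" using R unfolding scaleR_cancel_left by simp
 thus ?thesis by simp
qed

text \<open>\<open>Y\<close> collects the centres of all balls of radius \<open>R\<close> that miss
  \<open>Om\<close>. Near the boundary the distance to \<open>Y\<close> is between \<open>R\<close>
  and \<open>R + s\<close>, where \<open>strip_barrier\<close> applies; \<open>K\<close> is the
  remaining compact part, on which the sign of \<open>E\<close> is assumed.\<close>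

lemma strip_maximum_principle:
 fixes ga Ga de C R :: real and Om :: "(real^'n) set"
 assumes ga: "0 < ga" "ga <= Ga" and de: "de >= 0" and C: "C >= 0" and R: "R > 0" and Om: "open Om" "bounded Om" "Om ~= {}"
  and ext: "!!z. z \<in> frontier Om ==> \<exists>nu. tangent_balls Om R z nu"
 obtains K where "compact K" "K \<subseteq> Om"
  "!!E e x. continuous_on Om E ==> (!!ep. ep > 0 ==> compact {x\<in>Om. ep <= E x}) ==> (!!x. x \<in> K ==> E x <= 0) ==> e >= 0 ==>
   esub ga Ga de {x\<in>Om. E x > 0} E (\<lambda>x. C*E x + e) ==> x \<in> Om ==> E x <= 2*e"
proof -
 define Y where "Y = {y. ball y R \<inter> Om = {}}"
 have YR: "R <= dist x y" if "x \<in> closure Om" "y \<in> Y" for x y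
 proof -
  have "ball y R \<inter> closure Om = {}" using that(2) by (simp add: Y_def open_Int_closure_eq_empty)
  thus ?thesis using that(1) by (force simp: dist_commute)
 qed
 have "Y = {y. \<forall>x\<in>Om. R <= dist y x}" by (auto simp: Y_def disjoint_iff not_less)
 also have "... = (\<Inter>x\<in>Om. {y. R <= dist y x})" by auto
 finally have "closed Y" by (auto intro!: closed_INT closed_Collect_le continuous_intros)
 have out: "z - R *\<^sub>R nu \<in> Y" if "tangent_balls Om R z nu" for z nu using that by (simp add: Y_def tangent_balls_def)
 obtain z0 where "z0 \<in> frontier Om" using frontier_not_empty[of Om] Om(2,3) not_bounded_UNIV by blast
 hence Y: "Y ~= {}" using ext out by blast
 have infY: "R <= infdist x Y" if "x \<in> closure Om" for x
  unfolding infdist_notempty[OF Y] using Y YR[OF that] by (intro cINF_greatest)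
 show thesis
 proof (rule strip_barrier[OF ga de C R, where 'n = 'n], goal_cases)
  case s: (1 s G)
  note G = s(2-5)
  define K where "K = closure Om \<inter> {x. R + s <= infdist x Y}"
  show thesis
  proof (rule that[of K])
   show "compact K" unfolding K_def using Om(2)
    by (intro compact_Int_closed closed_Collect_le continuous_intros) (simp add: compact_closure)
   show "K \<subseteq> Om"
   proof
    fix x assume x: "x \<in> K"
    show "x \<in> Om"
    proof (rule ccontr)
     assume "x \<notin> Om"
     hence "x \<in> frontier Om" using x Om(1) by (simp add: K_def frontier_def interior_open)
     then obtain nu where nu: "tangent_balls Om R x nu" using ext by blast
     have "infdist x Y <= dist x (x - R *\<^sub>R nu)" by (rule infdist_le[OF out[OF nu]])
     also have "... = R" using nu R by (simp add: dist_norm tangent_balls_def)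
     finally show False using x s(1) by (simp add: K_def)
    qed
   qed
   fix E e x assume E: "continuous_on Om E" "!!ep. ep > 0 ==> compact {x\<in>Om. ep <= E x}" "!!x. x \<in> K ==> E x <= 0" and e: "e >= 0"
    and es: "esub ga Ga de {x\<in>Om. E x > 0} E (\<lambda>x. C*E x + e)" and x: "x \<in> Om"
   have cl: "y \<in> closure Om" if "y \<in> Om" for y using that closure_subset by blast
   show "E x <= 2*e"
   proof (rule barrier_max_principle[OF ga Om(1) E(1,2) _ _ C e _ es x, where g = "\<lambda>y. G (infdist y Y)"])
    show "continuous_on Om (\<lambda>y. G (infdist y Y))" by (rule continuous_on_compose2[OF G(1)]) (auto intro: continuous_intros)
    show "1 <= G (infdist y Y)" if "y \<in> Om" for y using infY cl that by (intro G(2)) blast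
    fix y assume y: "y \<in> Om" "E y > 0"
    hence "y \<notin> K" using E(3) by force
    hence "infdist y Y <= R + s" using cl[OF y(1)] by (simp add: K_def)
    thus "G (infdist y Y) <= 2 \<and> (\<exists>p X. mjet (\<lambda>y. G (infdist y Y)) y p X \<and> 2*C + 1 <= pucci_minus ga Ga X - de*norm p)"
     using G(3)[OF infdist_nonneg] G(4)[OF \<open>closed Y\<close> Y infY[OF cl[OF y(1)]]] by blast
   qed
  qed
 qed
qed

section \<open>The Dirichlet problem\<close>

lemma (in elliptic) vsol_locally_lipschitz:
 assumes u: "continuous_on Om u" "vsol F Om u h" and h: "continuous_on Om h" and x: "x \<in> Om"
 shows "\<exists>r>0. \<exists>L. \<forall>y\<in>ball x r. \<forall>z\<in>ball x r. \<bar>u y - u z\<bar> <= L*norm (y-z)"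
proof -
 obtain s where s: "s > 0" "cball x s \<subseteq> Om" using open_Om x by (meson open_contains_cball)
 have "bounded (u ` cball x s)" "bounded (h ` cball x s)"
  using continuous_on_subset[OF u(1) s(2)] continuous_on_subset[OF h s(2)]
  by (simp_all add: compact_imp_bounded compact_continuous_image)
 then obtain a b where ab: "\<forall>y\<in>u ` cball x s. norm y <= a" "\<forall>y\<in>h ` cball x s. norm y <= b" unfolding bounded_iff by blast
 have M: "\<bar>a\<bar> + \<bar>b\<bar> + 1 > 0" by simp
 have s2: "s/2 > 0" "cball x (2*(s/2)) \<subseteq> Om" using s by auto
 show ?thesis
 proof (rule interior_lipschitz[OF s2 M], goal_cases)
  case L: (1 L)
  have b: "\<bar>u y\<bar> <= \<bar>a\<bar> + \<bar>b\<bar> + 1 \<and> \<bar>h y\<bar> <= \<bar>a\<bar> + \<bar>b\<bar> + 1" if "y \<in> cball x (2*(s/2))" for y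
  proof -
   have "y \<in> cball x s" using that by simp
   hence "norm (u y) <= a" "norm (h y) <= b" using ab by blast+
   thus ?thesis unfolding real_norm_def by linarith
  qed
  show ?thesis using L[OF u b] s(1) by (intro exI[of _ "s/2/2"] conjI exI[of _ L] ballI) auto
 qed
qed

lemma compact_superlevel:
 fixes g :: "'a::t2_space => real"
 assumes "compact S" "continuous_on S g"
 shows "compact {x\<in>S. c <= g x}"
proof -
 have "closed (S \<inter> g -` {c..})" by (rule continuous_closed_preimage[OF assms(2) compact_imp_closed[OF assms(1)] closed_atLeast])
 hence "compact (S \<inter> (S \<inter> g -` {c..}))" by (rule compact_Int_closed[OF assms(1)])
 moreover have "S \<inter> (S \<inter> g -` {c..}) = {x\<in>S. c <= g x}" by auto
 ultimately show ?thesis by simp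
qed

definition dsol :: "'n::finite op => (real^'n) set => (real^'n => real) => (real^'n => real) => bool" where
 "dsol F Om h u \<longleftrightarrow> continuous_on (closure Om) u \<and> (\<forall>x\<in>frontier Om. u x = 0) \<and> vsol F Om u h"

locale elliptic_domain = elliptic F Om de1 de0 ga Ga for F :: "'n::finite op" and Om de1 de0 ga Ga +
 fixes R p :: real
 assumes bounded_Om: "bounded Om" and connected_Om: "connected Om" and nonempty_Om: "Om ~= {}" and R: "R > 0" and p: "p > real CARD('n)"
  and tangent: "!!z. z \<in> frontier Om ==> \<exists>nu. tangent_balls Om R z nu"
begin

lemma domain_reflected: "elliptic_domain (reflected F) Om de1 de0 ga Ga R p"
 using elliptic_domain_axioms elliptic_reflected by (simp add: elliptic_domain_def)

lemma compact_closure_Om: "compact (closure Om)" using bounded_Om by (simp add: compact_closure)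

lemma closure_cases: "x \<in> closure Om ==> x \<in> Om \<or> x \<in> frontier Om" using open_Om by (simp add: frontier_def interior_open)

lemma dsol_bounded: "dsol F Om h u ==> \<exists>U>0. \<forall>x\<in>closure Om. \<bar>u x\<bar> <= U"
proof -
 assume "dsol F Om h u"
 hence "bounded (u ` closure Om)" unfolding dsol_def by (intro compact_imp_bounded compact_continuous_image compact_closure_Om) blast
 then obtain U where "U > 0" "\<forall>y\<in>u ` closure Om. norm y <= U" unfolding bounded_pos by blast
 thus ?thesis by (intro exI[of _ U]) simp
qed

lemma dsol_continuous: "dsol F Om h u ==> continuous_on Om u"
 unfolding dsol_def by (blast intro: continuous_on_subset[OF _ closure_subset])

lemma super_esub:
 assumes "dsol F Om h u"
 shows "esub ga Ga de1 Om (\<lambda>x. - u x) (\<lambda>x. de0*\<bar>u x\<bar> - h x)"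
proof -
 have "vsub (reflected F) Om (\<lambda>x. - u x) (\<lambda>x. - h x)" using assms by (simp add: dsol_def vsol_def)
 from elliptic.vsub_imp_esub[OF elliptic_reflected this] show ?thesis by simp
qed

text \<open>The strong minimum principle for a constant sequence without error: \<open>f\<close> has
  the favourable sign, and \<open>a*u\<close> is absorbed in the constant \<open>C\<close>.\<close>

lemma positive_of_nonneg:
 assumes u: "dsol F Om (\<lambda>x. a*u x + f x) u" and f: "!!x. x \<in> Om ==> 0 <= f x" and u0: "!!x. x \<in> Om ==> 0 <= u x"
  and x0: "x0 \<in> Om" "u x0 > 0" and x: "x \<in> Om"
 shows "u x > 0"
proof -
 have "isCont u x0" using dsol_continuous[OF u] x0(1) open_Om by (simp add: continuous_on_eq_continuous_at)
 then obtain r where r: "r > 0" "!!y. dist y x0 < r ==> dist (u y) (u x0) < u x0/2"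
  using x0(2) unfolding continuous_at_eps_delta by (meson half_gt_zero)
 have "\<exists>r>0. \<exists>th>0. \<forall>\<^sub>F j in sequentially. \<forall>x\<in>ball x r. th <= u x"
 proof (rule strong_minimum_sequence[OF ga de(1) _ open_Om connected_Om, where D = "\<lambda>_. u" and e = "\<lambda>_. 0" and C = "de0 + \<bar>a\<bar>"])
  show "esub ga Ga de1 Om (\<lambda>x. - u x) (\<lambda>x. (de0 + \<bar>a\<bar>)*\<bar>u x\<bar> + 0)"
  proof (rule esub_mono[OF super_esub[OF u] order_refl])
   fix y assume y: "y \<in> Om"
   have "- a*u y <= \<bar>a\<bar>*u y" using u0[OF y] by (intro mult_right_mono) auto
   thus "de0*\<bar>u y\<bar> - (a*u y + f y) <= (de0 + \<bar>a\<bar>)*\<bar>u y\<bar> + 0" using f[OF y] u0[OF y] by (simp add: distrib_right)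
  qed
  show "\<forall>\<^sub>F j in sequentially. \<forall>x\<in>ball x0 r. u x0/2 <= u x"
  proof (intro always_eventually allI ballI)
   fix y assume "y \<in> ball x0 r"
   hence "dist (u y) (u x0) < u x0/2" using r(2)[of y] by (simp add: dist_commute)
   thus "u x0/2 <= u y" unfolding dist_real_def by linarith
  qed
  show "- 0 <= u y" if "y \<in> Om" for y using u0[OF that] by simp
  show "continuous_on Om u" by (rule dsol_continuous[OF u])
 qed (use de x0 r(1) x in simp_all)
 then obtain r th where "r > 0" "th > 0" "\<forall>y\<in>ball x r. th <= u y" by (auto simp: eventually_sequentially)
 thus ?thesis by (metis centre_in_ball less_le_trans)
qed

text \<open>On the compact set of the strip principle uniform convergence gives positivity. In the
  strip, where the limit tends to zero and convergence says nothing about signs, the maximum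
  principle for \<open>- v k\<close> gives \<open>0 <= v k\<close>, without error because of the
  sign of \<open>f\<close>.\<close>

lemma limit_positive:
 assumes v: "!!k::nat. dsol F Om (\<lambda>x. l k * v k x + e k*f x) (v k)" and l: "!!k. \<bar>l k\<bar> <= L"
  and f: "!!x. x \<in> Om ==> 0 <= f x" and e: "!!k. 0 <= e k"
  and V: "continuous_on (closure Om) V" "!!x. x \<in> Om ==> 0 < V x" and lim: "uniform_limit (closure Om) v V sequentially"
 shows "\<forall>\<^sub>F k in sequentially. \<forall>x\<in>Om. 0 < v k x"
proof (rule strip_maximum_principle[OF ga de(1) _ R open_Om bounded_Om nonempty_Om tangent, of "de0 + L"], goal_cases)
 case 1
 thus ?case using l[of 0] de by linarith
next
 case K: (3 K)
 note strip = K(3)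
 obtain x0 where x0: "x0 \<in> Om" using nonempty_Om by blast
 have cl: "Om \<subseteq> closure Om" by (rule closure_subset)
 have K': "compact (insert x0 K)" "insert x0 K \<subseteq> closure Om" using K x0 cl by auto
 obtain y where y: "y \<in> insert x0 K" "!!x. x \<in> insert x0 K ==> V y <= V x"
  using continuous_attains_inf[OF K'(1) _ continuous_on_subset[OF V(1) K'(2)]] by blast
 have Vy: "V y > 0" using y(1) x0 K(2) V(2) by blast
 from uniform_limitD[OF lim Vy] show ?thesis
 proof eventually_elim
  case (elim k)
  have pos: "v k x > 0" if "x \<in> insert x0 K" for x
  proof -
   have "dist (v k x) (V x) < V y" using elim that K'(2) by blast
   thus ?thesis using y(2)[OF that] unfolding dist_real_def by linarith
  qed
  have nonneg: "0 <= v k x" if x: "x \<in> Om" for x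
  proof -
   have "- v k x <= 2*0"
   proof (rule strip[OF _ _ _ order_refl _ x])
    show "continuous_on Om (\<lambda>x. - v k x)" by (intro continuous_intros dsol_continuous[OF v])
    show "compact {x \<in> Om. ep <= - v k x}" if ep: "ep > 0" for ep
    proof -
     have "{x \<in> Om. ep <= - v k x} = {x \<in> closure Om. ep <= - v k x}"
      using cl closure_cases v[of k] ep by (force simp: dsol_def)
     moreover have "continuous_on (closure Om) (\<lambda>x. - v k x)" using v[of k] by (auto simp: dsol_def intro: continuous_intros)
     hence "compact {x \<in> closure Om. ep <= - v k x}" by (rule compact_superlevel[OF compact_closure_Om])
     ultimately show ?thesis by simp
    qed
    show "- v k x <= 0" if "x \<in> K" for x using pos[of x] that by simp
    show "esub ga Ga de1 {x \<in> Om. 0 < - v k x} (\<lambda>x. - v k x) (\<lambda>x. (de0 + L) * - v k x + 0)"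
    proof (rule esub_mono[OF super_esub[OF v]])
     fix x assume x: "x \<in> {x \<in> Om. 0 < - v k x}"
     have "l k * - v k x <= L * - v k x" using l[of k] x by (intro mult_right_mono) auto
     moreover have "0 <= e k*f x" using e f x by simp
     moreover have a: "\<bar>v k x\<bar> = - v k x" using x by simp
     ultimately show "de0*\<bar>v k x\<bar> - (l k * v k x + e k*f x) <= (de0 + L) * - v k x + 0"
      unfolding a distrib_right mult_minus_right by linarith
    qed auto
   qed
   thus ?thesis by simp
  qed
  show ?case
  proof
   fix x assume x: "x \<in> Om"
   have "0 <= e k*f x" if "x \<in> Om" for x using e[of k] f[OF that] by simp
   from positive_of_nonneg[OF v[of k] this nonneg x0 pos[OF insertI1] x] show "0 < v k x" .
  qed
 qed
qed

text \<open>The multiple of \<open>w\<^sub>j\<close> that touches \<open>u\<close> from below on a large compact set lies below \<open>u\<close> up to an error that tends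
 to \<open>0\<close>; by the strong minimum principle the difference tends to \<open>0\<close> somewhere in every ball.\<close>

lemma sign_of_solution_at_eigenvalue:
 assumes u: "dsol F Om (\<lambda>x. a*u x + f x) u" and f: "continuous_on Om f" "!!x. x \<in> Om ==> 0 <= f x" and xs: "xs \<in> Om" "u xs < 0"
  and w: "!!j::nat. continuous_on Om (w j)" "!!j x. x \<in> Om ==> w j x < 0" "!!j. vsub F Om (w j) (\<lambda>x. rh j*w j x)"
  and rh: "!!j. a - 1 <= rh j" "!!j. rh j <= a" "rh \<longlonglongrightarrow> a" and x1: "x1 \<in> Om"
 shows "u x1 < 0 \<and> f x1 = 0"
proof (rule strip_maximum_principle[OF ga de(1) _ R open_Om bounded_Om nonempty_Om tangent, of "de0 + \<bar>a\<bar> + 1"], goal_cases)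
 case 1
 thus ?case using de by simp
next
 case K: (3 K)
 note strip = K(3)
 define C where "C = de0 + \<bar>a\<bar> + 1"
 have C: "C >= 0" using de by (simp add: C_def)
 \<comment> \<open>The point \<open>xs\<close>, where \<open>u\<close> is negative, makes the
   touching multiple \<open>t j\<close> positive.\<close>
 define K' where "K' = insert xs K"
 have K': "compact K'" "K' \<subseteq> Om" "xs \<in> K'" using K xs by (auto simp: K'_def)
 have uc: "continuous_on Om u" by (rule dsol_continuous[OF u])
 obtain U where U: "U > 0" "\<forall>x\<in>closure Om. \<bar>u x\<bar> <= U" using dsol_bounded[OF u] by blast
 have UOm: "\<bar>u x\<bar> <= U" if "x \<in> Om" for x using U(2) that closure_subset by blast
 have "\<exists>t y. t > 0 \<and> y \<in> K' \<and> t*w j y = u y \<and> (\<forall>x\<in>K'. t*w j x <= u x)" for j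
 proof -
  have "continuous_on K' (\<lambda>x. u x/w j x)"
   using w(2)[of _ j] K'(2) by (intro continuous_intros continuous_on_subset[OF uc K'(2)] continuous_on_subset[OF w(1) K'(2)]) force
  then obtain y where y: "y \<in> K'" "!!x. x \<in> K' ==> u x/w j x <= u y/w j y"
   using continuous_attains_sup[OF K'(1)] K'(3) by blast
  have "u xs/w j xs > 0" using xs w(2)[OF xs(1), of j] by (simp add: divide_neg_neg)
  hence "u y/w j y > 0" using y(2)[OF K'(3)] by linarith
  moreover have wn: "w j x < 0" if "x \<in> K'" for x using w(2) K'(2) that by blast
  moreover have "u y/w j y*w j x <= u x" if "x \<in> K'" for x
   using y(2)[OF that] wn[OF that] by (simp add: neg_divide_le_eq)
  ultimately show ?thesis using y(1) wn[OF y(1)] by (intro exI[of _ "u y/w j y"] exI[of _ y]) auto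
 qed
 then obtain t y where t: "!!j. t j > 0" and y: "!!j. y j \<in> K'" "!!j. t j*w j (y j) = u (y j)"
  and tu: "!!j x. x \<in> K' ==> t j*w j x <= u x" by metis
 define W where "W j x = t j*w j x" for j x
 have W: "continuous_on Om (W j)" "x \<in> Om ==> W j x < 0" for j x
  using w(1,2) t[of j] unfolding W_def by (auto intro!: continuous_intros simp: mult_pos_neg)
 have Wsub: "vsub F Om (W j) (\<lambda>x. rh j*W j x)" for j
  using vsub_scale[OF w(3)[of j] t[of j]] by (simp add: W_def[abs_def] mult_ac)
 \<comment> \<open>The error made when \<open>rh j\<close> is replaced by \<open>a\<close> in front
   of \<open>u\<close>.\<close>
 define d where "d j = (a - rh j)*U" for j
 have d0: "d j >= 0" for j using rh(2)[of j] U(1) by (simp add: d_def)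
 have dlim: "d \<longlonglongrightarrow> 0" unfolding d_def by (rule tendsto_eq_intros rh(3) refl | simp)+
 have rhC: "\<bar>rh j\<bar> <= \<bar>a\<bar> + 1" for j using rh(1,2)[of j] by linarith
 have E1: "esub ga Ga de1 Om (\<lambda>x. W j x - u x) (\<lambda>x. C*\<bar>W j x - u x\<bar> + d j - f x)" for j
 proof (rule esub_mono[OF difference_esub[OF Wsub W(1) _ _ uc _ vsol_locally_lipschitz[OF uc]] order_refl])
  show "continuous_on Om (\<lambda>x. rh j*W j x)" by (intro continuous_intros W(1))
  show c: "continuous_on Om (\<lambda>x. a*u x + f x)" "continuous_on Om (\<lambda>x. a*u x + f x)" by (intro continuous_intros uc f(1))+
  show "vsol F Om u (\<lambda>x. a*u x + f x)" "vsub (reflected F) Om (\<lambda>x. - u x) (\<lambda>x. - (a*u x + f x))" using u by (auto simp: dsol_def vsol_def)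
  fix x assume x: "x \<in> Om"
  have "rh j*(W j x - u x) <= (\<bar>a\<bar> + 1)*\<bar>W j x - u x\<bar>"
   using mult_right_mono[OF rhC[of j], of "\<bar>W j x - u x\<bar>"] abs_ge_self[of "rh j*(W j x - u x)"] by (simp add: abs_mult)
  moreover have "(a - rh j) * - u x <= d j"
   unfolding d_def using rh(2)[of j] UOm[OF x] by (intro mult_left_mono) auto
  ultimately show "de0*\<bar>W j x - u x\<bar> + rh j*W j x - (a*u x + f x) <= C*\<bar>W j x - u x\<bar> + d j - f x"
   unfolding C_def by (simp add: algebra_simps)
 qed
 have E2: "W j x - u x <= 2*d j" if x: "x \<in> Om" for j x
 proof (rule strip[OF _ _ _ d0 _ x])
  show c: "continuous_on Om (\<lambda>x. W j x - u x)" by (intro continuous_intros W(1) uc)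
  show "compact {x \<in> Om. ep <= W j x - u x}" if ep: "ep > 0" for ep
  proof -
   have ucl: "continuous_on (closure Om) u" and u0: "\<forall>x\<in>frontier Om. u x = 0" using u by (auto simp: dsol_def)
   define S where "S = {x \<in> closure Om. ep <= - u x}"
   have S: "compact S" unfolding S_def by (intro compact_superlevel compact_closure_Om continuous_intros ucl)
   have sub: "S \<subseteq> Om" using u0 ep closure_cases by (force simp: S_def)
   have "x \<in> S" if "x \<in> Om" "ep <= W j x - u x" for x
    using that W(2)[OF that(1), of j] closure_subset[of Om] by (auto simp: S_def)
   hence "{x \<in> Om. ep <= W j x - u x} = {x \<in> S. ep <= W j x - u x}" using sub by blast
   thus ?thesis using compact_superlevel[OF S continuous_on_subset[OF c sub]] by simp
  qed
  show "W j x - u x <= 0" if "x \<in> K" for x using tu[of x j] that by (simp add: K'_def W_def)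
  show "esub ga Ga de1 {x \<in> Om. 0 < W j x - u x} (\<lambda>x. W j x - u x) (\<lambda>x. (de0 + \<bar>a\<bar> + 1)*(W j x - u x) + d j)"
   by (rule esub_mono[OF E1]) (use f(2) in \<open>auto simp: C_def\<close>)
 qed
 have d2lim: "(\<lambda>j. 2*d j) \<longlonglongrightarrow> 0" using tendsto_mult_right[OF dlim, of 2] by simp
 \<comment> \<open>A uniform gap between \<open>u\<close> and \<open>W j\<close> near one point
   would spread to all of \<open>K'\<close>. Since the contact points \<open>y j\<close> move with
   \<open>j\<close>, a finite subcover is needed to contradict them.\<close>
 have no_gap: False if x0: "x0 \<in> Om" "r > 0" "th > 0" "\<forall>\<^sub>F j in sequentially. \<forall>x\<in>ball x0 r. th <= u x - W j x" for x0 r th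
 proof -
  have "\<exists>r>0. \<exists>th>0. \<forall>\<^sub>F j in sequentially. \<forall>z\<in>ball x r. th <= u z - W j z" if x: "x \<in> K'" for x
  proof (rule strong_minimum_sequence[OF ga de(1) C open_Om connected_Om _ _ _ _ d2lim x0])
   show "esub ga Ga de1 Om (\<lambda>x. - (u x - W j x)) (\<lambda>x. C*\<bar>u x - W j x\<bar> + 2*d j)" for j
   proof (unfold minus_diff_eq, rule esub_mono[OF E1 order_refl])
    fix x assume "x \<in> Om"
    thus "C*\<bar>W j x - u x\<bar> + d j - f x <= C*\<bar>u x - W j x\<bar> + 2*d j"
     using f(2)[of x] d0[of j] by (simp add: abs_minus_commute)
   qed
   show "continuous_on Om (\<lambda>x. u x - W j x)" for j by (intro continuous_intros W(1) uc)
   show "- (2*d j) <= u x - W j x" if "x \<in> Om" for j x using E2[OF that, of j] by simp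
   show "0 <= 2*d j" for j using d0[of j] by simp
   show "x \<in> Om" using x K'(2) by blast
  qed
  note ball = this
  define G where "G = {V. open V \<and> (\<forall>\<^sub>F j in sequentially. \<forall>z\<in>V. 0 < u z - W j z)}"
  have "K' \<subseteq> \<Union>G"
  proof
   fix x assume "x \<in> K'"
   then obtain r th where r: "r > 0" "th > 0" "\<forall>\<^sub>F j in sequentially. \<forall>z\<in>ball x r. th <= u z - W j z" using ball by blast
   have "\<forall>\<^sub>F j in sequentially. \<forall>z\<in>ball x r. 0 < u z - W j z" using r(3) by (rule eventually_mono) (use r(2) in force)
   hence "ball x r \<in> G" by (simp add: G_def)
   thus "x \<in> \<Union>G" using r(1) by (meson UnionI centre_in_ball)
  qed
  moreover have "!!V. V \<in> G ==> open V" by (simp add: G_def)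
  ultimately obtain S where S: "S \<subseteq> G" "finite S" "K' \<subseteq> \<Union>S" by (rule compactE[OF K'(1)])
  have "\<forall>\<^sub>F j in sequentially. \<forall>V\<in>S. \<forall>z\<in>V. 0 < u z - W j z"
   using S by (intro eventually_ball_finite) (auto simp: G_def)
  then obtain j where j: "\<forall>V\<in>S. \<forall>z\<in>V. 0 < u z - W j z" by (auto simp: eventually_sequentially)
  have "0 < u (y j) - W j (y j)" using j S(3) y(1) by blast
  thus False using y(2)[of j] by (simp add: W_def)
 qed
 have cont_at: "\<exists>r>0. \<forall>z\<in>ball x r. z \<in> Om \<and> \<bar>k z - k x\<bar> < e" if kx: "continuous_on Om k" "x \<in> Om" "e > 0" for k :: "real^'n => real" and x e
 proof -
  have "((\<lambda>z. k z) \<longlongrightarrow> k x) (nhds x)" using kx open_Om by (metis continuous_on_eq_continuous_at isCont_def tendsto_at_iff_tendsto_nhds)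
  hence "\<forall>\<^sub>F z in nhds x. dist (k z) (k x) < e" using kx(3) by (rule tendstoD)
  moreover have "\<forall>\<^sub>F z in nhds x. z \<in> Om" using kx(2) open_Om by (rule eventually_nhds_in_open[rotated])
  ultimately have "\<forall>\<^sub>F z in nhds x. z \<in> Om \<and> \<bar>k z - k x\<bar> < e" by eventually_elim (simp add: dist_real_def)
  thus ?thesis unfolding eventually_nhds_metric by (metis dist_commute mem_ball)
 qed
 have dsmall: "\<forall>\<^sub>F j in sequentially. 2*d j < e" if "e > 0" for e using order_tendstoD(2)[OF d2lim that] .
 show ?thesis
 proof
  obtain r where r: "r > 0" "\<forall>z\<in>ball xs r. z \<in> Om \<and> \<bar>u z - u xs\<bar> < - u xs/3" using cont_at[OF uc xs(1), of "- u xs/3"] xs(2) by auto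
  \<comment> \<open>At \<open>xs\<close> the bound \<open>W j x - u x <= 2*d j\<close> makes
    \<open>W j\<close> uniformly negative; the strong minimum principle for \<open>- W j\<close>
    carries this to \<open>x1\<close>.\<close>
  have near: "\<forall>\<^sub>F j in sequentially. \<forall>x\<in>ball xs r. - u xs/3 <= - W j x"
  proof (rule eventually_mono[OF dsmall[of "- u xs/3"]])
   show "- u xs/3 > 0" using xs by simp
   fix j assume "2*d j < - u xs/3"
   moreover have "\<bar>u x - u xs\<bar> < - u xs/3" "W j x - u x <= 2*d j" if "x \<in> ball xs r" for x using r(2) E2[of x j] that by auto
   ultimately show "\<forall>x\<in>ball xs r. - u xs/3 <= - W j x" by force
  qed
  have "\<exists>r>0. \<exists>th>0. \<forall>\<^sub>F j in sequentially. \<forall>x\<in>ball x1 r. th <= - W j x"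
  proof (rule strong_minimum_sequence[OF ga de(1) C open_Om connected_Om _ _ _ _ _ xs(1) r(1) _ near x1, where e = "\<lambda>_. 0"])
   show "esub ga Ga de1 Om (\<lambda>x. - (- W j x)) (\<lambda>x. C*\<bar>- W j x\<bar> + 0)" for j
   proof (unfold minus_minus, rule esub_mono[OF vsub_imp_esub[OF Wsub] order_refl])
    fix x assume "x \<in> Om"
    have "rh j*W j x <= (\<bar>a\<bar> + 1)*\<bar>W j x\<bar>"
     using mult_right_mono[OF rhC[of j], of "\<bar>W j x\<bar>"] abs_ge_self[of "rh j*W j x"] by (simp add: abs_mult)
    thus "de0*\<bar>W j x\<bar> + rh j*W j x <= C*\<bar>- W j x\<bar> + 0" by (simp add: C_def distrib_right)
   qed
   show "- 0 <= - W j x" if "x \<in> Om" for j x using W(2)[OF that, of j] by simp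
   show "continuous_on Om (\<lambda>x. - W j x)" for j by (intro continuous_intros W(1))
  qed (use xs in simp_all)
  then obtain r1 th where r1: "r1 > 0" "th > 0" "\<forall>\<^sub>F j in sequentially. \<forall>x\<in>ball x1 r1. th <= - W j x" by blast
  \<comment> \<open>Otherwise the uniformly negative \<open>W j\<close> would leave a gap at
    \<open>x1\<close>.\<close>
  show "u x1 < 0"
  proof (rule ccontr)
   assume n: "\<not> u x1 < 0"
   obtain r2 where r2: "r2 > 0" "\<forall>z\<in>ball x1 r2. z \<in> Om \<and> \<bar>u z - u x1\<bar> < th/2" using cont_at[OF uc x1, of "th/2"] r1(2) by auto
   have "\<forall>\<^sub>F j in sequentially. \<forall>x\<in>ball x1 (min r1 r2). th/2 <= u x - W j x"
   proof (rule eventually_mono[OF r1(3)], intro ballI)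
    fix j x assume j: "\<forall>x\<in>ball x1 r1. th <= - W j x" and x: "x \<in> ball x1 (min r1 r2)"
    have "th <= - W j x" "\<bar>u x - u x1\<bar> < th/2" using j r2(2) x by auto
    thus "th/2 <= u x - W j x" using n by linarith
   qed
   thus False using no_gap[OF x1, of "min r1 r2" "th/2"] r1(1,2) r2(1) by simp
  qed
  show "f x1 = 0"
  proof (rule ccontr)
   assume "f x1 ~= 0"
   hence fx: "f x1 > 0" using f(2)[OF x1] by simp
   define b where "b = f x1/2"
   obtain r where r: "r > 0" "\<forall>z\<in>ball x1 r. z \<in> Om \<and> \<bar>f z - f x1\<bar> < b" using cont_at[OF f(1) x1, of b] fx by (auto simp: b_def)
   have b: "b > 0" "!!z. z \<in> ball x1 r ==> b <= f z"
   proof -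
    show "b > 0" using fx by (simp add: b_def)
    fix z assume "z \<in> ball x1 r"
    hence "\<bar>f z - f x1\<bar> < b" using r(2) by blast
    thus "b <= f z" unfolding b_def by linarith
   qed
   define n where "n = real CARD('n)"
   define s where "s = r/3"
   have s: "s > 0" using r by (simp add: s_def)
   define D where "D = 2*n*Ga + 2*de1 * s + 1"
   have D: "D > 0" using de ga s by (simp add: D_def n_def add_nonneg_pos)
   \<comment> \<open>The paraboloid \<open>k*(norm (x-z))^2\<close> costs at most \<open>b/4\<close>
     in the inequality for \<open>W j - u\<close>, whose right-hand side contains
     \<open>- f <= - b\<close>. So \<open>W j - u\<close> cannot exceed \<open>- th\<close> at any
     \<open>z\<close> near \<open>x1\<close>, and this is a gap.\<close>
   define k where "k = b/(4*D)"
   have k: "k > 0" "k*D = b/4" using b D by (auto simp: k_def)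
   define th where "th = min (k * s^2/4) (b/(4*(C + 1)))"
   have th: "th > 0" "2*th < k * s^2" "(C + 1)*th <= b/4"
   proof -
    show "th > 0" using k b C s by (simp add: th_def)
    have "th <= k * s^2/4" "th <= b/(4*(C + 1))" unfolding th_def by (rule min.cobounded1, rule min.cobounded2)
    moreover have "k * s^2 > 0" using k s by simp
    ultimately show "2*th < k * s^2" "(C + 1)*th <= b/4" using C by (auto simp: field_simps)
   qed
   have "\<forall>\<^sub>F j in sequentially. \<forall>x\<in>ball x1 s. th <= u x - W j x"
   proof (rule eventually_mono[OF dsmall[OF th(1)]], intro ballI, rule ccontr)
    fix j z assume dj: "2*d j < th" and z: "z \<in> ball x1 s" and neg: "\<not> th <= u z - W j z"
    have sub: "y \<in> ball x1 r" if "y \<in> cball z s" for y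
     using z that dist_triangle[of x1 y z] s by (simp add: s_def)
    hence subOm: "y \<in> Om" if "y \<in> cball z s" for y using that r(2) by blast
    have "continuous_on (cball z s) (\<lambda>x. W j x - u x - k*(norm (x-z))^2)"
     using subOm by (intro continuous_intros continuous_on_subset[OF W(1)] continuous_on_subset[OF uc]) blast+
    then obtain q where q: "q \<in> cball z s" "!!y. y \<in> cball z s ==> W j y - u y - k*(norm (y-z))^2 <= W j q - u q - k*(norm (q-z))^2"
     using continuous_attains_sup[of "cball z s" "\<lambda>x. W j x - u x - k*(norm (x-z))^2"] s by auto
    have Eq: "W j q - u q - k*(norm (q-z))^2 > - th" using q(2)[of z] s neg by simp
    have "W j q - u q <= 2*d j" by (rule E2[OF subOm[OF q(1)]])
    hence "k*(norm (q-z))^2 < k * s^2" using Eq dj th(2) by linarith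
    hence "norm (q-z) < s" using k s by (simp add: power_less_imp_less_base[of _ 2])
    hence jet: "mjet (\<lambda>x. W j x - u x) q ((2 * k) *\<^sub>R (q-z)) (mat (2 * k))"
    proof (intro mjet_mono[OF mjet_square[of k z q], of "s - norm (q-z)"])
     fix y assume "norm (y-q) < s - norm (q-z)"
     hence "y \<in> cball z s" using norm_triangle_ineq[of "y - q" "q - z"] by (simp add: dist_norms)
     from q(2)[OF this] show "W j y - u y - (W j q - u q) <= k*(norm (y-z))^2 - k*(norm (q-z))^2" by linarith
    qed simp
    have "- (2 * k*(n*Ga)) <= pucci_minus ga Ga (mat (2 * k) :: real^'n^'n)"
    proof (rule pucci_minus_geI[OF ga])
     fix A :: "real^'n^'n" assume A: "A \<in> pucci_class ga Ga"
     have "2 * k*trace A <= 2 * k*(n*Ga)" using pucci_class_trace(2)[OF A] k unfolding n_def by (intro mult_left_mono) auto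
     thus "- (2 * k*(n*Ga)) <= - trace (A ** mat (2 * k))" by (simp add: trace_mult_mat)
    qed
    also have "... <= de1*norm ((2 * k) *\<^sub>R (q-z)) + (C*\<bar>W j q - u q\<bar> + d j - f q)"
     by (rule esubD[OF E1 subOm[OF q(1)] jet])
    also have "de1*norm ((2 * k) *\<^sub>R (q-z)) <= de1*(2 * k * s)"
     using k \<open>norm (q - z) < s\<close> de by (intro mult_left_mono) auto
    finally have 1: "- (2 * k*(n*Ga)) <= de1*(2 * k * s) + (C*\<bar>W j q - u q\<bar> + d j - f q)" by simp
    have "0 <= k*(norm (q-z))^2" using k by simp
    hence "\<bar>W j q - u q\<bar> <= th" using Eq \<open>W j q - u q <= 2 * d j\<close> dj unfolding abs_le_iff by linarith
    hence "C*\<bar>W j q - u q\<bar> <= C*th" using C by (rule mult_left_mono)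
    moreover have "b <= f q" by (rule b(2)[OF sub[OF q(1)]])
    moreover have "2 * k*(n*Ga) + de1*(2 * k * s) + k = b/4" using k(2) by (simp add: D_def algebra_simps)
    ultimately show False using 1 dj th(1,3) k(1) b(1) d0[of j] unfolding distrib_right by linarith
   qed
   thus False using no_gap[OF x1 s th(1)] by blast
  qed
 qed
qed

end

section \<open>Compactness of families of solutions up to the boundary\<close>

context elliptic_domain
begin

text \<open>Division by \<open>s*T\<close> reduces this to \<open>boundary_growth\<close>. The
  result is linear in \<open>s\<close>, which \<open>limit_negative\<close> exploits when the
  functions and data are small. \<open>T\<close> normalises the \<open>L^p\<close> norm; the
  majorant \<open>h\<close> turns integrability in the sense of \<open>integrable_on\<close> into a
  bound for a nonnegative Lebesgue integral.\<close>

lemma boundary_bound: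
 assumes f: "continuous_on Om f" "(\<lambda>x. \<bar>f x\<bar> powr p) integrable_on Om" and c: "c >= 0" and r1: "r1 > 0"
 obtains r0 C where "0 < r0" "r0 <= r1" "C > 0"
  "!!z w s x. z \<in> frontier Om ==> 0 < s ==> continuous_on (closure Om) w ==> (!!y. y \<in> frontier Om ==> w y <= 0) ==>
   (!!y. y \<in> closure Om ==> w y <= s) ==> esub ga Ga de1 {y\<in>Om \<inter> ball z r0. 0 < w y} w (\<lambda>x. s*(c + \<bar>f x\<bar>)) ==>
   x \<in> closure Om ==> norm (x-z) <= r0 ==> w x <= C * s*norm (x-z)"
proof (rule boundary_growth[OF ga p de(1) R r1], goal_cases)
 case (1 r0 C)
 note r0 = this(2-4) and B = this(5)
 have p0: "p > 0" using p by (meson of_nat_0_le_iff order_le_less_trans)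
 define h where "h x = 2 powr p*(c powr p + \<bar>f x\<bar> powr p)" for x
 have hf: "(c + \<bar>f x\<bar>) powr p <= h x" for x
 proof -
  define m where "m = max c \<bar>f x\<bar>"
  have "(c + \<bar>f x\<bar>) powr p <= (2*m) powr p" using c p0 by (intro powr_mono2) (auto simp: m_def max_def)
  also have "... = 2 powr p*m powr p" using c by (simp add: powr_mult m_def)
  also have "m powr p <= c powr p + \<bar>f x\<bar> powr p" by (simp add: m_def max_def)
  finally show ?thesis by (simp add: h_def)
 qed
 have "(\<lambda>x. c powr p) integrable_on Om" by (rule integrable_on_const[OF lmeasurable_open[OF bounded_Om open_Om]])
 hence "h integrable_on Om" unfolding h_def by (intro integrable_on_mult_right integrable_add f(2))
 then obtain J where J: "(h has_integral J) Om" unfolding integrable_on_def by blast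
 define T where "T = max 1 (\<bar>J\<bar> powr (1/p))"
 have T: "T >= 1" by (simp add: T_def)
 have "(\<bar>J\<bar> powr (1/p)) powr p <= T powr p" using p0 by (intro powr_mono2) (auto simp: T_def)
 hence JT: "J <= T powr p" using p0 by (simp add: powr_powr split: if_splits)
 have "((\<lambda>x. h x/T powr p) has_integral J/T powr p) Om" using has_integral_divide[OF J] .
 hence "(\<integral>\<^sup>+x. ennreal (indicator Om x*(h x/T powr p)) \<partial>lborel) = ennreal (J/T powr p)"
  by (intro nn_integral_has_integral_lebesgue) (simp add: h_def)
 also have "... <= 1" using JT T by (simp add: divide_le_eq_1)
 finally have le1: "(\<integral>\<^sup>+x. ennreal (indicator Om x*(h x/T powr p)) \<partial>lborel) <= 1" .
 show thesis
 proof (rule that[of r0 "C*T"])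
  show "C*T > 0" using r0 T by simp
  fix z w s and x :: "real^'n"
  assume z: "z \<in> frontier Om" and s: "0 < s" and w: "continuous_on (closure Om) w" "!!y. y \<in> frontier Om ==> w y <= 0" "!!y. y \<in> closure Om ==> w y <= s"
   and es: "esub ga Ga de1 {y\<in>Om \<inter> ball z r0. 0 < w y} w (\<lambda>x. s*(c + \<bar>f x\<bar>))" and x: "x \<in> closure Om" "norm (x-z) <= r0"
  obtain nu where nu: "tangent_balls Om R z nu" using tangent[OF z] by blast
  have sT: "s*T > 0" using s T by simp
  have "1/(s*T)*w x <= C*norm (x-z)"
  proof (rule B[OF open_Om, of nu z "\<lambda>x. 1/(s*T)*w x" "\<lambda>x. (c + \<bar>f x\<bar>)/T"])
   show "norm nu = 1" "ball (z - R *\<^sub>R nu) R \<inter> Om = {}" using nu by (auto simp: tangent_balls_def)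
   show "continuous_on (closure Om \<inter> cball z r0) (\<lambda>x. 1/(s*T)*w x)"
    by (intro continuous_intros continuous_on_subset[OF w(1)]) auto
   show "1/(s*T)*w y <= 0" if "y \<in> frontier Om" for y
    using mult_nonneg_nonpos[of "1/(s*T)" "w y"] w(2)[OF that] sT by simp
   show "1/(s*T)*w y <= 1" if "y \<in> closure Om" for y
   proof -
    have "w y <= s*T" using w(3)[OF that] mult_left_mono[OF T, of s] s by linarith
    thus ?thesis using sT by (simp add: divide_le_eq)
   qed
   show "continuous_on Om (\<lambda>x. (c + \<bar>f x\<bar>)/T)" using T by (intro continuous_intros f(1)) auto
   show "0 <= (c + \<bar>f y\<bar>)/T" for y using c T by simp
   have "(\<integral>\<^sup>+y\<in>Om. ennreal (((c + \<bar>f y\<bar>)/T) powr p) \<partial>lborel) <= (\<integral>\<^sup>+x. ennreal (indicator Om x*(h x/T powr p)) \<partial>lborel)"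
   proof (rule nn_integral_mono)
    fix y :: "real^'n"
    have "((c + \<bar>f y\<bar>)/T) powr p <= h y/T powr p"
     using hf[of y] c T by (simp add: powr_divide divide_right_mono)
    thus "ennreal (((c + \<bar>f y\<bar>)/T) powr p)*indicator Om y <= ennreal (indicator Om y*(h y/T powr p))"
     by (auto simp: indicator_def ennreal_leI)
   qed
   thus "(\<integral>\<^sup>+y\<in>Om. ennreal (((c + \<bar>f y\<bar>)/T) powr p) \<partial>lborel) <= 1" using le1 by (rule order_trans)
   have "{y\<in>Om \<inter> ball z r0. 0 < 1/(s*T)*w y} = {y\<in>Om \<inter> ball z r0. 0 < w y}" using sT by (simp add: zero_less_divide_iff)
   moreover have "1/(s*T)*(s*(c + \<bar>f x\<bar>)) = (c + \<bar>f x\<bar>)/T" for x using s by simp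
   ultimately show "esub ga Ga de1 {y\<in>Om \<inter> ball z r0. 0 < 1/(s*T)*w y} (\<lambda>x. 1/(s*T)*w x) (\<lambda>x. (c + \<bar>f x\<bar>)/T)"
    using esub_scale[OF ga es, of "1/(s*T)"] sT by simp
   show "x \<in> closure Om" "norm (x-z) <= r0" by fact+
  qed
  from mult_left_mono[OF this, of "s*T"] s T show "w x <= C*T * s*norm (x-z)" by (simp add: mult_ac)
 qed (use r0(1,2) in auto)
qed

lemma solution_esub_bound:
 assumes v: "dsol F Om (\<lambda>x. l * v x + e*f x) v" and l: "\<bar>l\<bar> <= L" and e: "0 <= e" "e <= s" and x: "x \<in> Om" and j: "mjet v x q X"
 shows "pucci_minus ga Ga X <= de1*norm q + ((de0 + L)*\<bar>v x\<bar> + s*\<bar>f x\<bar>)"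
proof -
 have "vsub F Om v (\<lambda>x. l * v x + e*f x)" using v by (simp add: dsol_def vsol_def)
 from esubD[OF vsub_imp_esub[OF this] x j]
 have "pucci_minus ga Ga X <= de1*norm q + (de0*\<bar>v x\<bar> + (l * v x + e*f x))" .
 moreover have "l * v x <= L*\<bar>v x\<bar>"
  using mult_right_mono[OF l, of "\<bar>v x\<bar>"] abs_ge_self[of "l * v x"] by (simp add: abs_mult)
 moreover have "e*f x <= s*\<bar>f x\<bar>" using e mult_mono[of e s "f x" "\<bar>f x\<bar>"] abs_ge_self[of "f x"] by (meson abs_ge_zero abs_ge_self mult_left_mono mult_right_mono order_trans)
 ultimately show ?thesis unfolding distrib_right by linarith
qed

text \<open>Equicontinuity is checked point by point. At interior points the right-hand sides are
  bounded on a small closed ball, and the Lipschitz estimate applies; at boundary points, where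
  \<open>f\<close> may be unbounded, the linear growth of \<open>v k\<close> and
  \<open>- v k\<close> replaces it.\<close>

lemma solutions_compact:
 fixes v :: "nat => real^'n => real"
 assumes f: "continuous_on Om f" "(\<lambda>x. \<bar>f x\<bar> powr p) integrable_on Om"
  and v: "!!k. dsol F Om (\<lambda>x. l k * v k x + e k*f x) (v k)" and l: "!!k. \<bar>l k\<bar> <= L" and e: "!!k. 0 <= e k" "!!k. e k <= 1"
  and v1: "!!k x. x \<in> closure Om ==> \<bar>v k x\<bar> <= 1"
 obtains V r where "continuous_on (closure Om) V" "strict_mono (r :: nat => nat)" "uniform_limit (closure Om) (\<lambda>k. v (r k)) V sequentially"
proof -
 have L: "L >= 0" using l[of 0] by linarith
 have cl: "Om \<subseteq> closure Om" by (rule closure_subset)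
 have equi: "\<exists>d>0. \<forall>k y. y \<in> closure Om \<and> norm (x-y) < d --> norm (v k x - v k y) < ep" if x: "x \<in> closure Om" and ep: "ep > 0" for x ep
 proof -
  have mod: ?thesis if "r > 0" "!!k y. y \<in> closure Om ==> norm (x-y) < r ==> \<bar>v k x - v k y\<bar> <= A*norm (x-y)" for r A
  proof (intro exI[of _ "min r (ep/(\<bar>A\<bar> + 1))"] conjI allI impI)
   show "min r (ep/(\<bar>A\<bar> + 1)) > 0" using that(1) ep by simp
   fix k y assume y: "y \<in> closure Om \<and> norm (x-y) < min r (ep/(\<bar>A\<bar> + 1))"
   hence "(\<bar>A\<bar> + 1)*norm (x-y) < ep" by (simp add: pos_less_divide_eq mult.commute)
   moreover have "A*norm (x-y) <= (\<bar>A\<bar> + 1)*norm (x-y)" by (intro mult_right_mono) auto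
   ultimately show "norm (v k x - v k y) < ep" using that(2)[of y k] y by simp
  qed
  show ?thesis
  proof (cases "x \<in> Om")
   case True
   then obtain s0 where s0: "s0 > 0" "cball x s0 \<subseteq> Om" using open_Om by (meson open_contains_cball)
   define s where "s = s0/2"
   have s: "s > 0" "cball x (2 * s) \<subseteq> Om" using s0 by (auto simp: s_def)
   have "bounded (f ` cball x (2 * s))" by (intro compact_imp_bounded compact_continuous_image continuous_on_subset[OF f(1) s(2)] compact_cball)
   then obtain b where b: "!!y. y \<in> cball x (2 * s) ==> \<bar>f y\<bar> <= b" unfolding bounded_iff by (auto simp del: mem_cball)
   have M: "1 + L + \<bar>b\<bar> > 0" using L by simp
   show ?thesis
   proof (rule interior_lipschitz[OF s M], goal_cases)
    case A: (1 A)
    show ?thesis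
    proof (rule mod[of "s/2" A])
     fix k y assume y: "y \<in> closure Om" "norm (x-y) < s/2"
     show "\<bar>v k x - v k y\<bar> <= A*norm (x-y)"
     proof (rule A[OF dsol_continuous[OF v]])
      show "vsol F Om (v k) (\<lambda>x. l k * v k x + e k*f x)" using v by (simp add: dsol_def)
      show "x \<in> ball x (s/2)" "y \<in> ball x (s/2)" using s(1) y(2) by (simp_all add: dist_norm)
      fix x' assume x': "x' \<in> cball x (2 * s)"
      have v': "\<bar>v k x'\<bar> <= 1" using v1 x' s(2) cl by blast
      moreover have "\<bar>l k * v k x'\<bar> <= L*1" unfolding abs_mult using l[of k] v' L by (intro mult_mono) auto
      moreover have "\<bar>e k*f x'\<bar> <= 1*\<bar>b\<bar>" unfolding abs_mult using e[of k] b[OF x'] by (intro mult_mono) auto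
      ultimately show "\<bar>v k x'\<bar> <= 1 + L + \<bar>b\<bar> \<and> \<bar>l k * v k x' + e k*f x'\<bar> <= 1 + L + \<bar>b\<bar>" using L by linarith
     qed
    qed (use s in simp)
   qed
  next
   case False
   hence xf: "x \<in> frontier Om" using x closure_cases by blast
   have c: "de0 + L >= 0" using de L by simp
   show ?thesis
   proof (rule boundary_bound[OF f c zero_less_one], goal_cases)
    case r0: (1 r0 C)
    note B = r0(4)
    have vc: "continuous_on (closure Om) (v k)" and v0: "y \<in> frontier Om ==> v k y = 0" for k y using v by (auto simp: dsol_def)
    have g: "(de0 + L)*\<bar>v k y\<bar> + 1*\<bar>f y\<bar> <= 1*(de0 + L + \<bar>f y\<bar>)" if "y \<in> Om" for k y
     using mult_left_mono[OF v1[of y k] c] that cl by auto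
    have up: "v k y <= C*1*norm (y-x)" if "y \<in> closure Om" "norm (y-x) <= r0" for k y
    proof (rule B[OF xf zero_less_one vc _ _ _ that])
     show "v k y <= 0" if "y \<in> frontier Om" for y using v0[OF that] by simp
     show "v k y <= 1" if "y \<in> closure Om" for y using v1[OF that, of k] by linarith
     show "esub ga Ga de1 {y \<in> Om \<inter> ball x r0. 0 < v k y} (v k) (\<lambda>x. 1*(de0 + L + \<bar>f x\<bar>))"
      unfolding esub_def
     proof (intro ballI allI impI)
      fix y q X assume "y \<in> {y \<in> Om \<inter> ball x r0. 0 < v k y}" "mjet (v k) y q X"
      hence "y \<in> Om" "mjet (v k) y q X" by auto
      from solution_esub_bound[OF v l e this] g[OF this(1), of k]
      show "pucci_minus ga Ga X <= de1*norm q + 1*(de0 + L + \<bar>f y\<bar>)" by linarith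
     qed
    qed
    have lo: "- v k y <= C*1*norm (y-x)" if "y \<in> closure Om" "norm (y-x) <= r0" for k y
    proof (rule B[OF xf zero_less_one _ _ _ _ that])
     show "continuous_on (closure Om) (\<lambda>y. - v k y)" by (intro continuous_intros vc)
     show "- v k y <= 0" if "y \<in> frontier Om" for y using v0[OF that] by simp
     show "- v k y <= 1" if "y \<in> closure Om" for y using v1[OF that, of k] by linarith
     show "esub ga Ga de1 {y \<in> Om \<inter> ball x r0. 0 < - v k y} (\<lambda>y. - v k y) (\<lambda>x. 1*(de0 + L + \<bar>f x\<bar>))"
     proof (rule esub_mono[OF super_esub[OF v]])
      fix y assume y: "y \<in> {y \<in> Om \<inter> ball x r0. 0 < - v k y}"
      hence yO: "y \<in> Om" by simp
      have "- (l k * v k y) <= L*\<bar>v k y\<bar>" using mult_right_mono[OF l[of k], of "\<bar>v k y\<bar>"] abs_ge_minus_self[of "l k * v k y"] by (simp add: abs_mult)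
      moreover have "- (e k*f y) <= 1*\<bar>f y\<bar>" using mult_right_mono[OF e(2)[of k], of "\<bar>f y\<bar>"] e(1)[of k] abs_ge_minus_self[of "e k*f y"] by (simp add: abs_mult)
      ultimately show "de0*\<bar>v k y\<bar> - (l k * v k y + e k*f y) <= 1*(de0 + L + \<bar>f y\<bar>)" using g[OF yO, of k] unfolding distrib_right by linarith
     qed auto
    qed
    show ?thesis
     by (rule mod[OF r0(1), of C]) (use up lo v0[OF xf] in \<open>auto simp: norm_minus_commute abs_le_iff\<close>)
   qed
  qed
 qed
 show thesis
 proof (rule Arzela_Ascoli[OF compact_closure_Om, of v 1])
  show "norm (v k x) <= 1" if "x \<in> closure Om" for k x using v1[OF that] by simp
  show "\<exists>d>0. \<forall>k y. y \<in> closure Om \<and> norm (x-y) < d --> norm (v k x - v k y) < ep" if "x \<in> closure Om" "0 < ep" for x ep by (rule equi[OF that])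
  fix V and r :: "nat => nat" assume V: "continuous_on (closure Om) V" "strict_mono r" "!!ep. 0 < ep ==> \<exists>N. \<forall>n x. n >= N \<and> x \<in> closure Om --> norm (v (r n) x - V x) < ep"
  have "uniform_limit (closure Om) (\<lambda>k. v (r k)) V sequentially"
   unfolding uniform_limit_iff eventually_sequentially dist_norm using V(3) by blast
  thus thesis by (rule that[OF V(1,2)])
 qed
qed

text \<open>Stability asks for convergence of the right-hand sides on compact subsets of
  \<open>Om\<close> only, and there \<open>f\<close> is bounded; boundary values pass to the limit
  directly.\<close>

lemma limit_solution:
 assumes f: "continuous_on Om f" and v: "!!k. dsol F Om (\<lambda>x. l k * v k x + e k*f x) (v k)" and v1: "!!k x. x \<in> closure Om ==> \<bar>v k x\<bar> <= 1"
  and l: "l \<longlonglongrightarrow> a" and e: "e \<longlonglongrightarrow> c" and V: "continuous_on (closure Om) V" and lim: "uniform_limit (closure Om) v V sequentially"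
 shows "dsol F Om (\<lambda>x. a*V x + c*f x) V"
 unfolding dsol_def vsol_def
proof (intro conjI ballI V)
 have cl: "Om \<subseteq> closure Om" by (rule closure_subset)
 have VOm: "continuous_on Om V" "continuous_on Om (v k)" for k using continuous_on_subset[OF V cl] dsol_continuous[OF v] by auto
 fix x assume x: "x \<in> frontier Om"
 hence "(\<lambda>k. v k x) \<longlonglongrightarrow> V x" by (intro tendsto_uniform_limitI[OF lim]) (simp add: frontier_def)
 moreover have "(\<lambda>k. v k x) = (\<lambda>k. 0)" using v x by (auto simp: dsol_def)
 ultimately show "V x = 0" by (simp add: LIMSEQ_const_iff)
next
 have cl: "Om \<subseteq> closure Om" by (rule closure_subset)
 have VOm: "continuous_on Om V" "continuous_on Om (v k)" for k using continuous_on_subset[OF V cl] dsol_continuous[OF v] by auto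
 have H: "continuous_on Om (\<lambda>x. a*V x + c*f x)" by (intro continuous_intros VOm f)
 have loc: "\<forall>\<^sub>F k in sequentially. \<forall>x\<in>K. \<bar>v k x - V x\<bar> < ep \<and> \<bar>(l k * v k x + e k*f x) - (a*V x + c*f x)\<bar> < ep"
  if K: "compact K" "K \<subseteq> Om" and ep: "ep > 0" for K ep
 proof -
  have "bounded (f ` K)" using K by (intro compact_imp_bounded compact_continuous_image continuous_on_subset[OF f])
  then obtain b where b: "b > 0" "!!y. y \<in> K ==> \<bar>f y\<bar> <= b" unfolding bounded_pos by auto
  define et where "et = ep/(2 + \<bar>a\<bar> + b)"
  have D: "2 + \<bar>a\<bar> + b > 0" using b(1) by simp
  hence et: "et > 0" "et*(2 + \<bar>a\<bar> + b) = ep" using ep by (auto simp: et_def)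
  from uniform_limitD[OF lim et(1)] tendstoD[OF l et(1)] tendstoD[OF e et(1)] show ?thesis
  proof eventually_elim
   case (elim k)
   show ?case
   proof
    fix x assume x: "x \<in> K"
    hence xc: "x \<in> closure Om" using K(2) cl by blast
    have 1: "\<bar>v k x - V x\<bar> < et" using elim(1) xc by (simp add: dist_real_def)
    have "\<bar>(l k - a) * v k x\<bar> <= et*1" unfolding abs_mult using elim(2) v1[OF xc, of k] by (intro mult_mono) (auto simp: dist_real_def)
    moreover have "\<bar>a*(v k x - V x)\<bar> <= \<bar>a\<bar>*et" unfolding abs_mult using 1 by (intro mult_left_mono) auto
    moreover have "\<bar>(e k - c)*f x\<bar> <= et*b" unfolding abs_mult using elim(3) b(2)[OF x] et(1) by (intro mult_mono) (auto simp: dist_real_def)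
    moreover have "(l k * v k x + e k*f x) - (a*V x + c*f x) = (l k - a) * v k x + a*(v k x - V x) + (e k - c)*f x" by (simp add: algebra_simps)
    moreover have "et*2 + \<bar>a\<bar>*et + et*b = ep" using et(2) by (simp add: algebra_simps)
    moreover have "0 <= \<bar>a\<bar>*et" "0 <= et*b" using et(1) b(1) by simp_all
    ultimately show "\<bar>v k x - V x\<bar> < ep \<and> \<bar>(l k * v k x + e k*f x) - (a*V x + c*f x)\<bar> < ep" using 1 et(1) by linarith
   qed
  qed
 qed
 have vs: "vsub F Om (v k) (\<lambda>x. l k * v k x + e k*f x)" "vsub (reflected F) Om (\<lambda>x. - v k x) (\<lambda>x. - (l k * v k x + e k*f x))" for k
  using v by (auto simp: dsol_def vsol_def)
 show "vsub F Om V (\<lambda>x. a*V x + c*f x)" by (rule vsub_limit[OF VOm(2) vs(1) VOm(1) H loc])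
 show "vsub (reflected F) Om (\<lambda>x. - V x) (\<lambda>x. - (a*V x + c*f x))"
 proof (rule elliptic.vsub_limit[OF elliptic_reflected _ vs(2)])
  show "continuous_on Om (\<lambda>x. - v k x)" "continuous_on Om (\<lambda>x. - V x)" "continuous_on Om (\<lambda>x. - (a*V x + c*f x))" for k
   by (intro continuous_on_minus VOm H)+
  show "\<forall>\<^sub>F k in sequentially. \<forall>x\<in>K. \<bar>- v k x - - V x\<bar> < ep \<and> \<bar>- (l k * v k x + e k*f x) - - (a*V x + c*f x)\<bar> < ep"
   if "compact K" "K \<subseteq> Om" "ep > 0" for K ep
   unfolding minus_diff_minus abs_minus_cancel by (rule loc[OF that])
 qed
qed

end

section \<open>Negativity of the solutions up to the boundary\<close>

context elliptic_domain
begin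

text \<open>The limit lies below a negative barrier in the interior balls at boundary points, and the difference between the
 solutions and the limit grows at most linearly away from the boundary.\<close>

lemma limit_negative:
 assumes f: "continuous_on Om f" "(\<lambda>x. \<bar>f x\<bar> powr p) integrable_on Om"
  and v: "!!k. dsol F Om (\<lambda>x. l k * v k x + e k*f x) (v k)" and l: "!!k. \<bar>l k\<bar> <= L" and e: "!!k. 0 <= e k" "e \<longlonglongrightarrow> 0"
  and V: "dsol F Om (\<lambda>x. a*V x) V" "!!x. x \<in> Om ==> V x < 0" and a: "\<bar>a\<bar> <= L" and lim: "uniform_limit (closure Om) v V sequentially"
 shows "\<forall>\<^sub>F k in sequentially. \<forall>x\<in>Om. v k x < 0"
proof -
 have L: "L >= 0" using a by linarith
 define c where "c = de0 + L"
 have c: "c >= 0" using de L by (simp add: c_def)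
 have cl: "Om \<subseteq> closure Om" by (rule closure_subset)
 have Vc: "continuous_on (closure Om) V" and V0: "y \<in> frontier Om ==> V y = 0" for y using V(1) by (auto simp: dsol_def)
 have Vle: "V y <= 0" if "y \<in> closure Om" for y using closure_cases[OF that] V(2)[of y] V0[of y] by linarith
 have R2: "R/2 > 0" using R by simp
 obtain al where al: "al > 0"
  "!!x z :: real^'n. R/2 <= norm (x-z) ==> \<exists>p X. mjet (\<lambda>y. - exp (- al*(norm (y-z))^2)) x p X \<and>
    (c + 1)*exp (- al*(norm (x-z))^2) <= pucci_minus ga Ga X - de1*norm p"
  using gaussian_barrier[OF ga de(1) R2, of "c + 1", where 'n = 'n] by metis
 \<comment> \<open>Vanishes on the sphere of radius \<open>R\<close> about \<open>z\<close>, is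
   negative outside and grows linearly inwards from it; a multiple of it will bound
   \<open>- V\<close> from below.\<close>
 define h where "h z x = exp (- al*(norm (x-z))^2) - exp (- al * R^2)" for z x :: "real^'n"
 have h1: "h z x <= 1" for z x
 proof -
  have "exp (- al*(norm (x-z))^2) <= 1" using al(1) by simp
  thus ?thesis unfolding h_def using exp_gt_zero[of "- al * R^2"] by linarith
 qed
 have hexp: "h z x <= exp (- al*(norm (x-z))^2)" for z x by (simp add: h_def)
 have hneg: "h z x <= 0" if "R <= norm (x-z)" for z x
 proof -
  have "R^2 <= (norm (x-z))^2" using that R by (intro power_mono) auto
  thus ?thesis using al(1) by (simp add: h_def)
 qed
 define fr where "fr = frontier Om"
 have fr: "fr ~= {}" "closed fr" unfolding fr_def using frontier_not_empty[OF nonempty_Om] bounded_Om not_bounded_UNIV frontier_closed by blast+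
 have core: "\<exists>m>0. \<forall>x\<in>closure Om. s <= infdist x fr --> V x <= - m" if s: "s > 0" for s
 proof -
  define K where "K = {x\<in>closure Om. s <= infdist x fr}"
  have K: "compact K" unfolding K_def by (intro compact_superlevel compact_closure_Om continuous_intros)
  have sub: "K \<subseteq> Om"
  proof
   fix x assume x: "x \<in> K"
   hence "x \<notin> fr" using s by (auto simp: K_def)
   thus "x \<in> Om" using x closure_cases by (auto simp: K_def fr_def)
  qed
  show ?thesis
  proof (cases "K = {}")
   case True
   thus ?thesis by (intro exI[of _ 1]) (auto simp: K_def)
  next
   case False
   then obtain y where "y \<in> K" "!!x. x \<in> K ==> V x <= V y"
    using continuous_attains_sup[OF K False continuous_on_subset[OF Vc order_trans[OF sub cl]]] by blast
   thus ?thesis using V(2)[of y] sub by (intro exI[of _ "- V y"]) (auto simp: K_def)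
  qed
 qed
 obtain m where m: "m > 0" "!!x. x \<in> closure Om ==> R/2 <= infdist x fr ==> V x <= - m" using core[OF R2] by blast
 have ballcl: "cball z R \<subseteq> closure Om" if "ball z R \<subseteq> Om" for z using closure_mono[OF that] R by (simp add: closure_ball)
 have far: "R - norm (x-z) <= infdist x fr" if "ball z R \<subseteq> Om" for z x
  unfolding infdist_notempty[OF fr(1)]
 proof (rule cINF_greatest[OF fr(1)])
  fix y assume "y \<in> fr"
  hence "y \<notin> ball z R" using that open_Om by (auto simp: fr_def frontier_def interior_open)
  thus "R - norm (x-z) <= dist x y" using dist_triangle[of z y x] by (simp add: dist_norms)
 qed
 have jetV: "pucci_minus ga Ga X <= de1*norm q + c*\<bar>V x\<bar>" if "x \<in> Om" "mjet V x q X" for x q X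
 proof -
  have "dsol F Om (\<lambda>x. a*V x + 0*f x) V" using V(1) by simp
  from solution_esub_bound[OF this a order_refl order_refl that] show ?thesis by (simp add: c_def)
 qed
 \<comment> \<open>Hopf's argument: on the inner half of the ball \<open>V <= - m\<close> suffices,
   on the sphere \<open>h\<close> vanishes, and in the annulus the strict inequality of the barrier
   excludes a positive maximum.\<close>
 have below: "V x + m*h z x <= 0" if ball: "ball z R \<subseteq> Om" and x: "x \<in> cball z R" for z x
 proof -
  have "continuous_on (cball z R) (\<lambda>x. V x + m*h z x)"
   unfolding h_def by (intro continuous_intros continuous_on_subset[OF Vc ballcl[OF ball]])
  then obtain y where y: "y \<in> cball z R" "!!x. x \<in> cball z R ==> V x + m*h z x <= V y + m*h z y"
   using continuous_attains_sup[OF compact_cball, of z R "\<lambda>x. V x + m*h z x"] x by blast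
  have "V y + m*h z y <= 0"
  proof (rule ccontr)
   assume "\<not> ?thesis"
   hence pos: "V y + m*h z y > 0" by simp
   have yc: "y \<in> closure Om" using y(1) ballcl[OF ball] by blast
   have yR: "norm (y-z) < R"
   proof (rule ccontr)
    assume "\<not> norm (y-z) < R"
    hence "m*h z y <= 0" using hneg[of y z] m(1) by (simp add: mult_nonneg_nonpos)
    thus False using pos Vle[OF yc] by linarith
   qed
   have yR2: "R/2 <= norm (y-z)"
   proof (rule ccontr)
    assume "\<not> ?thesis"
    hence "V y <= - m" using m(2)[OF yc] far[OF ball, of y] by simp
    moreover have "m*h z y <= m*1" using h1 m(1) by (intro mult_left_mono) auto
    ultimately show False using pos by simp
   qed
   have yOm: "y \<in> Om" using yR ball by (auto simp: dist_norms)
   obtain q X where qX: "mjet (\<lambda>y. - exp (- al*(norm (y-z))^2)) y q X" "(c + 1)*exp (- al*(norm (y-z))^2) <= pucci_minus ga Ga X - de1*norm q"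
    using al(2)[OF yR2] by blast
   have "mjet V y (m *\<^sub>R q) (m *\<^sub>R X)"
   proof (rule mjet_mono[OF mjet_scale[OF qX(1) m(1)]])
    show "R - norm (y-z) > 0" using yR by simp
    fix x assume "norm (x-y) < R - norm (y-z)"
    hence "x \<in> cball z R" using norm_triangle_ineq[of "x - y" "y - z"] by (simp add: dist_norms)
    from y(2)[OF this] show "V x - V y <= m * - exp (- al*(norm (x-z))^2) - m * - exp (- al*(norm (y-z))^2)"
     by (simp add: h_def algebra_simps)
   qed
   from jetV[OF yOm this] have "m*pucci_minus ga Ga X <= m*(de1*norm q) + c*\<bar>V y\<bar>"
    using m(1) by (simp add: pucci_minus_scaleR[OF ga] mult.left_commute)
   moreover have "m*((c + 1)*exp (- al*(norm (y-z))^2)) <= m*(pucci_minus ga Ga X - de1*norm q)"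
    using qX(2) m(1) by (intro mult_left_mono) auto
   moreover have "c*\<bar>V y\<bar> <= c*(m*exp (- al*(norm (y-z))^2))"
   proof (rule mult_left_mono[OF _ c])
    have "m*h z y <= m*exp (- al*(norm (y-z))^2)" using hexp m(1) by (intro mult_left_mono) auto
    thus "\<bar>V y\<bar> <= m*exp (- al*(norm (y-z))^2)" using pos Vle[OF yc] by linarith
   qed
   moreover have "m*exp (- al*(norm (y-z))^2) > 0" using m(1) by simp
   ultimately show False by (simp add: algebra_simps)
  qed
  thus ?thesis using y(2)[OF x] by linarith
 qed
 show ?thesis
 proof (rule boundary_bound[OF f c R2], goal_cases)
  case r0: (1 r0 C)
  note B = r0(4)
  obtain m2 where m2: "m2 > 0" "!!x. x \<in> closure Om ==> r0 <= infdist x fr ==> V x <= - m2" using core[OF r0(1)] by blast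
  \<comment> \<open>A lower bound for the slope of \<open>h\<close> along the inner normal.\<close>
  define c1 where "c1 = exp (- al * R^2)*al * R"
  have c1: "c1 > 0" using al(1) R by (simp add: c1_def)
  \<comment> \<open>Chosen so that the error, which grows like \<open>C * s\<close> times the
    distance to the boundary, uses up only half of the gain \<open>m*c1\<close> times that
    distance.\<close>
  define s where "s = m*c1/(2*C)"
  have s: "s > 0" "C * s = m*c1/2" using m(1) c1 r0(3) by (auto simp: s_def)
  have "min s m2 > 0" using s(1) m2(1) by simp
  from uniform_limitD[OF lim this] order_tendstoD(2)[OF e(2) s(1)] show ?thesis
  proof eventually_elim
   case (elim k)
   have close: "\<bar>v k x - V x\<bar> < s" "\<bar>v k x - V x\<bar> < m2" if "x \<in> closure Om" for x using elim(1) that by (auto simp: dist_real_def)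
   have vc: "continuous_on (closure Om) (v k)" and v0: "y \<in> frontier Om ==> v k y = 0" for y using v by (auto simp: dsol_def)
   show ?case
   proof
    fix x assume x: "x \<in> Om"
    hence xc: "x \<in> closure Om" using cl by blast
    show "v k x < 0"
    proof (cases "r0 <= infdist x fr")
     case True
     thus ?thesis using m2(2)[OF xc] close(2)[OF xc] by linarith
    next
     case False
     obtain z where z: "z \<in> fr" "infdist x fr = dist x z" using infdist_attains_inf[OF fr(2,1)] by blast
     have zf: "z \<in> frontier Om" using z(1) by (simp add: fr_def)
     then obtain nu where nu: "tangent_balls Om R z nu" using tangent by blast
     define t where "t = dist x z"
     define y where "y = z + R *\<^sub>R nu"
     have t: "0 < t" "t < r0" using x zf open_Om False z(2) by (auto simp: t_def frontier_def interior_open)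
     \<comment> \<open>On the inner normal the distance to the centre \<open>y\<close> is
       \<open>R - t\<close>, so that \<open>h y x\<close> can be computed.\<close>
     have xz: "x = z + t *\<^sub>R nu" unfolding t_def
      using infdist_le[of _ fr x] z(2) by (intro nearest_boundary_point_normal[OF open_Om x zf _ R nu]) (auto simp: fr_def)
     have n1: "norm nu = 1" and ball: "ball y R \<subseteq> Om" using nu by (auto simp: tangent_balls_def y_def)
     \<comment> \<open>By the barrier below \<open>- V\<close> this function is at most
       \<open>s\<close>, and the positive part vanishes on the boundary of \<open>Om\<close>. Where
       \<open>h y\<close> is not positive, jets of \<open>w\<close> are jets of \<open>v k\<close>,
       because \<open>v k\<close> touches \<open>w\<close> from below there; elsewhere the strict
       inequality of the Gaussian absorbs the added term.\<close>
     define w where "w x = v k x + m*max (h y x) 0" for x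
     have wv: "v k x <= w x" for x using m(1) by (simp add: w_def)
     have ws: "w x <= s" if "x \<in> closure Om" for x
     proof (cases "h y x <= 0")
      case True
      thus ?thesis using close(1)[OF that] Vle[OF that] by (simp add: w_def)
     next
      case False
      hence "x \<in> cball y R" using hneg[of x y] by (force simp: dist_norms)
      thus ?thesis using below[OF ball] False close(1)[OF that] by (fastforce simp: w_def)
     qed
     have wjet: "pucci_minus ga Ga X <= de1*norm q + s*(c + \<bar>f x\<bar>)"
      if x: "x \<in> Om" "norm (x-z) < r0" "0 < w x" and j: "mjet w x q X" for x q X
     proof -
      have xs: "w x <= s" using ws x(1) cl by blast
      show ?thesis
      proof (cases "h y x <= 0")
       case True
       hence eq: "w x = v k x" by (simp add: w_def)
       have "mjet (v k) x q X" by (rule mjet_mono[OF j zero_less_one]) (use wv eq in auto)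
       from solution_esub_bound[OF v l e(1) less_imp_le[OF elim(2)] x(1) this]
       have "pucci_minus ga Ga X <= de1*norm q + (c*\<bar>v k x\<bar> + s*\<bar>f x\<bar>)" by (simp add: c_def)
       moreover have "c*\<bar>v k x\<bar> <= c * s" using xs x(3) eq c by (intro mult_left_mono) auto
       ultimately show ?thesis by (simp add: distrib_left mult.commute)
      next
       case False
       hence hp: "h y x > 0" by simp
       have eq: "w x = v k x + m*h y x" using hp by (simp add: w_def)
       have "R/2 <= norm (x-y)"
        using norm_triangle_ineq2[of "R *\<^sub>R nu" "x - z"] x(2) r0(2) n1 R by (simp add: y_def norm_minus_commute algebra_simps)
       then obtain q' Y where qY: "mjet (\<lambda>x. - exp (- al*(norm (x-y))^2)) x q' Y" "(c + 1)*exp (- al*(norm (x-y))^2) <= pucci_minus ga Ga Y - de1*norm q'"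
        using al(2) by blast
       have "isCont (h y) x" unfolding h_def by (intro continuous_intros)
       hence "\<forall>\<^sub>F x' in nhds x. 0 < h y x'" using hp by (intro order_tendstoD(1)) (auto simp: isCont_def tendsto_at_iff_tendsto_nhds)
       then obtain d where d: "d > 0" "!!x'. norm (x'-x) < d ==> 0 < h y x'" unfolding eventually_nhds_metric dist_norm by blast
       have "mjet (v k) x (q + m *\<^sub>R q') (X + m *\<^sub>R Y)"
       proof (rule mjet_mono[OF mjet_add[OF j mjet_scale[OF qY(1) m(1)]] d(1)])
        fix x' assume "norm (x'-x) < d"
        from d(2)[OF this] have "w x' = v k x' + m*h y x'" by (simp add: w_def)
        thus "v k x' - v k x <= w x' + m * - exp (- al*(norm (x'-y))^2) - (w x + m * - exp (- al*(norm (x-y))^2))"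
         unfolding eq by (simp add: h_def algebra_simps)
       qed
       from solution_esub_bound[OF v l e(1) less_imp_le[OF elim(2)] x(1) this]
       have 1: "pucci_minus ga Ga (X + m *\<^sub>R Y) <= de1*norm (q + m *\<^sub>R q') + (c*\<bar>v k x\<bar> + s*\<bar>f x\<bar>)" by (simp add: c_def)
       have 2: "pucci_minus ga Ga X + m*pucci_minus ga Ga Y <= pucci_minus ga Ga (X + m *\<^sub>R Y)"
        using pucci_minus_superadditive[OF ga, of X "m *\<^sub>R Y"] m(1) by (simp add: pucci_minus_scaleR[OF ga])
       have 3: "de1*norm (q + m *\<^sub>R q') <= de1*(norm q + m*norm q')"
        using norm_triangle_ineq[of q "m *\<^sub>R q'"] m(1) de by (intro mult_left_mono) auto
       have 4: "m*((c + 1)*exp (- al*(norm (x-y))^2)) <= m*(pucci_minus ga Ga Y - de1*norm q')"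
        using qY(2) m(1) by (intro mult_left_mono) auto
       have mh: "m*h y x <= m*exp (- al*(norm (x-y))^2)" "0 < m*h y x" using hexp[of y x] m(1) hp by auto
       have "c*\<bar>v k x\<bar> <= c*(s + m*exp (- al*(norm (x-y))^2))"
        using xs x(3) eq mh s(1) c by (intro mult_left_mono) (auto simp: abs_le_iff)
       hence 5: "c*\<bar>v k x\<bar> <= c * s + c*(m*exp (- al*(norm (x-y))^2))" by (simp add: distrib_left)
       have 6: "m*exp (- al*(norm (x-y))^2) > 0" using m(1) by simp
       have "m*((c + 1)*exp (- al*(norm (x-y))^2)) = c*(m*exp (- al*(norm (x-y))^2)) + m*exp (- al*(norm (x-y))^2)"
        by (simp add: algebra_simps)
       moreover have "m*(pucci_minus ga Ga Y - de1*norm q') = m*pucci_minus ga Ga Y - m*(de1*norm q')"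
        "de1*(norm q + m*norm q') = de1*norm q + m*(de1*norm q')" "s*(c + \<bar>f x\<bar>) = c * s + s*\<bar>f x\<bar>"
        by (simp_all add: algebra_simps)
       ultimately show ?thesis using 1 2 3 4 5 6 by linarith
      qed
     qed
     have "w x <= C * s*norm (x-z)"
     proof (rule B[OF zf s(1) _ _ ws _ xc])
      show "continuous_on (closure Om) w" unfolding w_def h_def by (intro continuous_intros vc)
      show "w x' <= 0" if x': "x' \<in> frontier Om" for x'
      proof -
       have "x' \<notin> ball y R" using x' ball open_Om by (auto simp: frontier_def interior_open)
       hence "h y x' <= 0" by (intro hneg) (simp add: dist_norms)
       thus ?thesis using v0[OF x'] by (simp add: w_def)
      qed
      show "esub ga Ga de1 {x \<in> Om \<inter> ball z r0. 0 < w x} w (\<lambda>x. s*(c + \<bar>f x\<bar>))"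
       unfolding esub_def using wjet by (simp add: dist_norms)
      show "norm (x-z) <= r0" using t by (simp add: t_def dist_norm)
     qed
     moreover have "norm (x-z) = t" by (simp add: t_def dist_norm)
     moreover have "c1*t <= h y x"
     proof -
      have tR: "t <= R" using t(2) r0(2) R by linarith
      have "x - y = (t-R) *\<^sub>R nu" by (simp add: xz y_def algebra_simps)
      hence sq: "(norm (x-y))^2 = (R-t)^2" using n1 by (simp add: power2_commute)
      have "- al*(norm (x-y))^2 = - al * R^2 + al*(2 * R*t - t^2)" unfolding sq by (simp add: power2_diff algebra_simps)
      hence "h y x = exp (- al * R^2)*(exp (al*(2 * R*t - t^2)) - 1)"
       by (simp only: h_def exp_add right_diff_distrib mult_1_right)
      moreover have "al*(R*t) <= exp (al*(2 * R*t - t^2)) - 1"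
      proof -
       have "t*t <= R*t" using tR t(1) by (intro mult_right_mono) auto
       hence "al*(R*t) <= al*(2 * R*t - t^2)" using al(1) by (intro mult_left_mono) (auto simp: power2_eq_square)
       thus ?thesis using exp_ge_add_one_self[of "al*(2 * R*t - t^2)"] by linarith
      qed
      hence "exp (- al * R^2)*(al*(R*t)) <= exp (- al * R^2)*(exp (al*(2 * R*t - t^2)) - 1)" by (intro mult_left_mono) auto
      ultimately show ?thesis by (simp add: c1_def mult.assoc)
     qed
     hence "m*(c1*t) <= m*h y x" using m(1) by (intro mult_left_mono) auto
     moreover have "m*h y x <= m*max (h y x) 0" using m(1) by (intro mult_left_mono) auto
     moreover have "m*(c1*t) > 0" using m(1) c1 t(1) by simp
     moreover have "C * s*t = m*(c1*t)/2" unfolding s(2) by simp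
     ultimately show ?thesis unfolding w_def by simp
    qed
   qed
  qed
 qed
qed

end

section \<open>The contradiction argument and the exchange of the two eigenvalues\<close>

lemma dsol_scale:
 assumes "elliptic F Om de1 de0 ga Ga" and u: "dsol F Om h u" and t: "t > 0"
 shows "dsol F Om (\<lambda>x. t*h x) (\<lambda>x. t*u x)"
proof -
 interpret elliptic F Om de1 de0 ga Ga by fact
 have "vsub F Om u h" "vsub (reflected F) Om (\<lambda>x. - u x) (\<lambda>x. - h x)" using u by (auto simp: dsol_def vsol_def)
 from vsub_scale[OF this(1) t] elliptic.vsub_scale[OF elliptic_reflected this(2) t] u show ?thesis
  by (auto simp: dsol_def vsol_def intro: continuous_intros)
qed

lemma (in elliptic_domain) eventually_signed:
 fixes u :: "nat => real^'n => real"
 assumes f: "continuous_on Om f" "(\<lambda>x. \<bar>f x\<bar> powr p) integrable_on Om" "!!x. x \<in> Om ==> 0 <= f x" and x0: "x0 \<in> Om" "f x0 ~= 0"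
  and w: "!!j::nat. continuous_on Om (w j)" "!!j x. x \<in> Om ==> w j x < 0" "!!j. vsub F Om (w j) (\<lambda>x. rh j*w j x)"
  and rh: "!!j. a - 1 <= rh j" "!!j. rh j <= a" "rh \<longlonglongrightarrow> a"
  and u: "!!k. dsol F Om (\<lambda>x. l k*u k x + f x) (u k)" and l: "!!k. \<bar>l k\<bar> <= L" "l \<longlonglongrightarrow> a"
 shows "\<exists>k. (\<forall>x\<in>Om. u k x < 0) \<or> (\<forall>x\<in>Om. 0 < u k x)"
proof -
 have cl: "Om \<subseteq> closure Om" by (rule closure_subset)
 have "\<exists>y\<in>closure Om. \<forall>x\<in>closure Om. \<bar>u k x\<bar> <= \<bar>u k y\<bar>" for k
  by (rule continuous_attains_sup[OF compact_closure_Om]) (use u[of k] nonempty_Om in \<open>auto simp: dsol_def intro: continuous_intros\<close>)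
 then obtain y where y: "!!k. y k \<in> closure Om" "!!k x. x \<in> closure Om ==> \<bar>u k x\<bar> <= \<bar>u k (y k)\<bar>" by metis
 \<comment> \<open>The maximum with 1 keeps the coefficient of \<open>f\<close> in the equation for
   \<open>v k\<close> at most 1, so bounded and unbounded sequences are treated alike.\<close>
 define e where "e k = 1/max 1 \<bar>u k (y k)\<bar>" for k
 have e: "0 < e k" "e k <= 1" for k by (auto simp: e_def max_def)
 define v where "v k x = e k*u k x" for k x
 have v: "dsol F Om (\<lambda>x. l k * v k x + e k*f x) (v k)" for k
  using dsol_scale[OF elliptic_axioms u e(1), of k] by (simp add: v_def[abs_def] distrib_left mult.left_commute)
 have v1: "\<bar>v k x\<bar> <= 1" if "x \<in> closure Om" for k x
 proof -
  have "\<bar>u k x\<bar> <= max 1 \<bar>u k (y k)\<bar>" using y(2)[OF that, of k] by simp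
  thus ?thesis by (simp add: v_def e_def abs_mult divide_le_eq)
 qed
 have "e k \<in> {0..1}" for k using e[of k] by simp
 then obtain c s where c: "c \<in> {0..1}" "strict_mono (s :: nat => nat)" "(e \<circ> s) \<longlonglongrightarrow> c"
  using compact_Icc[of "0::real" 1] unfolding compact_eq_seq_compact_metric seq_compact_def by meson
 obtain V r where V: "continuous_on (closure Om) V" "strict_mono (r :: nat => nat)" "uniform_limit (closure Om) (\<lambda>k. v (s (r k))) V sequentially"
  using solutions_compact[OF f(1,2), of "\<lambda>k. l (s k)" "\<lambda>k. v (s k)" "\<lambda>k. e (s k)" L] v l(1) e v1 by (metis less_imp_le)
 define q where "q k = s (r k)" for k
 have q: "strict_mono q" using strict_mono_compose[OF c(2) V(2)] unfolding q_def by simp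
 have eq: "(\<lambda>k. e (q k)) \<longlonglongrightarrow> c" using LIMSEQ_subseq_LIMSEQ[OF c(3) V(2)] by (simp add: q_def comp_def)
 have lq: "(\<lambda>k. l (q k)) \<longlonglongrightarrow> a" using LIMSEQ_subseq_LIMSEQ[OF l(2) q] by (simp add: comp_def)
 have vq: "uniform_limit (closure Om) (\<lambda>k. v (q k)) V sequentially" using V(3) by (simp add: q_def)
 have D: "dsol F Om (\<lambda>x. a*V x + c*f x) V" by (rule limit_solution[OF f(1) v v1 lq eq V(1) vq])
 have cf: "0 <= c*f x" if "x \<in> Om" for x using c(1) f(3)[OF that] by simp
 have c0: "c = 0" if "!!x. x \<in> Om ==> c*f x = 0" using that[OF x0(1)] x0(2) by simp
 have aL: "\<bar>a\<bar> <= L" by (rule LIMSEQ_le_const2[OF tendsto_rabs[OF l(2)]]) (use l(1) in blast)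
 have sign: "0 < v k x \<longleftrightarrow> 0 < u k x" "v k x < 0 \<longleftrightarrow> u k x < 0" for k x using e(1)[of k] by (simp_all add: v_def zero_less_mult_iff mult_less_0_iff)
 show ?thesis
 proof (cases "\<exists>x\<in>Om. V x < 0")
  case True
  then obtain xs where "xs \<in> Om" "V xs < 0" by blast
  note S = sign_of_solution_at_eigenvalue[OF D continuous_on_mult_left[OF f(1)] cf this w rh]
  \<comment> \<open>This makes \<open>limit_negative\<close> applicable, which requires that the
    coefficients of \<open>f\<close> tend to zero.\<close>
  have c: "c = 0" using S by (intro c0) blast
  have "\<forall>\<^sub>F k in sequentially. \<forall>x\<in>Om. v (q k) x < 0"
   by (rule limit_negative[OF f(1,2) v l(1) less_imp_le[OF e(1)] _ _ _ aL vq]) (use eq c D S in auto)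
  thus ?thesis by (auto simp: eventually_sequentially sign)
 next
  case False
  hence V0: "0 <= V x" if "x \<in> Om" for x using that by force
  show ?thesis
  proof (cases "\<exists>x\<in>Om. 0 < V x")
   case True
   then obtain x1 where "x1 \<in> Om" "0 < V x1" by blast
   from positive_of_nonneg[OF D cf V0 this] have "!!x. x \<in> Om ==> 0 < V x" .
   from limit_positive[OF v l(1) f(3) less_imp_le[OF e(1)] V(1) this vq]
   have "\<forall>\<^sub>F k in sequentially. \<forall>x\<in>Om. 0 < v (q k) x" .
   thus ?thesis by (auto simp: eventually_sequentially sign)
  next
   case False
   hence VOm: "V x = 0" if "x \<in> Om" for x using V0[OF that] that by force
   have Vcl: "V x = 0" if "x \<in> closure Om" for x using closure_cases[OF that] VOm D by (auto simp: dsol_def)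
   \<comment> \<open>The zero function has the zero jet, and the supersolution property of the limit
     leaves \<open>c*f x <= 0\<close>.\<close>
   have "c*f x = 0" if x: "x \<in> Om" for x
   proof -
    obtain d where d: "d > 0" "ball x d \<subseteq> Om" using open_Om x by (meson open_contains_ball)
    have "mjet (\<lambda>x. - V x) x 0 0"
    proof (rule mjet_mono[OF mjet_const[of 0] d(1)])
     fix y assume "norm (y-x) < d"
     hence "y \<in> Om" using d(2) by (auto simp: dist_norms)
     thus "- V y - - V x <= 0 - 0" using VOm x by simp
    qed
    hence "reflected F 0 0 (- V x) x <= - (a*V x + c*f x)" using D x unfolding dsol_def vsol_def vsub_def by blast
    hence "c*f x <= 0" using VOm[OF x] F_zero[OF x] by (simp add: reflected_def)
    thus ?thesis using cf[OF x] by simp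
   qed
   hence "c = 0" by (rule c0)
   \<comment> \<open>Then the norms being divided by exceed 1, so \<open>v (q k)\<close> has
     absolute value 1 at its maximum point, against uniform convergence to zero.\<close>
   hence "\<forall>\<^sub>F k in sequentially. e (q k) < 1" using order_tendstoD(2)[OF eq, of 1] by simp
   moreover have "\<forall>\<^sub>F k in sequentially. \<forall>x\<in>closure Om. dist (v (q k) x) (V x) < 1" by (rule uniform_limitD[OF vq]) simp
   ultimately have "\<forall>\<^sub>F k::nat in sequentially. False"
   proof eventually_elim
    case (elim k)
    hence "\<bar>u (q k) (y (q k))\<bar> > 1" by (auto simp: e_def max_def split: if_splits)
    hence "\<bar>v (q k) (y (q k))\<bar> = 1" by (simp add: v_def e_def abs_mult)
    thus ?case using elim(2) y(1)[of "q k"] Vcl by (auto simp: dist_real_def)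
   qed
   thus ?thesis by simp
  qed
 qed
qed

lemma C2_with_minus: "C2_with U ph Dph D2ph ==> C2_with U (\<lambda>x. - ph x) (\<lambda>x. - Dph x) (\<lambda>x. - D2ph x)"
proof -
 have "(- A) *v x = - (A *v x)" for A :: "real^'a^'a" and x by (simp add: matrix_vector_mult_def vec_eq_iff sum_negf)
 thus "C2_with U ph Dph D2ph ==> ?thesis" by (auto simp: C2_with_def intro: has_derivative_minus continuous_intros)
qed

lemma visc_super_reflected: "visc_super F Om u h ==> visc_sub (reflected F) Om (\<lambda>x. - u x) (\<lambda>x. - h x)"
 unfolding visc_sub_def
proof (intro allI impI)
 fix ph Dph D2ph x0
 assume F: "visc_super F Om u h" and C2: "C2_with Om ph Dph D2ph" and x0: "x0 \<in> Om" and "\<exists>r>0. \<forall>x\<in>Om \<inter> ball x0 r. - u x - ph x <= - u x0 - ph x0"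
 then obtain r where r: "r > 0" "!!x. x \<in> Om \<inter> ball x0 r ==> - u x - ph x <= - u x0 - ph x0" by blast
 have "\<forall>x\<in>Om \<inter> ball x0 r. u x - - ph x >= u x0 - - ph x0" using r(2) by force
 hence "h x0 <= F (- D2ph x0) (- Dph x0) (u x0) x0"
  using F C2_with_minus[OF C2] x0 r(1) unfolding visc_super_def by blast
 thus "reflected F (D2ph x0) (Dph x0) (- u x0) x0 <= - h x0" by (simp add: reflected_def)
qed

lemma visc_sub_reflected: "visc_sub F Om u h ==> visc_super (reflected F) Om (\<lambda>x. - u x) (\<lambda>x. - h x)"
 unfolding visc_super_def
proof (intro allI impI)
 fix ph Dph D2ph x0
 assume F: "visc_sub F Om u h" and C2: "C2_with Om ph Dph D2ph" and x0: "x0 \<in> Om" and "\<exists>r>0. \<forall>x\<in>Om \<inter> ball x0 r. - u x - ph x >= - u x0 - ph x0"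
 then obtain r where r: "r > 0" "!!x. x \<in> Om \<inter> ball x0 r ==> - u x - ph x >= - u x0 - ph x0" by blast
 have "\<forall>x\<in>Om \<inter> ball x0 r. u x - - ph x <= u x0 - - ph x0" using r(2) by force
 hence "F (- D2ph x0) (- Dph x0) (u x0) x0 <= h x0"
  using F C2_with_minus[OF C2] x0 r(1) unfolding visc_sub_def by blast
 thus "reflected F (D2ph x0) (Dph x0) (- u x0) x0 >= - h x0" by (simp add: reflected_def)
qed

text \<open>Negation exchanges the admissible functions of the two suprema. Since reflecting twice
  gives back \<open>F\<close>, two implications valid for every operator are enough.\<close>

lemma lambda1_reflected:
 fixes F :: "'n::finite op"
 shows "lambda1_plus (reflected F) Om = lambda1_minus F Om" "lambda1_minus (reflected F) Om = lambda1_plus F Om"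
proof -
 let ?P = "\<lambda>(F::'n op) rh. \<exists>v. continuous_on Om v \<and> (\<forall>x\<in>Om. v x > 0) \<and> visc_super F Om v (\<lambda>x. rh * v x)"
 let ?M = "\<lambda>(F::'n op) rh. \<exists>v. continuous_on Om v \<and> (\<forall>x\<in>Om. v x < 0) \<and> visc_sub F Om v (\<lambda>x. rh * v x)"
 have 1: "?M (reflected F) rh" if "?P F rh" for F rh
 proof -
  obtain v where v: "continuous_on Om v" "\<forall>x\<in>Om. v x > 0" "visc_super F Om v (\<lambda>x. rh * v x)" using \<open>?P F rh\<close> by blast
  show ?thesis using visc_super_reflected[OF v(3)] v(1,2) by (intro exI[of _ "\<lambda>x. - v x"]) (auto intro: continuous_intros)
 qed
 have 2: "?P (reflected F) rh" if "?M F rh" for F rh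
 proof -
  obtain v where v: "continuous_on Om v" "\<forall>x\<in>Om. v x < 0" "visc_sub F Om v (\<lambda>x. rh * v x)" using \<open>?M F rh\<close> by blast
  show ?thesis using visc_sub_reflected[OF v(3)] v(1,2) by (intro exI[of _ "\<lambda>x. - v x"]) (auto intro: continuous_intros)
 qed
 have "?P (reflected F) rh \<longleftrightarrow> ?M F rh" "?M (reflected F) rh \<longleftrightarrow> ?P F rh" for rh
  using 1[of F rh] 2[of F rh] 1[of "reflected F" rh] 2[of "reflected F" rh] unfolding reflected_reflected by argo+
 thus "lambda1_plus (reflected F) Om = lambda1_minus F Om" "lambda1_minus (reflected F) Om = lambda1_plus F Om"
  unfolding lambda1_plus_def lambda1_minus_def by (simp_all only:)
qed

lemma (in elliptic) dirichlet_sol_imp_dsol: "dirichlet_sol F Om lam f u ==> dsol F Om (\<lambda>x. lam*u x + f x) u"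
 unfolding dirichlet_sol_def visc_sol_def dsol_def vsol_def
 using visc_sub_imp_vsub elliptic.visc_sub_imp_vsub[OF elliptic_reflected] visc_super_reflected by blast

lemma (in elliptic_domain) negative_beyond_lambda1_minus:
 assumes f: "continuous_on Om f" "(\<lambda>x. \<bar>f x\<bar> powr p) integrable_on Om" "\<exists>x\<in>Om. f x ~= 0" "\<forall>x\<in>Om. 0 <= f x"
 shows "\<exists>et>0. \<forall>lam::real. lambda1_plus F Om <= lambda1_minus F Om \<and> lambda1_minus F Om < ereal lam \<and>
   ereal lam <= lambda1_minus F Om + ereal et --> (\<forall>u. dirichlet_sol F Om lam f u --> (\<forall>x\<in>Om. u x < 0))"
proof (cases "\<exists>a. lambda1_minus F Om = ereal a")
 case False
 \<comment> \<open>At an infinite value the prescribed range of \<open>lam\<close> is empty.\<close>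
 hence "lambda1_minus F Om = \<infinity> \<or> lambda1_minus F Om = - \<infinity>" by (cases "lambda1_minus F Om") auto
 thus ?thesis by (intro exI[of _ 1]) auto
next
 case True
 then obtain a where a: "lambda1_minus F Om = ereal a" by blast
 \<comment> \<open>Members of the set defining the supremum, within \<open>1/(j + 1)\<close> of
   it.\<close>
 have "\<exists>rh w. rh <= a \<and> a - inverse (real (Suc j)) < rh \<and> continuous_on Om w \<and> (\<forall>x\<in>Om. w x < 0) \<and> visc_sub F Om w (\<lambda>x. rh*w x)" for j
 proof -
  have "ereal (a - inverse (real (Suc j))) < lambda1_minus F Om" by (simp add: a)
  then obtain rh w where rh: "a - inverse (real (Suc j)) < rh" "continuous_on Om w" "\<forall>x\<in>Om. w x < 0" "visc_sub F Om w (\<lambda>x. rh*w x)"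
   unfolding lambda1_minus_def less_Sup_iff by auto
  hence "ereal rh <= lambda1_minus F Om" unfolding lambda1_minus_def by (intro Sup_upper) blast
  thus ?thesis using rh a by auto
 qed
 then obtain rh w where w: "!!j. rh j <= a" "!!j. a - inverse (real (Suc j)) < rh j" "!!j. continuous_on Om (w j)"
  "!!j. \<forall>x\<in>Om. w j x < 0" "!!j. visc_sub F Om (w j) (\<lambda>x. rh j*w j x)" by metis
 have inv: "(\<lambda>j. inverse (real (Suc j))) \<longlonglongrightarrow> 0" by (rule LIMSEQ_inverse_real_of_nat)
 have rhlim: "rh \<longlonglongrightarrow> a"
 proof (rule tendsto_sandwich)
  show "\<forall>\<^sub>F j in sequentially. a - inverse (real (Suc j)) <= rh j" by (intro always_eventually allI less_imp_le w(2))
  show "\<forall>\<^sub>F j in sequentially. rh j <= a" by (intro always_eventually allI w(1))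
  show "(\<lambda>j. a - inverse (real (Suc j))) \<longlonglongrightarrow> a" using tendsto_diff[OF tendsto_const inv, of a] by simp
 qed simp
 have inv1: "inverse (real (Suc j)) <= 1" for j by (simp add: inverse_eq_divide)
 show ?thesis
 proof (rule ccontr)
  assume "\<not> ?thesis"
  hence "\<exists>lam u. lambda1_plus F Om <= ereal a \<and> a < lam \<and> lam <= a + inverse (real (Suc k)) \<and> dirichlet_sol F Om lam f u \<and> \<not> (\<forall>x\<in>Om. u x < 0)" for k
   unfolding a by (auto dest: spec[of _ "inverse (real (Suc k))"])
  then obtain l u where l: "!!k. lambda1_plus F Om <= ereal a" "!!k. a < l k" "!!k. l k <= a + inverse (real (Suc k))"
   and u: "!!k. dirichlet_sol F Om (l k) f (u k)" "!!k. \<not> (\<forall>x\<in>Om. u k x < 0)" by metis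
  obtain x0 where x0: "x0 \<in> Om" "f x0 ~= 0" using f(3) by blast
  have "\<exists>k. (\<forall>x\<in>Om. u k x < 0) \<or> (\<forall>x\<in>Om. 0 < u k x)"
  proof (rule eventually_signed[OF f(1,2) _ x0 w(3) _ visc_sub_imp_vsub[OF w(5)] _ w(1) rhlim dirichlet_sol_imp_dsol[OF u(1)]])
   show "0 <= f x" if "x \<in> Om" for x using f(4) that by blast
   show "w j x < 0" if "x \<in> Om" for j x using w(4) that by blast
   show "a - 1 <= rh j" for j using w(2)[of j] inv1[of j] by linarith
   show "\<bar>l k\<bar> <= \<bar>a\<bar> + 1" for k using l(2,3)[of k] inv1[of k] by linarith
   show "l \<longlonglongrightarrow> a"
   proof (rule tendsto_sandwich)
    show "\<forall>\<^sub>F k in sequentially. a <= l k" by (intro always_eventually allI less_imp_le l(2))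
    show "\<forall>\<^sub>F k in sequentially. l k <= a + inverse (real (Suc k))" by (intro always_eventually allI l(3))
    show "(\<lambda>k. a + inverse (real (Suc k))) \<longlonglongrightarrow> a" using tendsto_add[OF tendsto_const inv, of a] by simp
   qed simp
  qed
  then obtain k where pos: "\<forall>x\<in>Om. 0 < u k x" using u(2) by blast
  have "visc_super F Om (u k) (\<lambda>x. l k*u k x + f x)" "continuous_on (closure Om) (u k)" using u(1) by (auto simp: dirichlet_sol_def visc_sol_def)
  \<comment> \<open>Since \<open>f >= 0\<close>, dropping it from the right-hand side keeps a
    supersolution; this is what makes \<open>l k\<close> admissible.\<close>
  moreover from this(1) have "visc_super F Om (u k) (\<lambda>x. l k*u k x)"
   using f(4) unfolding visc_super_def by (meson add_increasing2 order_refl order_trans)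
  ultimately have "ereal (l k) <= lambda1_plus F Om"
   unfolding lambda1_plus_def using pos continuous_on_subset[OF _ closure_subset] by (intro Sup_upper) blast
  thus False using l(1) l(2)[of k] by (meson ereal_less_eq(3) leD order_trans)
 qed
qed

theorem theorem2p5:
  fixes F :: "'n::finite op" and \<Omega> :: "(real^'n) set" and f :: "real^'n \<Rightarrow> real" and p :: real
  assumes dom: "smooth_bounded_domain \<Omega>"
    and F1: "cond_F1 F \<Omega>" and F2: "cond_F2 F \<Omega>" and F3: "cond_F3 F \<Omega>"
    and p: "p > real CARD('n)"
    and fcont: "continuous_on \<Omega> f"
    and fLp: "(\<lambda>x. \<bar>f x\<bar> powr p) integrable_on \<Omega>"
    and fnz: "\<exists>x\<in>\<Omega>. f x \<noteq> 0"
  shows "((\<forall>x\<in>\<Omega>. f x \<ge> 0) \<longrightarrow>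
           (\<exists>\<eta>>0. \<forall>lam::real. lambda1_plus F \<Omega> \<le> lambda1_minus F \<Omega> \<and> lambda1_minus F \<Omega> < ereal lam \<and>
               ereal lam \<le> lambda1_minus F \<Omega> + ereal \<eta> \<longrightarrow>
             (\<forall>u. dirichlet_sol F \<Omega> lam f u \<longrightarrow> (\<forall>x\<in>\<Omega>. u x < 0))))
      \<and> ((\<forall>x\<in>\<Omega>. f x \<le> 0) \<longrightarrow>
           (\<exists>\<eta>>0. \<forall>lam::real. lambda1_minus F \<Omega> \<le> lambda1_plus F \<Omega> \<and> lambda1_plus F \<Omega> < ereal lam \<and>
               ereal lam \<le> lambda1_plus F \<Omega> + ereal \<eta> \<longrightarrow>
             (\<forall>u. dirichlet_sol F \<Omega> lam f u \<longrightarrow> (\<forall>x\<in>\<Omega>. u x > 0))))"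
proof -
 have \<Omega>: "open \<Omega>" "bounded \<Omega>" "connected \<Omega>" "\<Omega> ~= {}" using dom by (auto simp: smooth_bounded_domain_def)
 obtain R where R: "R > 0" "!!z. z \<in> frontier \<Omega> ==> \<exists>nu. tangent_balls \<Omega> R z nu" using smooth_bounded_domain_tangent_balls[OF dom] by blast
 obtain de1 de0 ga Ga where c: "de1 >= 0" "de0 >= 0" "0 < ga" "ga <= Ga"
  "!!M N p q z w x. symmetric_mat M ==> symmetric_mat N ==> x \<in> \<Omega> ==>
     pucci_minus ga Ga (M-N) - de1*norm (p-q) - de0*\<bar>z - w\<bar> <= F M p z x - F N q w x \<and>
     F M p z x - F N q w x <= pucci_plus ga Ga (M-N) + de1*norm (p-q) + de0*\<bar>z - w\<bar>"
  using F2 unfolding cond_F2_def by blast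
 interpret elliptic_domain F \<Omega> de1 de0 ga Ga R p
  by unfold_locales (use c \<Omega> F1 F3 R p in blast)+
 interpret r: elliptic_domain "reflected F" \<Omega> de1 de0 ga Ga R p by (rule domain_reflected)
 \<comment> \<open>Negating a solution reflects the operator and negates \<open>f\<close>, so that
   the case \<open>f <= 0\<close> becomes the case already treated, with the two eigenvalues
   exchanged.\<close>
 have "dirichlet_sol (reflected F) \<Omega> lam (\<lambda>x. - f x) (\<lambda>x. - u x)" if "dirichlet_sol F \<Omega> lam f u" for lam u
  using that visc_sub_reflected[of F \<Omega> u "\<lambda>x. lam*u x + f x"] visc_super_reflected[of F \<Omega> u "\<lambda>x. lam*u x + f x"]
  by (auto simp: dirichlet_sol_def visc_sol_def intro: continuous_intros)
 moreover have "\<exists>et>0. \<forall>lam::real. lambda1_minus F \<Omega> <= lambda1_plus F \<Omega> \<and> lambda1_plus F \<Omega> < ereal lam \<and>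
   ereal lam <= lambda1_plus F \<Omega> + ereal et --> (\<forall>u. dirichlet_sol (reflected F) \<Omega> lam (\<lambda>x. - f x) u --> (\<forall>x\<in>\<Omega>. u x < 0))"
  if "\<forall>x\<in>\<Omega>. f x <= 0"
  using r.negative_beyond_lambda1_minus[of "\<lambda>x. - f x"] fcont fLp fnz that
  unfolding lambda1_reflected by (auto intro: continuous_intros)
 ultimately have "\<exists>et>0. \<forall>lam::real. lambda1_minus F \<Omega> <= lambda1_plus F \<Omega> \<and> lambda1_plus F \<Omega> < ereal lam \<and>
   ereal lam <= lambda1_plus F \<Omega> + ereal et --> (\<forall>u. dirichlet_sol F \<Omega> lam f u --> (\<forall>x\<in>\<Omega>. u x > 0))"
  if "\<forall>x\<in>\<Omega>. f x <= 0" using that by (metis neg_less_0_iff_less)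
 thus ?thesis using negative_beyond_lambda1_minus[OF fcont fLp fnz] by blast
qed

end
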